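(* Consider the gradual-impulse control problem with primitives $(\mathbf X,\mathbf A^G,\mathbf A^I,q,Q,c^G,c^I)$, policies $u\in\mathcal U$, performance measure $\mathcal V(x,u)$ and value function $\mathcal V^\ast$, as described in the context. Suppose that: (1) there exists a $[1,\infty)$-valued continuous function $w$ on $\mathbf X$ such that $c^G(x,a)+q_x(a)+1\le w(x)$ for each $(x,a)\in\mathbf X\times\mathbf A^G$; (2) $c^I$ and $c^G$ are lower semicontinuous on $\mathbf X\times\mathbf A^I\times\mathbf X$ and $\mathbf X\times\mathbf A^G$, respectively, and for each bounded continuous function $g$ on $\mathbf X$, $\int_{\mathbf X}g(y)Q(dy|x,b)$ is continuous in $(x,b)\in\mathbf X\times\mathbf A^I$ and $\int_{\mathbf X}g(y)\tilde q(dy|x,a)$ is continuous in $(x,a)\in\mathbf X\times\mathbf A^G$. Let $W^\ast$ be the value function of the tilde DTMDP (built with $w$; see the context). Then the following assertions hold. (a) $W^\ast=\mathcal V^\ast$ on $\mathbf X$. (b) $\mathbf X\setminus\mathbf X^I(W^\ast)\subseteq\mathbf X^G(W^\ast)$. (c) There is a deterministic stationary optimal policy for the gradual-impulse control problem (minimize $\mathcal V(x,u)$ over $u\in\mathcal U$), which can be obtained as follows. For each pair $(\psi^\ast,f^\ast)$ of measurable mappings $\psi^\ast:\mathbf X\to\mathbf A^I$, $f^\ast:\mathbf X\to\mathbf A^G$ satisfying the conserving relation: for each $x\in\mathbf X$ there is some $\tilde a^\ast\in\tilde{\mathbf A}$ such that $$\int_{\mathbf X}e^{\tilde l(x,\tilde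 a^\ast,y)}W^\ast(y)\tilde Q(dy|x,\tilde a^\ast)=\inf_{\tilde a\in\tilde{\mathbf A}}\Big\{\int_{\mathbf X}e^{\tilde l(x,\tilde a,y)}W^\ast(y)\tilde Q(dy|x,\tilde a)\Big\}$$ $$=\int_{\mathbf X}e^{\tilde l(x,\psi^\ast(x),y)}W^\ast(y)\tilde Q(dy|x,\psi^\ast(x))\,I\{\tilde a^\ast\in\mathbf A^I\}+\int_{\mathbf X}e^{\tilde l(x,f^\ast(x),y)}W^\ast(y)\tilde Q(dy|x,f^\ast(x))\,I\{\tilde a^\ast\in\mathbf A^G\}$$ (and there exists such a pair), the following deterministic stationary policy $(\varphi,\psi,F)$ is optimal: $\psi(x)=\psi^\ast(x)$ and $F(x)_t(da)\equiv\delta_{f^\ast(x)}(da)$ for all $x\in\mathbf X$ (i.e. the gradual control $f^\ast(x)$ is used), and $\varphi(x)=\infty$ for all $x\in\mathbf X\setminus\mathbf X^I(W^\ast)$, $\varphi(x)=0$ for all $x\in\mathbf X^I(W^\ast)$.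
   Context: Conventions: $0/0:=0$, $0\cdot\infty:=0$, $1/0:=+\infty$, $\infty-\infty:=\infty$. $I$ denotes an indicator; $\delta_x$ is the Dirac measure; measurability is Borel unless stated otherwise. **Primitives.** $\mathbf X$ (states), $\mathbf A^G$ (gradual controls), $\mathbf A^I$ (impulses) are Borel spaces; $\mathbf A^G,\mathbf A^I$ are compact and are disjoint subsets of a Borel space; $\tilde{\mathbf A}:=\mathbf A^I\cup\mathbf A^G$ (disjoint union). $q(dy|x,a)$ is a signed kernel on $\mathcal B(\mathbf X)$ given $\mathbf X\times\mathbf A^G$ with $q(\Gamma|x,a)\in[0,\infty)$ whenever $x\notin\Gamma$, $q(\mathbf X|x,a)=0$, and $\bar q_x:=\sup_a q_x(a)<\infty$ for each $x$, where $q_x(a):=-q(\{x\}|x,a)$. Put $\tilde q(dy|x,a):=q(dy\setminus\{x\}|x,a)$. $Q(dy|x,b)$ is a stochastic kernel on $\mathcal B(\mathbf X)$ given $\mathbf X\times\mathbf A^I$. $c^G$ and $c^I$ are $[0,\infty)$-valued measurable functions on $\mathbf X\times\mathbf A^G$ and $\mathbf X\times\mathbf A^I\times\mathbf X$, and $\sup_{a}c^G(x,a)<\infty$ for each $x$. **Interventions.** Let $\Delta$ be a cemetery point not in $\mathbf X$ or $\mathbf A^I$; $\mathbf X_\Delta:=\mathbf X\cup\{\Delta\}$, $\mathbf A^I_\Delta:=\mathbf A^I\cup\{\Delta\}$, and $Q(\{\Delta\}|x,b):=1$ if $x=\Delta$ or $b=\Delta$. The intervention DTMDP (discrete-time Markov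 decision process) has state space $\mathbf X_\Delta$, action space $\mathbf A^I_\Delta$ and transition kernel $Q$; at state $\Delta$ only $\Delta$ is used; initial states are in $\mathbf X$. Its sample space is $\mathbf Y:=\left(\bigcup_{k\ge0}\mathbf Y_k\right)\cup(\mathbf X\times\mathbf A^I)^\infty$, $\mathbf Y_k:=(\mathbf X\times\mathbf A^I)^k\times(\mathbf X\times\{\Delta\})\times(\{\Delta\}\times\{\Delta\})^\infty$. An element of $\mathbf Y$ is an intervention. $\mathbf Y^\ast:=\mathbf Y\setminus\mathbf Y_0$. For a (randomized, history-dependent) strategy $\sigma$ in the intervention DTMDP, $\beta^\sigma(\cdot|x)$ is the induced probability measure on $\mathbf Y$ with initial state $x$. $\mathcal P^{\mathbf Y}$ is the set of all stochastic kernels $\beta^\sigma(\cdot|\cdot)$; $\mathcal P^{\mathbf Y}(x):=\{\beta^\sigma(\cdot|x):\sigma\}$; $\mathcal P^{\mathbf Y^\ast}(x):=\{\beta(\cdot|x):\beta\in\mathcal P^{\mathbf Y},\beta(\mathbf Y^\ast|x)=1\}$. For $y=(x_0,b_0,x_1,b_1,\dots)\in\mathbf Y$: $\bar x(y):=x_k$ if $y\in\mathbf Y_k$, and $\bar x(y):=\Delta$ if $y\in(\mathbf X\times\mathbf A^I)^\infty$; $C^I(y):=\sum_{k\ge0}c^I(x_k,b_k,x_{k+1})$ with $c^I(x,\Delta,\Delta):=0$ for $x\in\mathbf X_\Delta$. **Sample space.** $\mathbf Y_\Delta:=\mathbf Y\cup\{\Delta\}$. $\Omega$ is the set of sequences $\omega=(y_0,\theta_1,y_1,\theta_2,y_2,\dots)$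 with $y_0\in\mathbf Y$, $\theta_1=0$, $y_1\in\mathbf Y$, and either $(\theta_n,y_n)\in(0,\infty)\times\mathbf Y$ for all $n\ge2$, or this holds up to some finite index and $(\theta_n,y_n)=(\infty,\Delta)$ afterwards. For initial state $x_0\in\mathbf X$, $y_0:=(x_0,\Delta,\Delta,\dots)$. $Y_n,\Theta_n$ are the coordinate maps, $T_n:=\sum_{i=1}^n\Theta_i$ (so $T_1=0$), $T_\infty:=\lim T_n$, $H_n:=(Y_0,\Theta_1,Y_1,\dots,\Theta_n,Y_n)$; $\mathbf H_n$ is the set of values $h_n=(y_0,0,y_1,\theta_2,\dots,\theta_n,y_n)$. $\xi_t:=Y_n$ if $T_n\le t<T_{n+1}$, $n\ge1$, and $\xi_t:=\Delta$ if $t\ge T_\infty$. **Policies.** A policy is $u=\{u_n\}_{n\ge0}$ with $u_0\in\mathcal P^{\mathbf Y}$ and, for $n\ge1$, $u_n=(\Phi_n,\Pi_n,\Gamma^0_n,\Gamma^1_n)$, where $\Phi_n$ is a stochastic kernel on $(0,\infty]$ given $\mathbf H_n$ with $\Phi_n(\{\infty\}|h_n)=1$ if $y_n\in(\mathbf X\times\mathbf A^I)^\infty$; $\Pi_n$ is a stochastic kernel on $\mathbf A^G$ given $\mathbf H_n\times(0,\infty)$; $\Gamma^0_n$ is a stochastic kernel on $\mathbf Y$ given $\mathbf H_n\times(0,\infty)\times\mathbf X$ with $\Gamma_n^0(\cdot|h_n,t,x)\in\mathcal P^{\mathbf Y}(x)$; $\Gamma^1_n$ is a stochastic kernel on $\mathbf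 Y$ given $\mathbf H_n$ with $\Gamma^1_n(\cdot|h_n)\in\mathcal P^{\mathbf Y^\ast}(\bar x(y_n))$. (Values at $y_n=\Delta$ are immaterial.) $\mathcal U$ is the set of policies. Put $q_\Delta(a):=0$ (so no natural jumps occur from $\Delta$), $c^G(\Delta,a):=0$, $C^I(\Delta):=0$, $\lambda^u_n(\Gamma|h_n,t):=\int_{\mathbf A^G}\tilde q(\Gamma|\bar x(y_n),a)\Pi_n(da|h_n,t)$, $\Lambda^u_n(\Gamma|h_n,t):=\int_0^t\lambda^u_n(\Gamma|h_n,s)ds$. Under $u$ and initial state $x_0$, the probability ${\rm P}^u_{x_0}$ on $\Omega$ is determined (Ionescu-Tulcea) by: $Y_1$ has law $u_0(\cdot|x_0)$, and for $n\ge1$ the conditional law of $(\Theta_{n+1},Y_{n+1})$ given $H_n=h_n$ is $G_n^u(\cdot|h_n)$ on $(0,\infty]\times\mathbf Y_\Delta$, where $$G_n^u(\{\infty\}\times\{\Delta\}|h_n)=\delta_{y_n}(\{\Delta\})+\delta_{y_n}(\mathbf Y)e^{-\Lambda^u_n(\mathbf X|h_n,\infty)}\Phi_n(\{\infty\}|h_n),$$ and on $(0,\infty)\times\mathbf Y$ $$G^u_n(dt\times dy|h_n)=\delta_{y_n}(\mathbf Y)\Big\{\Gamma^1_n(dy|h_n)e^{-\Lambda^u_n(\mathbf X|h_n,t)}\Phi_n(dt|h_n)+\int_{\mathbf X}\Phi_n([t,\infty]|h_n)\Gamma^0_n(dy|h_n,t,x)\lambda^u_n(dx|h_n,t)e^{-\Lambda^u_n(\mathbf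 X|h_n,t)}dt\Big\}.$$ **Performance.** $\mathcal V(x,u):={\rm E}^u_x\Big[\exp\Big(\sum_{n\ge1}\big(C^I(Y_n)+\int_{T_n}^{T_{n+1}}\int_{\mathbf A^G}c^G(\bar x(\xi_s),a)\Pi_n(da|H_n,s-T_n)ds\big)\Big)\Big]$, and $\mathcal V^\ast(x):=\inf_{u\in\mathcal U}\mathcal V(x,u)$. A policy $u^\ast$ is optimal if $\mathcal V(x,u^\ast)=\mathcal V^\ast(x)$ for all $x\in\mathbf X$. **Deterministic stationary policy.** A policy is deterministic stationary if there are measurable maps $(\varphi,\psi,f)$ on $\mathbf X$ with $\varphi(x)\in\{0,\infty\}$, $\psi(x)\in\mathbf A^I$, $f(x)\in\mathbf A^G$, such that $\Phi_n(\{\infty\}|h_n)=1$, $\Pi_n(da|h_n,t)=\delta_{f(\bar x(y_n))}(da)$ for all $t$, and $u_0(\cdot|x)=\Gamma^0_n(\cdot|h_n,t,x)=\beta^\pi(\cdot|x)$, where $\pi$ is the deterministic stationary strategy in the intervention DTMDP with $\pi(\{\Delta\}|x_0,b_0,\dots,x_n)=I\{\varphi(x_n)=\infty\}$ and $\pi(db|x_0,b_0,\dots,x_n)=I\{\varphi(x_n)=0\}\delta_{\psi(x_n)}(db)$ on $\mathbf A^I$ ($\Gamma^1_n$ is arbitrary, being irrelevant). Such a policy is also written $(\varphi,\psi,F)$ with $F(x)_t(da)=\delta_{f(x)}(da)$ for all $t\ge0$. **Tilde DTMDP.** State space $\mathbf X$, action space $\tilde{\mathbf A}$; for $a\in\mathbf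 A^G$: $\tilde Q(dy|x,a):=\frac{q(dy|x,a)}{w(x)}+\delta_x(dy)$, $\tilde l(x,a,y):=\ln\frac{w(x)}{w(x)-c^G(x,a)}$; for $b\in\mathbf A^I$: $\tilde Q(dy|x,b):=Q(dy|x,b)$, $\tilde l(x,b,y):=c^I(x,b,y)$. With state and action processes $X_n,A_n$, its value function is $W^\ast(x):=\inf_\sigma{\bf E}^\sigma_x\big[e^{\sum_{n\ge0}\tilde l(X_n,A_n,X_{n+1})}\big]$, infimum over all (randomized, history-dependent) strategies. **Sets.** For a $[1,\infty]$-valued universally measurable $g$ on $\mathbf X$: $\mathbf X^G(g):=\{x:\ g(x)<\infty,\ 0=\inf_{a\in\mathbf A^G}\{\int_{\mathbf X}g(y)\tilde q(dy|x,a)-(q_x(a)-c^G(x,a))g(x)\}\}$, and $\mathbf X^I(g):=\{x:\ g(x)=\inf_{b\in\mathbf A^I}\int_{\mathbf X}g(y)e^{c^I(x,b,y)}Q(dy|x,b)\}$. The value function $W^\ast$ is universally measurable.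
   Formalization: In (c), the conserving relation additionally requires ã* ∈ A^I at each x ∈ X^I(W* ); otherwise, where an impulse and a gradual control both attain the minimum, ψ*(x) would be unconstrained there and the policy may fail to be optimal. *)

theory Defs
  imports "HOL-Probability.Probability"
begin

section \<open>Extended exponentials, semicontinuity, cemetery points\<close>

definition exp_pos :: "ennreal \<Rightarrow> ennreal" where
  "exp_pos c = (if c = \<infinity> then \<infinity> else ennreal (exp (enn2real c)))"

definition exp_neg :: "ennreal \<Rightarrow> ennreal" where
  "exp_neg c = (if c = \<infinity> then 0 else ennreal (exp (- enn2real c)))"

definition lsc_on :: "'a::topological_space set \<Rightarrow> ('a \<Rightarrow> real) \<Rightarrow> bool" where
  "lsc_on S f \<longleftrightarrow> (\<forall>c. openin (top_of_set S) {x \<in> S. c < f x})"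

text \<open>The cemetery point is \<^term>\<open>None\<close>; it is adjoined as an isolated point.\<close>

definition cemetery :: "'a measure \<Rightarrow> 'a option measure" where
  "cemetery M = sigma (insert None (Some ` space M)) (insert {None} ((`) Some ` sets M))"


section \<open>Discrete-time Markov decision processes\<close>

text \<open>
  A DTMDP has a state space \<open>S\<close>, an action space \<open>A\<close>, sets \<open>D s\<close> of admissible actions and a
  transition kernel \<open>T\<close>.  A path \<open>\<omega>\<close> is the sequence of pairs \<open>\<omega> n = (X\<^sub>n, A\<^sub>n)\<close>, and the
  decision \<open>\<sigma> n h s\<close> is taken in state \<open>X\<^sub>n = s\<close> after the history \<open>h\<close> of the pairs with
  indices below \<open>n\<close>.
\<close>

definition strategies ::
  "'s measure \<Rightarrow> 'b measure \<Rightarrow> ('s \<Rightarrow> 'b set)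
    \<Rightarrow> (nat \<Rightarrow> (nat \<Rightarrow> 's \<times> 'b) \<Rightarrow> 's \<Rightarrow> 'b measure) set" where
  "strategies S A D =
    {\<sigma>. \<forall>n. (\<lambda>(h, s). \<sigma> n h s) \<in> (\<Pi>\<^sub>M i\<in>{0..<n}. S \<Otimes>\<^sub>M A) \<Otimes>\<^sub>M S \<rightarrow>\<^sub>M prob_algebra A \<and>
         (\<forall>h \<in> space (\<Pi>\<^sub>M i\<in>{0..<n}. S \<Otimes>\<^sub>M A). \<forall>s \<in> space S. emeasure (\<sigma> n h s) (D s) = 1)}"

definition path_measure ::
  "(nat \<Rightarrow> (nat \<Rightarrow> 'c) \<Rightarrow> 'c measure) \<Rightarrow> (nat \<Rightarrow> 'c measure) \<Rightarrow> (nat \<Rightarrow> 'c) measure" where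
  "path_measure K M = projective_family.lim UNIV (Ionescu_Tulcea.CI K M) M"

definition dtmdp_step ::
  "'s measure \<Rightarrow> 'b measure \<Rightarrow> ('s \<Rightarrow> 'b \<Rightarrow> 's measure)
    \<Rightarrow> (nat \<Rightarrow> (nat \<Rightarrow> 's \<times> 'b) \<Rightarrow> 's \<Rightarrow> 'b measure) \<Rightarrow> 's
    \<Rightarrow> nat \<Rightarrow> (nat \<Rightarrow> 's \<times> 'b) \<Rightarrow> ('s \<times> 'b) measure" where
  "dtmdp_step S A T \<sigma> x n h =
    (case n of 0 \<Rightarrow> return S x | Suc m \<Rightarrow> T (fst (h m)) (snd (h m)))
      \<bind> (\<lambda>s. \<sigma> n h s \<bind> (\<lambda>a. return (S \<Otimes>\<^sub>M A) (s, a)))"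

definition dtmdp_law ::
  "'s measure \<Rightarrow> 'b measure \<Rightarrow> ('s \<Rightarrow> 'b \<Rightarrow> 's measure)
    \<Rightarrow> (nat \<Rightarrow> (nat \<Rightarrow> 's \<times> 'b) \<Rightarrow> 's \<Rightarrow> 'b measure) \<Rightarrow> 's \<Rightarrow> (nat \<Rightarrow> 's \<times> 'b) measure" where
  "dtmdp_law S A T \<sigma> x = path_measure (dtmdp_step S A T \<sigma> x) (\<lambda>_. S \<Otimes>\<^sub>M A)"


section \<open>Primitives of the gradual-impulse control model\<close>

text \<open>
  A Borel space is a Borel subset of a Polish type; both action spaces are subsets of one Polish
  type.  The signed kernel \<open>q(\<Gamma>|x,a)\<close> is the real set function \<open>qker M x a \<Gamma>\<close>.
\<close>

record ('x, 'a) gi_model =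
  states :: "'x set"
  gradual :: "'a set"
  impulses :: "'a set"
  qker :: "'x \<Rightarrow> 'a \<Rightarrow> 'x set \<Rightarrow> real"
  Qker :: "'x \<Rightarrow> 'a \<Rightarrow> 'x measure"
  costG :: "'x \<Rightarrow> 'a \<Rightarrow> real"
  costI :: "'x \<Rightarrow> 'a \<Rightarrow> 'x \<Rightarrow> real"

context
  fixes M :: "('x::polish_space, 'a::polish_space) gi_model"
begin

definition stateM :: "'x measure" where
  "stateM = restrict_space borel (states M)"

definition gradM :: "'a measure" where
  "gradM = restrict_space borel (gradual M)"

definition impM :: "'a measure" where
  "impM = restrict_space borel (impulses M)"

definition jump_rate :: "'x \<Rightarrow> 'a \<Rightarrow> real" where
  "jump_rate x a = - qker M x a {x}"

definition qtilde :: "'x \<Rightarrow> 'a \<Rightarrow> 'x measure" where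
  "qtilde x a = measure_of (states M) (sets stateM) (\<lambda>B. ennreal (qker M x a (B - {x})))"

definition gi_primitives :: bool where
  "gi_primitives \<longleftrightarrow>
    states M \<in> sets borel \<and>
    compact (gradual M) \<and> gradual M \<noteq> {} \<and>
    compact (impulses M) \<and> impulses M \<noteq> {} \<and>
    gradual M \<inter> impulses M = {} \<and>
    (\<forall>x \<in> states M. \<forall>a \<in> gradual M. \<forall>B. range B \<subseteq> sets stateM \<longrightarrow> disjoint_family B \<longrightarrow>
        (\<lambda>i::nat. qker M x a (B i)) sums qker M x a (\<Union>i. B i)) \<and>
    (\<forall>B \<in> sets stateM. (\<lambda>(x, a). qker M x a B) \<in> stateM \<Otimes>\<^sub>M gradM \<rightarrow>\<^sub>M borel) \<and>
    (\<forall>x \<in> states M. \<forall>a \<in> gradual M. \<forall>B \<in> sets stateM. x \<notin> B \<longrightarrow> 0 \<le> qker M x a B) \<and>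
    (\<forall>x \<in> states M. \<forall>a \<in> gradual M. qker M x a (states M) = 0) \<and>
    (\<forall>x \<in> states M. bdd_above (jump_rate x ` gradual M)) \<and>
    (\<lambda>(x, b). Qker M x b) \<in> stateM \<Otimes>\<^sub>M impM \<rightarrow>\<^sub>M prob_algebra stateM \<and>
    (\<lambda>(x, a). costG M x a) \<in> stateM \<Otimes>\<^sub>M gradM \<rightarrow>\<^sub>M borel \<and>
    (\<forall>x \<in> states M. \<forall>a \<in> gradual M. 0 \<le> costG M x a) \<and>
    (\<lambda>(x, b, y). costI M x b y) \<in> stateM \<Otimes>\<^sub>M (impM \<Otimes>\<^sub>M stateM) \<rightarrow>\<^sub>M borel \<and>
    (\<forall>x \<in> states M. \<forall>b \<in> impulses M. \<forall>y \<in> states M. 0 \<le> costI M x b y) \<and>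
    (\<forall>x \<in> states M. bdd_above (costG M x ` gradual M))"


section \<open>Interventions\<close>

definition stateD :: "'x option measure" where
  "stateD = cemetery stateM"

definition impD :: "'a option measure" where
  "impD = cemetery impM"

definition QkerD :: "'x option \<Rightarrow> 'a option \<Rightarrow> 'x option measure" where
  "QkerD x b = (case (x, b) of
      (Some x', Some b') \<Rightarrow> distr (Qker M x' b') stateD Some
    | _ \<Rightarrow> return stateD None)"

definition admD :: "'x option \<Rightarrow> 'a option set" where
  "admD x = (case x of None \<Rightarrow> {None} | Some _ \<Rightarrow> space impD)"

definition Yfin :: "nat \<Rightarrow> (nat \<Rightarrow> 'x option \<times> 'a option) set" where
  "Yfin k = {y. (\<forall>i<k. y i \<in> (Some ` states M) \<times> (Some ` impulses M)) \<and>
               y k \<in> (Some ` states M) \<times> {None} \<and>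
               (\<forall>i>k. y i = (None, None))}"

definition Yinf :: "(nat \<Rightarrow> 'x option \<times> 'a option) set" where
  "Yinf = {y. \<forall>i. y i \<in> (Some ` states M) \<times> (Some ` impulses M)}"

definition Yset :: "(nat \<Rightarrow> 'x option \<times> 'a option) set" where
  "Yset = (\<Union>k. Yfin k) \<union> Yinf"

definition Ystar :: "(nat \<Rightarrow> 'x option \<times> 'a option) set" where
  "Ystar = Yset - Yfin 0"

definition YM :: "(nat \<Rightarrow> 'x option \<times> 'a option) measure" where
  "YM = restrict_space (\<Pi>\<^sub>M i\<in>UNIV. stateD \<Otimes>\<^sub>M impD) Yset"

definition beta ::
  "(nat \<Rightarrow> (nat \<Rightarrow> 'x option \<times> 'a option) \<Rightarrow> 'x option \<Rightarrow> 'a option measure)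
    \<Rightarrow> 'x \<Rightarrow> (nat \<Rightarrow> 'x option \<times> 'a option) measure" where
  "beta \<sigma> x = restrict_space (dtmdp_law stateD impD QkerD \<sigma> (Some x)) Yset"

definition PY_kernels :: "('x \<Rightarrow> (nat \<Rightarrow> 'x option \<times> 'a option) measure) set" where
  "PY_kernels = {\<beta>. \<exists>\<sigma> \<in> strategies stateD impD admD. \<forall>x \<in> states M. \<beta> x = beta \<sigma> x}"

definition PY :: "'x \<Rightarrow> (nat \<Rightarrow> 'x option \<times> 'a option) measure set" where
  "PY x = {beta \<sigma> x | \<sigma>. \<sigma> \<in> strategies stateD impD admD}"

definition PYstar :: "'x \<Rightarrow> (nat \<Rightarrow> 'x option \<times> 'a option) measure set" where
  "PYstar x = {\<beta> x | \<beta>. \<beta> \<in> PY_kernels \<and> emeasure (\<beta> x) Ystar = 1}"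

definition xbar :: "(nat \<Rightarrow> 'x option \<times> 'a option) \<Rightarrow> 'x option" where
  "xbar y = (if \<exists>k. y \<in> Yfin k then fst (y (THE k. y \<in> Yfin k)) else None)"

definition costI_D :: "'x option \<Rightarrow> 'a option \<Rightarrow> 'x option \<Rightarrow> ennreal" where
  "costI_D x b z = (case (x, b, z) of
      (Some x', Some b', Some z') \<Rightarrow> ennreal (costI M x' b' z')
    | _ \<Rightarrow> 0)"

definition CI :: "(nat \<Rightarrow> 'x option \<times> 'a option) \<Rightarrow> ennreal" where
  "CI y = (\<Sum>k. costI_D (fst (y k)) (snd (y k)) (fst (y (Suc k))))"


section \<open>Sample paths and histories\<close>

text \<open>
  A sample path \<open>(y\<^sub>0, \<theta>\<^sub>1, y\<^sub>1, \<theta>\<^sub>2, y\<^sub>2, \<dots>)\<close> is the sequence \<open>\<omega>\<close> with \<open>\<omega> n = (\<theta>\<^sub>n, y\<^sub>n)\<close>, where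
  \<open>\<theta>\<^sub>0 = 0\<close> is a dummy entry.
\<close>

definition coordM :: "(ennreal \<times> (nat \<Rightarrow> 'x option \<times> 'a option) option) measure" where
  "coordM = borel \<Otimes>\<^sub>M cemetery YM"

definition Omega :: "(nat \<Rightarrow> ennreal \<times> (nat \<Rightarrow> 'x option \<times> 'a option) option) set" where
  "Omega = {\<omega>. \<omega> 0 \<in> {0} \<times> (Some ` Yset) \<and> \<omega> 1 \<in> {0} \<times> (Some ` Yset) \<and>
      ((\<forall>n\<ge>2. \<omega> n \<in> {0<..<\<infinity>} \<times> (Some ` Yset)) \<or>
       (\<exists>m\<ge>1. (\<forall>n\<in>{2..m}. \<omega> n \<in> {0<..<\<infinity>} \<times> (Some ` Yset)) \<and> (\<forall>n>m. \<omega> n = (\<infinity>, None))))}"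

text \<open>
  Histories \<open>h\<^sub>n\<close> with \<open>y\<^sub>n \<noteq> \<Delta>\<close>; the values of a policy at \<open>y\<^sub>n = \<Delta>\<close> are immaterial and are not
  part of the data.
\<close>

definition Hset :: "nat \<Rightarrow> (nat \<Rightarrow> ennreal \<times> (nat \<Rightarrow> 'x option \<times> 'a option) option) set" where
  "Hset n = {h. h 0 \<in> {0} \<times> (Some ` Yset) \<and> h 1 \<in> {0} \<times> (Some ` Yset) \<and>
               (\<forall>i\<in>{2..n}. h i \<in> {0<..<\<infinity>} \<times> (Some ` Yset))}"

definition histM :: "nat \<Rightarrow> (nat \<Rightarrow> ennreal \<times> (nat \<Rightarrow> 'x option \<times> 'a option) option) measure" where
  "histM n = restrict_space (\<Pi>\<^sub>M i\<in>{..n}. coordM) (Hset n)"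

definition Ypath :: "nat \<Rightarrow> (nat \<Rightarrow> ennreal \<times> (nat \<Rightarrow> 'x option \<times> 'a option) option)
    \<Rightarrow> (nat \<Rightarrow> 'x option \<times> 'a option) option" where
  "Ypath n \<omega> = snd (\<omega> n)"

definition xbar_at :: "nat \<Rightarrow> (nat \<Rightarrow> ennreal \<times> (nat \<Rightarrow> 'x option \<times> 'a option) option)
    \<Rightarrow> 'x option" where
  "xbar_at n h = Option.bind (Ypath n h) xbar"

definition Tpath :: "nat \<Rightarrow> (nat \<Rightarrow> ennreal \<times> (nat \<Rightarrow> 'x option \<times> 'a option) option)
    \<Rightarrow> ennreal" where
  "Tpath n \<omega> = (\<Sum>i=1..n. fst (\<omega> i))"

definition xi :: "(nat \<Rightarrow> ennreal \<times> (nat \<Rightarrow> 'x option \<times> 'a option) option) \<Rightarrow> real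
    \<Rightarrow> (nat \<Rightarrow> 'x option \<times> 'a option) option" where
  "xi \<omega> t =
    (if \<exists>n\<ge>1. Tpath n \<omega> \<le> ennreal t \<and> ennreal t < Tpath (Suc n) \<omega>
     then Ypath (THE n. n \<ge> 1 \<and> Tpath n \<omega> \<le> ennreal t \<and> ennreal t < Tpath (Suc n) \<omega>) \<omega>
     else None)"

end


section \<open>Policies\<close>

record ('x, 'a) gi_policy =
  pol_init :: "'x \<Rightarrow> (nat \<Rightarrow> 'x option \<times> 'a option) measure"
  pol_Phi :: "nat \<Rightarrow> (nat \<Rightarrow> ennreal \<times> (nat \<Rightarrow> 'x option \<times> 'a option) option) \<Rightarrow> ennreal measure"
  pol_Pi :: "nat \<Rightarrow> (nat \<Rightarrow> ennreal \<times> (nat \<Rightarrow> 'x option \<times> 'a option) option) \<Rightarrow> real \<Rightarrow> 'a measure"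
  pol_Gam0 :: "nat \<Rightarrow> (nat \<Rightarrow> ennreal \<times> (nat \<Rightarrow> 'x option \<times> 'a option) option) \<Rightarrow> real \<Rightarrow> 'x
                 \<Rightarrow> (nat \<Rightarrow> 'x option \<times> 'a option) measure"
  pol_Gam1 :: "nat \<Rightarrow> (nat \<Rightarrow> ennreal \<times> (nat \<Rightarrow> 'x option \<times> 'a option) option)
                 \<Rightarrow> (nat \<Rightarrow> 'x option \<times> 'a option) measure"

context
  fixes M :: "('x::polish_space, 'a::polish_space) gi_model"
begin

definition policies :: "('x, 'a) gi_policy set" where
  "policies = {u.
     pol_init u \<in> PY_kernels M \<and>
     (\<forall>n\<ge>1.
        pol_Phi u n \<in> histM M n \<rightarrow>\<^sub>M prob_algebra (restrict_space borel {0<..}) \<and>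
        (\<forall>h \<in> space (histM M n). Ypath n h \<in> Some ` Yinf M \<longrightarrow> emeasure (pol_Phi u n h) {\<infinity>} = 1) \<and>
        (\<lambda>(h, t). pol_Pi u n h t)
          \<in> histM M n \<Otimes>\<^sub>M restrict_space borel {0<..} \<rightarrow>\<^sub>M prob_algebra (gradM M) \<and>
        (\<lambda>(h, t, x). pol_Gam0 u n h t x)
          \<in> histM M n \<Otimes>\<^sub>M (restrict_space borel {0<..} \<Otimes>\<^sub>M stateM M) \<rightarrow>\<^sub>M prob_algebra (YM M) \<and>
        (\<forall>h \<in> space (histM M n). \<forall>t>0. \<forall>x \<in> states M. pol_Gam0 u n h t x \<in> PY M x) \<and>
        pol_Gam1 u n \<in> histM M n \<rightarrow>\<^sub>M prob_algebra (YM M) \<and>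
        (\<forall>h \<in> space (histM M n). \<forall>x. xbar_at M n h = Some x \<longrightarrow> pol_Gam1 u n h \<in> PYstar M x))}"


section \<open>The controlled process\<close>

definition lam :: "('x, 'a) gi_policy \<Rightarrow> nat
    \<Rightarrow> (nat \<Rightarrow> ennreal \<times> (nat \<Rightarrow> 'x option \<times> 'a option) option) \<Rightarrow> real \<Rightarrow> 'x measure" where
  "lam u n h t = (case xbar_at M n h of
      None \<Rightarrow> null_measure (stateM M)
    | Some x \<Rightarrow> measure_of (states M) (sets (stateM M))
                 (\<lambda>B. \<integral>\<^sup>+a. emeasure (qtilde M x a) B \<partial>pol_Pi u n h t))"

definition Lam :: "('x, 'a) gi_policy \<Rightarrow> nat
    \<Rightarrow> (nat \<Rightarrow> ennreal \<times> (nat \<Rightarrow> 'x option \<times> 'a option) option) \<Rightarrow> ennreal \<Rightarrow> ennreal" where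
  "Lam u n h t = (\<integral>\<^sup>+s\<in>{s. 0 < s \<and> ennreal s < t}. emeasure (lam u n h s) (states M) \<partial>lborel)"

text \<open>The conditional law of \<open>(\<Theta>\<^sub>n\<^sub>+\<^sub>1, Y\<^sub>n\<^sub>+\<^sub>1)\<close> given a history with \<open>y\<^sub>n \<noteq> \<Delta>\<close>.\<close>

definition Gker :: "('x, 'a) gi_policy \<Rightarrow> nat
    \<Rightarrow> (nat \<Rightarrow> ennreal \<times> (nat \<Rightarrow> 'x option \<times> 'a option) option)
    \<Rightarrow> (ennreal \<times> (nat \<Rightarrow> 'x option \<times> 'a option) option) measure" where
  "Gker u n h = measure_of (space (coordM M)) (sets (coordM M)) (\<lambda>B.
      exp_neg (Lam u n h \<infinity>) * emeasure (pol_Phi u n h) {\<infinity>} * indicator B (\<infinity>, None)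
    + (\<integral>\<^sup>+t\<in>{0<..<\<infinity>}. emeasure (pol_Gam1 u n h) {y \<in> Yset M. (t, Some y) \<in> B} * exp_neg (Lam u n h t)
         \<partial>pol_Phi u n h)
    + (\<integral>\<^sup>+t\<in>{0<..}. (\<integral>\<^sup>+x. emeasure (pol_Phi u n h) {ennreal t..}
                        * emeasure (pol_Gam0 u n h t x) {y \<in> Yset M. (ennreal t, Some y) \<in> B}
                        * exp_neg (Lam u n h (ennreal t)) \<partial>lam u n h t) \<partial>lborel))"

definition y_init :: "'x \<Rightarrow> nat \<Rightarrow> 'x option \<times> 'a option" where
  "y_init x = (\<lambda>k. if k = 0 then (Some x, None) else (None, None))"

text \<open>The law of coordinate \<open>i\<close> given the coordinates with smaller indices.\<close>

definition gi_step :: "('x, 'a) gi_policy \<Rightarrow> 'x \<Rightarrow> nat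
    \<Rightarrow> (nat \<Rightarrow> ennreal \<times> (nat \<Rightarrow> 'x option \<times> 'a option) option)
    \<Rightarrow> (ennreal \<times> (nat \<Rightarrow> 'x option \<times> 'a option) option) measure" where
  "gi_step u x i h =
    (if i = 0 then return (coordM M) (0, Some (y_init x))
     else if i = 1 then distr (pol_init u x) (coordM M) (\<lambda>y. (0, Some y))
     else if h \<in> Hset M (i - 1) then Gker u (i - 1) h
     else return (coordM M) (\<infinity>, None))"

definition gi_law :: "('x, 'a) gi_policy \<Rightarrow> 'x
    \<Rightarrow> (nat \<Rightarrow> ennreal \<times> (nat \<Rightarrow> 'x option \<times> 'a option) option) measure" where
  "gi_law u x = restrict_space (path_measure (gi_step u x) (\<lambda>_. coordM M)) (Omega M)"

definition costG_rate :: "('x, 'a) gi_policy \<Rightarrow> nat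
    \<Rightarrow> (nat \<Rightarrow> ennreal \<times> (nat \<Rightarrow> 'x option \<times> 'a option) option) \<Rightarrow> real \<Rightarrow> ennreal" where
  "costG_rate u n \<omega> s = (case Option.bind (xi \<omega> s) (xbar M) of
      None \<Rightarrow> 0
    | Some x \<Rightarrow> (\<integral>\<^sup>+a. ennreal (costG M x a)
                  \<partial>pol_Pi u n (restrict \<omega> {..n}) (s - enn2real (Tpath n \<omega>))))"

definition total_cost :: "('x, 'a) gi_policy
    \<Rightarrow> (nat \<Rightarrow> ennreal \<times> (nat \<Rightarrow> 'x option \<times> 'a option) option) \<Rightarrow> ennreal" where
  "total_cost u \<omega> = (\<Sum>m. let n = Suc m in
      (case Ypath n \<omega> of None \<Rightarrow> 0 | Some y \<Rightarrow> CI M y)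
      + (\<integral>\<^sup>+s\<in>{s. Tpath n \<omega> < ennreal s \<and> ennreal s < Tpath (Suc n) \<omega>}. costG_rate u n \<omega> s \<partial>lborel))"

definition performance :: "'x \<Rightarrow> ('x, 'a) gi_policy \<Rightarrow> ennreal" where
  "performance x u = (\<integral>\<^sup>+\<omega>. exp_pos (total_cost u \<omega>) \<partial>gi_law u x)"

definition gi_value :: "'x \<Rightarrow> ennreal" where
  "gi_value x = (INF u\<in>policies. performance x u)"

definition optimal_policy :: "('x, 'a) gi_policy \<Rightarrow> bool" where
  "optimal_policy u \<longleftrightarrow> u \<in> policies \<and> (\<forall>x \<in> states M. performance x u = gi_value x)"


section \<open>Deterministic stationary policies\<close>

definition stationary_imp :: "('x \<Rightarrow> ennreal) \<Rightarrow> ('x \<Rightarrow> 'a)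
    \<Rightarrow> nat \<Rightarrow> (nat \<Rightarrow> 'x option \<times> 'a option) \<Rightarrow> 'x option \<Rightarrow> 'a option measure" where
  "stationary_imp \<phi> \<psi> n h s = (case s of
      None \<Rightarrow> return (impD M) None
    | Some x \<Rightarrow> if \<phi> x = \<infinity> then return (impD M) None else return (impD M) (Some (\<psi> x)))"

text \<open>
  \<open>det_stationary \<phi> \<psi> f u\<close>: the policy \<open>u\<close> is the deterministic stationary policy given by
  \<open>(\<phi>, \<psi>, f)\<close>.  The kernels \<open>\<Gamma>\<^sup>1\<^sub>n\<close> are left arbitrary, so \<open>u\<close> is not unique.
\<close>

definition det_stationary :: "('x \<Rightarrow> ennreal) \<Rightarrow> ('x \<Rightarrow> 'a) \<Rightarrow> ('x \<Rightarrow> 'a)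
    \<Rightarrow> ('x, 'a) gi_policy \<Rightarrow> bool" where
  "det_stationary \<phi> \<psi> f u \<longleftrightarrow>
     u \<in> policies \<and>
     \<phi> \<in> stateM M \<rightarrow>\<^sub>M borel \<and> \<phi> \<in> states M \<rightarrow> {0, \<infinity>} \<and>
     \<psi> \<in> stateM M \<rightarrow>\<^sub>M impM M \<and> f \<in> stateM M \<rightarrow>\<^sub>M gradM M \<and>
     (\<forall>x \<in> states M. pol_init u x = beta M (stationary_imp \<phi> \<psi>) x) \<and>
     (\<forall>n\<ge>1. \<forall>h \<in> space (histM M n).
        emeasure (pol_Phi u n h) {\<infinity>} = 1 \<and>
        (\<forall>t>0.
           (\<forall>x. xbar_at M n h = Some x \<longrightarrow> pol_Pi u n h t = return (gradM M) (f x)) \<and>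
           (\<forall>x \<in> states M. pol_Gam0 u n h t x = beta M (stationary_imp \<phi> \<psi>) x)))"


section \<open>The tilde DTMDP\<close>

definition actM :: "'a measure" where
  "actM = restrict_space borel (impulses M \<union> gradual M)"

definition Qtil :: "('x \<Rightarrow> real) \<Rightarrow> 'x \<Rightarrow> 'a \<Rightarrow> 'x measure" where
  "Qtil w x a = (if a \<in> gradual M
     then measure_of (states M) (sets (stateM M)) (\<lambda>B. ennreal (qker M x a B / w x + indicator B x))
     else Qker M x a)"

definition ltil :: "('x \<Rightarrow> real) \<Rightarrow> 'x \<Rightarrow> 'a \<Rightarrow> 'x \<Rightarrow> real" where
  "ltil w x a y = (if a \<in> gradual M then ln (w x / (w x - costG M x a)) else costI M x a y)"

definition Wstar :: "('x \<Rightarrow> real) \<Rightarrow> 'x \<Rightarrow> ennreal" where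
  "Wstar w x = (INF \<sigma>\<in>strategies (stateM M) actM (\<lambda>_. space actM).
     (\<integral>\<^sup>+\<omega>. exp_pos (\<Sum>n. ennreal (ltil w (fst (\<omega> n)) (snd (\<omega> n)) (fst (\<omega> (Suc n)))))
       \<partial>dtmdp_law (stateM M) actM (Qtil w) \<sigma> x))"

text \<open>
  The functions integrated below are only universally measurable in general; \<^term>\<open>nn_integral\<close>
  is then the integral with respect to the completed measure (nn_integral_completion).
\<close>

definition bellman :: "('x \<Rightarrow> real) \<Rightarrow> ('x \<Rightarrow> ennreal) \<Rightarrow> 'x \<Rightarrow> 'a \<Rightarrow> ennreal" where
  "bellman w g x a = (\<integral>\<^sup>+y. ennreal (exp (ltil w x a y)) * g y \<partial>Qtil w x a)"

definition XG :: "('x \<Rightarrow> ennreal) \<Rightarrow> 'x set" where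
  "XG g = {x \<in> states M. g x < \<infinity> \<and>
     0 = (INF a\<in>gradual M. enn2ereal (\<integral>\<^sup>+y. g y \<partial>qtilde M x a)
            - ereal (jump_rate M x a - costG M x a) * enn2ereal (g x))}"

definition XI :: "('x \<Rightarrow> ennreal) \<Rightarrow> 'x set" where
  "XI g = {x \<in> states M.
     g x = (INF b\<in>impulses M. \<integral>\<^sup>+y. g y * ennreal (exp (costI M x b y)) \<partial>Qker M x b)}"

definition conserving :: "('x \<Rightarrow> real) \<Rightarrow> ('x \<Rightarrow> 'a) \<Rightarrow> ('x \<Rightarrow> 'a) \<Rightarrow> 'x \<Rightarrow> 'a \<Rightarrow> bool" where
  "conserving w \<psi> f x c \<longleftrightarrow>
     bellman w (Wstar w) x c = (INF a\<in>impulses M \<union> gradual M. bellman w (Wstar w) x a) \<and>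
     (INF a\<in>impulses M \<union> gradual M. bellman w (Wstar w) x a) =
       bellman w (Wstar w) x (\<psi> x) * indicator (impulses M) c
       + bellman w (Wstar w) x (f x) * indicator (gradual M) c"

text \<open>
  The argument \<open>c\<close> of \<^term>\<open>conserving\<close> is the minimizing action whose existence is required.
  If at some \<open>x\<close> the minimum is attained both by an impulse and by a gradual control, then the
  relation with a gradual action \<open>c\<close> says nothing about \<open>\<psi> x\<close>, whereas the policy of the theorem
  applies \<open>\<psi> x\<close> on \<open>XI (Wstar w)\<close>.  Hence \<open>c\<close> has to be an impulse on that set.
\<close>

definition conserving_pair :: "('x \<Rightarrow> real) \<Rightarrow> ('x \<Rightarrow> 'a) \<Rightarrow> ('x \<Rightarrow> 'a) \<Rightarrow> bool" where
  "conserving_pair w \<psi> f \<longleftrightarrow>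
     \<psi> \<in> stateM M \<rightarrow>\<^sub>M impM M \<and> f \<in> stateM M \<rightarrow>\<^sub>M gradM M \<and>
     (\<forall>x \<in> states M. \<exists>c \<in> impulses M \<union> gradual M.
        (x \<in> XI (Wstar w) \<longrightarrow> c \<in> impulses M) \<and> conserving w \<psi> f x c)"

end

end

theory Submission
  imports Defs
begin

text \<open>The tilde DTMDP is the uniformization of the continuous-time problem, and both problems have the optimality
equation \<open>W = inf\<^sub>a T\<^sub>a W\<close> with the operator \<open>T\<^sub>a = bellman\<close>. The
theorem follows once \<open>Wstar\<close> and \<open>gi_value\<close> are both identified with one function,
\<open>Vinf\<close>.

The constant \<open>\<infinity>\<close> solves the equation as well, and an arbitrary strategy need not let
the terminal payoff disappear. Therefore \<open>Vinf\<close> is the supremum of \<open>V (n+1) = min (n+2,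
inf\<^sub>a T\<^sub>a (\<alpha>\<^sub>n V n + 1 - \<alpha>\<^sub>n))\<close> with
\<open>\<alpha>\<^sub>n\<close> increasing to 1. These functions are bounded, lower semicontinuous and
increasing. Compactness of the action spaces makes \<open>Vinf\<close> a solution
(\<open>Vinf_bellman\<close>), while each \<open>V n\<close> satisfies \<open>V n \<le> T\<^sub>a
(\<alpha>\<^sub>n V n + 1 - \<alpha>\<^sub>n)\<close> for all actions.

For the lower bounds, iteration of this inequality along any strategy gives \<open>V n x \<le> E (e\<^sup>c (1
+ \<alpha>\<^sub>n\<^sup>k (V n (X\<^sub>k) - 1)))\<close>, where \<open>c\<close> is the cost of
\<open>k\<close> steps, and \<open>k \<rightarrow> \<infinity>\<close> is harmless as \<open>V n\<close> is
bounded. In the tilde DTMDP a step is a transition (\<open>lower_bound\<close>). In the gradual-impulse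
problem it is a sojourn followed by an intervention (\<open>performance_lower\<close>): each impulse earns a
factor \<open>\<alpha>\<^sub>n\<close> (\<open>PYstar_lower\<close>), and between impulses the inequality
becomes a differential inequality for the expected exponential cost up to the next jump
(\<open>stage_lower\<close>).

For the upper bounds, lower semicontinuity and compactness give measurable minimizers. Along a conserving pair
the exponential cost times \<open>Vinf\<close> of the current state decreases in expectation, and \<open>Vinf
\<ge> 1\<close> (\<open>upper_bound\<close>, \<open>performance_upper\<close>). A sojourn then has constant
rates, and the conserving relation reads \<open>\<integral>Vinf dqtilde = (q - c) Vinf\<close>
(\<open>stage_upper\<close>).\<close>

section \<open>Integration against kernels and path measures\<close>

text \<open>Sigma-additive functionals on the nonnegative measurable functions. A set function given by a formula is
recognized as a measure, and integrated, by extending the formula from indicators to functions.\<close>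
definition pos_functional :: "'z measure => (('z => ennreal) => ennreal) => bool" where
 "pos_functional N I \<longleftrightarrow>
  (\<forall>f \<in> borel_measurable N. \<forall>g \<in> borel_measurable N. I (%z. f z + g z) = I f + I g) &
  (\<forall>c. \<forall>f \<in> borel_measurable N. I (%z. c * f z) = c * I f) &
  (\<forall>F::nat => 'z => ennreal. (\<forall>i. F i \<in> borel_measurable N) --> incseq F --> I (%z. SUP i. F i z) = (SUP i. I (F i))) &
  (\<forall>f g. (\<forall>z\<in>space N. f z = g z) --> I f = I g)"

lemma pos_functional_suminf:
 assumes I: "pos_functional N I" and F[measurable]: "!!i::nat. F i \<in> borel_measurable N"
 shows "I (%z. \<Sum>i. F i z) = (\<Sum>i. I (F i))"
proof -
 have zero: "I (%z. 0) = 0"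
  using I[unfolded pos_functional_def, THEN conjunct2, THEN conjunct1, rule_format, of "%z. 0" 0] by simp
 have add: "I (%z. f z + g z) = I f + I g" if "f \<in> borel_measurable N" "g \<in> borel_measurable N" for f g
  using I that unfolding pos_functional_def by blast
 have fin: "I (%z. \<Sum>i<n. F i z) = (\<Sum>i<n. I (F i))" for n
  by (induction n) (simp_all add: zero add)
 have eq: "(%z. \<Sum>i. F i z) = (%z. SUP n. \<Sum>i<n. F i z)"
  by (simp add: fun_eq_iff suminf_eq_SUP)
 have inc: "incseq (%n z. \<Sum>i<n. F i z)"
  by (auto simp: incseq_def le_fun_def intro!: sum_mono2)
 have "I (%z. SUP n. \<Sum>i<n. F i z) = (SUP n. I (%z. \<Sum>i<n. F i z))"
  using I[unfolded pos_functional_def, THEN conjunct2, THEN conjunct2, THEN conjunct1, rule_format, OF _ inc] by simp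
 then show ?thesis unfolding eq fin suminf_eq_SUP .
qed

lemma
 assumes I: "pos_functional N I"
 defines "P == measure_of (space N) (sets N) (%B. I (indicator B))"
 shows sets_functional: "sets P = sets N"
  and emeasure_functional: "B \<in> sets N ==> emeasure P B = I (indicator B)"
  and nn_integral_functional: "f \<in> borel_measurable N ==> (\<integral>\<^sup>+z. f z \<partial>P) = I f"
proof -
 have scale: "I (%z. c * f z) = c * I f" if "f \<in> borel_measurable N" for f c
  using I that unfolding pos_functional_def by blast
 have add: "I (%z. f z + g z) = I f + I g" if "f \<in> borel_measurable N" "g \<in> borel_measurable N" for f g
  using I that unfolding pos_functional_def by blast
 have zero: "I (%z. 0) = 0" using scale[of "%z. 0" 0] by simp
 have ms: "measure_space (space N) (sets N) (%B. if B \<in> sets N then I (indicator B) else 0)"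
 proof (rule measure_space_def[THEN iffD2], intro conjI)
  show "sigma_algebra (space N) (sets N)" by (rule sets.sigma_algebra_axioms)
  show "positive (sets N) (%B. if B \<in> sets N then I (indicator B) else 0)"
   using zero by (simp add: positive_def indicator_def[abs_def])
  show "countably_additive (sets N) (%B. if B \<in> sets N then I (indicator B) else 0)"
  proof (rule countably_additiveI)
   fix A :: "nat => 'a set" assume A: "range A \<subseteq> sets N" "disjoint_family A" "(\<Union>i. A i) \<in> sets N"
   have "(%z. indicator (\<Union>i. A i) z :: ennreal) = (%z. \<Sum>i. indicator (A i) z)"
    using suminf_indicator[OF A(2)] by (auto simp: fun_eq_iff)
   moreover have "I (%z. \<Sum>i. indicator (A i) z) = (\<Sum>i. I (indicator (A i)))"
    using A by (intro pos_functional_suminf[OF I]) auto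
   ultimately have *: "I (indicator (\<Union>i. A i)) = (\<Sum>i. I (indicator (A i)))" by simp
   have "(if A i \<in> sets N then I (indicator (A i)) else 0) = I (indicator (A i))" for i using A(1) by auto
   then show "(\<Sum>i. if A i \<in> sets N then I (indicator (A i)) else 0)
     = (if (\<Union>i. A i) \<in> sets N then I (indicator (\<Union>i. A i)) else 0)" using * A(3) by simp
  qed
 qed
 have P_eq: "P = measure_of (space N) (sets N) (%B. if B \<in> sets N then I (indicator B) else 0)"
  unfolding P_def by (rule measure_of_eq[OF sets.space_closed]) (simp add: sets.sigma_sets_eq)
 show s: "sets P = sets N" unfolding P_def by (simp add: sets.space_closed sets.sigma_sets_eq)
 show em: "emeasure P B = I (indicator B)" if "B \<in> sets N" for B
  using emeasure_measure_of_sigma[of "space N" "sets N" "%B. if B \<in> sets N then I (indicator B) else 0" B] ms that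
  unfolding P_eq measure_space_def by auto
 have sp: "space P = space N" using s by (rule sets_eq_imp_space_eq)
 show "(\<integral>\<^sup>+z. f z \<partial>P) = I f" if "f \<in> borel_measurable N"
  using that
 proof (induction rule: borel_measurable_induct)
  case (cong f g)
  then have "I f = I g" using I unfolding pos_functional_def by blast
  then show ?case using cong by (subst nn_integral_cong[of P f g]) (auto simp: sp)
 next
  case (set A) then show ?case using em s by simp
 next
  case (mult u c)
  then show ?case using scale[of u c] by (subst nn_integral_cmult) (auto cong: measurable_cong_sets simp: measurable_cong_sets[OF s refl])
 next
  case (add u v)
  then show ?case using assms(1) by (subst nn_integral_add)
    (auto simp: measurable_cong_sets[OF s refl] \<open>!!f g. f \<in> borel_measurable N ==> g \<in> borel_measurable N ==> I (%z. f z + g z) = I f + I g\<close>)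
 next
  case (seq U)
  have "(\<integral>\<^sup>+z. (SUP i. U i) z \<partial>P) = (SUP i. \<integral>\<^sup>+z. U i z \<partial>P)"
   unfolding SUP_apply using seq by (intro nn_integral_monotone_convergence_SUP) (auto simp: measurable_cong_sets[OF s refl])
  moreover have "I (%z. SUP i. U i z) = (SUP i. I (U i))"
   using I seq unfolding pos_functional_def by blast
  moreover have "(SUP i. U i) = (%z. SUP i. U i z)" by (simp add: fun_eq_iff image_comp)
  ultimately show ?case using seq by simp
 qed
qed

lemma pos_functional_nn_integral: "sets P = sets N ==> pos_functional N (%f. \<integral>\<^sup>+z. f z \<partial>P)"
 unfolding pos_functional_def
 by (auto simp: measurable_cong_sets[of P N borel borel, symmetric] nn_integral_add nn_integral_cmult
    nn_integral_monotone_convergence_SUP dest: sets_eq_imp_space_eq intro!: nn_integral_cong)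

lemma pos_functional_eval: "z \<in> space N ==> pos_functional N (%f. c * f z)"
 unfolding pos_functional_def
 by (auto simp: distrib_left mult_ac SUP_mult_left_ennreal image_comp)

lemma pos_functional_mono:
 assumes I: "pos_functional N I" and fg: "f \<in> borel_measurable N" "g \<in> borel_measurable N" "f <= g"
 shows "I f <= I g"
proof -
 define F where "F i = (if i = 0 then f else g)" for i :: nat
 have "incseq F" using fg by (auto simp: F_def incseq_def le_fun_def)
 moreover have "\<forall>i. F i \<in> borel_measurable N" using fg by (auto simp: F_def)
 ultimately have "I (%z. SUP i. F i z) = (SUP i. I (F i))"
  using I unfolding pos_functional_def by blast
 moreover have "(%z. SUP i. F i z) = g"
  using fg by (auto simp: F_def le_fun_def fun_eq_iff intro!: antisym SUP_least SUP_upper2[of 1])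
 ultimately show ?thesis using SUP_upper[of 0 UNIV "%i. I (F i)"] by (simp add: F_def)
qed

lemma pos_functional_add:
 assumes I: "pos_functional N I" and J: "pos_functional N J"
 shows "pos_functional N (%f. I f + J f)"
proof -
 note I' = I[unfolded pos_functional_def] and J' = J[unfolded pos_functional_def]
 show ?thesis unfolding pos_functional_def
 proof (intro conjI ballI allI impI)
  fix F :: "nat => 'a => ennreal" assume F: "\<forall>i. F i \<in> borel_measurable N" "incseq F"
  have "incseq (%i. I (F i))" "incseq (%i. J (F i))"
   using F pos_functional_mono[OF I] pos_functional_mono[OF J] by (auto simp: incseq_def)
  from ennreal_SUP_add[OF this]
  have "(SUP i. I (F i) + J (F i)) = (SUP i. I (F i)) + (SUP i. J (F i))" .
  moreover have "I (%z. SUP i. F i z) = (SUP i. I (F i))" "J (%z. SUP i. F i z) = (SUP i. J (F i))"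
   using I' J' F by blast+
  ultimately show "I (%z. SUP i. F i z) + J (%z. SUP i. F i z) = (SUP i. I (F i) + J (F i))" by simp
 next
  fix f g :: "'a => ennreal" assume "f \<in> borel_measurable N" "g \<in> borel_measurable N"
  then have "I (%z. f z + g z) = I f + I g" "J (%z. f z + g z) = J f + J g" using I' J' by blast+
  then show "I (%z. f z + g z) + J (%z. f z + g z) = I f + J f + (I g + J g)" by (simp add: ac_simps)
 next
  fix c and f :: "'a => ennreal" assume "f \<in> borel_measurable N"
  then have "I (%z. c * f z) = c * I f" "J (%z. c * f z) = c * J f" using I' J' by blast+
  then show "I (%z. c * f z) + J (%z. c * f z) = c * (I f + J f)" by (simp add: distrib_left)
 next
  fix f g :: "'a => ennreal" assume "\<forall>z\<in>space N. f z = g z"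
  then have "I f = I g" "J f = J g" using I' J' by blast+
  then show "I f + J f = I g + J g" by simp
 qed
qed

lemma pos_functional_mixture:
 assumes I: "!!t. t \<in> space P ==> pos_functional N (I t)"
  and m: "!!f. f \<in> borel_measurable N ==> (%t. I t f) \<in> borel_measurable P"
  and [measurable]: "h \<in> borel_measurable P"
 shows "pos_functional N (%f. \<integral>\<^sup>+t. h t * I t f \<partial>P)"
 unfolding pos_functional_def
proof (intro conjI ballI allI impI)
 fix f g :: "'b => ennreal" assume fg: "f \<in> borel_measurable N" "g \<in> borel_measurable N"
 note [measurable] = m[OF fg(1)] m[OF fg(2)]
 have "(\<integral>\<^sup>+t. h t * I t (%z. f z + g z) \<partial>P) = (\<integral>\<^sup>+t. h t * I t f + h t * I t g \<partial>P)"
  using I fg by (intro nn_integral_cong) (auto simp: pos_functional_def distrib_left)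
 also have "... = (\<integral>\<^sup>+t. h t * I t f \<partial>P) + (\<integral>\<^sup>+t. h t * I t g \<partial>P)"
  by (intro nn_integral_add) measurable
 finally show "(\<integral>\<^sup>+t. h t * I t (%z. f z + g z) \<partial>P) = ..." .
next
 fix c and f :: "'b => ennreal" assume f: "f \<in> borel_measurable N"
 note [measurable] = m[OF f]
 have "(\<integral>\<^sup>+t. h t * I t (%z. c * f z) \<partial>P) = (\<integral>\<^sup>+t. c * (h t * I t f) \<partial>P)"
  using I f by (intro nn_integral_cong) (auto simp: pos_functional_def mult_ac)
 also have "... = c * (\<integral>\<^sup>+t. h t * I t f \<partial>P)"
  by (intro nn_integral_cmult) measurable
 finally show "(\<integral>\<^sup>+t. h t * I t (%z. c * f z) \<partial>P) = ..." .
next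
 fix F :: "nat => 'b => ennreal" assume F: "\<forall>i. F i \<in> borel_measurable N" "incseq F"
 then have [measurable]: "(%t. I t (F i)) \<in> borel_measurable P" for i using m by blast
 have "(\<integral>\<^sup>+t. h t * I t (%z. SUP i. F i z) \<partial>P) = (\<integral>\<^sup>+t. (SUP i. h t * I t (F i)) \<partial>P)"
  using I F by (intro nn_integral_cong) (auto simp: pos_functional_def SUP_mult_left_ennreal)
 also have "... = (SUP i. \<integral>\<^sup>+t. h t * I t (F i) \<partial>P)"
 proof (rule nn_integral_monotone_convergence_SUP_AE)
  fix i show "AE t in P. h t * I t (F i) <= h t * I t (F (Suc i))"
   using F by (intro AE_I2 mult_left_mono pos_functional_mono[OF I]) (auto simp: incseq_Suc_iff)
 qed measurable
 finally show "(\<integral>\<^sup>+t. h t * I t (%z. SUP i. F i z) \<partial>P) = ..." .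
next
 fix f g :: "'b => ennreal" assume fg: "\<forall>z\<in>space N. f z = g z"
 have "I t f = I t g" if "t \<in> space P" for t
  using I[OF that] fg unfolding pos_functional_def by blast
 then show "(\<integral>\<^sup>+t. h t * I t f \<partial>P) = (\<integral>\<^sup>+t. h t * I t g \<partial>P)"
  by (intro nn_integral_cong) simp
qed

subsection \<open>Path measures\<close>

context Ionescu_Tulcea
begin

lemma sets_path_measure: "sets (path_measure P M) = sets (PiM UNIV M)"
 by (simp add: path_measure_def)

lemma nn_integral_path_restrict:
 assumes [measurable]: "f \<in> borel_measurable (PiM {0..<n} M)"
 shows "(\<integral>\<^sup>+om. f (restrict om {0..<n}) \<partial>path_measure P M) = (\<integral>\<^sup>+om. f om \<partial>C 0 n (%_. undefined))"
proof -
 let ?u = "%_::nat. undefined :: 'a"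
 have u: "?u \<in> space (PiM {0..<0} M)" by (simp add: space_PiM)
 have m: "(%om. restrict om {0..<n}) \<in> PiM UNIV M \<rightarrow>\<^sub>M PiM {0..<n} M"
  by (rule measurable_restrict_subset) simp
 have up: "up_to {0..<n} <= n" by (simp add: up_to_iff)
 have up': "up_to {0..<n} = n"
  using up up_to_less[of "{0..<n}" "n - 1"] by (cases n) auto
 have "(\<integral>\<^sup>+om. f (restrict om {0..<n}) \<partial>path_measure P M)
   = (\<integral>\<^sup>+om. f om \<partial>distr (path_measure P M) (PiM {0..<n} M) (%om. restrict om {0..<n}))"
  using m by (subst nn_integral_distr) (auto simp: measurable_cong_sets[OF sets_path_measure refl])
 also have "... = (\<integral>\<^sup>+om. f om \<partial>CI {0..<n})"
  unfolding path_measure_def by (subst distr_lim) auto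
 also have "... = (\<integral>\<^sup>+om. f (restrict om {0..<n}) \<partial>C 0 n ?u)"
  unfolding CI_def up'
  by (subst nn_integral_distr) (auto simp: sets_C[OF u] measurable_cong_sets[OF sets_C[OF u] refl] intro!: measurable_restrict)
 also have "... = (\<integral>\<^sup>+om. f om \<partial>C 0 n ?u)"
  by (intro nn_integral_cong) (auto simp: space_C[OF u] space_PiM)
 finally show ?thesis .
qed

text \<open>The coordinate \<open>n\<close> is integrated out by the kernel \<open>P n\<close>. All estimates along paths
below are iterations of this identity.\<close>
lemma nn_integral_path_Suc:
 assumes [measurable]: "f \<in> borel_measurable (PiM {0..<Suc n} M)"
 shows "(\<integral>\<^sup>+om. f (restrict om {0..<Suc n}) \<partial>path_measure P M) =
  (\<integral>\<^sup>+om. (\<integral>\<^sup>+z. f ((restrict om {0..<n})(n := z)) \<partial>P n (restrict om {0..<n})) \<partial>path_measure P M)"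
proof -
 let ?u = "%_::nat. undefined :: 'a"
 have u: "?u \<in> space (PiM {0..<0} M)" by (simp add: space_PiM)
 have mC: "measurable (C 0 n ?u) N = measurable (PiM {0..<n} M) N" for N :: "'c measure"
  using sets_C[OF u, of n] by (auto cong: measurable_cong_sets)
 have m: "(%om. (\<integral>\<^sup>+x. f (fun_upd om n x) \<partial>P n om)) \<in> borel_measurable (PiM {0..<n} M)"
 proof -
  have "(%om. \<integral>\<^sup>+x. f x \<partial>eP n om) \<in> borel_measurable (PiM {0..<n} M)"
   by measurable
  then show ?thesis
   by (rule measurable_cong[THEN iffD1, rotated]) (simp add: nn_integral_eP)
 qed
 have "(\<integral>\<^sup>+om. f (restrict om {0..<Suc n}) \<partial>path_measure P M) = (\<integral>\<^sup>+om. f om \<partial>C 0 (Suc n) ?u)"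
  by (rule nn_integral_path_restrict) simp
 also have "... = (\<integral>\<^sup>+om. (\<integral>\<^sup>+x. f x \<partial>eP n om) \<partial>C 0 n ?u)"
  using u by (simp, subst nn_integral_bind[where B="PiM {0 ..< Suc n} M"])
   (auto simp: mC measurable_eP)
 also have "... = (\<integral>\<^sup>+om. (\<integral>\<^sup>+x. f (fun_upd om n x) \<partial>P n om) \<partial>C 0 n ?u)"
  by (intro nn_integral_cong) (simp add: nn_integral_eP space_C[OF u])
 also have "... = (\<integral>\<^sup>+om. (\<integral>\<^sup>+z. f ((restrict om {0..<n})(n := z)) \<partial>P n (restrict om {0..<n})) \<partial>path_measure P M)"
  using nn_integral_path_restrict[OF m] by simp
 finally show ?thesis .
qed

lemma prob_space_path_measure: "prob_space (path_measure P M)"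
proof -
 have "prob_space (C 0 0 (%_. undefined))" by (rule prob_space_C) (simp add: space_PiM)
 then have "(\<integral>\<^sup>+om. 1 \<partial>C 0 0 (%_. undefined)) = 1" by (simp add: prob_space.emeasure_space_1)
 with nn_integral_path_restrict[of "%_. 1" 0] have "emeasure (path_measure P M) (space (path_measure P M)) = 1"
  by simp
 then show ?thesis by (rule prob_spaceI)
qed

end

text \<open>Only the first step depends on the initial state, so the dependence on it is measurable on cylinder sets by
induction on the length of the cylinder, and cylinders generate.\<close>
lemma path_measure_kernel:
 assumes IT: "!!x. x \<in> space N ==> Ionescu_Tulcea (K x) M"
  and K0: "(%x. K x 0 (%_. undefined)) \<in> N \<rightarrow>\<^sub>M prob_algebra (M 0)"
  and K: "!!x x' n. x \<in> space N ==> x' \<in> space N ==> K x (Suc n) = K x' (Suc n)"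
 shows "(%x. path_measure (K x) M) \<in> N \<rightarrow>\<^sub>M prob_algebra (PiM UNIV M)"
proof -
 have fin: "(%x. \<integral>\<^sup>+om. f (restrict om {0..<Suc n}) \<partial>path_measure (K x) M) \<in> borel_measurable N"
  if "f \<in> borel_measurable (PiM {0..<Suc n} M)" for f n
  using that
 proof (induction n arbitrary: f)
  case 0
  note [measurable] = 0
  let ?u = "%_::nat. undefined"
  have u: "?u \<in> space (PiM {0..<0} M)" by (simp add: space_PiM)
  have m: "(%z. f (?u(0 := z))) \<in> borel_measurable (M 0)"
   by (rule measurable_compose[OF _ 0], rule measurable_fun_upd[where J="{}"]) auto
  have eq: "(\<integral>\<^sup>+om. f (restrict om {0..<Suc 0}) \<partial>path_measure (K x) M) = (\<integral>\<^sup>+z. f (?u(0 := z)) \<partial>K x 0 ?u)"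
   if x: "x \<in> space N" for x
  proof -
   interpret Ionescu_Tulcea "K x" M using IT[OF x] .
   interpret prob_space "path_measure (K x) M" by (rule prob_space_path_measure)
   have r: "restrict om {0..<0} = ?u" for om :: "nat => 'b" by auto
   show ?thesis
    by (subst nn_integral_path_Suc[OF 0]) (simp only: r, simp add: emeasure_space_1)
  qed
  have m2: "(%x. \<integral>\<^sup>+z. f (?u(0 := z)) \<partial>K x 0 ?u) \<in> borel_measurable N"
   using m measurable_compose[OF measurable_prob_algebraD[OF K0] nn_integral_measurable_subprob_algebra] by blast
  show ?case by (subst measurable_cong[OF eq]) (assumption, rule m2)
 next
  case (Suc n)
  note [measurable] = Suc.prems
  show ?case
  proof (cases "space N = {}")
   case True then show ?thesis by (simp add: measurable_def)
  next
   case False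
   then obtain x0 where x0: "x0 \<in> space N" by auto
   interpret I0: Ionescu_Tulcea "K x0" M using IT[OF x0] .
   define f' where "f' om = (\<integral>\<^sup>+z. f (fun_upd om (Suc n) z) \<partial>K x0 (Suc n) om)" for om
   have m: "f' \<in> borel_measurable (PiM {0..<Suc n} M)"
   proof -
    have "(%om. \<integral>\<^sup>+x. f x \<partial>I0.eP (Suc n) om) \<in> borel_measurable (PiM {0..<Suc n} M)"
     by measurable
    then show ?thesis
     unfolding f'_def by (rule measurable_cong[THEN iffD1, rotated]) (simp add: I0.nn_integral_eP)
   qed
   have eq: "(\<integral>\<^sup>+om. f (restrict om {0..<Suc (Suc n)}) \<partial>path_measure (K x) M)
     = (\<integral>\<^sup>+om. f' (restrict om {0..<Suc n}) \<partial>path_measure (K x) M)" if x: "x \<in> space N" for x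
   proof -
    interpret Ionescu_Tulcea "K x" M using IT[OF x] .
    show ?thesis unfolding f'_def K[OF x0 x] by (rule nn_integral_path_Suc) simp
   qed
   show ?thesis by (subst measurable_cong[OF eq]) (assumption, rule Suc.IH[OF m])
  qed
 qed
 show ?thesis
 proof (rule measurable_prob_algebra_generated[OF sets_PiM Int_stable_prod_algebra prod_algebra_sets_into_space])
  fix x assume x: "x \<in> space N"
  interpret Ionescu_Tulcea "K x" M using IT[OF x] .
  show "prob_space (path_measure (K x) M)" by (rule prob_space_path_measure)
  show "sets (path_measure (K x) M) = sets (PiM UNIV M)" by (rule sets_path_measure)
 next
  fix A assume "A \<in> prod_algebra UNIV M"
  from prod_algebraE[OF this] obtain J E where A: "A = prod_emb UNIV M J (Pi\<^sub>E J E)"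
   and J: "finite J" and E: "!!i. i \<in> J ==> E i \<in> sets (M i)" by metis
  from J obtain n where n: "J \<subseteq> {0..<Suc n}"
   by (metis atLeastLessThan_iff finite_nat_set_iff_bounded less_SucI subsetI zero_le)
  define B where "B = prod_emb {0..<Suc n} M J (Pi\<^sub>E J E)"
  have B[measurable]: "B \<in> sets (PiM {0..<Suc n} M)"
   unfolding B_def using n J E by (intro sets_PiM_I) auto
  have A': "A \<in> sets (PiM UNIV M)" unfolding A using J E by (intro sets_PiM_I) auto
  have "emeasure (path_measure (K x) M) A = (\<integral>\<^sup>+om. indicator B (restrict om {0..<Suc n}) \<partial>path_measure (K x) M)"
   if x: "x \<in> space N" for x
  proof -
   interpret Ionescu_Tulcea "K x" M using IT[OF x] .
   have "emeasure (path_measure (K x) M) A = (\<integral>\<^sup>+om. indicator A om \<partial>path_measure (K x) M)"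
    using A' sets_path_measure by simp
   also have "... = (\<integral>\<^sup>+om. indicator B (restrict om {0..<Suc n}) \<partial>path_measure (K x) M)"
   proof (rule nn_integral_cong)
    fix om assume "om \<in> space (path_measure (K x) M)"
    then have w: "om \<in> space (PiM UNIV M)" using sets_eq_imp_space_eq[OF sets_path_measure] by simp
    have r: "restrict (restrict om {0..<Suc n}) J = restrict om J" using n by (simp add: Int_absorb1)
    have "om \<in> A \<longleftrightarrow> restrict om {0..<Suc n} \<in> B"
     using w r unfolding A B_def prod_emb_def by (auto simp: space_PiM)
    then show "indicator A om = (indicator B (restrict om {0..<Suc n}) :: ennreal)"
     by (simp add: indicator_def)
   qed
   finally show ?thesis .
  qed
  moreover have "(%x. \<integral>\<^sup>+om. indicator B (restrict om {0..<Suc n}) \<partial>path_measure (K x) M) \<in> borel_measurable N"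
   by (rule fin) simp
  ultimately show "(%x. emeasure (path_measure (K x) M) A) \<in> borel_measurable N"
   by (simp cong: measurable_cong)
 qed
qed

section \<open>Lower semicontinuous functions and measurable selection\<close>

text \<open>Lower semicontinuity relative to \<open>S\<close> with values in \<open>[0, \<infinity>]\<close>.\<close>
definition elsc :: "'z::topological_space set => ('z => ennreal) => bool" where
 "elsc S f \<longleftrightarrow> (\<forall>c. openin (top_of_set S) {x \<in> S. c < f x})"

lemma elscD: "elsc S f ==> \<exists>W. open W & {x \<in> S. c < f x} = S \<inter> W"
 unfolding elsc_def openin_open by blast

lemma elsc_SUP:
 assumes "!!i. i \<in> I ==> elsc S (f i)"
 shows "elsc S (%x. SUP i\<in>I. f i x)"
 unfolding elsc_def
proof
 fix c
 have "{x \<in> S. c < (SUP i\<in>I. f i x)} = (\<Union>i\<in>I. {x \<in> S. c < f i x})"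
  by (auto simp: less_SUP_iff)
 also have "openin (top_of_set S) ..." using assms by (auto simp: elsc_def)
 finally show "openin (top_of_set S) {x \<in> S. c < (SUP i\<in>I. f i x)}" .
qed

lemma elsc_min: "elsc S f ==> elsc S g ==> elsc S (%x. min (f x) (g x))"
 unfolding elsc_def
proof
 fix c
 assume *: "\<forall>c. openin (top_of_set S) {x \<in> S. c < f x}" "\<forall>c. openin (top_of_set S) {x \<in> S. c < g x}"
 have "{x \<in> S. c < min (f x) (g x)} = {x \<in> S. c < f x} \<inter> {x \<in> S. c < g x}" by auto
 then show "openin (top_of_set S) {x \<in> S. c < min (f x) (g x)}" using * by (simp add: openin_Int)
qed

lemma elsc_cong: "(!!x. x \<in> S ==> f x = g x) ==> elsc S f \<longleftrightarrow> elsc S g"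
 unfolding elsc_def by (metis (mono_tags, lifting) Collect_cong)

lemma elsc_continuous:
 assumes "continuous_on S f"
 shows "elsc S f"
 unfolding elsc_def
proof
 fix c
 have "{x \<in> S. c < f x} = S \<inter> f -` {c<..}" by auto
 then show "openin (top_of_set S) {x \<in> S. c < f x}"
  using continuous_openin_preimage_gen[OF assms open_greaterThan] by simp
qed

lemma elsc_compose:
 assumes f: "elsc T f" and g: "continuous_on S g" "g ` S \<subseteq> T"
 shows "elsc S (%x. f (g x))"
 unfolding elsc_def
proof
 fix c
 obtain W where W: "open W" "{x \<in> T. c < f x} = T \<inter> W" using elscD[OF f] by metis
 have "{x \<in> S. c < f (g x)} = S \<inter> g -` W" using W(2) g(2) by fastforce
 then show "openin (top_of_set S) {x \<in> S. c < f (g x)}"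
  using continuous_openin_preimage_gen[OF g(1) W(1)] by simp
qed

lemma elsc_measurable:
 assumes "elsc S f"
 shows "f \<in> borel_measurable (restrict_space borel S)"
proof (rule borel_measurableI_greater)
 fix c
 obtain W where W: "open W" "{x \<in> S. c < f x} = S \<inter> W" using elscD[OF assms] by metis
 then show "{x \<in> space (restrict_space borel S). c < f x} \<in> sets (restrict_space borel S)"
  by (auto simp: space_restrict_space sets_restrict_space)
qed

text \<open>Infimal convolution with multiples of the distance.\<close>
lemma elsc_lipschitz_approx:
 fixes f :: "'z::metric_space => ennreal"
 assumes f: "elsc S f" and ne: "S ~= {}"
 obtains F :: "nat => 'z => real" where
  "!!k x. 0 <= F k x" "!!k x. x \<in> S ==> F k x <= real k"
  "!!k x y. \<bar>F k x - F k y\<bar> <= real k * dist x y"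
  "!!x. incseq (%k. F k x)"
  "!!x. x \<in> S ==> f x = (SUP k. ennreal (F k x))"
proof -
 define m where "m k y = enn2real (min (of_nat k) (f y))" for k y
 have m0: "0 <= m k y" for k y by (simp add: m_def)
 have em: "ennreal (m k y) = min (of_nat k) (f y)" for k y
 proof -
  have "min (of_nat k) (f y) < top" by (simp add: min_less_iff_disj of_nat_less_top)
  then show ?thesis by (simp add: m_def)
 qed
 have mk: "m k y <= real k" for k y
  unfolding m_def by (rule enn2real_leI) (auto simp: ennreal_of_nat_eq_real_of_nat)
 have mmono: "m k y <= m (Suc k) y" for k y
 proof -
  have "ennreal (m k y) <= ennreal (m (Suc k) y)"
   unfolding em by (intro min.mono) (auto simp: le_add_same_cancel2)
  then show ?thesis using m0 by (simp add: ennreal_le_iff)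
 qed
 define F where "F k x = (INF y\<in>S. m k y + real k * dist x y)" for k x
 have bdd: "bdd_below ((%y. m k y + real k * dist x y) ` S)" for k x
  by (rule bdd_belowI2[of _ 0]) (simp add: m0)
 show thesis
 proof
  show F0: "0 <= F k x" for k x unfolding F_def by (intro cINF_greatest ne) (simp add: m0)
  have lip: "F k x <= F k y + real k * dist x y" for k x y
  proof -
   have "F k x - real k * dist x y <= F k y"
    unfolding F_def[of k y]
   proof (intro cINF_greatest ne)
    fix z assume z: "z \<in> S"
    have "F k x <= m k z + real k * dist x z" unfolding F_def by (rule cINF_lower[OF bdd z])
    also have "... <= m k z + real k * (dist x y + dist y z)"
     by (intro add_left_mono mult_left_mono dist_triangle) simp
    finally show "F k x - real k * dist x y <= m k z + real k * dist y z" by (simp add: algebra_simps)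
   qed
   then show ?thesis by simp
  qed
  show "\<bar>F k x - F k y\<bar> <= real k * dist x y" for k x y
   using lip[of k x y] lip[of k y x] by (simp add: dist_commute)
  have FS: "F k x <= m k x" if "x \<in> S" for k x
   using cINF_lower[OF bdd that, of k x] by (simp add: F_def)
  show "F k x <= real k" if "x \<in> S" for k x
   using FS[OF that, of k] mk[of k x] by linarith
  show "incseq (%k. F k x)" for x
  proof (rule incseq_SucI)
   fix k show "F k x <= F (Suc k) x" unfolding F_def
    by (rule cINF_mono[OF ne bdd]) (use mmono in "force intro!: add_mono mult_right_mono")
  qed
  show "f x = (SUP k. ennreal (F k x))" if x: "x \<in> S" for x
  proof (rule antisym)
   show "(SUP k. ennreal (F k x)) <= f x"
   proof (rule SUP_least)
    fix k have "ennreal (F k x) <= ennreal (m k x)" using FS[OF x] by (simp add: ennreal_leI)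
    also have "... <= f x" unfolding em by simp
    finally show "ennreal (F k x) <= f x" .
   qed
   show "f x <= (SUP k. ennreal (F k x))"
   proof (rule dense_le)
    fix c assume c: "c < f x"
    then have ctop: "c < top" by (rule order_less_le_trans) simp
    define r where "r = enn2real c"
    have r: "c = ennreal r" "0 <= r" using ctop by (auto simp: r_def)
    obtain W where W: "open W" "{y \<in> S. c < f y} = S \<inter> W" using elscD[OF f] by metis
    then have "x \<in> W" using x c by blast
    then obtain e where e: "e > 0" "ball x e \<subseteq> W" using W(1) open_contains_ball by blast
    obtain k :: nat where k: "r <= real k" "r <= real k * e"
    proof -
     obtain k :: nat where "max r (r / e) <= real k" using real_arch_simple by blast
     then show thesis using e that[of k] by (auto simp: field_simps)
    qed
    have "r <= F k x" unfolding F_def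
    proof (intro cINF_greatest ne)
     fix y assume y: "y \<in> S"
     show "r <= m k y + real k * dist x y"
     proof (cases "dist x y < e")
      case True
      then have "c < f y" using e W y by auto
      then have "ennreal r <= ennreal (m k y)" unfolding em using r k
       by (simp add: ennreal_of_nat_eq_real_of_nat ennreal_leI)
      then have "r <= m k y" using m0 by simp
      then show ?thesis by (smt (verit) mult_nonneg_nonneg of_nat_0_le_iff zero_le_dist)
     next
      case False
      then have "real k * e <= real k * dist x y" by (intro mult_left_mono) auto
      then show ?thesis using k m0[of k y] by linarith
     qed
    qed
    then have "c <= ennreal (F k x)" using r by (simp add: ennreal_leI)
    then show "c <= (SUP k. ennreal (F k x))" by (rule SUP_upper2[OF UNIV_I])
   qed
  qed
 qed
qed

lemma elsc_mult:
 fixes f g :: "'z::metric_space => ennreal"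
 assumes f: "elsc S f" and g: "elsc S g"
 shows "elsc S (%x. f x * g x)"
proof (cases "S = {}")
 case True then show ?thesis by (simp add: elsc_def)
next
 case False
 obtain F :: "nat => 'z => real" where F: "!!k x. 0 <= F k x" "!!k x y. \<bar>F k x - F k y\<bar> <= real k * dist x y"
  "!!x. incseq (%k. F k x)" "!!x. x \<in> S ==> f x = (SUP k. ennreal (F k x))"
  using elsc_lipschitz_approx[OF f False] by metis
 obtain G :: "nat => 'z => real" where G: "!!k x. 0 <= G k x" "!!k x y. \<bar>G k x - G k y\<bar> <= real k * dist x y"
  "!!x. incseq (%k. G k x)" "!!x. x \<in> S ==> g x = (SUP k. ennreal (G k x))"
  using elsc_lipschitz_approx[OF g False] by metis
 have cont: "continuous_on S (H k)" if "!!k x y. \<bar>H k x - H k y\<bar> <= real k * dist x y" for H :: "nat => 'z => real" and k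
 proof (rule lipschitz_on_continuous_on)
  show "(real k)-lipschitz_on S (H k)" by (rule lipschitz_onI) (use that in "auto simp: dist_real_def")
 qed
 have "elsc S (%x. SUP k. SUP l. ennreal (F k x * G l x))"
  by (intro elsc_SUP elsc_continuous continuous_on_ennreal continuous_on_mult cont F G)
 moreover have "(SUP k. SUP l. ennreal (F k x * G l x)) = f x * g x" if "x \<in> S" for x
  using F(1) G(1) F(4)[OF that] G(4)[OF that]
  by (simp add: ennreal_mult SUP_mult_left_ennreal[symmetric] SUP_mult_right_ennreal[symmetric])
 ultimately show ?thesis by (simp cong: elsc_cong)
qed

text \<open>A weakly continuous kernel preserves lower semicontinuity: \<open>h\<close> is an increasing limit of bounded
Lipschitz functions. The point \<open>z\<close> also occurs in the integrand, which costs an error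
proportional to the Lipschitz constant and the distance of the parameters.\<close>
lemma elsc_kernel:
 fixes h :: "'z::metric_space \<times> 'x::metric_space => ennreal" and N :: "'z => 'x measure"
 assumes N: "!!z. z \<in> D ==> N z \<in> space (prob_algebra (restrict_space borel S))"
  and weak: "!!g :: 'x => real. continuous_on S g ==> bounded (g ` S) ==> continuous_on D (%z. \<integral>y. g y \<partial>N z)"
  and h: "elsc (D \<times> S) h"
 shows "elsc D (%z. \<integral>\<^sup>+y. h (z, y) \<partial>N z)"
proof (cases "D \<times> S = {}")
 case True
 have "D = {}"
 proof (rule ccontr)
  assume "D ~= {}"
  then obtain z where z: "z \<in> D" by auto
  then have "S = {}" using True by auto
  moreover have "space (N z) = S" "prob_space (N z)" using N[OF z]
   by (auto simp: space_prob_algebra space_restrict_space dest: sets_eq_imp_space_eq)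
  ultimately show False using prob_space.not_empty by blast
 qed
 then show ?thesis by (simp add: elsc_def)
next
 case False
 obtain F :: "nat => 'z \<times> 'x => real" where F0: "!!k x. 0 <= F k x" and Fk: "!!k x. x \<in> D \<times> S ==> F k x <= real k"
  and lip: "!!k x y. \<bar>F k x - F k y\<bar> <= real k * dist x y" and inc: "!!x. incseq (%k. F k x)"
  and sup: "!!x. x \<in> D \<times> S ==> h x = (SUP k. ennreal (F k x))"
  by (rule elsc_lipschitz_approx[OF h False]) blast
 have N': "prob_space (N z)" "sets (N z) = sets (restrict_space borel S)" "space (N z) = S" if "z \<in> D" for z
  using N[OF that] by (auto simp: space_prob_algebra space_restrict_space dest: sets_eq_imp_space_eq)
 have cont: "continuous_on S (%y. F k (z, y))" for k z
 proof (rule lipschitz_on_continuous_on)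
  show "(real k)-lipschitz_on S (%y. F k (z, y))"
  proof (rule lipschitz_onI)
   show "dist (F k (z, x)) (F k (z, y)) <= real k * dist x y" for x y
    using lip[of k "(z,x)" "(z,y)"] by (simp add: dist_real_def dist_Pair_Pair)
  qed simp
 qed
 have bdd: "bounded ((%y. F k (z, y)) ` S)" if "z \<in> D" for k z
  unfolding bounded_iff using F0 Fk that by (intro exI[of _ "real k"]) auto
 have meas: "(%y. F k (z, y)) \<in> borel_measurable (N z')" if "z' \<in> D" for k z z'
  using borel_measurable_continuous_on_restrict[OF cont, of k z] N'(2)[OF that]
  by (simp add: measurable_cong_sets[OF N'(2)[OF that] refl])
 have int: "integrable (N z') (%y. F k (z, y))" if z: "z' \<in> D" "z \<in> D" for k z z'
 proof -
  interpret prob_space "N z'" by (rule N'[OF z(1)])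
  show ?thesis
   by (rule integrable_const_bound[of _ "real k"])
     (use z F0 Fk meas N'(3)[OF z(1)] in "auto intro!: AE_I2")
 qed
 define \<phi> where "\<phi> k z = (\<integral>y. F k (z, y) \<partial>N z)" for k z
 have "continuous_on D (\<phi> k)" for k
  unfolding continuous_on_iff
 proof (intro ballI allI impI)
  fix z0 and e :: real assume z0: "z0 \<in> D" and e: "0 < e"
  from weak[OF cont bdd[OF z0], of k, unfolded continuous_on_iff, rule_format, OF z0, of "e / 2"] e
  obtain d where d: "d > 0" and d': "!!z. z \<in> D ==> dist z z0 < d ==>
    dist (\<integral>y. F k (z0, y) \<partial>N z) (\<integral>y. F k (z0, y) \<partial>N z0) < e / 2" by auto
  define d2 where "d2 = min d (e / (2 * (real k + 1)))"
  have "d2 > 0" using d e by (auto simp: d2_def)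
  moreover have "dist (\<phi> k z) (\<phi> k z0) < e" if z: "z \<in> D" "dist z z0 < d2" for z
  proof -
   interpret prob_space "N z" by (rule N'[OF z(1)])
   have "\<bar>\<phi> k z - (\<integral>y. F k (z0, y) \<partial>N z)\<bar> = \<bar>\<integral>y. F k (z, y) - F k (z0, y) \<partial>N z\<bar>"
    unfolding \<phi>_def using int z z0 by simp
   also have "... <= (\<integral>y. \<bar>F k (z, y) - F k (z0, y)\<bar> \<partial>N z)" by (rule integral_abs_bound)
   also have "... <= (\<integral>y. real k * dist z z0 \<partial>N z)"
   proof (rule integral_mono)
    show "\<bar>F k (z, y) - F k (z0, y)\<bar> <= real k * dist z z0" for y
     using lip[of k "(z,y)" "(z0,y)"] by (simp add: dist_Pair_Pair)
   qed (use int z z0 in auto)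
   also have "... = real k * dist z z0" using prob_space by simp
   also have "... < e / 2"
   proof -
    have "(real k + 1) * dist z z0 < (real k + 1) * (e / (2 * (real k + 1)))"
     using z by (intro mult_strict_left_mono) (auto simp: d2_def)
    also have "... = e / 2" by (simp add: field_simps)
    finally show ?thesis by (smt (verit, best) mult_right_mono zero_le_dist)
   qed
   finally have "\<bar>\<phi> k z - (\<integral>y. F k (z0, y) \<partial>N z)\<bar> < e / 2" .
   moreover have "\<bar>(\<integral>y. F k (z0, y) \<partial>N z) - \<phi> k z0\<bar> < e / 2"
    using d'[OF z(1)] z(2) by (simp add: \<phi>_def d2_def dist_real_def)
   ultimately show ?thesis unfolding dist_real_def by linarith
  qed
  ultimately show "\<exists>d>0. \<forall>z\<in>D. dist z z0 < d --> dist (\<phi> k z) (\<phi> k z0) < e" by blast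
 qed
 then have "elsc D (%z. SUP k. ennreal (\<phi> k z))"
  by (intro elsc_SUP elsc_continuous continuous_on_ennreal) auto
 moreover have "(SUP k. ennreal (\<phi> k z)) = (\<integral>\<^sup>+y. h (z, y) \<partial>N z)" if z: "z \<in> D" for z
 proof -
  have "(\<integral>\<^sup>+y. h (z, y) \<partial>N z) = (\<integral>\<^sup>+y. (SUP k. ennreal (F k (z, y))) \<partial>N z)"
   using z sup N'(3)[OF z] by (intro nn_integral_cong) auto
  also have "... = (SUP k. \<integral>\<^sup>+y. ennreal (F k (z, y)) \<partial>N z)"
   using inc meas[OF z] by (intro nn_integral_monotone_convergence_SUP)
    (auto simp: incseq_def le_fun_def intro!: ennreal_leI)
  also have "... = (SUP k. ennreal (\<phi> k z))"
   unfolding \<phi>_def using z int F0 by (simp add: nn_integral_eq_integral)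
  finally show ?thesis by simp
 qed
 ultimately show ?thesis by (simp cong: elsc_cong)
qed

lemma elsc_slice: "elsc (S \<times> K) f ==> x \<in> S ==> elsc K (%a. f (x, a))"
 by (rule elsc_compose[where g="%a. (x, a)" and f=f]) (auto intro!: continuous_intros)

lemma elsc_subset: "elsc T f ==> S \<subseteq> T ==> elsc S f"
 using elsc_compose[of T f S "%x. x"] by auto

lemma elsc_INF_compact:
 assumes K: "compact K" and f: "elsc (S \<times> K) f"
 shows "elsc S (%x. INF a\<in>K. f (x, a))"
 unfolding elsc_def
proof
 fix c
 show "openin (top_of_set S) {x \<in> S. c < (INF a\<in>K. f (x, a))}"
 proof (subst openin_subopen, intro ballI)
  fix x assume "x \<in> {x \<in> S. c < (INF a\<in>K. f (x, a))}"
  then have x: "x \<in> S" "c < (INF a\<in>K. f (x, a))" by auto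
  obtain c' where c': "c < c'" "c' < (INF a\<in>K. f (x, a))" using dense x by blast
  obtain W where W: "open W" "{z \<in> S \<times> K. c' < f z} = S \<times> K \<inter> W" using elscD[OF f] by metis
  have "{x} \<times> K \<subseteq> W"
   using W(2) x c' by (auto dest: less_INF_D)
  from Elementary_Topology.tube_lemma[OF K W(1) this] obtain X0 where X0: "x \<in> X0" "open X0" "X0 \<times> K \<subseteq> W" by blast
  have "c < (INF a\<in>K. f (x', a))" if "x' \<in> S \<inter> X0" for x'
  proof -
   have "c' <= (INF a\<in>K. f (x', a))"
    using W(2) X0 that by (intro INF_greatest) (auto intro: less_imp_le)
   then show ?thesis using c' by simp
  qed
  then show "\<exists>T. openin (top_of_set S) T & x \<in> T & T \<subseteq> {x \<in> S. c < (INF a\<in>K. f (x, a))}"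
   using x X0 by (intro exI[of _ "S \<inter> X0"]) (auto intro: openin_open_Int)
 qed
qed

text \<open>An exhaustion of a compact set by superlevel sets of an increasing family.\<close>
lemma elsc_compact_cover:
 assumes K: "compact K" and f: "!!i::nat. elsc K (f i)" and m: "!!i a. a \<in> K ==> f i a <= f (Suc i) a"
  and c: "decseq c" and cov: "!!a. a \<in> K ==> \<exists>i. c i < f i a"
 obtains i :: nat where "!!a. a \<in> K ==> c i < f i a"
proof -
 have "\<forall>i. \<exists>W. open W & {x \<in> K. c i < f i x} = K \<inter> W" using elscD[OF f] by blast
 then obtain W where W: "!!i. open (W i)" "!!i. {x \<in> K. c i < f i x} = K \<inter> W i" by metis
 have "K \<subseteq> (\<Union>i. W i)"
 proof
  fix a assume a: "a \<in> K"
  from cov[OF this] obtain i where "c i < f i a" ..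
  then have "a \<in> K \<inter> W i" using a unfolding W(2)[symmetric] by simp
  then show "a \<in> (\<Union>i. W i)" by auto
 qed
 from compactE_image[OF K _ this] W(1) obtain C where C: "finite C" "K \<subseteq> (\<Union>i\<in>C. W i)" by metis
 obtain n where n: "!!i. i \<in> C ==> i <= n" using C(1) finite_nat_set_iff_bounded_le by auto
 have inc: "f i a <= f j a" if "i <= j" "a \<in> K" for i j a
  using that(1) by (induction rule: dec_induct) (auto intro: order_trans m[OF that(2)])
 show thesis
 proof
  fix a assume a: "a \<in> K"
  then obtain i where "i \<in> C" "a \<in> W i" using C by auto
  then have "c i < f i a" "i <= n" using W(2)[of i] a n by blast+
  then show "c n < f n a" using inc[of i n a] a decseqD[OF c, of i n] by (meson order_le_less_trans order_less_le_trans)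
 qed
qed

lemma elsc_INF_attained:
 assumes K: "compact K" and f: "elsc K f" and ne: "K ~= {}"
 shows "\<exists>a\<in>K. f a = (INF a\<in>K. f a)"
proof (rule ccontr)
 let ?m = "INF a\<in>K. f a"
 assume no: "\<not> ?thesis"
 have gt: "?m < f a" if "a \<in> K" for a
  using no that INF_lower[OF that, of f] by (metis order_le_imp_less_or_eq)
 obtain a0 where "a0 \<in> K" using ne by auto
 then have top: "?m < top" using gt order_less_le_trans top_greatest by blast
 then obtain u :: "nat => ennreal" where u: "!!i. ?m < u i" "u \<longlonglongrightarrow> ?m"
  using approx_from_above_dense_linorder[OF top] by auto
 define c where "c n = Min (u ` {..n})" for n
 have c: "decseq c" "!!i. ?m < c i" "!!i. c i <= u i"
  using u(1) by (auto simp: c_def decseq_def intro!: Min_antimono)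
 have "\<exists>i. c i < f a" if a: "a \<in> K" for a
 proof -
  obtain i where "u i < f a"
   using order_tendstoD(2)[OF u(2) gt[OF a]] by (auto simp: eventually_sequentially)
  then show ?thesis using c(3)[of i] by (blast intro: order_le_less_trans)
 qed
 from elsc_compact_cover[of K "%i. f" c, OF K f _ c(1) this] obtain i where "!!a. a \<in> K ==> c i < f a" by auto
 then have "c i <= ?m" by (intro INF_greatest) (auto intro: less_imp_le)
 then show False using c(2)[of i] by simp
qed

text \<open>On a compact set infima commute with increasing suprema: for \<open>c\<close> below the right-hand side
finitely many, hence one, of the open sets \<open>{c < f i}\<close> cover \<open>K\<close>.\<close>
lemma elsc_SUP_INF:
 assumes K: "compact K" and f: "!!i::nat. elsc K (f i)" and m: "!!i a. a \<in> K ==> f i a <= f (Suc i) a"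
 shows "(SUP i. INF a\<in>K. f i a) = (INF a\<in>K. SUP i. f i a)"
proof (rule antisym)
 show "(SUP i. INF a\<in>K. f i a) <= (INF a\<in>K. SUP i. f i a)"
 proof (intro SUP_least INF_greatest)
  fix i a assume "a \<in> K"
  then have "(INF a\<in>K. f i a) <= f i a" by (rule INF_lower)
  also have "... <= (SUP i. f i a)" by (rule SUP_upper) simp
  finally show "(INF a\<in>K. f i a) <= (SUP i. f i a)" .
 qed
 show "(INF a\<in>K. SUP i. f i a) <= (SUP i. INF a\<in>K. f i a)"
 proof (rule dense_le)
  fix c assume "c < (INF a\<in>K. SUP i. f i a)"
  then have "\<exists>i. c < f i a" if "a \<in> K" for a using that by (auto dest!: less_INF_D simp: less_SUP_iff)
  from elsc_compact_cover[of K f "%_. c", OF K f m _ this] obtain i where "!!a. a \<in> K ==> c < f i a"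
   by auto
  then have "c <= (INF a\<in>K. f i a)" by (intro INF_greatest) (auto intro: less_imp_le)
  then show "c <= (SUP i. INF a\<in>K. f i a)" by (rule SUP_upper2[OF UNIV_I])
 qed
qed

text \<open>A minimizer is localized in closed balls of radius \<open>(1/2) ^ n\<close> around a dense sequence: the first
ball that still contains a minimizer from the balls chosen before. The choices are measurable because infima
over compact sets are semicontinuous in \<open>x\<close>, and the centres converge to a minimizer.\<close>
theorem measurable_minimizer:
 fixes K :: "'a::polish_space set" and f :: "'x::topological_space \<times> 'a => ennreal"
 assumes K: "compact K" "K ~= {}" and f: "elsc (S \<times> K) f"
 shows "\<exists>\<phi> \<in> restrict_space borel S \<rightarrow>\<^sub>M restrict_space borel K. \<forall>x\<in>S. f (x, \<phi> x) = (INF a\<in>K. f (x, a))"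
proof -
 let ?M = "restrict_space borel S :: 'x measure"
 obtain E :: "'a set" where E: "countable E" "!!X. open X ==> X ~= {} ==> \<exists>d\<in>E. d \<in> X"
  using countable_dense_setE by metis
 have "E ~= {}" using E(2)[of UNIV] by auto
 then obtain e :: "nat => 'a" where e: "range e = E" using E(1) by (metis range_from_nat_into)
 define D :: "nat list => 'a set" where "D = rec_list K (%j l C. C \<inter> cball (e j) ((1/2) ^ length l))"
 have D: "D [] = K" "D (j # l) = D l \<inter> cball (e j) ((1/2) ^ length l)" for j l by (simp_all add: D_def)
 have Dc: "compact (D l)" "D l \<subseteq> K" for l
  by (induction l) (auto simp: D K intro!: compact_Int_closed)
 define m where "m x = (INF a\<in>K. f (x, a))" for x
 define A where "A x l \<longleftrightarrow> D l ~= {} & (INF a\<in>D l. f (x, a)) = m x" for x l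
 have A_iff: "A x l \<longleftrightarrow> (\<exists>a\<in>D l. f (x, a) = m x)" if x: "x \<in> S" for x l
 proof
  assume "A x l"
  then show "\<exists>a\<in>D l. f (x, a) = m x"
   using elsc_INF_attained[OF Dc(1)[of l] elsc_subset[OF elsc_slice[OF f x] Dc(2)]] by (auto simp: A_def)
 next
  assume "\<exists>a\<in>D l. f (x, a) = m x"
  then obtain a where "a \<in> D l" "f (x, a) = m x" by auto
  moreover have "m x <= (INF a\<in>D l. f (x, a))" unfolding m_def by (rule INF_superset_mono) (use Dc(2) in auto)
  ultimately show "A x l" unfolding A_def by (auto intro!: antisym INF_lower2[of a])
 qed
 have inf_m: "(%x. INF a\<in>D l. f (x, a)) \<in> borel_measurable ?M" for l
  by (intro elsc_measurable elsc_INF_compact Dc elsc_subset[OF f]) (use Dc(2) in auto)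
 have m_m: "m \<in> borel_measurable ?M" unfolding m_def using inf_m[of "[]"] by (simp add: D)
 have A_m[measurable]: "Measurable.pred ?M (%x. A x l)" for l
 proof -
  note [measurable] = inf_m m_m
  show ?thesis unfolding A_def by measurable
 qed
 define J where "J x l = (LEAST j. A x (j # l))" for x l
 have J_m: "(%x. J x l) \<in> ?M \<rightarrow>\<^sub>M count_space UNIV" for l unfolding J_def by measurable
 define L where "L x = rec_nat [] (%_ l. J x l # l)" for x
 have L: "L x 0 = []" "L x (Suc n) = J x (L x n) # L x n" for x n by (simp_all add: L_def)
 have len: "length (L x n) = n" for x n by (induction n) (simp_all add: L)
 have L_m: "(%x. L x n) \<in> ?M \<rightarrow>\<^sub>M count_space UNIV" for n
 proof (induction n)
  case (Suc n)
  have "(%x. (%l x. J x l # l) (L x n) x) \<in> ?M \<rightarrow>\<^sub>M count_space UNIV"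
  proof (rule measurable_compose_countable[OF _ Suc])
   fix l show "(%x. J x l # l) \<in> ?M \<rightarrow>\<^sub>M count_space UNIV"
    by (rule measurable_compose[OF J_m]) simp
  qed
  then show ?case by (simp add: L)
 qed (simp add: L)
 have AL: "A x (L x n)" if x: "x \<in> S" for x n
 proof (induction n)
  case 0 show ?case using elsc_INF_attained[OF K(1) elsc_slice[OF f x] K(2)] by (simp add: L A_iff[OF x] D m_def)
 next
  case (Suc n)
  then obtain a where a: "a \<in> D (L x n)" "f (x, a) = m x" using A_iff[OF x] by auto
  have "ball a ((1/2) ^ n) ~= {}" by (simp add: not_le)
  then obtain j where "e j \<in> ball a ((1/2) ^ n)" using E(2)[OF open_ball] e by blast
  then have "a \<in> D (j # L x n)" using a by (auto simp: D len dist_commute)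
  then have "A x (j # L x n)" using a A_iff[OF x] by auto
  then show ?case unfolding L J_def by (rule LeastI)
 qed
 define p where "p n x = e (J x (L x n))" for n x
 have p_m: "p n \<in> borel_measurable ?M" for n
 proof -
  have "(%x. (%l x. e (J x l)) (L x n) x) \<in> ?M \<rightarrow>\<^sub>M borel"
   by (rule measurable_compose_countable[OF _ L_m]) (rule measurable_compose[OF J_m], simp)
  then show ?thesis by (simp add: p_def[abs_def])
 qed
 have ex: "\<exists>a\<in>K. f (x, a) = m x & (%n. p n x) \<longlonglongrightarrow> a" if x: "x \<in> S" for x
 proof -
  have "\<forall>n. \<exists>a. a \<in> D (L x n) & f (x, a) = m x" using AL[OF x] A_iff[OF x] by blast
  then obtain a where a: "!!n. a n \<in> D (L x n)" "!!n. f (x, a n) = m x" by metis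
  have dec: "D (L x n') \<subseteq> D (L x n)" if "n <= n'" for n n'
   using that by (induction rule: dec_induct) (auto simp: L D)
  have "\<forall>n. a n \<in> K" using a(1) Dc(2) by blast
  then obtain b r where b: "b \<in> K" "strict_mono r" "(a \<circ> r) \<longlonglongrightarrow> b"
   using K(1) unfolding compact_eq_seq_compact_metric seq_compact_def by metis
  have bD: "b \<in> D (L x n)" for n
  proof (rule closed_sequentially)
   show "closed (D (L x n))" using Dc(1) by (rule compact_imp_closed)
   show "a (r (k + n)) \<in> D (L x n)" for k
    using a(1)[of "r (k + n)"] dec[of n "r (k + n)"] strict_mono_imp_increasing[OF b(2), of "k + n"] by auto
   show "(%k. a (r (k + n))) \<longlonglongrightarrow> b" using LIMSEQ_ignore_initial_segment[OF b(3)] by (simp add: o_def)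
  qed
  have db: "dist c (p n x) <= (1/2) ^ n" if "c \<in> D (L x (Suc n))" for n c
   using that by (auto simp: L D len p_def dist_commute)
  have lim: "q \<longlonglongrightarrow> p'" if "!!n. dist (q n) (p' :: 'a) <= C * (1/2) ^ n" for q p' C
  proof (rule metric_LIMSEQ_I)
   have "(%n. C * (1/2) ^ n) \<longlonglongrightarrow> C * 0" by (intro tendsto_intros LIMSEQ_power_zero) simp
   moreover fix r :: real assume "0 < r"
   ultimately have "\<forall>\<^sub>F n in sequentially. C * (1/2) ^ n < r" by (intro order_tendstoD) auto
   then show "\<exists>no. \<forall>n\<ge>no. dist (q n) p' < r"
    unfolding eventually_sequentially using that order_le_less_trans by blast
  qed
  have pb: "(%n. p n x) \<longlonglongrightarrow> b" by (rule lim[of _ _ 1]) (use db[OF bD] in "simp add: dist_commute")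
  have "(%n. a (Suc n)) \<longlonglongrightarrow> b"
  proof (rule lim)
   fix n show "dist (a (Suc n)) b <= 2 * (1/2) ^ n"
    using db[OF a(1), of n] db[OF bD, of n] dist_triangle2[of "a (Suc n)" b "p n x"] by simp
  qed
  then have ab: "a \<longlonglongrightarrow> b" by (simp add: filterlim_sequentially_Suc)
  have "f (x, b) <= m x"
  proof (rule ccontr)
   assume "\<not> f (x, b) <= m x"
   then have lt: "m x < f (x, b)" by simp
   obtain W where W: "open W" "{a \<in> K. m x < f (x, a)} = K \<inter> W" using elscD[OF elsc_slice[OF f x]] by metis
   have "b \<in> W" using W lt b(1) by auto
   then have "\<forall>\<^sub>F n in sequentially. a n \<in> W" using ab W(1) by (auto dest: topological_tendstoD)
   then obtain n where "a n \<in> W" by (auto simp: eventually_sequentially)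
   then show False using W(2) a[of n] Dc(2)[of "L x n"] by force
  qed
  then have "f (x, b) = m x" unfolding m_def using b(1) by (auto intro!: antisym INF_lower2[of b])
  then show ?thesis using b(1) pb by auto
 qed
 define \<phi> where "\<phi> x = lim (%n. p n x)" for x
 have phi: "\<phi> x \<in> K" "f (x, \<phi> x) = m x" "(%n. p n x) \<longlonglongrightarrow> \<phi> x" if "x \<in> S" for x
  using ex[OF that] limI unfolding \<phi>_def by metis+
 have "\<phi> \<in> borel_measurable ?M"
  by (rule borel_measurable_LIMSEQ_metric[of p]) (auto simp: p_m phi space_restrict_space)
 then have "\<phi> \<in> ?M \<rightarrow>\<^sub>M restrict_space borel K"
  by (rule measurable_restrict_space2[rotated]) (auto simp: phi space_restrict_space)
 then show ?thesis using phi by (intro bexI[of _ \<phi>]) (auto simp: m_def)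
qed

lemma lsc_on_elsc: "lsc_on S f ==> elsc S (%x. ennreal (f x))"
 unfolding elsc_def
proof
 fix c assume f: "lsc_on S f"
 show "openin (top_of_set S) {x \<in> S. c < ennreal (f x)}"
 proof (cases c)
  case (real r)
  then have "{x \<in> S. c < ennreal (f x)} = {x \<in> S. r < f x}" by (auto simp: ennreal_less_iff)
  then show ?thesis using f by (simp add: lsc_on_def)
 next
  case top then show ?thesis by simp
 qed
qed

lemma elsc_mono_image:
 fixes f :: "'z::metric_space => real" and h :: "'z => real => real"
 assumes f: "lsc_on S f" and f0: "!!x. x \<in> S ==> 0 <= f x"
  and cont: "continuous_on {(x, t). x \<in> S & 0 <= t & t <= f x} (%(x, t). h x t)"
  and mono: "!!x s t. x \<in> S ==> 0 <= s ==> s <= t ==> t <= f x ==> h x s <= h x t"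
 shows "elsc S (%x. ennreal (h x (f x)))"
proof (cases "S = {}")
 case True then show ?thesis by (simp add: elsc_def)
next
 case False
 obtain F :: "nat => 'z => real" where F: "!!k x. 0 <= F k x" "!!k x y. \<bar>F k x - F k y\<bar> <= real k * dist x y"
  "!!x. incseq (%k. F k x)" "!!x. x \<in> S ==> ennreal (f x) = (SUP k. ennreal (F k x))"
  using elsc_lipschitz_approx[OF lsc_on_elsc[OF f] False] by metis
 have Ff: "F k x <= f x" if "x \<in> S" for k x
 proof -
  have "ennreal (F k x) <= ennreal (f x)" unfolding F(4)[OF that] by (rule SUP_upper) simp
  then show ?thesis using f0[OF that] by (simp add: ennreal_le_iff)
 qed
 have lim: "(%k. F k x) \<longlonglongrightarrow> f x" if "x \<in> S" for x
 proof -
  have "(%k. ennreal (F k x)) \<longlonglongrightarrow> ennreal (f x)"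
   unfolding F(4)[OF that] by (intro LIMSEQ_SUP) (use F(3) in "auto simp: incseq_def intro!: ennreal_leI")
  then show ?thesis using F(1) f0[OF that] by (simp add: tendsto_ennreal_iff)
 qed
 have cF: "continuous_on S (F k)" for k
 proof (rule lipschitz_on_continuous_on)
  show "(real k)-lipschitz_on S (F k)" by (rule lipschitz_onI) (use F in "auto simp: dist_real_def")
 qed
 have "elsc S (%x. SUP k. ennreal (h x (F k x)))"
 proof (intro elsc_SUP elsc_continuous continuous_on_ennreal)
  fix k
  have "continuous_on S ((%(x, t). h x t) \<circ> (%x. (x, F k x)))"
   by (intro continuous_on_compose continuous_intros cF continuous_on_subset[OF cont]) (use F Ff in auto)
  then show "continuous_on S (%x. h x (F k x))" by (simp add: o_def)
 qed
 moreover have "(SUP k. ennreal (h x (F k x))) = ennreal (h x (f x))" if x: "x \<in> S" for x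
 proof -
  have "(%k. ((%(x, t). h x t) \<circ> (%k. (x, F k x))) k) \<longlonglongrightarrow> (%(x, t). h x t) (x, f x)"
   unfolding o_def
   by (rule continuous_on_tendsto_compose[OF cont])
     (use x f0 F Ff lim in "auto intro!: tendsto_intros")
  then have "(%k. ennreal (h x (F k x))) \<longlonglongrightarrow> ennreal (h x (f x))" by (auto simp: o_def intro!: tendsto_ennrealI)
  moreover have "(%k. ennreal (h x (F k x))) \<longlonglongrightarrow> (SUP k. ennreal (h x (F k x)))"
   using F(3) F(1) Ff x by (intro LIMSEQ_SUP) (auto simp: incseq_def intro!: ennreal_leI mono)
  ultimately show ?thesis by (rule LIMSEQ_unique[symmetric])
 qed
 ultimately show ?thesis by (simp cong: elsc_cong)
qed

text \<open>Impulses and gradual controls are disjoint closed sets, so semicontinuity in the action can be checked on each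
of them.\<close>
lemma elsc_Un:
 fixes S :: "'x::topological_space set" and K1 :: "'a::topological_space set"
 assumes K: "closed K1" "closed K2" "K1 \<inter> K2 = {}" and f: "elsc (S \<times> K1) f" "elsc (S \<times> K2) f"
 shows "elsc (S \<times> (K1 \<union> K2)) f"
 unfolding elsc_def
proof
 fix c
 obtain W1 W2 where W: "open W1" "{x \<in> S \<times> K1. c < f x} = S \<times> K1 \<inter> W1"
  "open W2" "{x \<in> S \<times> K2. c < f x} = S \<times> K2 \<inter> W2" using elscD[OF f(1)] elscD[OF f(2)] by metis
 have eq: "{x \<in> S \<times> (K1 \<union> K2). c < f x} = S \<times> (K1 \<union> K2) \<inter> (W1 \<inter> (UNIV \<times> - K2) \<union> W2 \<inter> (UNIV \<times> - K1))"
  (is "?L = ?R")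
 proof (rule set_eqI)
  fix z :: "'x \<times> 'a" obtain x a where z: "z = (x, a)" by (cases z)
  show "z \<in> ?L \<longleftrightarrow> z \<in> ?R"
   using W(2)[THEN eqset_imp_iff, of z] W(4)[THEN eqset_imp_iff, of z] K(3) unfolding z by auto
 qed
 show "openin (top_of_set (S \<times> (K1 \<union> K2))) {x \<in> S \<times> (K1 \<union> K2). c < f x}"
  unfolding eq by (intro openin_open_Int open_Un open_Int W open_Times) (use K in auto)
qed

section \<open>The primitives\<close>

locale gi_control =
 fixes M :: "('x::polish_space, 'a::polish_space) gi_model" and w :: "'x => real"
 assumes prim: "gi_primitives M"
  and w_cont: "continuous_on (states M) w"
  and w_ge_1: "\<forall>x \<in> states M. 1 <= w x"
  and w_bound: "\<forall>x \<in> states M. \<forall>a \<in> gradual M. costG M x a + jump_rate M x a + 1 <= w x"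
  and cI_lsc: "lsc_on (states M \<times> impulses M \<times> states M) (%(x, b, y). costI M x b y)"
  and cG_lsc: "lsc_on (states M \<times> gradual M) (%(x, a). costG M x a)"
  and Q_cont: "\<forall>g :: 'x => real. continuous_on (states M) g --> bounded (g ` states M) -->
    continuous_on (states M \<times> impulses M) (%(x, b). \<integral>y. g y \<partial>Qker M x b)"
  and q_cont: "\<forall>g :: 'x => real. continuous_on (states M) g --> bounded (g ` states M) -->
    continuous_on (states M \<times> gradual M) (%(x, a). \<integral>y. g y \<partial>qtilde M x a)"
begin

abbreviation "S == states M"
abbreviation "AI == impulses M"
abbreviation "AG == gradual M"
abbreviation "SM == stateM M"

lemma
 shows S_borel[measurable]: "S \<in> sets borel"
  and AG: "compact AG" "AG ~= {}" and AI: "compact AI" "AI ~= {}" and disj: "AG \<inter> AI = {}"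
  and q_sums: "!!x a B. x \<in> S ==> a \<in> AG ==> range B \<subseteq> sets SM ==> disjoint_family B ==>
    (%i::nat. qker M x a (B i)) sums qker M x a (\<Union>i. B i)"
  and q_meas: "!!B. B \<in> sets SM ==> (%(x, a). qker M x a B) \<in> SM \<Otimes>\<^sub>M gradM M \<rightarrow>\<^sub>M borel"
  and q_nonneg: "!!x a B. x \<in> S ==> a \<in> AG ==> B \<in> sets SM ==> x \<notin> B ==> 0 <= qker M x a B"
  and q_S: "!!x a. x \<in> S ==> a \<in> AG ==> qker M x a S = 0"
  and Q_meas: "(%(x, b). Qker M x b) \<in> SM \<Otimes>\<^sub>M impM M \<rightarrow>\<^sub>M prob_algebra SM"
  and cG_meas: "(%(x, a). costG M x a) \<in> SM \<Otimes>\<^sub>M gradM M \<rightarrow>\<^sub>M borel"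
  and cG_nonneg: "!!x a. x \<in> S ==> a \<in> AG ==> 0 <= costG M x a"
  and cI_meas: "(%(x, b, y). costI M x b y) \<in> SM \<Otimes>\<^sub>M (impM M \<Otimes>\<^sub>M SM) \<rightarrow>\<^sub>M borel"
  and cI_nonneg: "!!x b y. x \<in> S ==> b \<in> AI ==> y \<in> S ==> 0 <= costI M x b y"
 using prim unfolding gi_primitives_def by blast+

lemma space_SM[simp]: "space SM = S"
 and space_gradM[simp]: "space (gradM M) = AG"
 and space_impM[simp]: "space (impM M) = AI"
 and space_actM[simp]: "space (actM M) = AI \<union> AG"
 by (auto simp: stateM_def gradM_def impM_def actM_def space_restrict_space)

lemma AG_borel[measurable]: "AG \<in> sets borel" and AI_borel[measurable]: "AI \<in> sets borel"
 using AG AI by (auto intro: borel_compact)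

lemma sing_SM[measurable]: "x \<in> S ==> {x} \<in> sets SM"
 unfolding stateM_def sets_restrict_space by (intro image_eqI[of _ _ "{x}"]) auto

lemma S_sets: "S \<in> sets SM"
 using sets.top[of SM] by simp

lemma q_empty: "x \<in> S ==> a \<in> AG ==> qker M x a {} = 0"
 using q_sums[of x a "%_. {}"] summable_LIMSEQ_zero[of "%_::nat. qker M x a {}"]
 by (auto simp: disjoint_family_on_def sums_iff LIMSEQ_const_iff)

lemma q_add:
 assumes "x \<in> S" "a \<in> AG" "A \<in> sets SM" "B \<in> sets SM" "A \<inter> B = {}"
 shows "qker M x a (A \<union> B) = qker M x a A + qker M x a B"
proof -
 have "(%i. qker M x a (binaryset A B i)) sums qker M x a (\<Union>i. binaryset A B i)"
  using assms by (intro q_sums) (auto simp: range_binaryset_eq disjoint_family_on_def binaryset_def)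
 moreover have "(%i. qker M x a (binaryset A B i)) sums (qker M x a A + qker M x a B)"
  by (rule binaryset_sums) (use q_empty assms in auto)
 ultimately show ?thesis by (simp add: UN_binaryset_eq sums_unique2)
qed

lemma q_Diff: "x \<in> S ==> a \<in> AG ==> B \<in> sets SM ==>
  qker M x a B = qker M x a (B - {x}) - jump_rate M x a * indicator B x"
 using q_add[of x a "B - {x}" "{x}"] sing_SM[of x]
 by (cases "x \<in> B") (auto simp: jump_rate_def insert_absorb)

lemma q_jump: "x \<in> S ==> a \<in> AG ==> qker M x a (S - {x}) = jump_rate M x a"
 using q_Diff[OF _ _ S_sets, of x a] q_S[of x a] by simp

lemma jump_nonneg: "x \<in> S ==> a \<in> AG ==> 0 <= jump_rate M x a"
 using q_jump[of x a] q_nonneg[of x a "S - {x}"] S_sets sing_SM[of x] by auto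

lemma w_bounds: "x \<in> S ==> a \<in> AG ==>
  1 <= w x - jump_rate M x a & 1 <= w x - costG M x a & costG M x a + 1 <= w x - jump_rate M x a & 0 < w x"
 using w_bound jump_nonneg[of x a] cG_nonneg[of x a] by fastforce

lemma w_measurable[measurable]: "w \<in> borel_measurable SM"
 unfolding stateM_def by (rule borel_measurable_continuous_on_restrict[OF w_cont])

subsection \<open>The transition kernels\<close>

lemma
 assumes x: "x \<in> S" and a: "a \<in> AG"
 shows sets_Qtil_G: "sets (Qtil M w x a) = sets SM"
  and emeasure_Qtil_G: "B \<in> sets SM ==> emeasure (Qtil M w x a) B = ennreal (qker M x a B / w x + indicator B x)"
  and prob_Qtil_G: "prob_space (Qtil M w x a)"
proof -
 define \<mu> where "\<mu> B = qker M x a B / w x + indicator B x" for B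
 have w0: "0 < w x" using w_bounds[OF x a] by simp
 have pos: "0 <= \<mu> B" if B: "B \<in> sets SM" for B
 proof (cases "x \<in> B")
  case False then show ?thesis using q_nonneg[OF x a B] w0 by (simp add: \<mu>_def)
 next
  case True
  have "0 <= qker M x a (B - {x})" using q_nonneg[OF x a, of "B - {x}"] B sing_SM[OF x] by auto
  then have "- w x <= qker M x a B" using q_Diff[OF x a B] w_bounds[OF x a] True by simp
  then have "-1 <= qker M x a B / w x" using w0 by (simp add: field_simps)
  then show ?thesis using True by (simp add: \<mu>_def)
 qed
 have ms: "measure_space S (sets SM) (%B. ennreal (\<mu> B))"
  unfolding measure_space_def
 proof (intro conjI)
  show "sigma_algebra S (sets SM)" using sets.sigma_algebra_axioms[of SM] by simp
  show "positive (sets SM) (%B. ennreal (\<mu> B))" using q_empty[OF x a] by (simp add: positive_def \<mu>_def)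
  show "countably_additive (sets SM) (%B. ennreal (\<mu> B))"
  proof (rule countably_additiveI)
   fix A :: "nat => 'x set" assume A: "range A \<subseteq> sets SM" "disjoint_family A"
   have "(%i. qker M x a (A i) / w x + indicator (A i) x) sums (qker M x a (\<Union>i. A i) / w x + indicator (\<Union>i. A i) x)"
   proof (intro sums_add sums_divide q_sums x a A)
    show "(%i. indicator (A i) x :: real) sums indicator (\<Union>i. A i) x"
     using indicator_sums[of A x] A(2) by (auto simp: disjoint_family_on_def)
   qed
   then have "(%i. \<mu> (A i)) sums \<mu> (\<Union>i. A i)" by (simp add: \<mu>_def)
   then show "(\<Sum>i. ennreal (\<mu> (A i))) = ennreal (\<mu> (\<Union>i. A i))"
    using A pos by (intro suminf_ennreal_eq) auto
  qed
 qed
 have eq: "Qtil M w x a = measure_of S (sets SM) (%B. ennreal (\<mu> B))"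
  using a by (simp add: Qtil_def \<mu>_def)
 show s: "sets (Qtil M w x a) = sets SM" unfolding eq
  using sets.sigma_sets_eq[of SM] sets.space_closed[of SM] by (simp add: sets_measure_of)
 show em: "emeasure (Qtil M w x a) B = ennreal (qker M x a B / w x + indicator B x)" if "B \<in> sets SM" for B
  using emeasure_measure_of_sigma[of S "sets SM" "%B. ennreal (\<mu> B)" B] ms that
  unfolding eq measure_space_def by (simp add: \<mu>_def)
 show "prob_space (Qtil M w x a)"
  using em[OF S_sets] q_S[OF x a] x sets_eq_imp_space_eq[OF s] by (intro prob_spaceI) simp
qed

lemma Q_kernel: "x \<in> S ==> b \<in> AI ==> Qker M x b \<in> space (prob_algebra SM)"
 using measurable_space[OF Q_meas, of "(x, b)"] by (simp add: space_pair_measure)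

lemma Qtil_I: "b \<in> AI ==> Qtil M w x b = Qker M x b"
 using disj by (auto simp: Qtil_def)

lemma Qtil_kernel: "x \<in> S ==> a \<in> AI \<union> AG ==> Qtil M w x a \<in> space (prob_algebra SM)"
 using Q_kernel[of x a] Qtil_I[of a x]
 by (cases "a \<in> AI") (simp_all add: space_prob_algebra sets_Qtil_G prob_Qtil_G)

lemma Qtil_G_measurable: "(%(x, a). Qtil M w x a) \<in> SM \<Otimes>\<^sub>M gradM M \<rightarrow>\<^sub>M prob_algebra SM"
proof (rule measurable_prob_algebraI)
 fix z assume "z \<in> space (SM \<Otimes>\<^sub>M gradM M)"
 then show "prob_space (case z of (x, a) => Qtil M w x a)"
  using prob_Qtil_G by (auto simp: space_pair_measure)
next
 show "(%(x, a). Qtil M w x a) \<in> SM \<Otimes>\<^sub>M gradM M \<rightarrow>\<^sub>M subprob_algebra SM"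
 proof (rule measurable_subprob_algebra)
  fix z assume "z \<in> space (SM \<Otimes>\<^sub>M gradM M)"
  then show "subprob_space (case z of (x, a) => Qtil M w x a)" "sets (case z of (x, a) => Qtil M w x a) = sets SM"
   using prob_Qtil_G sets_Qtil_G by (auto simp: space_pair_measure intro: prob_space_imp_subprob_space)
 next
  fix B assume B: "B \<in> sets SM"
  have [measurable]: "(%z. qker M (fst z) (snd z) B) \<in> borel_measurable (SM \<Otimes>\<^sub>M gradM M)"
   using q_meas[OF B] by (simp add: split_beta')
  note B[measurable]
  have "(%z. ennreal (qker M (fst z) (snd z) B / w (fst z) + indicator B (fst z))) \<in> borel_measurable (SM \<Otimes>\<^sub>M gradM M)"
   by measurable
  then show "(%z. emeasure (case z of (x, a) => Qtil M w x a) B) \<in> borel_measurable (SM \<Otimes>\<^sub>M gradM M)"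
   by (rule measurable_cong[THEN iffD1, rotated]) (auto simp: space_pair_measure emeasure_Qtil_G B)
 qed
qed

lemma indicator_SM: "(%y. indicator (- {x}) y :: ennreal) \<in> borel_measurable SM"
 unfolding stateM_def by (intro measurable_restrict_space1 borel_measurable_indicator) auto

lemma sets_measure_of_SM: "sets (measure_of S (sets SM) \<mu>) = sets SM"
 using sets.sigma_sets_eq[of SM] sets.space_closed[of SM] by (simp add: sets_measure_of)

lemma measure_of_SM_eqI:
 assumes D: "sets D = sets SM" and em: "!!B. B \<in> sets SM ==> emeasure D B = \<mu> B"
 shows "measure_of S (sets SM) \<mu> = D"
proof -
 have "measure_of S (sets SM) \<mu> = measure_of S (sets SM) (emeasure D)"
  by (rule measure_of_eq) (use em sets.space_closed[of SM] sets.sigma_sets_eq[of SM] in auto)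
 also have "... = D" using measure_of_of_measure[of D] D sets_eq_imp_space_eq[OF D] by simp
 finally show ?thesis .
qed

lemma qtilde_eq_density:
 assumes x: "x \<in> S" and a: "a \<in> AG"
 shows "qtilde M x a = density (Qtil M w x a) (%y. ennreal (w x) * indicator (- {x}) y)"
 unfolding qtilde_def
proof (rule measure_of_SM_eqI)
 have w0: "0 < w x" using w_bounds[OF x a] by simp
 note s = sets_Qtil_G[OF x a]
 have sp: "space (Qtil M w x a) = S" using sets_eq_imp_space_eq[OF s] by simp
 have xm: "{x} \<in> sets SM" using x by simp
 fix B assume B: "B \<in> sets SM"
 have "emeasure (density (Qtil M w x a) (%y. ennreal (w x) * indicator (- {x}) y)) B
   = (\<integral>\<^sup>+y. ennreal (w x) * indicator (- {x}) y * indicator B y \<partial>Qtil M w x a)"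
  using B indicator_SM[of x] by (intro emeasure_density) (auto simp: s measurable_cong_sets[OF s refl])
 also have "... = (\<integral>\<^sup>+y. ennreal (w x) * indicator (B - {x}) y \<partial>Qtil M w x a)"
  by (intro nn_integral_cong) (auto split: split_indicator)
 also have "... = ennreal (w x) * emeasure (Qtil M w x a) (B - {x})"
  using B xm by (subst nn_integral_cmult_indicator) (auto simp: s)
 also have "... = ennreal (w x * (qker M x a (B - {x}) / w x))"
  using B xm w0 q_nonneg[OF x a, of "B - {x}"] by (subst emeasure_Qtil_G[OF x a]) (auto simp: ennreal_mult[symmetric])
 finally show "emeasure (density (Qtil M w x a) (%y. ennreal (w x) * indicator (- {x}) y)) B
   = ennreal (qker M x a (B - {x}))" using w0 by simp
qed (simp add: sets_Qtil_G[OF x a])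

lemma sets_qtilde: "sets (qtilde M x a) = sets SM"
 unfolding qtilde_def by (rule sets_measure_of_SM)

lemma space_qtilde[simp]: "space (qtilde M x a) = S"
 using sets_eq_imp_space_eq[OF sets_qtilde] by simp

lemma nn_integral_qtilde:
 assumes x: "x \<in> S" and a: "a \<in> AG" and g: "g \<in> borel_measurable SM"
 shows "(\<integral>\<^sup>+y. g y \<partial>qtilde M x a) = ennreal (w x) * (\<integral>\<^sup>+y. g y * indicator (- {x}) y \<partial>Qtil M w x a)"
 unfolding qtilde_eq_density[OF x a]
 using g indicator_SM[of x]
 by (subst nn_integral_density)
   (auto simp: measurable_cong_sets[OF sets_Qtil_G[OF x a] refl] nn_integral_cmult[symmetric] mult_ac intro!: nn_integral_cong)

lemma emeasure_qtilde: "x \<in> S ==> a \<in> AG ==> B \<in> sets SM ==> emeasure (qtilde M x a) B = ennreal (qker M x a (B - {x}))"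
proof -
 assume x: "x \<in> S" and a: "a \<in> AG" and B: "B \<in> sets SM"
 have w0: "0 < w x" using w_bounds[OF x a] by simp
 have "emeasure (qtilde M x a) B = (\<integral>\<^sup>+y. indicator B y \<partial>qtilde M x a)"
  using B by (simp add: sets_qtilde)
 also have "... = ennreal (w x) * (\<integral>\<^sup>+y. indicator (B - {x}) y \<partial>Qtil M w x a)"
  using B by (subst nn_integral_qtilde[OF x a]) (auto intro!: arg_cong2[where f="(*)"] nn_integral_cong split: split_indicator)
 also have "... = ennreal (w x) * emeasure (Qtil M w x a) (B - {x})"
  using B x by (simp add: sets_Qtil_G[OF x a])
 also have "... = ennreal (w x * (qker M x a (B - {x}) / w x))"
  using B x w0 q_nonneg[OF x a, of "B - {x}"] by (subst emeasure_Qtil_G[OF x a]) (auto simp: ennreal_mult[symmetric])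
 finally show ?thesis using w0 by simp
qed

lemma emeasure_qtilde_S: "x \<in> S ==> a \<in> AG ==> emeasure (qtilde M x a) S = ennreal (jump_rate M x a)"
 by (simp add: emeasure_qtilde S_sets q_jump)

lemma emeasure_Qtil_sing:
 "x \<in> S ==> a \<in> AG ==> ennreal (w x) * emeasure (Qtil M w x a) {x} = ennreal (w x - jump_rate M x a)"
proof -
 assume x: "x \<in> S" and a: "a \<in> AG"
 have eq: "w x * (qker M x a {x} / w x + 1) = w x - jump_rate M x a"
  using w_bounds[OF x a] by (simp add: jump_rate_def field_simps)
 have "0 <= w x" "0 <= w x * (qker M x a {x} / w x + 1)" unfolding eq using w_bounds[OF x a] by auto
 then have "ennreal (w x) * ennreal (qker M x a {x} / w x + 1) = ennreal (w x * (qker M x a {x} / w x + 1))"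
  using w_bounds[OF x a] by (subst ennreal_mult) (auto simp: zero_le_mult_iff)
 then show ?thesis unfolding eq using emeasure_Qtil_G[OF x a, of "{x}"] x by simp
qed

text \<open>Uniformization: \<open>w\<close> times the tilde transition consists of the jumps with intensity
\<open>qtilde\<close> and a fictitious jump from \<open>x\<close> to \<open>x\<close> with the remaining
intensity.\<close>
lemma nn_integral_Qtil_G:
 assumes x: "x \<in> S" and a: "a \<in> AG" and g[measurable]: "g \<in> borel_measurable SM"
 shows "ennreal (w x) * (\<integral>\<^sup>+y. g y \<partial>Qtil M w x a) = (\<integral>\<^sup>+y. g y \<partial>qtilde M x a) + ennreal (w x - jump_rate M x a) * g x"
proof -
 note s[measurable_cong] = sets_Qtil_G[OF x a]
 have xm: "{x} \<in> sets (Qtil M w x a)" using x by (simp add: s)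
 note i[measurable] = indicator_SM[of x]
 have "(\<integral>\<^sup>+y. g y \<partial>Qtil M w x a) = (\<integral>\<^sup>+y. g y * indicator (- {x}) y + g x * indicator {x} y \<partial>Qtil M w x a)"
  by (intro nn_integral_cong) (auto split: split_indicator)
 also have "... = (\<integral>\<^sup>+y. g y * indicator (- {x}) y \<partial>Qtil M w x a) + g x * emeasure (Qtil M w x a) {x}"
  using xm g i by (subst nn_integral_add) (auto simp: measurable_cong_sets[OF s refl] nn_integral_cmult_indicator)
 finally show ?thesis using emeasure_Qtil_sing[OF x a]
  by (simp add: distrib_left nn_integral_qtilde[OF x a g] mult.assoc[symmetric] mult.commute[of _ "g x"])
    (simp add: mult.assoc mult.left_commute)
qed

lemma finite_qtilde: "x \<in> S ==> a \<in> AG ==> finite_measure (qtilde M x a)"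
 using emeasure_qtilde_S sets_eq_imp_space_eq[OF sets_qtilde] by (intro finite_measureI) simp

lemma integral_Qtil_G:
 fixes g :: "'x => real"
 assumes x: "x \<in> S" and a: "a \<in> AG" and g: "g \<in> borel_measurable SM" and b: "!!y. y \<in> S ==> \<bar>g y\<bar> <= B"
 shows "(\<integral>y. g y \<partial>Qtil M w x a) = (\<integral>y. g y \<partial>qtilde M x a) / w x + (1 - jump_rate M x a / w x) * g x"
proof -
 note s = sets_Qtil_G[OF x a]
 have sp: "space (Qtil M w x a) = S" "space (qtilde M x a) = S" using sets_eq_imp_space_eq[OF s] sets_eq_imp_space_eq[OF sets_qtilde] by auto
 interpret Q: prob_space "Qtil M w x a" by (rule prob_Qtil_G[OF x a])
 interpret q: finite_measure "qtilde M x a" by (rule finite_qtilde[OF x a])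
 have w0: "0 < w x" using w_bounds[OF x a] by simp
 have *: "(\<integral>y. h y \<partial>Qtil M w x a) = (\<integral>y. h y \<partial>qtilde M x a) / w x + (1 - jump_rate M x a / w x) * h x"
  if h: "h \<in> borel_measurable SM" "!!y. y \<in> S ==> 0 <= h y & h y <= C" for h :: "'x => real" and C
 proof -
  have i1: "integrable (Qtil M w x a) h"
   by (rule Q.integrable_const_bound[of _ C]) (use h in "auto simp: sp measurable_cong_sets[OF s refl] intro!: AE_I2")
  have i2: "integrable (qtilde M x a) h"
   by (rule q.integrable_const_bound[of _ C]) (use h in "auto simp: sp measurable_cong_sets[OF sets_qtilde refl] intro!: AE_I2")
  have e1: "(\<integral>\<^sup>+y. ennreal (h y) \<partial>Qtil M w x a) = ennreal (\<integral>y. h y \<partial>Qtil M w x a)"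
   by (rule nn_integral_eq_integral[OF i1]) (use h in "auto simp: sp intro!: AE_I2")
  have e2: "(\<integral>\<^sup>+y. ennreal (h y) \<partial>qtilde M x a) = ennreal (\<integral>y. h y \<partial>qtilde M x a)"
   by (rule nn_integral_eq_integral[OF i2]) (use h in "auto simp: sp intro!: AE_I2")
  have "(%y. ennreal (h y)) \<in> borel_measurable SM" using h(1) by measurable
  from nn_integral_Qtil_G[OF x a this]
  have "ennreal (w x) * ennreal (\<integral>y. h y \<partial>Qtil M w x a) = ennreal (\<integral>y. h y \<partial>qtilde M x a) + ennreal (w x - jump_rate M x a) * ennreal (h x)"
   unfolding e1 e2 .
  moreover have "0 <= (\<integral>y. h y \<partial>Qtil M w x a)" "0 <= (\<integral>y. h y \<partial>qtilde M x a)"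
   using h by (auto intro!: integral_nonneg_AE AE_I2 simp: sp)
  moreover have "0 <= h x" "0 <= w x - jump_rate M x a" using h x w_bounds[OF x a] by auto
  ultimately have "w x * (\<integral>y. h y \<partial>Qtil M w x a) = (\<integral>y. h y \<partial>qtilde M x a) + (w x - jump_rate M x a) * h x"
   using w0 by (simp add: ennreal_mult[symmetric] ennreal_plus[symmetric] del: ennreal_plus)
  then show ?thesis using w0 by (simp add: field_simps)
 qed
 have c: "0 <= g y + B & g y + B <= 2 * B" if "y \<in> S" for y using b[OF that] by (auto simp: abs_le_iff)
 have i1: "integrable (Qtil M w x a) g"
  by (rule Q.integrable_const_bound[of _ B]) (use g b in "auto simp: sp measurable_cong_sets[OF s refl] intro!: AE_I2")
 have i2: "integrable (qtilde M x a) g"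
  by (rule q.integrable_const_bound[of _ B]) (use g b in "auto simp: sp measurable_cong_sets[OF sets_qtilde refl] intro!: AE_I2")
 have m: "measure (qtilde M x a) S = jump_rate M x a"
  using emeasure_qtilde_S[OF x a] jump_nonneg[OF x a] by (simp add: measure_def)
 have "(\<integral>y. g y + B \<partial>Qtil M w x a) = (\<integral>y. g y + B \<partial>qtilde M x a) / w x + (1 - jump_rate M x a / w x) * (g x + B)"
  by (rule *[of _ "2 * B"]) (use g c in auto)
 moreover have "(\<integral>y. g y + B \<partial>Qtil M w x a) = (\<integral>y. g y \<partial>Qtil M w x a) + B"
  using i1 Q.prob_space by (simp add: sp)
 moreover have "(\<integral>y. g y + B \<partial>qtilde M x a) = (\<integral>y. g y \<partial>qtilde M x a) + jump_rate M x a * B"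
  using i2 m by (simp add: sp)
 moreover have "(I + jump_rate M x a * B) / w x + (1 - jump_rate M x a / w x) * (g x + B)
   = I / w x + (1 - jump_rate M x a / w x) * g x + B" for I
  using w0 by (simp add: field_simps)
 ultimately show ?thesis by simp
qed

lemma Qtil_weak:
 fixes g :: "'x => real"
 assumes g: "continuous_on S g" "bounded (g ` S)"
 shows "continuous_on (S \<times> AG) (%z. \<integral>y. g y \<partial>Qtil M w (fst z) (snd z))"
proof -
 have gm: "(h :: 'x => real) \<in> borel_measurable SM" if "continuous_on S h" for h
  unfolding stateM_def by (rule borel_measurable_continuous_on_restrict[OF that])
 obtain B where B: "!!y. y \<in> S ==> \<bar>g y\<bar> <= B" using g(2) by (auto simp: bounded_iff)
 have m: "measure (qtilde M x a) S = jump_rate M x a" if "x \<in> S" "a \<in> AG" for x a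
  using emeasure_qtilde_S[OF that] jump_nonneg[OF that] sets_eq_imp_space_eq[OF sets_qtilde, of x a]
  by (simp add: measure_def)
 have qc: "continuous_on (S \<times> AG) (%z. \<integral>y. h y \<partial>qtilde M (fst z) (snd z))"
  if "continuous_on S h" "bounded (h ` S)" for h :: "'x => real"
  using q_cont that by (simp add: split_beta')
 have jc: "continuous_on (S \<times> AG) (%z. jump_rate M (fst z) (snd z))"
  using qc[of "%_. 1"] by (rule continuous_on_cong[THEN iffD1, rotated 2]) (auto simp: m bounded_iff)
 have wc: "continuous_on (S \<times> AG) (%z. w (fst z))"
  by (rule continuous_on_compose2[OF w_cont]) (auto intro!: continuous_intros)
 have gc: "continuous_on (S \<times> AG) (%z. g (fst z))"
  by (rule continuous_on_compose2[OF g(1)]) (auto intro!: continuous_intros)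
 have w0: "w (fst z) ~= 0" if "z \<in> S \<times> AG" for z using w_bounds[of "fst z" "snd z"] that by auto
 have "continuous_on (S \<times> AG) (%z. (\<integral>y. g y \<partial>qtilde M (fst z) (snd z)) / w (fst z)
   + (1 - jump_rate M (fst z) (snd z) / w (fst z)) * g (fst z))"
  by (intro continuous_intros qc g jc wc gc) (use w0 in auto)
 then show ?thesis
  by (rule continuous_on_cong[THEN iffD1, rotated 2])
    (use integral_Qtil_G[OF _ _ gm[OF g(1)] B] in auto)
qed

end

lemma elsc_add:
 fixes f g :: "'z::metric_space => ennreal"
 assumes f: "elsc S f" and g: "elsc S g"
 shows "elsc S (%x. f x + g x)"
proof (cases "S = {}")
 case True then show ?thesis by (simp add: elsc_def)
next
 case False
 obtain F :: "nat => 'z => real" where F: "!!k x. 0 <= F k x" "!!k x y. \<bar>F k x - F k y\<bar> <= real k * dist x y"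
  "!!x. incseq (%k. F k x)" "!!x. x \<in> S ==> f x = (SUP k. ennreal (F k x))"
  using elsc_lipschitz_approx[OF f False] by metis
 obtain G :: "nat => 'z => real" where G: "!!k x. 0 <= G k x" "!!k x y. \<bar>G k x - G k y\<bar> <= real k * dist x y"
  "!!x. incseq (%k. G k x)" "!!x. x \<in> S ==> g x = (SUP k. ennreal (G k x))"
  using elsc_lipschitz_approx[OF g False] by metis
 have cont: "continuous_on S (H k)" if "!!k x y. \<bar>H k x - H k y\<bar> <= real k * dist x y" for H :: "nat => 'z => real" and k
 proof (rule lipschitz_on_continuous_on)
  show "(real k)-lipschitz_on S (H k)" by (rule lipschitz_onI) (use that in "auto simp: dist_real_def")
 qed
 have "elsc S (%x. SUP k. ennreal (F k x + G k x))"
  by (intro elsc_SUP elsc_continuous continuous_on_ennreal continuous_on_add cont F G)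
 moreover have "(SUP k. ennreal (F k x + G k x)) = f x + g x" if "x \<in> S" for x
 proof -
  have "(SUP k. ennreal (F k x) + ennreal (G k x)) = (SUP k. ennreal (F k x)) + (SUP k. ennreal (G k x))"
   by (rule ennreal_SUP_add) (use F G in "auto simp: incseq_def intro!: ennreal_leI")
  then show ?thesis using that F G by simp
 qed
 ultimately show ?thesis by (simp cong: elsc_cong)
qed

lemma lsc_on_compose:
 assumes f: "lsc_on T f" and g: "continuous_on S g" "g ` S \<subseteq> T"
 shows "lsc_on S (%x. f (g x))"
 unfolding lsc_on_def
proof
 fix c
 obtain W where W: "open W" "{x \<in> T. c < f x} = T \<inter> W" using f unfolding lsc_on_def openin_open by metis
 have "{x \<in> S. c < f (g x)} = S \<inter> g -` W" using W(2) g(2) by fastforce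
 then show "openin (top_of_set S) {x \<in> S. c < f (g x)}"
  using continuous_openin_preimage_gen[OF g(1) W(1)] by simp
qed

section \<open>The multiplicative Bellman operator\<close>

text \<open>Terminal payoff 1 with probability \<open>1 - \<alpha>\<close> at the end of a stage.\<close>
definition kill :: "real => ('x => ennreal) => 'x => ennreal" where
 "kill \<alpha> g y = ennreal \<alpha> * g y + ennreal (1 - \<alpha>)"

lemma kill_mono:
 assumes "0 <= a" "a <= a'" "a' <= 1" "1 <= g y" "g y <= g' y"
 shows "kill a g y <= kill a' g' y"
proof -
 have "kill a g y = ennreal a * g y + (ennreal (a' - a) * 1 + ennreal (1 - a'))"
  using assms by (simp add: kill_def ennreal_plus[symmetric] del: ennreal_plus)
 also have "... <= ennreal a * g y + (ennreal (a' - a) * g y + ennreal (1 - a'))"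
  using assms by (intro add_mono mult_left_mono) auto
 also have "... = kill a' g y"
  using assms by (simp add: kill_def add.assoc[symmetric] distrib_right[symmetric] ennreal_plus[symmetric] del: ennreal_plus)
 also have "... <= kill a' g' y" unfolding kill_def using assms by (intro add_mono mult_left_mono) auto
 finally show ?thesis .
qed

lemma kill_ge1: "0 <= a ==> a <= 1 ==> 1 <= g y ==> 1 <= kill a g y"
 using kill_mono[of 0 a "g" y g] by (simp add: kill_def)

lemma kill_le: "0 <= a ==> a <= 1 ==> 1 <= g y ==> kill a g y <= g y"
 using kill_mono[of a 1 "g" y g] by (simp add: kill_def)

lemma kill_measurable[measurable]: "g \<in> borel_measurable N ==> kill a g \<in> borel_measurable N"
 unfolding kill_def[abs_def] by (intro borel_measurable_add borel_measurable_times_ennreal borel_measurable_const)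

text \<open>Any increasing sequence in \<open>(0, 1)\<close> with limit 1 would do.\<close>
definition af :: "nat => real" where "af n = 1 - 1 / (real n + 2)"

lemma af: "0 <= af n" "af n < 1" "af n <= af (Suc n)" "0 < af n"
 by (auto simp: af_def field_simps)

lemma SUP_af: "(SUP n. ennreal (af n)) = 1"
proof -
 have "(%n. ennreal (af n)) \<longlonglongrightarrow> (SUP n. ennreal (af n))"
  by (intro LIMSEQ_SUP incseq_SucI ennreal_leI af)
 moreover have "af \<longlonglongrightarrow> 1" unfolding af_def[abs_def] by real_asymp
 then have "(%n. ennreal (af n)) \<longlonglongrightarrow> ennreal 1" by (intro tendsto_ennrealI)
 ultimately show ?thesis using LIMSEQ_unique by fastforce
qed

context gi_control
begin

abbreviation "AA == AI \<union> AG"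
abbreviation "bell == bellman M w"

lemma exp_ltil_I: "b \<in> AI ==> exp (ltil M w x b y) = exp (costI M x b y)"
 using disj by (auto simp: ltil_def)

lemma ltil_I: "b \<in> AI ==> ltil M w x b y = costI M x b y"
 using disj by (auto simp: ltil_def)

lemma exp_ltil_G: "x \<in> S ==> a \<in> AG ==> exp (ltil M w x a y) = w x / (w x - costG M x a)"
 using w_bounds[of x a] by (simp add: ltil_def)

lemma ltil_nonneg: "x \<in> S ==> a \<in> AA ==> y \<in> S ==> 0 <= ltil M w x a y"
 using cI_nonneg[of x a y] w_bounds[of x a] cG_nonneg[of x a] by (auto simp: ltil_def)

lemma space_Qtil: "x \<in> S ==> a \<in> AA ==> space (Qtil M w x a) = S"
 using Qtil_kernel[of x a] by (auto simp: space_prob_algebra dest: sets_eq_imp_space_eq)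

lemma sets_Qtil: "x \<in> S ==> a \<in> AA ==> sets (Qtil M w x a) = sets SM"
 using Qtil_kernel[of x a] by (auto simp: space_prob_algebra)

lemma measurable_actM:
 assumes G: "f \<in> P \<Otimes>\<^sub>M gradM M \<rightarrow>\<^sub>M N" and I: "f \<in> P \<Otimes>\<^sub>M impM M \<rightarrow>\<^sub>M N"
 shows "f \<in> P \<Otimes>\<^sub>M actM M \<rightarrow>\<^sub>M N"
proof -
 let ?R = "P \<Otimes>\<^sub>M actM M"
 have AGs: "AG \<in> sets (actM M)" unfolding actM_def sets_restrict_space by (intro image_eqI[of _ _ AG]) auto
 have m: "f \<in> restrict_space ?R (space P \<times> K) \<rightarrow>\<^sub>M N"
  if f: "f \<in> P \<Otimes>\<^sub>M restrict_space borel K \<rightarrow>\<^sub>M N" and K: "K \<subseteq> AA" for K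
 proof (rule measurable_compose[OF _ f, where f="%z. z", simplified])
  have "fst \<in> restrict_space ?R (space P \<times> K) \<rightarrow>\<^sub>M P" by (rule measurable_restrict_space1) simp
  moreover have "snd \<in> restrict_space ?R (space P \<times> K) \<rightarrow>\<^sub>M restrict_space borel K"
  proof (rule measurable_restrict_space2)
   show "snd \<in> space (restrict_space ?R (space P \<times> K)) \<rightarrow> K" by (auto simp: space_restrict_space space_pair_measure)
   have "snd \<in> ?R \<rightarrow>\<^sub>M actM M" by simp
   then have "snd \<in> ?R \<rightarrow>\<^sub>M borel" unfolding actM_def by (rule measurable_restrict_space2_iff[THEN iffD1, THEN conjunct1])
   then show "snd \<in> restrict_space ?R (space P \<times> K) \<rightarrow>\<^sub>M borel" by (rule measurable_restrict_space1)
  qed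
  ultimately have "(%z. (fst z, snd z)) \<in> restrict_space ?R (space P \<times> K) \<rightarrow>\<^sub>M P \<Otimes>\<^sub>M restrict_space borel K"
   by (rule measurable_Pair)
  then show "(%z. z) \<in> restrict_space ?R (space P \<times> K) \<rightarrow>\<^sub>M P \<Otimes>\<^sub>M restrict_space borel K" by simp
 qed
 show ?thesis
 proof (rule measurable_piecewise_restrict[where C="{space P \<times> AG, space P \<times> AI}"])
  show "space ?R \<subseteq> \<Union> {space P \<times> AG, space P \<times> AI}" by (auto simp: space_pair_measure)
  have AIs: "AI \<in> sets (actM M)" unfolding actM_def sets_restrict_space by (intro image_eqI[of _ _ AI]) auto
  show "\<Omega> \<inter> space ?R \<in> sets ?R" if "\<Omega> \<in> {space P \<times> AG, space P \<times> AI}" for \<Omega>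
   using that AGs AIs by (blast intro: sets.Int pair_measureI sets.top)
  show "f \<in> restrict_space ?R \<Omega> \<rightarrow>\<^sub>M N" if "\<Omega> \<in> {space P \<times> AG, space P \<times> AI}" for \<Omega>
   using that m[OF G[unfolded gradM_def] Un_upper2] m[OF I[unfolded impM_def] Un_upper1] by blast
 qed auto
qed

lemma Qtil_measurable: "(%z. Qtil M w (fst z) (snd z)) \<in> SM \<Otimes>\<^sub>M actM M \<rightarrow>\<^sub>M prob_algebra SM"
proof (rule measurable_actM)
 show "(%z. Qtil M w (fst z) (snd z)) \<in> SM \<Otimes>\<^sub>M gradM M \<rightarrow>\<^sub>M prob_algebra SM"
  using Qtil_G_measurable by (simp add: split_beta')
 have "(%z. Qker M (fst z) (snd z)) \<in> SM \<Otimes>\<^sub>M impM M \<rightarrow>\<^sub>M prob_algebra SM"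
  using Q_meas by (simp add: split_beta')
 then show "(%z. Qtil M w (fst z) (snd z)) \<in> SM \<Otimes>\<^sub>M impM M \<rightarrow>\<^sub>M prob_algebra SM"
  by (rule measurable_cong[THEN iffD1, rotated]) (auto simp: space_pair_measure Qtil_I)
qed

lemma exp_ltil_measurable:
 "(%z. ennreal (exp (ltil M w (fst (fst z)) (snd (fst z)) (snd z)))) \<in> borel_measurable ((SM \<Otimes>\<^sub>M actM M) \<Otimes>\<^sub>M SM)"
proof -
 let ?f = "%z. ennreal (exp (ltil M w (fst (fst z)) (snd z) (snd (fst z))))"
 have "?f \<in> borel_measurable ((SM \<Otimes>\<^sub>M SM) \<Otimes>\<^sub>M actM M)"
 proof (rule measurable_actM)
  have [measurable]: "(%z. costG M (fst z) (snd z)) \<in> borel_measurable (SM \<Otimes>\<^sub>M gradM M)"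
   using cG_meas by (simp add: split_beta')
  have [measurable]: "(%z. costG M (fst (fst z)) (snd z)) \<in> borel_measurable ((SM \<Otimes>\<^sub>M SM) \<Otimes>\<^sub>M gradM M)"
   by (rule measurable_compose[of "%z. (fst (fst z), snd z)" _ "SM \<Otimes>\<^sub>M gradM M" "%z. costG M (fst z) (snd z)", simplified]) measurable
  have "(%z. ennreal (w (fst (fst z)) / (w (fst (fst z)) - costG M (fst (fst z)) (snd z))))
    \<in> borel_measurable ((SM \<Otimes>\<^sub>M SM) \<Otimes>\<^sub>M gradM M)" by measurable
  then show "?f \<in> borel_measurable ((SM \<Otimes>\<^sub>M SM) \<Otimes>\<^sub>M gradM M)"
   by (rule measurable_cong[THEN iffD1, rotated]) (auto simp: space_pair_measure exp_ltil_G)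
  have "(%z. costI M (fst (fst z)) (snd z) (snd (fst z))) \<in> borel_measurable ((SM \<Otimes>\<^sub>M SM) \<Otimes>\<^sub>M impM M)"
   using measurable_compose[of "%z. (fst (fst z), (snd z, snd (fst z)))" "(SM \<Otimes>\<^sub>M SM) \<Otimes>\<^sub>M impM M", OF _ cI_meas]
   by (simp add: split_beta')
  then have "(%z. ennreal (exp (costI M (fst (fst z)) (snd z) (snd (fst z))))) \<in> borel_measurable ((SM \<Otimes>\<^sub>M SM) \<Otimes>\<^sub>M impM M)"
   by measurable
  then show "?f \<in> borel_measurable ((SM \<Otimes>\<^sub>M SM) \<Otimes>\<^sub>M impM M)"
   by (rule measurable_cong[THEN iffD1, rotated]) (auto simp: space_pair_measure ltil_I)
 qed
 from measurable_compose[of "%z. ((fst (fst z), snd z), snd (fst z))" "(SM \<Otimes>\<^sub>M actM M) \<Otimes>\<^sub>M SM", OF _ this]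
 show ?thesis by simp
qed

lemma exp_ltil_slice:
 assumes "x \<in> S" "a \<in> AA"
 shows "(%y. ennreal (exp (ltil M w x a y))) \<in> borel_measurable SM"
 using measurable_compose[of "%y. ((x, a), y)" SM, OF _ exp_ltil_measurable] assms by simp

lemma bell_mono:
 "x \<in> S ==> a \<in> AA ==> (!!y. y \<in> S ==> g y <= g' y) ==> bell g x a <= bell g' x a"
 unfolding bellman_def by (intro nn_integral_mono mult_left_mono) (auto simp: space_Qtil)

lemma bell_cong:
 "x \<in> S ==> a \<in> AA ==> (!!y. y \<in> S ==> g y = g' y) ==> bell g x a = bell g' x a"
 by (intro antisym bell_mono) auto

lemma bell_ge1:
 assumes x: "x \<in> S" "a \<in> AA" and g: "!!y. y \<in> S ==> 1 <= g y"
 shows "1 <= bell g x a"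
proof -
 interpret prob_space "Qtil M w x a" using Qtil_kernel[OF x] by (simp add: space_prob_algebra)
 have "1 = (\<integral>\<^sup>+y. 1 * 1 \<partial>Qtil M w x a)" by (simp add: emeasure_space_1)
 also have "... <= bell g x a" unfolding bellman_def
  using g ltil_nonneg[OF x] by (intro nn_integral_mono mult_mono) (auto simp: space_Qtil[OF x])
 finally show ?thesis .
qed

lemma bell_SUP:
 assumes x: "x \<in> S" "a \<in> AA" and g: "!!n. g n \<in> borel_measurable SM" and inc: "!!n y. y \<in> S ==> g n y <= g (Suc n) y"
 shows "bell (%y. SUP n. g n y) x a = (SUP n. bell (g n) x a)"
proof -
 have "bell (%y. SUP n. g n y) x a = (\<integral>\<^sup>+y. (SUP n. ennreal (exp (ltil M w x a y)) * g n y) \<partial>Qtil M w x a)"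
  unfolding bellman_def by (simp add: SUP_mult_left_ennreal)
 also have "... = (SUP n. \<integral>\<^sup>+y. ennreal (exp (ltil M w x a y)) * g n y \<partial>Qtil M w x a)"
  by (rule nn_integral_monotone_convergence_SUP_AE)
    (use g exp_ltil_slice[OF x] inc in "auto simp: space_Qtil[OF x] measurable_cong_sets[OF sets_Qtil[OF x] refl] intro!: AE_I2 mult_left_mono")
 finally show ?thesis by (simp add: bellman_def)
qed

lemma bell_I: "b \<in> AI ==> bell g x b = (\<integral>\<^sup>+y. ennreal (exp (costI M x b y)) * g y \<partial>Qker M x b)"
 by (simp add: bellman_def Qtil_I exp_ltil_I)

lemma bell_G_factor:
 assumes x: "x \<in> S" and a: "a \<in> AG" and g: "g \<in> borel_measurable SM"
 shows "bell g x a = ennreal (w x / (w x - costG M x a)) * (\<integral>\<^sup>+y. g y \<partial>Qtil M w x a)"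
 unfolding bellman_def exp_ltil_G[OF x a]
 by (rule nn_integral_cmult) (simp add: measurable_cong_sets[OF sets_Qtil_G[OF x a] refl] g)

text \<open>For a gradual control the optimality equation is that of the continuous-time problem: if \<open>bell g x a = g
x < \<infinity>\<close>, the multiples of \<open>w x\<close> cancel and \<open>\<integral>g dqtilde = (q - c)
g x\<close> remains.\<close>
lemma bell_G:
 assumes x: "x \<in> S" and a: "a \<in> AG" and g: "g \<in> borel_measurable SM"
 shows "ennreal (w x - costG M x a) * bell g x a = (\<integral>\<^sup>+y. g y \<partial>qtilde M x a) + ennreal (w x - jump_rate M x a) * g x"
proof -
 have "ennreal (w x - costG M x a) * ennreal (w x / (w x - costG M x a)) = ennreal (w x)"
  using w_bounds[OF x a] by (subst ennreal_mult[symmetric]) auto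
 then show ?thesis
  unfolding bell_G_factor[OF assms] nn_integral_Qtil_G[OF assms, symmetric] by (simp add: mult.assoc[symmetric])
qed

lemma
 assumes g: "elsc S g"
 shows elsc_bell_I: "elsc (S \<times> AI) (%(x, a). bell g x a)"
  and elsc_bell_G: "elsc (S \<times> AG) (%(x, a). bell g x a)"
proof -
 have gs: "elsc ((S \<times> K) \<times> S) (%z. g (snd z))" for K :: "'a set"
  by (rule elsc_compose[OF g]) (auto intro!: continuous_intros)
 have "elsc (S \<times> AI) (%z. \<integral>\<^sup>+y. (%z. ennreal (exp (costI M (fst (fst z)) (snd (fst z)) (snd z))) * g (snd z)) (z, y) \<partial>Qker M (fst z) (snd z))"
 proof (rule elsc_kernel)
  show "Qker M (fst z) (snd z) \<in> space (prob_algebra (restrict_space borel S))" if "z \<in> S \<times> AI" for z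
   using Q_kernel that by (auto simp: stateM_def)
  show "continuous_on (S \<times> AI) (%z. \<integral>y. h y \<partial>Qker M (fst z) (snd z))"
   if "continuous_on S h" "bounded (h ` S)" for h :: "'x => real"
   using Q_cont that by (simp add: split_beta')
  have "lsc_on ((S \<times> AI) \<times> S) (%z. costI M (fst (fst z)) (snd (fst z)) (snd z))"
  proof -
   have "continuous_on ((S \<times> AI) \<times> S) (%z. (fst (fst z), snd (fst z), snd z))" by (intro continuous_intros)
   moreover have "(%z. (fst (fst z), snd (fst z), snd z)) ` ((S \<times> AI) \<times> S) \<subseteq> S \<times> AI \<times> S" by auto
   ultimately show ?thesis using lsc_on_compose[OF cI_lsc] by fastforce
  qed
  then have "elsc ((S \<times> AI) \<times> S) (%z. ennreal ((%z. exp) z (costI M (fst (fst z)) (snd (fst z)) (snd z))))"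
   by (rule elsc_mono_image) (auto intro!: cI_nonneg continuous_intros simp: split_beta')
  then show "elsc ((S \<times> AI) \<times> S) (%z. ennreal (exp (costI M (fst (fst z)) (snd (fst z)) (snd z))) * g (snd z))"
   by (intro elsc_mult gs) simp
 qed
 then show "elsc (S \<times> AI) (%(x, a). bell g x a)"
  by (rule elsc_cong[THEN iffD1, rotated]) (auto simp: bell_I)
 have "elsc (S \<times> AG) (%z. \<integral>\<^sup>+y. (%z. ennreal (w (fst (fst z)) / (w (fst (fst z)) - costG M (fst (fst z)) (snd (fst z)))) * g (snd z)) (z, y) \<partial>Qtil M w (fst z) (snd z))"
 proof (rule elsc_kernel)
  show "Qtil M w (fst z) (snd z) \<in> space (prob_algebra (restrict_space borel S))" if "z \<in> S \<times> AG" for z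
   using Qtil_kernel that by (auto simp: stateM_def)
  show "continuous_on (S \<times> AG) (%z. \<integral>y. h y \<partial>Qtil M w (fst z) (snd z))"
   if "continuous_on S h" "bounded (h ` S)" for h :: "'x => real"
   using Qtil_weak that by blast
  have "lsc_on ((S \<times> AG) \<times> S) (%z. costG M (fst (fst z)) (snd (fst z)))"
  proof -
   have "continuous_on ((S \<times> AG) \<times> S) fst" by (intro continuous_intros)
   moreover have "fst ` ((S \<times> AG) \<times> S) \<subseteq> S \<times> AG" by auto
   ultimately show ?thesis using lsc_on_compose[OF cG_lsc, of "(S \<times> AG) \<times> S" fst] by (simp add: split_beta')
  qed
  then have "elsc ((S \<times> AG) \<times> S) (%z. ennreal ((%z t. w (fst (fst z)) / (w (fst (fst z)) - t)) z (costG M (fst (fst z)) (snd (fst z)))))"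
  proof (rule elsc_mono_image)
   let ?D = "{p. fst p \<in> (S \<times> AG) \<times> S & 0 <= snd p & snd p <= costG M (fst (fst (fst p))) (snd (fst (fst p)))}"
   have wc: "continuous_on ?D (%p. w (fst (fst (fst p))))"
    by (rule continuous_on_compose2[OF w_cont]) (auto intro!: continuous_intros)
   have "w (fst (fst (fst p))) - snd p ~= 0" if "p \<in> ?D" for p
    using w_bounds[of "fst (fst (fst p))" "snd (fst (fst p))"] that by auto
   then show "continuous_on {(z, t). z \<in> (S \<times> AG) \<times> S & 0 <= t & t <= costG M (fst (fst z)) (snd (fst z))}
     (%(z, t). w (fst (fst z)) / (w (fst (fst z)) - t))"
    unfolding split_beta' by (intro continuous_intros wc ballI)
   fix z s t assume *: "z \<in> (S \<times> AG) \<times> S" "0 <= (s::real)" "s <= t" "t <= costG M (fst (fst z)) (snd (fst z))"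
   then show "w (fst (fst z)) / (w (fst (fst z)) - s) <= w (fst (fst z)) / (w (fst (fst z)) - t)"
    using w_bounds[of "fst (fst z)" "snd (fst z)"] by (intro divide_left_mono mult_pos_pos) auto
  qed (auto intro: cG_nonneg)
  then show "elsc ((S \<times> AG) \<times> S) (%z. ennreal (w (fst (fst z)) / (w (fst (fst z)) - costG M (fst (fst z)) (snd (fst z)))) * g (snd z))"
   by (intro elsc_mult gs) simp
 qed
 then show "elsc (S \<times> AG) (%(x, a). bell g x a)"
  by (rule elsc_cong[THEN iffD1, rotated]) (auto simp: bellman_def exp_ltil_G)
qed

lemma elsc_bell: "elsc S g ==> elsc (S \<times> AA) (%(x, a). bell g x a)"
 by (intro elsc_Un elsc_bell_I elsc_bell_G compact_imp_closed AI AG) (use disj in auto)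

lemma compact_AA: "compact AA" by (intro compact_Un AI AG)

subsection \<open>Value iteration\<close>

text \<open>The truncation keeps \<open>V n\<close> bounded, the killing leaves a margin in the subsolution inequality;
both are removed in the limit.\<close>
primrec V :: "nat => 'x => ennreal" where
 "V 0 x = 1"
| "V (Suc n) x = min (of_nat (n + 2)) (INF a\<in>AA. bell (kill (af n) (V n)) x a)"

definition Vinf :: "'x => ennreal" where "Vinf x = (SUP n. V n x)"

lemma elsc_const: "elsc S (%_. c)"
 by (intro elsc_continuous continuous_intros)

lemma elsc_kill: "elsc S g ==> elsc S (kill a g)"
 unfolding kill_def[abs_def] by (intro elsc_add elsc_mult elsc_const)

lemma elsc_INF_bell: "elsc S g ==> elsc S (%x. INF a\<in>AA. bell g x a)"
 using elsc_INF_compact[OF compact_AA elsc_bell, of g] by simp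

lemma V_elsc: "elsc S (V n)"
proof (induction n)
 case 0 show ?case by (simp add: elsc_const)
next
 case (Suc n) then show ?case
  by (simp only: V.simps(2)[abs_def]) (intro elsc_min elsc_INF_bell elsc_kill elsc_const)
qed

lemma elsc_SM: "elsc S g ==> g \<in> borel_measurable SM"
 unfolding stateM_def by (rule elsc_measurable)

lemma V_measurable[measurable]: "V n \<in> borel_measurable SM"
 by (rule elsc_SM[OF V_elsc])

lemma V_ge1: "x \<in> S ==> 1 <= V n x"
proof (induction n arbitrary: x)
 case (Suc n)
 have "1 <= bell (kill (af n) (V n)) x a" if "a \<in> AA" for a
  using Suc af[of n] that by (intro bell_ge1 kill_ge1) auto
 moreover have "(1::ennreal) <= of_nat (n + 2)" using of_nat_mono[of 1 "n + 2"] by (metis le_add2 of_nat_1 one_le_numeral order_trans)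
 ultimately show ?case by (auto intro!: INF_greatest)
qed simp

lemma V_le: "V n x <= of_nat (n + 1)"
 by (cases n) auto

lemma V_mono: "x \<in> S ==> V n x <= V (Suc n) x"
proof (induction n arbitrary: x)
 case 0 then show ?case using V_ge1[of x "Suc 0"] by simp
next
 case (Suc n)
 have "(INF a\<in>AA. bell (kill (af n) (V n)) x a) <= (INF a\<in>AA. bell (kill (af (Suc n)) (V (Suc n))) x a)"
  using Suc af[of n] af[of "Suc n"] V_ge1[of _ n]
  by (intro INF_superset_mono[OF order_refl]) (auto intro!: bell_mono kill_mono simp del: V.simps)
 moreover have "(of_nat (n + 2) :: ennreal) <= of_nat (Suc n + 2)" by (rule of_nat_mono) simp
 ultimately show ?case unfolding V.simps(2) by (rule min.mono[rotated])
qed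

text \<open>This is used for the same \<open>n\<close> on both sides: \<open>V n\<close> lies below its own killed image
under every action, since \<open>V\<close> increases with \<open>n\<close>.\<close>
lemma V_subsolution: "x \<in> S ==> a \<in> AA ==> V n x <= bell (kill (af n) (V n)) x a"
 using V_mono[of x n] INF_lower[of a AA "%a. bell (kill (af n) (V n)) x a"] by (auto intro: order_trans)

lemma V_le_Vinf: "V n x <= Vinf x" unfolding Vinf_def by (rule SUP_upper) simp

lemma Vinf_ge1: "x \<in> S ==> 1 <= Vinf x"
 using V_ge1 V_le_Vinf order_trans by blast

lemma Vinf_elsc: "elsc S Vinf"
 unfolding Vinf_def[abs_def] by (intro elsc_SUP V_elsc)

lemma Vinf_measurable[measurable]: "Vinf \<in> borel_measurable SM"
 by (rule elsc_SM[OF Vinf_elsc])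

lemma SUP_kill: assumes y: "y \<in> S" shows "(SUP n. kill (af n) (V n) y) = Vinf y"
proof (rule antisym)
 show "(SUP n. kill (af n) (V n) y) <= Vinf y"
  using V_ge1[OF y] af by (intro SUP_least) (meson V_le_Vinf kill_le less_imp_le order_trans)
 have Vm: "V m y <= V n y" if "m <= n" for m n
  using that by (induction rule: dec_induct) (auto intro: order_trans V_mono[OF y] simp del: V.simps)
 have afm: "af m <= af n" if "m <= n" for m n
  using that by (induction rule: dec_induct) (auto intro: order_trans af)
 show "Vinf y <= (SUP n. kill (af n) (V n) y)"
  unfolding Vinf_def
 proof (rule SUP_least)
  fix m
  have "V m y = (SUP n. ennreal (af n)) * V m y" by (simp add: SUP_af)
  also have "... = (SUP n. ennreal (af n) * V m y)" by (rule SUP_mult_right_ennreal)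
  also have "... <= (SUP n. kill (af n) (V n) y)"
  proof (rule SUP_least)
   fix n
   have "ennreal (af n) * V m y <= ennreal (af (max m n)) * V (max m n) y"
    by (intro mult_mono ennreal_leI afm Vm) auto
   also have "... <= kill (af (max m n)) (V (max m n)) y" by (simp add: kill_def)
   also have "... <= (SUP n. kill (af n) (V n) y)" by (rule SUP_upper) simp
   finally show "ennreal (af n) * V m y <= (SUP n. kill (af n) (V n) y)" .
  qed
  finally show "V m y <= (SUP n. kill (af n) (V n) y)" .
 qed
qed

text \<open>Along the increasing sequence \<open>kill (af n) (V n)\<close> the limit passes through the integral by
monotone convergence and through the infimum by \<open>elsc_SUP_INF\<close>; this is where compactness and
semicontinuity are essential.\<close>
lemma Vinf_bellman:
 assumes x: "x \<in> S"
 shows "Vinf x = (INF a\<in>AA. bell Vinf x a)"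
proof -
 define B where "B n = (INF a\<in>AA. bell (kill (af n) (V n)) x a)" for n
 have km: "kill (af n) (V n) y <= kill (af (Suc n)) (V (Suc n)) y" if "y \<in> S" for n y
  by (rule kill_mono) (rule af less_imp_le[OF af(2)] V_ge1[OF that] V_mono[OF that])+
 have Bm: "B n <= B m" if "n <= m" for n m
  using that
 proof (induction rule: dec_induct)
  case (step k)
  have "B k <= B (Suc k)" unfolding B_def by (intro INF_superset_mono[OF order_refl]) (auto intro!: bell_mono km x simp del: V.simps)
  then show ?case using step by auto
 qed simp
 have "Vinf x = (SUP n. V (Suc n) x)"
  unfolding Vinf_def
 proof (rule antisym)
  show "(SUP n. V n x) <= (SUP n. V (Suc n) x)" using V_mono[OF x] by (intro SUP_mono) (blast intro: UNIV_I)
  show "(SUP n. V (Suc n) x) <= (SUP n. V n x)" by (intro SUP_mono) (blast intro: UNIV_I order_refl)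
 qed
 also have "... = (SUP n. B n)"
 proof (rule antisym)
  show "(SUP n. V (Suc n) x) <= (SUP n. B n)"
   unfolding V.simps B_def[symmetric] by (intro SUP_mono) (blast intro: UNIV_I min.cobounded2)
  show "(SUP n. B n) <= (SUP n. V (Suc n) x)"
  proof (rule SUP_least, rule dense_le)
   fix m c assume c: "c < B m"
   then have "c < top" using order_less_le_trans top_greatest by blast
   then obtain k :: nat where k: "c < of_nat k" using ennreal_Ex_less_of_nat by auto
   have "c <= of_nat (max k m + 2)"
    using k by (intro order_trans[OF less_imp_le[OF k] of_nat_mono]) simp
   moreover have "c <= B (max k m)" using c Bm[of m "max k m"] by simp
   ultimately have "c <= V (Suc (max k m)) x"
    unfolding V.simps B_def[symmetric] by (rule min.boundedI)
   then show "c <= (SUP n. V (Suc n) x)" by (rule SUP_upper2[OF UNIV_I])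
  qed
 qed
 also have "... = (INF a\<in>AA. SUP n. bell (kill (af n) (V n)) x a)"
 proof -
  have "elsc AA (%a. bell (kill (af n) (V n)) x a)" for n
   using elsc_slice[OF elsc_bell[OF elsc_kill[OF V_elsc]] x] by simp
  then show ?thesis
   unfolding B_def by (rule elsc_SUP_INF[OF compact_AA]) (intro bell_mono km x)
 qed
 also have "... = (INF a\<in>AA. bell Vinf x a)"
 proof (rule INF_cong)
  fix a assume a: "a \<in> AA"
  have "(SUP n. bell (kill (af n) (V n)) x a) = bell (%y. SUP n. kill (af n) (V n) y) x a"
   by (rule bell_SUP[symmetric]) (use a x km in "auto simp del: V.simps")
  also have "... = bell Vinf x a" by (rule bell_cong) (use a x SUP_kill in auto)
  finally show "(SUP n. bell (kill (af n) (V n)) x a) = bell Vinf x a" .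
 qed simp
 finally show ?thesis .
qed

lemma minimizers:
 obtains \<psi> f where "\<psi> \<in> SM \<rightarrow>\<^sub>M impM M" "f \<in> SM \<rightarrow>\<^sub>M gradM M"
  "!!x. x \<in> S ==> bell Vinf x (\<psi> x) = (INF b\<in>AI. bell Vinf x b)"
  "!!x. x \<in> S ==> bell Vinf x (f x) = (INF a\<in>AG. bell Vinf x a)"
proof -
 obtain \<psi> where "\<psi> \<in> SM \<rightarrow>\<^sub>M impM M" "\<forall>x\<in>S. bell Vinf x (\<psi> x) = (INF b\<in>AI. bell Vinf x b)"
  using measurable_minimizer[OF AI elsc_bell_I[OF Vinf_elsc]] unfolding stateM_def impM_def prod.case by (elim bexE)
 moreover obtain f where "f \<in> SM \<rightarrow>\<^sub>M gradM M" "\<forall>x\<in>S. bell Vinf x (f x) = (INF b\<in>AG. bell Vinf x b)"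
  using measurable_minimizer[OF AG elsc_bell_G[OF Vinf_elsc]] unfolding stateM_def gradM_def prod.case by (elim bexE)
 ultimately show thesis using that by simp
qed

end

section \<open>Exponential costs\<close>

lemma exp_pos_ennreal: "0 <= r ==> exp_pos (ennreal r) = ennreal (exp r)"
 by (simp add: exp_pos_def)

lemma exp_pos_0[simp]: "exp_pos 0 = 1"
 by (simp add: exp_pos_def)

lemma exp_pos_top[simp]: "exp_pos top = top"
 by (simp add: exp_pos_def)

lemma exp_pos_mono: "a <= b ==> exp_pos a <= exp_pos b"
 by (cases a; cases b) (auto simp: exp_pos_def top_unique intro!: ennreal_leI)

lemma exp_pos_ge1: "1 <= exp_pos a"
 using exp_pos_mono[of 0 a] by simp

lemma exp_pos_add: "exp_pos (a + b) = exp_pos a * exp_pos b"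
 by (cases a; cases b)
   (auto simp: exp_pos_ennreal exp_add ennreal_mult ennreal_plus[symmetric] ennreal_top_mult ennreal_mult_top simp del: ennreal_plus)

lemma exp_pos_measurable[measurable]: "exp_pos \<in> borel_measurable borel"
 unfolding exp_pos_def[abs_def] by measurable

lemma exp_pos_SUP:
 assumes inc: "incseq s"
 shows "exp_pos (SUP n. s n) = (SUP n::nat. exp_pos (s n))"
proof (cases "SUP n. s n")
 case (real r)
 have le: "s n <= ennreal r" for n using SUP_upper[of n UNIV s] real by simp
 have fin: "s n = ennreal (enn2real (s n))" for n
  using le[of n] by (simp add: ennreal_enn2real_if top_unique) (metis ennreal_neq_top top.extremum_uniqueI)
 have "s \<longlonglongrightarrow> ennreal r" using LIMSEQ_SUP[OF inc] real by simp
 then have "(%n. ennreal (enn2real (s n))) \<longlonglongrightarrow> ennreal r" using fin by simp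
 then have "(%n. enn2real (s n)) \<longlonglongrightarrow> r" using tendsto_ennreal_iff[of "%n. enn2real (s n)" sequentially r] real by simp
 then have "(%n. ennreal (exp (enn2real (s n)))) \<longlonglongrightarrow> ennreal (exp r)" by (intro tendsto_ennrealI tendsto_exp)
 moreover have "exp_pos (s n) = ennreal (exp (enn2real (s n)))" for n
  using exp_pos_ennreal[of "enn2real (s n)"] fin[of n] by simp
 ultimately have "(%n. exp_pos (s n)) \<longlonglongrightarrow> exp_pos (SUP n. s n)" using real by (simp add: exp_pos_ennreal)
 moreover have "(%n. exp_pos (s n)) \<longlonglongrightarrow> (SUP n. exp_pos (s n))"
  using inc by (intro LIMSEQ_SUP) (auto simp: incseq_def intro: exp_pos_mono)
 ultimately show ?thesis by (rule LIMSEQ_unique)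
next
 case top
 have "c <= exp_pos c" for c
  by (cases c) (auto simp: exp_pos_ennreal intro!: ennreal_leI order_trans[OF _ exp_ge_add_one_self])
 then have "(SUP n. s n) <= (SUP n. exp_pos (s n))" by (intro SUP_mono) auto
 then have "(SUP n. exp_pos (s n)) = top" unfolding top by (rule top_le)
 then show ?thesis by (simp only: top exp_pos_top)
qed

lemma exp_pos_sum: "exp_pos (\<Sum>k<n. c k) = (\<Prod>k<n. exp_pos (c k))" for n :: nat
 by (induction n) (simp_all add: exp_pos_add mult.commute)

lemma exp_pos_suminf: "exp_pos (\<Sum>k. c k) = (SUP n. \<Prod>k<n. exp_pos (c k))"
proof -
 have "exp_pos (\<Sum>k. c k) = (SUP n. exp_pos (\<Sum>k<n. c k))"
  unfolding suminf_eq_SUP by (rule exp_pos_SUP) (auto simp: incseq_def intro: sum_mono2)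
 then show ?thesis by (simp only: exp_pos_sum)
qed

section \<open>Multiplicative costs in a DTMDP\<close>

locale dtmdp =
 fixes N :: "'s measure" and A :: "'b measure" and T :: "'s => 'b => 's measure" and D
  and \<sigma> :: "nat => (nat => 's \<times> 'b) => 's => 'b measure"
 assumes T: "(%z. T (fst z) (snd z)) \<in> N \<Otimes>\<^sub>M A \<rightarrow>\<^sub>M prob_algebra N"
  and \<sigma>: "\<sigma> \<in> strategies N A D"
begin

abbreviation "SA == N \<Otimes>\<^sub>M A"
abbreviation "H n == PiM {0..<n} (%_. SA)"

definition state_law :: "'s => nat => (nat => 's \<times> 'b) => 's measure" where
 "state_law x n h = (case n of 0 => return N x | Suc m => T (fst (h m)) (snd (h m)))"

lemma sigma_measurable: "(%z. \<sigma> n (fst z) (snd z)) \<in> H n \<Otimes>\<^sub>M N \<rightarrow>\<^sub>M prob_algebra A"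
 using \<sigma> by (auto simp: strategies_def split_beta')

lemma sigma_space: "h \<in> space (H n) ==> s \<in> space N ==> \<sigma> n h s \<in> space (prob_algebra A)"
 using measurable_space[OF sigma_measurable, of "(h, s)" n] by (simp add: space_pair_measure)

lemma state_law_measurable:
 assumes x: "x \<in> space N"
 shows "state_law x n \<in> H n \<rightarrow>\<^sub>M prob_algebra N"
proof (cases n)
 case 0
 have "return N x \<in> space (prob_algebra N)"
  using x by (simp add: space_prob_algebra prob_space_return)
 then show ?thesis unfolding 0 state_law_def[abs_def] by simp
next
 case (Suc m)
 have "(%h. h m) \<in> H (Suc m) \<rightarrow>\<^sub>M SA" by (rule measurable_component_singleton) simp
 from measurable_compose[OF this T] show ?thesis unfolding Suc state_law_def[abs_def] by simp
qed

lemma step_eq: "dtmdp_step N A T \<sigma> x n h = state_law x n h \<bind> (%s. \<sigma> n h s \<bind> (%a. return SA (s, a)))"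
 by (simp add: dtmdp_step_def state_law_def)

lemma inner_measurable:
 "(%z. \<sigma> n (fst z) (snd z) \<bind> (%a. return SA (snd z, a))) \<in> H n \<Otimes>\<^sub>M N \<rightarrow>\<^sub>M prob_algebra SA"
proof (rule measurable_bind_prob_space2[OF sigma_measurable])
 have "(%z. return SA (snd (fst z), snd z)) \<in> (H n \<Otimes>\<^sub>M N) \<Otimes>\<^sub>M A \<rightarrow>\<^sub>M prob_algebra SA"
  by (rule measurable_compose[OF _ measurable_return_prob_space]) measurable
 then show "(%(z, a). return SA (snd z, a)) \<in> (H n \<Otimes>\<^sub>M N) \<Otimes>\<^sub>M A \<rightarrow>\<^sub>M prob_algebra SA"
  by (simp add: split_beta')
qed

lemma step_measurable:
 assumes x: "x \<in> space N"
 shows "dtmdp_step N A T \<sigma> x n \<in> H n \<rightarrow>\<^sub>M prob_algebra SA"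
proof -
 have "(%h. state_law x n h \<bind> (%s. \<sigma> n h s \<bind> (%a. return SA (s, a)))) \<in> H n \<rightarrow>\<^sub>M prob_algebra SA"
  by (rule measurable_bind_prob_space2[OF state_law_measurable[OF x]])
    (use inner_measurable[of n] in "simp add: split_beta'")
 then show ?thesis by (simp add: step_eq[abs_def])
qed

lemma Ionescu_Tulcea:
 assumes x: "x \<in> space N"
 shows "Ionescu_Tulcea (dtmdp_step N A T \<sigma> x) (%_. SA)"
proof (rule Ionescu_Tulcea.intro)
 show "dtmdp_step N A T \<sigma> x n \<in> H n \<rightarrow>\<^sub>M subprob_algebra SA" for n
  by (rule measurable_prob_algebraD[OF step_measurable[OF x]])
 show "prob_space (dtmdp_step N A T \<sigma> x n h)" if "h \<in> space (H n)" for n h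
  using measurable_space[OF step_measurable[OF x] that] by (simp add: space_prob_algebra)
qed

lemma nn_integral_step:
 assumes x: "x \<in> space N" and h: "h \<in> space (H n)" and f[measurable]: "f \<in> borel_measurable SA"
 shows "(\<integral>\<^sup>+z. f z \<partial>dtmdp_step N A T \<sigma> x n h) = (\<integral>\<^sup>+s. (\<integral>\<^sup>+a. f (s, a) \<partial>\<sigma> n h s) \<partial>state_law x n h)"
proof -
 have sl: "state_law x n h \<in> space (prob_algebra N)" by (rule measurable_space[OF state_law_measurable[OF x] h])
 then have s: "sets (state_law x n h) = sets N" by (simp add: space_prob_algebra)
 have m: "(%s. \<sigma> n h s \<bind> (%a. return SA (s, a))) \<in> N \<rightarrow>\<^sub>M prob_algebra SA"
  using measurable_compose[OF measurable_Pair1'[OF h] inner_measurable] by simp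
 have "(\<integral>\<^sup>+z. f z \<partial>dtmdp_step N A T \<sigma> x n h) = (\<integral>\<^sup>+s. (\<integral>\<^sup>+z. f z \<partial>(\<sigma> n h s \<bind> (%a. return SA (s, a)))) \<partial>state_law x n h)"
  unfolding step_eq
  by (rule nn_integral_bind[OF f]) (use measurable_prob_algebraD[OF m] in "simp add: measurable_cong_sets[OF s refl]")
 also have "... = (\<integral>\<^sup>+s. (\<integral>\<^sup>+a. f (s, a) \<partial>\<sigma> n h s) \<partial>state_law x n h)"
 proof (rule nn_integral_cong)
  fix s assume "s \<in> space (state_law x n h)"
  then have sN: "s \<in> space N" using s by (auto dest: sets_eq_imp_space_eq)
  have ss: "sets (\<sigma> n h s) = sets A" using sigma_space[OF h sN] by (simp add: space_prob_algebra)
  have "(%a. return SA (s, a)) \<in> \<sigma> n h s \<rightarrow>\<^sub>M subprob_algebra SA"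
   using sN by (simp add: measurable_cong_sets[OF ss refl])
  then have "(\<integral>\<^sup>+z. f z \<partial>(\<sigma> n h s \<bind> (%a. return SA (s, a)))) = (\<integral>\<^sup>+a. (\<integral>\<^sup>+z. f z \<partial>return SA (s, a)) \<partial>\<sigma> n h s)"
   by (rule nn_integral_bind[OF f])
  also have "... = (\<integral>\<^sup>+a. f (s, a) \<partial>\<sigma> n h s)"
   using sN sets_eq_imp_space_eq[OF ss] by (intro nn_integral_cong) (simp add: nn_integral_return space_pair_measure)
  finally show "(\<integral>\<^sup>+z. f z \<partial>(\<sigma> n h s \<bind> (%a. return SA (s, a)))) = ..." .
 qed
 finally show ?thesis .
qed

lemma dtmdp_law_measurable: "dtmdp_law N A T \<sigma> \<in> N \<rightarrow>\<^sub>M prob_algebra (PiM UNIV (%_. SA))"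
 unfolding dtmdp_law_def[abs_def]
proof (rule path_measure_kernel)
 show "Ionescu_Tulcea (dtmdp_step N A T \<sigma> x) (%_. SA)" if "x \<in> space N" for x
  by (rule Ionescu_Tulcea[OF that])
 let ?u = "%_::nat. undefined"
 have u: "?u \<in> space (H 0)" by (simp add: space_PiM)
 have "(%s. \<sigma> 0 ?u s \<bind> (%a. return SA (s, a))) \<in> N \<rightarrow>\<^sub>M prob_algebra SA"
  using measurable_compose[OF measurable_Pair1'[OF u] inner_measurable] by simp
 from measurable_bind_prob_space[OF measurable_return_prob_space this]
 show "(%x. dtmdp_step N A T \<sigma> x 0 ?u) \<in> N \<rightarrow>\<^sub>M prob_algebra SA"
  by (simp add: dtmdp_step_def)
qed (simp add: dtmdp_step_def[abs_def])

end

locale dtmdp_cost = dtmdp N A T D \<sigma>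
 for N :: "'s measure" and A :: "'b measure" and T D \<sigma> +
 fixes x :: 's and mf :: "nat => ('s \<times> 'b) \<times> 's => ennreal"
 assumes x: "x \<in> space N" and mf[measurable]: "!!n. mf n \<in> borel_measurable ((N \<Otimes>\<^sub>M A) \<Otimes>\<^sub>M N)"
begin

sublocale IT: Ionescu_Tulcea "dtmdp_step N A T \<sigma> x" "%_. SA"
 by (rule Ionescu_Tulcea[OF x])

abbreviation "P == dtmdp_law N A T \<sigma> x"

lemma sets_P: "sets P = sets (PiM UNIV (%_. SA))"
 unfolding dtmdp_law_def by (rule IT.sets_path_measure)

lemma space_P:
 assumes "om \<in> space P"
 shows "om n \<in> space SA" "fst (om n) \<in> space N"
proof -
 have "om \<in> space (PiM UNIV (%_. SA))" using assms sets_eq_imp_space_eq[OF sets_P] by simp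
 then show "om n \<in> space SA" unfolding space_PiM by (rule PiE_mem) simp
 then show "fst (om n) \<in> space N" by (simp add: space_pair_measure mem_Times_iff)
qed

lemma prob_space_P: "prob_space P"
 unfolding dtmdp_law_def by (rule IT.prob_space_path_measure)

definition cum :: "nat => (nat => 's \<times> 'b) => ennreal" where
 "cum n om = (\<Prod>k<n. mf k (om k, fst (om (Suc k))))"

definition cumS :: "nat => (nat => 's \<times> 'b) => 's => ennreal" where
 "cumS n h s = (case n of 0 => 1 | Suc m => cum m h * mf m (h m, s))"

lemma cum_measurable:
 assumes "{..n} \<subseteq> J"
 shows "cum n \<in> borel_measurable (PiM J (%_. SA))"
 unfolding cum_def[abs_def]
proof (intro borel_measurable_prod_ennreal)
 fix k assume "k \<in> {..<n}"
 then have k: "k \<in> J" "Suc k \<in> J" using assms by auto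
 have [measurable]: "(%om. om k) \<in> PiM J (%_. SA) \<rightarrow>\<^sub>M SA" "(%om. om (Suc k)) \<in> PiM J (%_. SA) \<rightarrow>\<^sub>M SA"
  using k by (auto intro: measurable_component_singleton)
 show "(%om. mf k (om k, fst (om (Suc k)))) \<in> borel_measurable (PiM J (%_. SA))" by measurable
qed

lemma cum_restrict: "cum n (restrict om {0..<Suc n}) = cum n om"
 unfolding cum_def by (intro prod.cong) auto

lemma cum_upd: "cum n (h(n := z)) = cumS n h (fst z)"
proof (cases n)
 case (Suc m)
 have "cum n (h(n := z)) = (\<Prod>k<m. mf k (h k, fst (h (Suc k)))) * mf m (h m, fst z)"
  unfolding cum_def Suc prod.lessThan_Suc by (intro arg_cong2[where f="(*)"] prod.cong) auto
 then show ?thesis by (simp add: cumS_def Suc cum_def)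
qed (simp add: cumS_def cum_def)

text \<open>The last action integrated out.\<close>
lemma nn_integral_last_action:
 assumes \<phi>[measurable]: "\<phi> \<in> borel_measurable SA"
 shows "(\<integral>\<^sup>+om. cum n om * \<phi> (om n) \<partial>P) =
  (\<integral>\<^sup>+om. (\<integral>\<^sup>+s. cumS n (restrict om {0..<n}) s * (\<integral>\<^sup>+a. \<phi> (s, a) \<partial>\<sigma> n (restrict om {0..<n}) s)
    \<partial>state_law x n (restrict om {0..<n})) \<partial>P)"
proof -
 let ?F = "%h. cum n h * \<phi> (h n)"
 have Fm: "?F \<in> borel_measurable (H (Suc n))"
 proof -
  have [measurable]: "cum n \<in> borel_measurable (H (Suc n))" by (rule cum_measurable) auto
  have [measurable]: "(%h. h n) \<in> H (Suc n) \<rightarrow>\<^sub>M SA" by (rule measurable_component_singleton) simp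
  show ?thesis by measurable
 qed
 have "(\<integral>\<^sup>+om. cum n om * \<phi> (om n) \<partial>P) = (\<integral>\<^sup>+om. ?F (restrict om {0..<Suc n}) \<partial>P)"
  by (simp only: cum_restrict, simp)
 also have "... = (\<integral>\<^sup>+om. (\<integral>\<^sup>+z. ?F ((restrict om {0..<n})(n := z)) \<partial>dtmdp_step N A T \<sigma> x n (restrict om {0..<n})) \<partial>P)"
  using IT.nn_integral_path_Suc[OF Fm] by (simp add: dtmdp_law_def)
 also have "... = (\<integral>\<^sup>+om. (\<integral>\<^sup>+s. cumS n (restrict om {0..<n}) s * (\<integral>\<^sup>+a. \<phi> (s, a) \<partial>\<sigma> n (restrict om {0..<n}) s)
    \<partial>state_law x n (restrict om {0..<n})) \<partial>P)"
 proof (rule nn_integral_cong)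
  fix om assume "om \<in> space P"
  then have h: "restrict om {0..<n} \<in> space (H n)" (is "?h \<in> _")
   using sets_eq_imp_space_eq[OF sets_P] by (auto simp: space_PiM)
  have "(%z. ?F (?h(n := z))) \<in> borel_measurable SA"
  proof (rule measurable_compose[OF _ Fm])
   show "(%z. ?h(n := z)) \<in> SA \<rightarrow>\<^sub>M H (Suc n)"
    using h by (intro measurable_fun_upd[where J="{0..<n}"]) auto
  qed
  then have Fm': "(%z. cumS n ?h (fst z) * \<phi> z) \<in> borel_measurable SA" by (simp only: cum_upd fun_upd_same)
  have "(\<integral>\<^sup>+z. ?F (?h(n := z)) \<partial>dtmdp_step N A T \<sigma> x n ?h) = (\<integral>\<^sup>+z. cumS n ?h (fst z) * \<phi> z \<partial>dtmdp_step N A T \<sigma> x n ?h)"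
   by (simp only: cum_upd fun_upd_same)
  also have "... = (\<integral>\<^sup>+s. (\<integral>\<^sup>+a. cumS n ?h s * \<phi> (s, a) \<partial>\<sigma> n ?h s) \<partial>state_law x n ?h)"
   using nn_integral_step[OF x h Fm'] by simp
  also have "... = (\<integral>\<^sup>+s. cumS n ?h s * (\<integral>\<^sup>+a. \<phi> (s, a) \<partial>\<sigma> n ?h s) \<partial>state_law x n ?h)"
  proof (rule nn_integral_cong)
   fix s assume "s \<in> space (state_law x n ?h)"
   then have sN: "s \<in> space N" using measurable_space[OF state_law_measurable[OF x] h]
    by (auto simp: space_prob_algebra dest: sets_eq_imp_space_eq)
   have ss: "sets (\<sigma> n ?h s) = sets A" using sigma_space[OF h sN] by (simp add: space_prob_algebra)
   show "(\<integral>\<^sup>+a. cumS n ?h s * \<phi> (s, a) \<partial>\<sigma> n ?h s) = cumS n ?h s * (\<integral>\<^sup>+a. \<phi> (s, a) \<partial>\<sigma> n ?h s)"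
    by (rule nn_integral_cmult) (use sN in "simp add: measurable_cong_sets[OF ss refl]")
  qed
  finally show "(\<integral>\<^sup>+z. ?F (?h(n := z)) \<partial>dtmdp_step N A T \<sigma> x n ?h) = ..." .
 qed
 finally show ?thesis .
qed

definition stage :: "nat => ('s => ennreal) => 's \<times> 'b => ennreal" where
 "stage n g z = (\<integral>\<^sup>+s'. mf n (z, s') * g s' \<partial>T (fst z) (snd z))"

lemma stage_measurable[measurable]:
 assumes [measurable]: "g \<in> borel_measurable N"
 shows "stage n g \<in> borel_measurable SA"
 unfolding stage_def[abs_def]
 by (rule nn_integral_measurable_subprob_algebra2[OF _ measurable_prob_algebraD[OF T]]) measurable

lemma nn_integral_next_state:
 assumes g[measurable]: "g \<in> borel_measurable N"
 shows "(\<integral>\<^sup>+om. cum (Suc n) om * g (fst (om (Suc n))) \<partial>P) = (\<integral>\<^sup>+om. cum n om * stage n g (om n) \<partial>P)"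
proof -
 have "(\<integral>\<^sup>+om. cum (Suc n) om * g (fst (om (Suc n))) \<partial>P) =
  (\<integral>\<^sup>+om. (\<integral>\<^sup>+s. cumS (Suc n) (restrict om {0..<Suc n}) s * (\<integral>\<^sup>+a. g s \<partial>\<sigma> (Suc n) (restrict om {0..<Suc n}) s)
    \<partial>state_law x (Suc n) (restrict om {0..<Suc n})) \<partial>P)"
  using nn_integral_last_action[of "%z. g (fst z)" "Suc n"] by simp
 also have "... = (\<integral>\<^sup>+om. cum n om * stage n g (om n) \<partial>P)"
 proof (rule nn_integral_cong)
  fix om assume "om \<in> space P"
  then have h: "restrict om {0..<Suc n} \<in> space (H (Suc n))" (is "?h \<in> _") and wn: "om n \<in> space SA"
   using sets_eq_imp_space_eq[OF sets_P] by (auto simp: space_PiM)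
  have sl: "state_law x (Suc n) ?h = T (fst (om n)) (snd (om n))" by (simp add: state_law_def)
  have sT: "sets (T (fst (om n)) (snd (om n))) = sets N" using measurable_space[OF T wn] by (simp add: space_prob_algebra)
  have "(\<integral>\<^sup>+s. cumS (Suc n) ?h s * (\<integral>\<^sup>+a. g s \<partial>\<sigma> (Suc n) ?h s) \<partial>state_law x (Suc n) ?h)
   = (\<integral>\<^sup>+s. cum n om * (mf n (om n, s) * g s) \<partial>T (fst (om n)) (snd (om n)))"
   unfolding sl
  proof (rule nn_integral_cong)
   fix s assume "s \<in> space (T (fst (om n)) (snd (om n)))"
   then have "s \<in> space N" using sets_eq_imp_space_eq[OF sT] by simp
   then have "prob_space (\<sigma> (Suc n) ?h s)" using sigma_space[OF h] by (simp add: space_prob_algebra)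
   then have "(\<integral>\<^sup>+a. g s \<partial>\<sigma> (Suc n) ?h s) = g s" by (simp add: prob_space.emeasure_space_1)
   moreover have "cumS (Suc n) ?h s = cum n om * mf n (om n, s)"
    using cum_restrict[of n om] by (simp add: cumS_def)
   ultimately show "cumS (Suc n) ?h s * (\<integral>\<^sup>+a. g s \<partial>\<sigma> (Suc n) ?h s) = cum n om * (mf n (om n, s) * g s)"
    by (simp add: mult.assoc)
  qed
  also have "... = cum n om * stage n g (om n)"
   unfolding stage_def
   by (rule nn_integral_cmult) (use wn in "simp add: measurable_cong_sets[OF sT refl]")
  finally show "(\<integral>\<^sup>+s. cumS (Suc n) ?h s * (\<integral>\<^sup>+a. g s \<partial>\<sigma> (Suc n) ?h s) \<partial>state_law x (Suc n) ?h) = ..." .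
 qed
 finally show ?thesis .
qed

lemma nn_integral_current_state:
 assumes g[measurable]: "g \<in> borel_measurable N"
 shows "(\<integral>\<^sup>+om. cum n om * g (fst (om n)) \<partial>P) =
  (\<integral>\<^sup>+om. (\<integral>\<^sup>+s. cumS n (restrict om {0..<n}) s * g s \<partial>state_law x n (restrict om {0..<n})) \<partial>P)"
proof -
 have "(\<integral>\<^sup>+om. cum n om * g (fst (om n)) \<partial>P) =
  (\<integral>\<^sup>+om. (\<integral>\<^sup>+s. cumS n (restrict om {0..<n}) s * (\<integral>\<^sup>+a. g s \<partial>\<sigma> n (restrict om {0..<n}) s)
    \<partial>state_law x n (restrict om {0..<n})) \<partial>P)"
  using nn_integral_last_action[of "%z. g (fst z)" n] by simp
 also have "... = (\<integral>\<^sup>+om. (\<integral>\<^sup>+s. cumS n (restrict om {0..<n}) s * g s \<partial>state_law x n (restrict om {0..<n})) \<partial>P)"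
 proof (intro nn_integral_cong)
  fix om s assume "om \<in> space P" and s: "s \<in> space (state_law x n (restrict om {0..<n}))"
  then have h: "restrict om {0..<n} \<in> space (H n)"
   using sets_eq_imp_space_eq[OF sets_P] by (auto simp: space_PiM)
  have "s \<in> space N" using measurable_space[OF state_law_measurable[OF x] h] s
   by (auto simp: space_prob_algebra dest: sets_eq_imp_space_eq)
  then have "prob_space (\<sigma> n (restrict om {0..<n}) s)" using sigma_space[OF h] by (simp add: space_prob_algebra)
  then show "cumS n (restrict om {0..<n}) s * (\<integral>\<^sup>+a. g s \<partial>\<sigma> n (restrict om {0..<n}) s) = cumS n (restrict om {0..<n}) s * g s"
   by (simp add: prob_space.emeasure_space_1)
 qed
 finally show ?thesis .
qed

lemma nn_integral_initial:
 assumes g[measurable]: "g \<in> borel_measurable N"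
 shows "(\<integral>\<^sup>+om. cum 0 om * g (fst (om 0)) \<partial>P) = g x"
 unfolding nn_integral_current_state[OF g]
 using x prob_space.emeasure_space_1[OF prob_space_P] by (simp add: cumS_def state_law_def nn_integral_return)

lemma in_hist:
 assumes "om \<in> space P" "s \<in> space (state_law x n (restrict om {0..<n}))"
 shows "restrict om {0..<n} \<in> space (H n)" "s \<in> space N"
proof -
 show h: "restrict om {0..<n} \<in> space (H n)"
  using assms sets_eq_imp_space_eq[OF sets_P] by (auto simp: space_PiM)
 show "s \<in> space N" using measurable_space[OF state_law_measurable[OF x] h] assms(2)
   by (auto simp: space_prob_algebra dest: sets_eq_imp_space_eq)
qed

lemma cum_mono:
 assumes mf1: "!!n z. z \<in> space (SA \<Otimes>\<^sub>M N) ==> 1 <= mf n z" and om: "om \<in> space P"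
 shows "cum n om <= cum (Suc n) om"
proof -
 have "(om n, fst (om (Suc n))) \<in> space (SA \<Otimes>\<^sub>M N)"
  using space_P[OF om] by (simp add: space_pair_measure[of SA N])
 from mult_left_mono[OF mf1[OF this, of n], of "cum n om"] show ?thesis by (simp add: cum_def)
qed

text \<open>The expectation of the accumulated factor times \<open>g n\<close> at time \<open>n\<close> increases with
\<open>n\<close>. As \<open>g n\<close> is at most \<open>1 + \<epsilon> n\<close>, only the total factor
remains in the limit.\<close>
theorem lower_bound:
 assumes g[measurable]: "!!n. g n \<in> borel_measurable N"
  and le: "!!n h s. h \<in> space (H n) ==> s \<in> space N ==> g n s <= (\<integral>\<^sup>+a. stage n (g (Suc n)) (s, a) \<partial>\<sigma> n h s)"
  and eps: "!!n s. s \<in> space N ==> g n s <= ennreal (1 + \<epsilon> n)" "\<epsilon> \<longlonglongrightarrow> 0"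
 shows "g 0 x <= (\<integral>\<^sup>+om. (SUP n. cum n om) \<partial>P)"
proof -
 let ?E = "%n. \<integral>\<^sup>+om. cum n om * g n (fst (om n)) \<partial>P"
 have step: "?E n <= ?E (Suc n)" for n
  unfolding nn_integral_next_state[OF g] nn_integral_current_state[OF g]
   nn_integral_last_action[OF stage_measurable[OF g]]
  by (intro nn_integral_mono mult_left_mono le) (auto intro: in_hist)
 have "?E 0 <= ?E n" for n
  by (induction n) (use step order_trans in blast)+
 then have *: "g 0 x <= ennreal (1 + \<epsilon> n) * (\<integral>\<^sup>+om. (SUP n. cum n om) \<partial>P)" for n
 proof -
  have "g 0 x <= ?E n" using \<open>?E 0 <= ?E n\<close> nn_integral_initial[OF g] by simp
  also have "... <= (\<integral>\<^sup>+om. ennreal (1 + \<epsilon> n) * (SUP n. cum n om) \<partial>P)"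
  proof (rule nn_integral_mono)
   fix om assume "om \<in> space P"
   then have "fst (om n) \<in> space N" by (rule space_P(2))
   then show "cum n om * g n (fst (om n)) <= ennreal (1 + \<epsilon> n) * (SUP n. cum n om)"
    using eps by (subst mult.commute) (intro mult_mono SUP_upper, auto)
  qed
  also have "... = ennreal (1 + \<epsilon> n) * (\<integral>\<^sup>+om. (SUP n. cum n om) \<partial>P)"
   by (rule nn_integral_cmult)
     (auto intro!: borel_measurable_SUP cum_measurable simp: measurable_cong_sets[OF sets_P refl])
  finally show ?thesis .
 qed
 show ?thesis
 proof (cases "(\<integral>\<^sup>+om. (SUP n. cum n om) \<partial>P) = top")
  case False
  have "(%n. (\<integral>\<^sup>+om. (SUP n. cum n om) \<partial>P) * ennreal (1 + \<epsilon> n)) \<longlonglongrightarrow> (\<integral>\<^sup>+om. (SUP n. cum n om) \<partial>P) * ennreal (1 + 0)"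
   using False by (intro ennreal_tendsto_cmult tendsto_ennrealI tendsto_intros eps) (simp add: less_top)
  then show ?thesis using * by (intro LIMSEQ_le_const[of _ "_ :: ennreal"]) (auto simp: mult.commute)
 qed simp
qed

text \<open>Dually, the expectation decreases, and \<open>g\<close> may be dropped because it is at least 1.\<close>
theorem upper_bound:
 assumes g[measurable]: "g \<in> borel_measurable N"
  and le: "!!n h s. h \<in> space (H n) ==> s \<in> space N ==> (\<integral>\<^sup>+a. stage n g (s, a) \<partial>\<sigma> n h s) <= g s"
  and g1: "!!s. s \<in> space N ==> 1 <= g s"
  and mf1: "!!n z. z \<in> space (SA \<Otimes>\<^sub>M N) ==> 1 <= mf n z"
 shows "(\<integral>\<^sup>+om. (SUP n. cum n om) \<partial>P) <= g x"
proof -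
 let ?E = "%n. \<integral>\<^sup>+om. cum n om * g (fst (om n)) \<partial>P"
 have step: "?E (Suc n) <= ?E n" for n
  unfolding nn_integral_next_state[OF g] nn_integral_current_state[OF g]
   nn_integral_last_action[OF stage_measurable[OF g]]
  by (intro nn_integral_mono mult_left_mono le) (auto intro: in_hist)
 have E: "?E n <= g x" for n
 proof (induction n)
  case 0 show ?case using nn_integral_initial[OF g] by simp
 next
  case (Suc n) then show ?case using step order_trans by blast
 qed
 have "(\<integral>\<^sup>+om. (SUP n. cum n om) \<partial>P) = (SUP n. \<integral>\<^sup>+om. cum n om \<partial>P)"
  by (rule nn_integral_monotone_convergence_SUP_AE)
    (auto intro!: AE_I2 cum_measurable cum_mono mf1 simp: measurable_cong_sets[OF sets_P refl])
 also have "... <= g x"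
 proof (rule SUP_least)
  fix n
  have "(\<integral>\<^sup>+om. cum n om \<partial>P) <= ?E n"
  proof (rule nn_integral_mono)
   fix om assume "om \<in> space P"
   then have "fst (om n) \<in> space N" by (rule space_P(2))
   then show "cum n om <= cum n om * g (fst (om n))" using mult_left_mono[OF g1, of _ "cum n om"] by simp
  qed
  then show "(\<integral>\<^sup>+om. cum n om \<partial>P) <= g x" using E[of n] by simp
 qed
 finally show ?thesis .
qed

end

section \<open>The tilde model\<close>

text \<open>A subsolution may be mixed with the constant 1, which is a subsolution because costs are nonnegative.\<close>
lemma (in gi_control) bell_kill:
 assumes x: "x \<in> S" and a: "a \<in> AA" and \<alpha>: "0 <= \<alpha>" "\<alpha> <= 1" and \<beta>: "0 <= \<beta>" "\<beta> <= 1"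
  and g[measurable]: "g \<in> borel_measurable SM" and sub: "g x <= bell (kill \<alpha> g) x a"
 shows "kill \<beta> g x <= bell (kill (\<beta> * \<alpha>) g) x a"
proof -
 note s = sets_Qtil[OF x a]
 have lm: "(%y. ennreal (exp (ltil M w x a y))) \<in> borel_measurable (Qtil M w x a)"
  using exp_ltil_slice[OF x a] by (simp add: measurable_cong_sets[OF s refl])
 have gm: "g \<in> borel_measurable (Qtil M w x a)" by (simp add: measurable_cong_sets[OF s refl])
 have eq: "kill (\<beta> * \<alpha>) g y = ennreal \<beta> * kill \<alpha> g y + ennreal (1 - \<beta>) * 1" for y
 proof -
  have "ennreal (1 - \<beta> * \<alpha>) = ennreal (\<beta> * (1 - \<alpha>) + (1 - \<beta>))" by (simp add: algebra_simps)
  also have "... = ennreal \<beta> * ennreal (1 - \<alpha>) + ennreal (1 - \<beta>)"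
   using \<alpha> \<beta> by (subst ennreal_plus) (auto simp: ennreal_mult)
  finally show ?thesis using \<alpha> \<beta> by (simp add: kill_def ennreal_mult distrib_left mult.assoc add.assoc)
 qed
 have "kill \<beta> g x <= ennreal \<beta> * bell (kill \<alpha> g) x a + ennreal (1 - \<beta>) * bell (%_. 1) x a"
  unfolding kill_def[of \<beta>] using sub mult_left_mono[OF bell_ge1[OF x a, of "%_. 1"], of "ennreal (1 - \<beta>)"]
  by (intro add_mono mult_left_mono) auto
 also have "... = bell (kill (\<beta> * \<alpha>) g) x a"
  unfolding bellman_def eq distrib_left
  using lm gm by (subst nn_integral_add) (auto simp: nn_integral_cmult[symmetric] mult_ac)
 finally show ?thesis .
qed

context gi_control
begin

abbreviation "mtil == %z :: ('x \<times> 'a) \<times> 'x. ennreal (exp (ltil M w (fst (fst z)) (snd (fst z)) (snd z)))"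

lemma tilde_dtmdp_cost:
 assumes "\<sigma> \<in> strategies SM (actM M) (%_. space (actM M))" "x \<in> S"
 shows "dtmdp_cost SM (actM M) (Qtil M w) (%_. space (actM M)) \<sigma> x (%_. mtil)"
 using assms Qtil_measurable exp_ltil_measurable
 by unfold_locales auto

lemma tilde_value:
 assumes \<sigma>: "\<sigma> \<in> strategies SM (actM M) (%_. space (actM M))" and x: "x \<in> S"
 shows "(\<integral>\<^sup>+om. exp_pos (\<Sum>n. ennreal (ltil M w (fst (om n)) (snd (om n)) (fst (om (Suc n)))))
    \<partial>dtmdp_law SM (actM M) (Qtil M w) \<sigma> x)
  = (\<integral>\<^sup>+om. (SUP n. dtmdp_cost.cum (%_. mtil) n om) \<partial>dtmdp_law SM (actM M) (Qtil M w) \<sigma> x)"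
proof -
 interpret dtmdp_cost SM "actM M" "Qtil M w" "%_. space (actM M)" \<sigma> x "%_. mtil"
  by (rule tilde_dtmdp_cost[OF assms])
 show ?thesis
 proof (rule nn_integral_cong)
  fix om assume "om \<in> space P"
  then have "fst (om n) \<in> S" "snd (om n) \<in> AA" for n
   using space_P[of om n] by (auto simp: space_pair_measure mem_Times_iff)
  then have "exp_pos (ennreal (ltil M w (fst (om n)) (snd (om n)) (fst (om (Suc n))))) = mtil (om n, fst (om (Suc n)))" for n
   using ltil_nonneg by (simp add: exp_pos_ennreal)
  then show "exp_pos (\<Sum>n. ennreal (ltil M w (fst (om n)) (snd (om n)) (fst (om (Suc n))))) = (SUP n. cum n om)"
   unfolding exp_pos_suminf cum_def by simp
 qed
qed

lemma kill_power_bound: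
 assumes "0 <= \<alpha>" "\<alpha> <= 1" "g y <= of_nat K"
 shows "kill (\<alpha> ^ n) g y <= ennreal (1 + \<alpha> ^ n * real K)"
proof -
 have a: "0 <= \<alpha> ^ n" "\<alpha> ^ n <= 1" using assms by (auto intro: power_le_one)
 have "kill (\<alpha> ^ n) g y <= ennreal (\<alpha> ^ n) * ennreal (real K) + ennreal 1"
  unfolding kill_def using a assms by (intro add_mono mult_left_mono ennreal_leI) (auto simp: ennreal_of_nat_eq_real_of_nat)
 also have "... = ennreal (1 + \<alpha> ^ n * real K)"
  using a by (simp add: ennreal_mult add.commute)
 finally show ?thesis .
qed

lemma Vinf_le_tilde:
 assumes \<sigma>: "\<sigma> \<in> strategies SM (actM M) (%_. space (actM M))" and x: "x \<in> S"
 shows "Vinf x <= (\<integral>\<^sup>+om. exp_pos (\<Sum>n. ennreal (ltil M w (fst (om n)) (snd (om n)) (fst (om (Suc n)))))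
    \<partial>dtmdp_law SM (actM M) (Qtil M w) \<sigma> x)"
 unfolding tilde_value[OF assms] Vinf_def
proof (rule SUP_least)
 fix j
 interpret dtmdp_cost SM "actM M" "Qtil M w" "%_. space (actM M)" \<sigma> x "%_. mtil"
  by (rule tilde_dtmdp_cost[OF assms])
 let ?\<alpha> = "af j"
 have \<alpha>: "0 <= ?\<alpha> ^ n" "?\<alpha> ^ n <= 1" for n using af[of j] by (auto intro: power_le_one)
 have "kill (?\<alpha> ^ 0) (V j) x <= (\<integral>\<^sup>+om. (SUP n. cum n om) \<partial>P)"
 proof (rule lower_bound[where g="%n. kill (?\<alpha> ^ n) (V j)" and \<epsilon>="%n. ?\<alpha> ^ n * real (j + 1)"])
  fix n :: nat and h s assume h: "h \<in> space (H n)" and s: "s \<in> space SM"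
  interpret prob_space "\<sigma> n h s" using sigma_space[OF h s] by (simp add: space_prob_algebra)
  have sp: "space (\<sigma> n h s) = AA" using sigma_space[OF h s] by (auto simp: space_prob_algebra dest: sets_eq_imp_space_eq)
  have "kill (?\<alpha> ^ n) (V j) s = (\<integral>\<^sup>+a. kill (?\<alpha> ^ n) (V j) s \<partial>\<sigma> n h s)" by (simp add: emeasure_space_1)
  also have "... <= (\<integral>\<^sup>+a. stage n (kill (?\<alpha> ^ Suc n) (V j)) (s, a) \<partial>\<sigma> n h s)"
  proof (rule nn_integral_mono)
   fix a assume a: "a \<in> space (\<sigma> n h s)"
   have "kill (?\<alpha> ^ n) (V j) s <= bell (kill (?\<alpha> ^ n * ?\<alpha>) (V j)) s a"
    using a s sp af[of j] \<alpha>[of n] by (intro bell_kill V_subsolution V_measurable) auto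
   then show "kill (?\<alpha> ^ n) (V j) s <= stage n (kill (?\<alpha> ^ Suc n) (V j)) (s, a)"
    by (simp add: stage_def bellman_def mult.commute)
  qed
  finally show "kill (?\<alpha> ^ n) (V j) s <= (\<integral>\<^sup>+a. stage n (kill (?\<alpha> ^ Suc n) (V j)) (s, a) \<partial>\<sigma> n h s)" .
 next
  show "kill (?\<alpha> ^ n) (V j) s <= ennreal (1 + ?\<alpha> ^ n * real (j + 1))" for n s
   by (rule kill_power_bound) (use af[of j] V_le in auto)
  have "(%n. ?\<alpha> ^ n) \<longlonglongrightarrow> 0" using af[of j] by (intro LIMSEQ_power_zero) simp
  then show "(%n. ?\<alpha> ^ n * real (j + 1)) \<longlonglongrightarrow> 0" by (rule tendsto_mult_left_zero)
 qed simp
 then show "V j x <= (\<integral>\<^sup>+om. (SUP n. cum n om) \<partial>P)" by (simp add: kill_def)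
qed

text \<open>A measurable selection of minimizing actions gives a deterministic stationary strategy to which
\<open>upper_bound\<close> applies with \<open>g = Vinf\<close>.\<close>
theorem Wstar_eq_Vinf:
 assumes x: "x \<in> S"
 shows "Wstar M w x = Vinf x"
proof (rule antisym)
 show "Vinf x <= Wstar M w x"
  unfolding Wstar_def by (intro INF_greatest Vinf_le_tilde x)
 obtain \<psi> f where sel: "\<psi> \<in> SM \<rightarrow>\<^sub>M impM M" "f \<in> SM \<rightarrow>\<^sub>M gradM M"
  "!!x. x \<in> S ==> bell Vinf x (\<psi> x) = (INF b\<in>AI. bell Vinf x b)"
  "!!x. x \<in> S ==> bell Vinf x (f x) = (INF a\<in>AG. bell Vinf x a)"
  using minimizers by metis
 define c where "c x = (if (INF b\<in>AI. bell Vinf x b) <= (INF a\<in>AG. bell Vinf x a) then \<psi> x else f x)" for x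
 have bc: "bell Vinf y (c y) = Vinf y" if "y \<in> S" for y
  unfolding Vinf_bellman[OF that] INF_union using sel that by (simp add: c_def inf_min min_def)
 have act: "g \<in> SM \<rightarrow>\<^sub>M actM M" if "g \<in> SM \<rightarrow>\<^sub>M restrict_space borel K" "K \<subseteq> AA" for g K
  unfolding actM_def
  by (rule measurable_restrict_space2) (use that in "auto simp: measurable_restrict_space2_iff")
 have [measurable]: "(%x. INF b\<in>AI. bell Vinf x b) \<in> borel_measurable SM" "(%x. INF b\<in>AG. bell Vinf x b) \<in> borel_measurable SM"
  using elsc_SM[OF elsc_INF_compact[OF AI(1) elsc_bell_I[OF Vinf_elsc]]] elsc_SM[OF elsc_INF_compact[OF AG(1) elsc_bell_G[OF Vinf_elsc]]]
  by simp_all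
 have [measurable]: "\<psi> \<in> SM \<rightarrow>\<^sub>M actM M" "f \<in> SM \<rightarrow>\<^sub>M actM M"
  using act[of \<psi> AI] act[of f AG] sel by (auto simp: impM_def gradM_def)
 have cm[measurable]: "c \<in> SM \<rightarrow>\<^sub>M actM M" unfolding c_def[abs_def] by measurable
 define \<sigma> :: "nat => (nat => 'x \<times> 'a) => 'x => 'a measure" where "\<sigma> = (%n h s. return (actM M) (c s))"
 have \<sigma>: "\<sigma> \<in> strategies SM (actM M) (%_. space (actM M))"
  unfolding strategies_def
 proof (safe)
  fix n
  show "(%(h, s). \<sigma> n h s) \<in> PiM {0..<n} (%i. SM \<Otimes>\<^sub>M actM M) \<Otimes>\<^sub>M SM \<rightarrow>\<^sub>M prob_algebra (actM M)"
   unfolding \<sigma>_def split_beta' by (rule measurable_compose[OF _ measurable_return_prob_space]) measurable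
  fix h s assume "s \<in> space SM"
  from prob_space.emeasure_space_1[OF prob_space_return[OF measurable_space[OF cm this]]]
  show "emeasure (\<sigma> n h s) (space (actM M)) = 1" by (simp only: \<sigma>_def space_return)
 qed
 interpret dtmdp_cost SM "actM M" "Qtil M w" "%_. space (actM M)" \<sigma> x "%_. mtil"
  by (rule tilde_dtmdp_cost[OF \<sigma> x])
 have "(\<integral>\<^sup>+om. (SUP n. cum n om) \<partial>P) <= Vinf x"
 proof (rule upper_bound)
  fix n h s assume "s \<in> space SM"
  then have s: "s \<in> S" "c s \<in> space (actM M)" using measurable_space[OF cm] by auto
  have "(\<integral>\<^sup>+a. stage n Vinf (s, a) \<partial>\<sigma> n h s) = stage n Vinf (s, c s)"
   unfolding \<sigma>_def
   by (rule nn_integral_return) (use s in "auto intro!: measurable_compose[OF _ stage_measurable] measurable_Pair")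
  also have "... = Vinf s" using bc[OF s(1)] by (simp add: stage_def bellman_def)
  finally show "(\<integral>\<^sup>+a. stage n Vinf (s, a) \<partial>\<sigma> n h s) <= Vinf s" by simp
 next
  fix z :: "('x \<times> 'a) \<times> 'x" assume "z \<in> space (SA \<Otimes>\<^sub>M SM)"
  then show "1 <= mtil z" using ltil_nonneg by (auto simp: space_pair_measure)
 qed (auto simp: Vinf_ge1)
 then show "Wstar M w x <= Vinf x"
  unfolding Wstar_def using tilde_value[OF \<sigma> assms] by (intro INF_lower2[OF \<sigma>]) simp
qed

end

section \<open>Adjoining a cemetery point\<close>

lemma cemetery_gen: "insert {None} ((`) Some ` sets M) \<subseteq> Pow (insert None (Some ` space M))"
 by (auto dest: sets.sets_into_space)

lemma space_cemetery[simp]: "space (cemetery M) = insert None (Some ` space M)"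
 unfolding cemetery_def by (rule space_measure_of[OF cemetery_gen])

lemma sets_cemetery_gen: "A \<in> insert {None} ((`) Some ` sets M) ==> A \<in> sets (cemetery M)"
 unfolding cemetery_def sets_measure_of[OF cemetery_gen] by (rule sigma_sets.Basic)

lemma None_cemetery[measurable]: "{None} \<in> sets (cemetery M)"
 and Some_cemetery: "A \<in> sets M ==> Some ` A \<in> sets (cemetery M)"
 by (auto intro: sets_cemetery_gen)

lemma measurable_Some[measurable]: "Some \<in> M \<rightarrow>\<^sub>M cemetery M"
 unfolding cemetery_def
proof (rule measurable_measure_of[OF cemetery_gen])
 fix A assume "A \<in> insert {None} ((`) Some ` sets M)"
 then consider "A = {None}" | B where "A = Some ` B" "B \<in> sets M" by auto
 then show "Some -` A \<inter> space M \<in> sets M"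
 proof cases
  case 1 then have "Some -` A \<inter> space M = {}" by auto
  then show ?thesis by simp
 next
  case 2 then have "Some -` A \<inter> space M = B" using sets.sets_into_space by (fastforce simp: image_iff)
  then show ?thesis using 2 by simp
 qed
qed auto

lemma measurable_from_cemetery:
 assumes N: "f None \<in> space N" and S: "(%x. f (Some x)) \<in> M \<rightarrow>\<^sub>M N"
 shows "f \<in> cemetery M \<rightarrow>\<^sub>M N"
proof (rule measurableI)
 show "f x \<in> space N" if "x \<in> space (cemetery M)" for x using that N measurable_space[OF S] by auto
 fix A assume A: "A \<in> sets N"
 have "f -` A \<inter> space (cemetery M) = (if f None \<in> A then {None} else {}) \<union> Some ` ((%x. f (Some x)) -` A \<inter> space M)"
  by auto
 also have "... \<in> sets (cemetery M)" using measurable_sets[OF S A] by (intro sets.Un Some_cemetery) auto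
 finally show "f -` A \<inter> space (cemetery M) \<in> sets (cemetery M)" .
qed

lemma measurable_cemetery_case:
 assumes f[measurable]: "f \<in> N \<rightarrow>\<^sub>M L" and g: "g \<in> N \<Otimes>\<^sub>M M \<rightarrow>\<^sub>M L" and o[measurable]: "k \<in> N \<rightarrow>\<^sub>M cemetery M"
 shows "(%om. case k om of None => f om | Some x => g (om, x)) \<in> N \<rightarrow>\<^sub>M L"
proof (cases "space M = {}")
 case True
 then have "k om = None" if "om \<in> space N" for om using measurable_space[OF o that] by simp
 then show ?thesis by (subst measurable_cong[where g=f]) auto
next
 case False
 then obtain a where a: "a \<in> space M" by auto
 have t[measurable]: "(%u. case u of None => a | Some x => x) \<in> cemetery M \<rightarrow>\<^sub>M M"
  by (rule measurable_from_cemetery) (use a in auto)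
 have *: "(%om. if k om = None then f om else g (om, case k om of None => a | Some x => x)) \<in> N \<rightarrow>\<^sub>M L"
 proof (rule measurable_If)
  show "(%om. g (om, case k om of None => a | Some x => x)) \<in> N \<rightarrow>\<^sub>M L"
   by (rule measurable_compose[OF _ g]) measurable
  have "k -` {None} \<inter> space N \<in> sets N" by (rule measurable_sets[OF o None_cemetery])
  also have "k -` {None} \<inter> space N = {x \<in> space N. k x = None}" by auto
  finally show "{x \<in> space N. k x = None} \<in> sets N" .
 qed (rule f)
 show ?thesis by (rule measurable_cong[THEN iffD1, OF _ *]) (simp split: option.split)
qed

lemma nn_integral_distr_Some:
 assumes "sets P = sets M" "f \<in> borel_measurable (cemetery M)"
 shows "(\<integral>\<^sup>+z. f z \<partial>distr P (cemetery M) Some) = (\<integral>\<^sup>+x. f (Some x) \<partial>P)"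
 using assms by (subst nn_integral_distr) (auto simp: measurable_cong_sets[OF assms(1) refl])

lemma ennreal_SUP_mult:
 fixes f g :: "nat => ennreal"
 assumes "incseq f" "incseq g"
 shows "(SUP n. f n * g n) = (SUP n. f n) * (SUP n. g n)"
proof (rule antisym)
 show "(SUP n. f n * g n) <= (SUP n. f n) * (SUP n. g n)" by (intro SUP_least mult_mono SUP_upper) auto
 have "(SUP n. f n) * (SUP n. g n) = (SUP i. f i * (SUP j. g j))" by (rule SUP_mult_right_ennreal)
 also have "... = (SUP i. SUP j. f i * g j)" by (simp only: SUP_mult_left_ennreal)
 also have "... <= (SUP n. f n * g n)"
 proof (intro SUP_least)
  fix i j
  have "f i * g j <= f (max i j) * g (max i j)" using assms by (intro mult_mono) (auto simp: incseq_def)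
  then show "f i * g j <= (SUP n. f n * g n)" by (rule SUP_upper2[OF UNIV_I])
 qed
 finally show "(SUP n. f n) * (SUP n. g n) <= (SUP n. f n * g n)" .
qed

section \<open>Almost sure path properties\<close>

context dtmdp
begin

lemma
 assumes x: "x \<in> space N"
 shows law_sets: "sets (dtmdp_law N A T \<sigma> x) = sets (PiM UNIV (%_. SA))"
  and law_prob: "prob_space (dtmdp_law N A T \<sigma> x)"
 using measurable_space[OF dtmdp_law_measurable x] by (auto simp: space_prob_algebra)

lemma AE_action:
 assumes x: "x \<in> space N" and B[measurable]: "B \<in> sets SA"
  and null: "!!h s. h \<in> space (H n) ==> s \<in> space N ==> AE a in \<sigma> n h s. (s, a) \<notin> B"
 shows "AE om in dtmdp_law N A T \<sigma> x. om n \<notin> B"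
proof -
 interpret dtmdp_cost N A T D \<sigma> x "%_ _. 1" by unfold_locales (use x in auto)
 have [measurable]: "(%om. om n) \<in> P \<rightarrow>\<^sub>M SA" by (simp add: measurable_cong_sets[OF sets_P refl])
 have "(\<integral>\<^sup>+om. indicator B (om n) \<partial>P) = 0"
  using nn_integral_last_action[of "indicator B" n]
 proof -
  have "(\<integral>\<^sup>+a. indicator B (s, a) \<partial>\<sigma> n (restrict om {0..<n}) s) = 0"
   if "om \<in> space P" "s \<in> space (state_law x n (restrict om {0..<n}))" for om s
  proof -
   have "(\<integral>\<^sup>+a. indicator B (s, a) \<partial>\<sigma> n (restrict om {0..<n}) s) = (\<integral>\<^sup>+a. 0 \<partial>\<sigma> n (restrict om {0..<n}) s)"
    by (rule nn_integral_cong_AE) (use null[OF in_hist[OF that]] in "auto simp: indicator_def")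
   then show ?thesis by simp
  qed
  then have "(\<integral>\<^sup>+om. (\<integral>\<^sup>+s. cumS n (restrict om {0..<n}) s * (\<integral>\<^sup>+a. indicator B (s, a) \<partial>\<sigma> n (restrict om {0..<n}) s)
    \<partial>state_law x n (restrict om {0..<n})) \<partial>P) = (\<integral>\<^sup>+om. (\<integral>\<^sup>+s. 0 \<partial>state_law x n (restrict om {0..<n})) \<partial>P)"
   by (intro nn_integral_cong) simp
  then show ?thesis using nn_integral_last_action[of "indicator B" n] by (simp add: cum_def)
 qed
 then have "AE om in P. (indicator B (om n) :: ennreal) = 0" by (subst (asm) nn_integral_0_iff_AE) measurable
 then show ?thesis by (auto simp: indicator_def)
qed

lemma AE_transition:
 assumes x: "x \<in> space N" and B[measurable]: "B \<in> sets (SA \<Otimes>\<^sub>M N)"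
  and null: "!!z. z \<in> space SA ==> AE s in T (fst z) (snd z). (z, s) \<notin> B"
 shows "AE om in dtmdp_law N A T \<sigma> x. (om n, fst (om (Suc n))) \<notin> B"
proof -
 interpret dtmdp_cost N A T D \<sigma> x "%k. if k = n then indicator B else (%_. 1)" by unfold_locales (use x in auto)
 have [measurable]: "(%om. om k) \<in> P \<rightarrow>\<^sub>M SA" for k by (simp add: measurable_cong_sets[OF sets_P refl])
 have c: "cum (Suc n) om = indicator B (om n, fst (om (Suc n)))" for om by (simp add: cum_def)
 have "(\<integral>\<^sup>+om. indicator B (om n, fst (om (Suc n))) \<partial>P) = (\<integral>\<^sup>+om. cum n om * stage n (%_. 1) (om n) \<partial>P)"
  using nn_integral_next_state[of "%_. 1" n] by (simp add: c)
 also have "... = (\<integral>\<^sup>+om. 0 \<partial>P)"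
 proof (rule nn_integral_cong)
  fix om assume "om \<in> space P"
  then have "stage n (%_. 1) (om n) = (\<integral>\<^sup>+s. 0 \<partial>T (fst (om n)) (snd (om n)))"
   unfolding stage_def by (intro nn_integral_cong_AE) (use null[of "om n"] space_P in "auto simp: indicator_def")
  then show "cum n om * stage n (%_. 1) (om n) = 0" by simp
 qed
 also have "... = 0" by simp
 finally have 0: "(\<integral>\<^sup>+om. indicator B (om n, fst (om (Suc n))) \<partial>P) = 0" .
 have "(%om. (om n, fst (om (Suc n)))) \<in> P \<rightarrow>\<^sub>M SA \<Otimes>\<^sub>M N" by measurable
 from measurable_compose[OF this borel_measurable_indicator[OF B]]
 have m: "(%om. indicator B (om n, fst (om (Suc n))) :: ennreal) \<in> borel_measurable P" .
 have "AE om in P. (indicator B (om n, fst (om (Suc n))) :: ennreal) = 0"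
  by (rule nn_integral_0_iff_AE[OF m, THEN iffD1, OF 0])
 then show ?thesis by (auto simp: indicator_def)
qed

lemma AE_initial:
 assumes x: "x \<in> space N" and s: "{x} \<in> sets N"
 shows "AE om in dtmdp_law N A T \<sigma> x. fst (om 0) = x"
proof -
 interpret dtmdp_cost N A T D \<sigma> x "%_ _. 1" by unfold_locales (use x in auto)
 have [measurable]: "(%om. om k) \<in> P \<rightarrow>\<^sub>M SA" for k by (simp add: measurable_cong_sets[OF sets_P refl])
 have [measurable]: "space N - {x} \<in> sets N" using s by auto
 have 0: "(\<integral>\<^sup>+om. indicator (space N - {x}) (fst (om 0)) \<partial>P) = 0"
  using nn_integral_initial[of "indicator (space N - {x})"] by (simp add: cum_def)
 have m: "(%om. indicator (space N - {x}) (fst (om 0)) :: ennreal) \<in> borel_measurable P" by measurable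
 have "AE om in P. (indicator (space N - {x}) (fst (om 0)) :: ennreal) = 0"
  by (rule nn_integral_0_iff_AE[OF m, THEN iffD1, OF 0])
 then show ?thesis
 proof (rule AE_mp, intro AE_I2 impI)
  fix om assume "om \<in> space P" "(indicator (space N - {x}) (fst (om 0)) :: ennreal) = 0"
  then show "fst (om 0) = x" using space_P(2)[of om 0] by (auto simp: indicator_def split: if_splits)
 qed
qed

end

section \<open>Interventions\<close>

text \<open>After an infinite intervention no state is left from which the process could go on, and the remaining cost is
0; hence the value 1.\<close>
definition ext :: "('x => ennreal) => 'x option => ennreal" where
 "ext g s = (case s of None => 1 | Some x => g x)"

lemma ext_simps[simp]: "ext g None = 1" "ext g (Some x) = g x"
 by (simp_all add: ext_def)

context gi_control
begin

abbreviation "SD == stateD M"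
abbreviation "ID == impD M"
abbreviation "SDI == SD \<Otimes>\<^sub>M ID"
abbreviation "PM == PiM UNIV (%_::nat. SDI)"
abbreviation "strat == strategies SD ID (admD M)"

lemma space_SD: "space SD = insert None (Some ` S)" and space_ID: "space ID = insert None (Some ` AI)"
 by (simp_all add: stateD_def impD_def)

lemma ext_measurable[measurable]: "g \<in> borel_measurable SM ==> ext g \<in> borel_measurable SD"
 unfolding ext_def[abs_def] stateD_def by (rule measurable_from_cemetery) auto

lemma QkerD_measurable: "(%z. QkerD M (fst z) (snd z)) \<in> SDI \<rightarrow>\<^sub>M prob_algebra SD"
proof -
 have N: "(%_. return SD None) \<in> K \<rightarrow>\<^sub>M prob_algebra SD" for K :: "'z measure"
  by (simp add: space_prob_algebra space_SD prob_space_return)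
 have D: "(%z. distr (Qker M (snd (fst z)) (snd z)) SD Some) \<in> (SDI \<Otimes>\<^sub>M SM) \<Otimes>\<^sub>M impM M \<rightarrow>\<^sub>M prob_algebra SD"
 proof (rule measurable_compose[of "%z. (snd (fst z), snd z)" _ "SM \<Otimes>\<^sub>M impM M" "%z. distr (Qker M (fst z) (snd z)) SD Some", simplified])
  have "(%z. Qker M (fst z) (snd z)) \<in> SM \<Otimes>\<^sub>M impM M \<rightarrow>\<^sub>M prob_algebra SM" using Q_meas by (simp add: split_beta')
  moreover have "(%P. distr P SD Some) \<in> prob_algebra SM \<rightarrow>\<^sub>M prob_algebra SD"
   unfolding stateD_def by (rule measurable_distr_prob_space) measurable
  ultimately show "(%z. distr (Qker M (fst z) (snd z)) SD Some) \<in> SM \<Otimes>\<^sub>M impM M \<rightarrow>\<^sub>M prob_algebra SD"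
   by (rule measurable_compose)
 qed measurable
 have 1: "(%p. case snd (fst p) of None => return SD None | Some b => (%z. distr (Qker M (snd (fst z)) (snd z)) SD Some) (p, b))
   \<in> SDI \<Otimes>\<^sub>M SM \<rightarrow>\<^sub>M prob_algebra SD"
  by (rule measurable_cemetery_case[OF N D]) (simp add: impD_def)
 have "(%z. case fst z of None => return SD None | Some x' =>
   (%p. case snd (fst p) of None => return SD None | Some b => (%z. distr (Qker M (snd (fst z)) (snd z)) SD Some) (p, b)) (z, x'))
   \<in> SDI \<rightarrow>\<^sub>M prob_algebra SD"
  by (rule measurable_cemetery_case[OF N 1]) (simp add: stateD_def)
 then show ?thesis
  by (rule measurable_cong[THEN iffD1, rotated]) (simp add: QkerD_def split: option.split prod.split)
qed

lemma nn_integral_QkerD: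
 assumes f: "f \<in> borel_measurable SD"
 shows "(\<integral>\<^sup>+s. f s \<partial>QkerD M None b) = f None" "(\<integral>\<^sup>+s. f s \<partial>QkerD M s' None) = f None"
  "x \<in> S ==> c \<in> AI ==> (\<integral>\<^sup>+s. f s \<partial>QkerD M (Some x) (Some c)) = (\<integral>\<^sup>+y. f (Some y) \<partial>Qker M x c)"
proof -
 have r: "(\<integral>\<^sup>+s. f s \<partial>return SD None) = f None" by (rule nn_integral_return) (use f in "auto simp: space_SD")
 show "(\<integral>\<^sup>+s. f s \<partial>QkerD M None b) = f None" "(\<integral>\<^sup>+s. f s \<partial>QkerD M s' None) = f None"
  using r by (auto simp: QkerD_def split: option.split)
 show "(\<integral>\<^sup>+s. f s \<partial>QkerD M (Some x) (Some c)) = (\<integral>\<^sup>+y. f (Some y) \<partial>Qker M x c)" if "x \<in> S" "c \<in> AI"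
  using nn_integral_distr_Some[of "Qker M x c" SM f] Q_kernel[OF that] f
  by (simp add: QkerD_def stateD_def space_prob_algebra)
qed

lemma costI_D_measurable:
 "(%z. costI_D M (fst (fst z)) (snd (fst z)) (snd z)) \<in> borel_measurable (SDI \<Otimes>\<^sub>M SD)"
proof -
 let ?R = "SDI \<Otimes>\<^sub>M SD"
 have "(%p. costI M (snd (fst (fst p))) (snd (fst p)) (snd p)) \<in> borel_measurable (((?R \<Otimes>\<^sub>M SM) \<Otimes>\<^sub>M impM M) \<Otimes>\<^sub>M SM)"
  using measurable_compose[of "%p. (snd (fst (fst p)), (snd (fst p), snd p))" "((?R \<Otimes>\<^sub>M SM) \<Otimes>\<^sub>M impM M) \<Otimes>\<^sub>M SM", OF _ cI_meas]
  by (simp add: split_beta')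
 then have 0: "(%p. ennreal (costI M (snd (fst (fst p))) (snd (fst p)) (snd p))) \<in> borel_measurable (((?R \<Otimes>\<^sub>M SM) \<Otimes>\<^sub>M impM M) \<Otimes>\<^sub>M SM)"
  by measurable
 have 1: "(%p. case snd (fst (fst p)) of None => 0 | Some y => (%p. ennreal (costI M (snd (fst (fst p))) (snd (fst p)) (snd p))) (p, y))
  \<in> borel_measurable ((?R \<Otimes>\<^sub>M SM) \<Otimes>\<^sub>M impM M)"
  by (rule measurable_cemetery_case[OF _ 0]) (simp_all add: stateD_def[of M, symmetric])
 have 2: "(%p. case snd (fst (fst p)) of None => 0 | Some b =>
   (%p. case snd (fst (fst p)) of None => 0 | Some y => (%p. ennreal (costI M (snd (fst (fst p))) (snd (fst p)) (snd p))) (p, y)) (p, b))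
  \<in> borel_measurable (?R \<Otimes>\<^sub>M SM)"
  by (rule measurable_cemetery_case[OF _ 1]) (simp_all add: impD_def[of M, symmetric])
 have 3: "(%p. case fst (fst p) of None => 0 | Some x => (%p. case snd (fst (fst p)) of None => 0 | Some b =>
   (%p. case snd (fst (fst p)) of None => 0 | Some y => (%p. ennreal (costI M (snd (fst (fst p))) (snd (fst p)) (snd p))) (p, y)) (p, b)) (p, x))
  \<in> borel_measurable ?R"
  by (rule measurable_cemetery_case[OF _ 2]) (simp_all add: stateD_def[of M, symmetric])
 then show ?thesis
  by (rule measurable_cong[THEN iffD1, rotated]) (auto simp: costI_D_def split: option.split)
qed

subsection \<open>The space of interventions\<close>

lemma step_sets[measurable]:
 "Some ` S \<times> Some ` AI \<in> sets SDI" "Some ` S \<times> {None} \<in> sets SDI" "{(None, None)} \<in> sets SDI"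
proof -
 have "Some ` S \<in> sets SD" "Some ` AI \<in> sets ID" "{None} \<in> sets SD" "{None} \<in> sets ID"
  unfolding stateD_def impD_def using Some_cemetery[OF sets.top[of SM]] Some_cemetery[OF sets.top[of "impM M"]] by auto
 then show "Some ` S \<times> Some ` AI \<in> sets SDI" "Some ` S \<times> {None} \<in> sets SDI"
  by (auto intro: pair_measureI)
 have "{None} \<times> {None} \<in> sets SDI"
  by (rule pair_measureI) fact+
 then show "{(None, None)} \<in> sets SDI" by simp
qed

lemma coord_measurable[measurable]: "(%y. y i) \<in> PM \<rightarrow>\<^sub>M SDI"
 by (rule measurable_component_singleton) simp

lemma step_space:
 "Some ` S \<times> Some ` AI \<subseteq> space SDI" "Some ` S \<times> {None} \<subseteq> space SDI" "(None, None) \<in> space SDI"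
 by (auto simp: space_pair_measure space_SD space_ID)

lemma Yfin_space: "Yfin M k \<subseteq> space PM"
proof
 fix y assume y: "y \<in> Yfin M k"
 have "y i \<in> space SDI" for i
  using y step_space by (cases i k rule: linorder_cases) (auto simp: Yfin_def)
 then show "y \<in> space PM" by (simp add: space_PiM PiE_iff)
qed

lemma Yinf_space: "Yinf M \<subseteq> space PM"
 using step_space by (auto simp: Yinf_def space_PiM)

lemma Yfin_sets[measurable]: "Yfin M k \<in> sets PM"
proof -
 have "Yfin M k = {y \<in> space PM. (\<forall>i\<in>{..<k}. y i \<in> Some ` S \<times> Some ` AI) & y k \<in> Some ` S \<times> {None} &
  (\<forall>i. k < i --> y i \<in> {(None, None)})}"
 proof -
  have "Yfin M k = {y \<in> space PM. y \<in> Yfin M k}" using Yfin_space by blast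
  then show ?thesis unfolding Yfin_def by (simp only: Ball_def lessThan_iff singleton_iff mem_Collect_eq)
 qed
 also have "... \<in> sets PM" by measurable
 finally show ?thesis .
qed

lemma Yinf_sets[measurable]: "Yinf M \<in> sets PM"
proof -
 have "Yinf M = {y \<in> space PM. (\<forall>i. y i \<in> Some ` S \<times> Some ` AI)}"
 proof -
  have "Yinf M = {y \<in> space PM. y \<in> Yinf M}" using Yinf_space by blast
  then show ?thesis unfolding Yinf_def by simp
 qed
 also have "... \<in> sets PM" by measurable
 finally show ?thesis .
qed

lemma Yset_sets[measurable]: "Yset M \<in> sets PM"
 unfolding Yset_def by measurable

lemma Yset_space: "Yset M \<subseteq> space PM"
 using Yfin_space Yinf_space by (auto simp: Yset_def)

lemma space_YM[simp]: "space (YM M) = Yset M"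
 using Yset_space by (auto simp: YM_def space_restrict_space)

lemma sets_YM: "B \<in> sets (YM M) \<longleftrightarrow> B \<in> sets PM & B \<subseteq> Yset M"
 unfolding YM_def sets_restrict_space_iff[OF sets.Int[OF Yset_sets sets.top]]
 by auto

lemma YM_measurable: "f \<in> PM \<rightarrow>\<^sub>M N ==> f \<in> YM M \<rightarrow>\<^sub>M N"
 unfolding YM_def by (rule measurable_restrict_space1)

lemma Yfin_unique: "y \<in> Yfin M k ==> y \<in> Yfin M k' ==> k = k'"
 by (cases k k' rule: linorder_cases) (fastforce simp: Yfin_def)+

lemma Yfin_the[simp]: "y \<in> Yfin M k ==> (THE k. y \<in> Yfin M k) = k"
 using Yfin_unique by blast

lemma xbar_Yfin: "y \<in> Yfin M k ==> xbar M y = fst (y k)"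
 by (auto simp: xbar_def)

lemma Yinf_Yfin: "y \<in> Yinf M ==> y \<notin> Yfin M k"
proof
 assume "y \<in> Yinf M" "y \<in> Yfin M k"
 then have "y k \<in> Some ` S \<times> Some ` AI" "y k \<in> Some ` S \<times> {None}" unfolding Yinf_def Yfin_def by blast+
 then show False by auto
qed

lemma xbar_Yinf: "y \<in> Yinf M ==> xbar M y = None"
 by (auto simp: xbar_def Yinf_Yfin)

lemma xbar_SomeD:
 assumes "y \<in> Yset M" "xbar M y = Some x"
 obtains k where "y \<in> Yfin M k" "y k = (Some x, None)" "x \<in> S"
 using assms by (auto simp: Yset_def xbar_Yinf xbar_Yfin) (auto simp: Yfin_def xbar_Yfin)

lemma xbar_None_iff: "y \<in> Yset M ==> xbar M y = None \<longleftrightarrow> y \<in> Yinf M"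
 by (auto simp: Yset_def xbar_Yinf xbar_Yfin) (auto simp: Yfin_def)

lemma xbar_measurable[measurable]: "xbar M \<in> YM M \<rightarrow>\<^sub>M SD"
proof (rule measurable_piecewise_restrict[where C="insert (Yinf M) (range (Yfin M))"])
 show "space (YM M) \<subseteq> \<Union> (insert (Yinf M) (range (Yfin M)))" by (auto simp: Yset_def)
 show "\<Omega> \<inter> space (YM M) \<in> sets (YM M)" if "\<Omega> \<in> insert (Yinf M) (range (Yfin M))" for \<Omega>
  using that by (auto simp: sets_YM intro!: sets.Int)
 fix \<Omega> assume "\<Omega> \<in> insert (Yinf M) (range (Yfin M))"
 then consider "\<Omega> = Yinf M" | k where "\<Omega> = Yfin M k" by auto
 then show "xbar M \<in> restrict_space (YM M) \<Omega> \<rightarrow>\<^sub>M SD"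
 proof cases
  case 1
  have "(%_. None) \<in> restrict_space (YM M) \<Omega> \<rightarrow>\<^sub>M SD" by (simp add: space_SD)
  then show ?thesis by (rule measurable_cong[THEN iffD1, rotated]) (auto simp: 1 space_restrict_space xbar_Yinf)
 next
  case 2
  have "(%y. fst (y k)) \<in> restrict_space (YM M) \<Omega> \<rightarrow>\<^sub>M SD"
   by (intro measurable_restrict_space1 YM_measurable) measurable
  then show ?thesis by (rule measurable_cong[THEN iffD1, rotated]) (auto simp: 2 space_restrict_space xbar_Yfin)
 qed
qed simp

lemma CI_measurable[measurable]: "CI M \<in> borel_measurable (YM M)"
proof (rule YM_measurable)
 have [measurable]: "(%y. costI_D M (fst (y k)) (snd (y k)) (fst (y (Suc k)))) \<in> borel_measurable PM" for k
  using measurable_compose[of "%y. (y k, fst (y (Suc k)))" PM, OF _ costI_D_measurable] by simp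
 show "CI M \<in> borel_measurable PM" unfolding CI_def[abs_def] by measurable
qed

subsection \<open>Laws of interventions\<close>

lemma strat_dtmdp: "\<sigma> \<in> strat ==> dtmdp SD ID (QkerD M) (admD M) \<sigma>"
 by (rule dtmdp.intro[OF QkerD_measurable])

lemma Some_space: "x \<in> S ==> Some x \<in> space SD"
 by (simp add: space_SD)

text \<open>The intervention model follows an intervention almost surely: the cemetery is absorbing, it is entered exactly
after the stopping decision, and only that decision is admissible there.\<close>
lemma AE_Yset:
 assumes \<sigma>: "\<sigma> \<in> strat" and x: "x \<in> S"
 shows "AE y in dtmdp_law SD ID (QkerD M) \<sigma> (Some x). y \<in> Yset M & fst (y 0) = Some x"
proof -
 interpret dtmdp SD ID "QkerD M" "admD M" \<sigma> by (rule strat_dtmdp[OF \<sigma>])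
 let ?P = "dtmdp_law SD ID (QkerD M) \<sigma> (Some x)"
 note xs = Some_space[OF x]
 have SI: "Some ` S \<in> sets SD" "Some ` AI \<in> sets ID" "{None} \<in> sets SD" "{None} \<in> sets ID" "{Some x} \<in> sets SD"
  unfolding stateD_def impD_def
  using Some_cemetery[OF sets.top[of SM]] Some_cemetery[OF sets.top[of "impM M"]] Some_cemetery[OF sing_SM[OF x]] by auto
 \<comment> \<open>the cemetery allows only the trivial action\<close>
 have 1: "AE y in ?P. y n \<notin> {None} \<times> Some ` AI" for n
 proof (rule AE_action[OF xs])
  show "{None} \<times> Some ` AI \<in> sets SA" using SI by (auto intro: pair_measureI)
  fix h s assume h: "h \<in> space (H n)" and s: "s \<in> space SD"
  show "AE a in \<sigma> n h s. (s, a) \<notin> {None} \<times> Some ` AI"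
  proof (cases s)
   case None
   interpret prob_space "\<sigma> n h s" using sigma_space[OF h s] by (simp add: space_prob_algebra)
   have sg: "sets (\<sigma> n h s) = sets ID" using sigma_space[OF h s] by (simp add: space_prob_algebra)
   have "emeasure (\<sigma> n h s) {None} = 1" using \<sigma> h s None unfolding strategies_def admD_def by force
   then have "AE a in \<sigma> n h s. a \<in> {None}"
    using SI sg by (intro AE_prob_1) (simp add: measure_def)
   then show ?thesis by (rule AE_mp) auto
  qed auto
 qed
 \<comment> \<open>a jump to the cemetery happens exactly after the trivial action\<close>
 define B where "B = ((Some ` S \<times> Some ` AI) \<times> {None}) \<union> (space SD \<times> {None}) \<times> Some ` S \<union> ({None} \<times> space ID) \<times> Some ` S"
 have Bm: "B \<in> sets (SA \<Otimes>\<^sub>M SD)"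
  unfolding B_def using SI by (intro sets.Un pair_measureI) auto
 have 2: "AE y in ?P. (y n, fst (y (Suc n))) \<notin> B" for n
 proof (rule AE_transition[OF xs Bm])
  fix z assume z: "z \<in> space SA"
  obtain s a where za: "z = (s, a)" by (cases z)
  have sT: "sets (QkerD M s a) = sets SD" using measurable_space[OF QkerD_measurable z] by (simp add: za space_prob_algebra)
  have Bz: "Pair z -` B \<in> sets SD" using Bm by (rule sets_Pair1)
  have "emeasure (QkerD M s a) (Pair z -` B) = (\<integral>\<^sup>+s'. indicator (Pair z -` B) s' \<partial>QkerD M s a)"
   using Bz sT by simp
  also have "... = 0"
  proof -
   have m: "indicator (Pair z -` B) \<in> borel_measurable SD" using Bz by simp
   consider "s = None" | "a = None" | x' b where "s = Some x'" "a = Some b" "x' \<in> S" "b \<in> AI"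
    using z by (auto simp: za space_pair_measure space_SD space_ID)
   then show ?thesis
   proof cases
    case 3
    then have "(\<integral>\<^sup>+s'. indicator (Pair z -` B) s' \<partial>QkerD M s a) = (\<integral>\<^sup>+y. indicator (Pair z -` B) (Some y) \<partial>Qker M x' b)"
     using nn_integral_QkerD(3)[OF m] by simp
    also have "... = (\<integral>\<^sup>+y. 0 \<partial>Qker M x' b)"
     using 3 by (intro nn_integral_cong) (auto simp: B_def za indicator_def)
    finally show ?thesis by simp
   qed (use nn_integral_QkerD[OF m] in "auto simp: B_def za indicator_def")
  qed
  finally have "Pair z -` B \<in> null_sets (QkerD M s a)" using Bz sT by (simp add: null_sets_def)
  from AE_not_in[OF this] show "AE s' in QkerD M (fst z) (snd z). (z, s') \<notin> B" unfolding za fst_conv snd_conv vimage_def mem_Collect_eq .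
 qed
 have 3: "AE y in ?P. fst (y 0) = Some x" by (rule AE_initial[OF xs SI(5)])
 have 12: "AE y in ?P. \<forall>n. y n \<notin> {None} \<times> Some ` AI & (y n, fst (y (Suc n))) \<notin> B"
  using 1 2 by (simp add: AE_all_countable)
 show ?thesis
  using 12 3
 proof (rule AE_mp[OF AE_conjI], intro AE_I2 impI)
  fix y assume y: "y \<in> space ?P" and *: "(\<forall>n. y n \<notin> {None} \<times> Some ` AI & (y n, fst (y (Suc n))) \<notin> B) & fst (y 0) = Some x"
  have sp: "y n \<in> space SA" for n
   using y sets_eq_imp_space_eq[OF law_sets[OF xs]] by (auto simp: space_PiM PiE_iff)
  have tr: "y n = (None, None)" if "fst (y n) = None" for n
   using *[THEN conjunct1, rule_format, of n] sp[of n] that by (cases "y n") (auto simp: space_pair_measure space_ID)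
  have nx: "fst (y (Suc n)) = None" if "snd (y n) = None | fst (y n) = None" for n
  proof (rule ccontr)
   assume "fst (y (Suc n)) ~= None"
   then have "fst (y (Suc n)) \<in> Some ` S" using sp[of "Suc n"] by (cases "y (Suc n)") (auto simp: space_pair_measure space_SD)
   then have "(y n, fst (y (Suc n))) \<in> B" using that sp[of n] unfolding B_def by (cases "y n") (auto simp: space_pair_measure)
   then show False using * by blast
  qed
  have ny: "fst (y (Suc n)) \<in> Some ` S" if "y n \<in> Some ` S \<times> Some ` AI" for n
  proof (rule ccontr)
   assume "fst (y (Suc n)) \<notin> Some ` S"
   then have "fst (y (Suc n)) = None" using sp[of "Suc n"] by (cases "y (Suc n)") (auto simp: space_pair_measure space_SD)
   then have "(y n, fst (y (Suc n))) \<in> B" using that unfolding B_def by auto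
   then show False using * by blast
  qed
  show "y \<in> Yset M & fst (y 0) = Some x"
  proof (cases "\<exists>n. snd (y n) = None")
   case False
   have "y n \<in> Some ` S \<times> Some ` AI" for n
   proof (induction n)
    case 0
    have "snd (y 0) ~= None" using False by metis
    then show ?case using * sp[of 0] x by (cases "y 0") (auto simp: space_pair_measure space_ID)
   next
    case (Suc n)
    have "snd (y (Suc n)) ~= None" using False by metis
    then show ?case using ny[OF Suc] sp[of "Suc n"] by (cases "y (Suc n)") (auto simp: space_pair_measure space_ID)
   qed
   then show ?thesis using * by (auto simp: Yset_def Yinf_def)
  next
   case True
   define k where "k = (LEAST n. snd (y n) = None)"
   have k: "snd (y k) = None" using True unfolding k_def by (rule LeastI_ex)
   have lt: "snd (y i) ~= None" if "i < k" for i using that unfolding k_def by (rule not_less_Least)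
   have st: "fst (y i) \<in> Some ` S & (i < k --> y i \<in> Some ` S \<times> Some ` AI)" if "i <= k" for i
    using that
   proof (induction i)
    case 0 show ?case using lt[of 0] * sp[of 0] x by (cases "y 0") (auto simp: space_pair_measure space_ID)
   next
    case (Suc i)
    then have "fst (y (Suc i)) \<in> Some ` S" using ny by simp
    then show ?case using lt[of "Suc i"] sp[of "Suc i"] by (cases "y (Suc i)") (auto simp: space_pair_measure space_ID)
   qed
   have af: "y (Suc k + i) = (None, None)" for i
    by (induction i) (use nx k tr in auto)
   have "y \<in> Yfin M k"
    unfolding Yfin_def
   proof (intro CollectI conjI allI impI)
    show "y k \<in> Some ` S \<times> {None}" using st[of k] k by (cases "y k") auto
    show "y i = (None, None)" if "k < i" for i using af[of "i - Suc k"] that by simp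
   qed (use st in auto)
   then show ?thesis using * by (auto simp: Yset_def)
  qed
 qed
qed

lemma beta_prob: "\<sigma> \<in> strat ==> x \<in> S ==> beta M \<sigma> x \<in> space (prob_algebra (YM M))"
proof -
 assume \<sigma>: "\<sigma> \<in> strat" and x: "x \<in> S"
 interpret dtmdp SD ID "QkerD M" "admD M" \<sigma> by (rule strat_dtmdp[OF \<sigma>])
 let ?P = "dtmdp_law SD ID (QkerD M) \<sigma> (Some x)"
 have s: "sets ?P = sets PM" by (rule law_sets[OF Some_space[OF x]])
 interpret prob_space ?P by (rule law_prob[OF Some_space[OF x]])
 have "emeasure ?P (Yset M) = 1"
  using AE_Yset[OF \<sigma> x] s Yset_sets by (intro emeasure_eq_1_AE) auto
 then have "prob_space (beta M \<sigma> x)"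
  unfolding beta_def using s Yset_sets Yset_space sets_eq_imp_space_eq[OF s]
  by (intro prob_spaceI) (simp add: space_restrict_space emeasure_restrict_space Int_absorb2)
 moreover have "sets (beta M \<sigma> x) = sets (YM M)"
  unfolding beta_def YM_def by (rule sets_restrict_space_cong[OF s])
 ultimately show ?thesis by (simp add: space_prob_algebra)
qed

lemma nn_integral_beta:
 assumes \<sigma>: "\<sigma> \<in> strat" and x: "x \<in> S"
 shows "(\<integral>\<^sup>+y. f y \<partial>beta M \<sigma> x) = (\<integral>\<^sup>+y. f y * indicator (Yset M) y \<partial>dtmdp_law SD ID (QkerD M) \<sigma> (Some x))"
proof -
 interpret dtmdp SD ID "QkerD M" "admD M" \<sigma> by (rule strat_dtmdp[OF \<sigma>])
 have s: "sets (dtmdp_law SD ID (QkerD M) \<sigma> (Some x)) = sets PM" by (rule law_sets[OF Some_space[OF x]])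
 show ?thesis unfolding beta_def
  by (rule nn_integral_restrict_space) (use s Yset_sets in auto)
qed

lemma beta_measurable: "\<sigma> \<in> strat ==> beta M \<sigma> \<in> SM \<rightarrow>\<^sub>M prob_algebra (YM M)"
proof -
 assume \<sigma>: "\<sigma> \<in> strat"
 interpret dtmdp SD ID "QkerD M" "admD M" \<sigma> by (rule strat_dtmdp[OF \<sigma>])
 have m: "(%x. dtmdp_law SD ID (QkerD M) \<sigma> (Some x)) \<in> SM \<rightarrow>\<^sub>M prob_algebra PM"
  by (rule measurable_compose[OF _ dtmdp_law_measurable]) (simp add: stateD_def)
 show ?thesis
 proof (rule measurable_prob_algebraI)
  show "prob_space (beta M \<sigma> x)" if "x \<in> space SM" for x using beta_prob[OF \<sigma>] that by (simp add: space_prob_algebra)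
  show "beta M \<sigma> \<in> SM \<rightarrow>\<^sub>M subprob_algebra (YM M)"
  proof (rule measurable_subprob_algebra)
   show "subprob_space (beta M \<sigma> x)" "sets (beta M \<sigma> x) = sets (YM M)" if "x \<in> space SM" for x
    using beta_prob[OF \<sigma>] that by (auto simp: space_prob_algebra intro: prob_space_imp_subprob_space)
   fix A assume A: "A \<in> sets (YM M)"
   then have "(%x. emeasure (dtmdp_law SD ID (QkerD M) \<sigma> (Some x)) A) \<in> borel_measurable SM"
    using measurable_compose[OF measurable_prob_algebraD[OF m] measurable_emeasure_subprob_algebra] by (simp add: sets_YM)
   moreover have eq: "emeasure (beta M \<sigma> x) A = emeasure (dtmdp_law SD ID (QkerD M) \<sigma> (Some x)) A" if "x \<in> space SM" for x
    unfolding beta_def using A law_sets[OF Some_space, of x] that Yset_sets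
    by (intro emeasure_restrict_space) (auto simp: sets_YM)
   ultimately show "(%x. emeasure (beta M \<sigma> x) A) \<in> borel_measurable SM" by (subst measurable_cong[OF eq])
  qed
 qed
qed

subsection \<open>Bounds for a single intervention\<close>

text \<open>The payoff \<open>g k\<close> is collected in the state in which the intervention stops after \<open>k\<close>
impulses.\<close>
definition stopv :: "(nat => 'x => ennreal) => (nat => 'x option \<times> 'a option) => ennreal" where
 "stopv g y = (if \<exists>k. y \<in> Yfin M k then ext (g (THE k. y \<in> Yfin M k)) (xbar M y) else 1)"

lemma stopv_Yfin: "y \<in> Yfin M k ==> stopv g y = ext (g k) (fst (y k))"
 by (auto simp: stopv_def xbar_Yfin)

lemma stopv_Yinf: "y \<in> Yinf M ==> stopv g y = 1"
 by (auto simp: stopv_def Yinf_Yfin)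

text \<open>With these factors the product over an intervention is its exponential cost times the stopping payoff. Thus
the generic bounds for a DTMDP apply.\<close>
definition mfac :: "(nat => 'x => ennreal) => nat => ('x option \<times> 'a option) \<times> 'x option => ennreal" where
 "mfac g n z = (if snd (fst z) = None then ext (g n) (fst (fst z)) else exp_pos (costI_D M (fst (fst z)) (snd (fst z)) (snd z)))"

lemma mfac_measurable:
 assumes g[measurable]: "g n \<in> borel_measurable SM"
 shows "mfac g n \<in> borel_measurable (SDI \<Otimes>\<^sub>M SD)"
 unfolding mfac_def[abs_def]
proof (rule measurable_If)
 note [measurable] = costI_D_measurable
 show "(%z. ext (g n) (fst (fst z))) \<in> borel_measurable (SDI \<Otimes>\<^sub>M SD)" by measurable
 show "(%z. exp_pos (costI_D M (fst (fst z)) (snd (fst z)) (snd z))) \<in> borel_measurable (SDI \<Otimes>\<^sub>M SD)" by measurable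
 have N: "{None} \<in> sets ID" unfolding impD_def by simp
 have "(%z. snd (fst z)) -` {None} \<inter> space (SDI \<Otimes>\<^sub>M SD) \<in> sets (SDI \<Otimes>\<^sub>M SD)"
  by (rule measurable_sets[OF _ N]) measurable
 also have "(%z. snd (fst z)) -` {None} \<inter> space (SDI \<Otimes>\<^sub>M SD) = {z \<in> space (SDI \<Otimes>\<^sub>M SD). snd (fst z) = None}" by auto
 finally show "{z \<in> space (SDI \<Otimes>\<^sub>M SD). snd (fst z) = None} \<in> sets (SDI \<Otimes>\<^sub>M SD)" .
qed

lemma mfac_SUP:
 assumes y: "y \<in> Yset M" and g: "!!n x. x \<in> S ==> 1 <= g n x"
 shows "(SUP n. \<Prod>k<n. mfac g k (y k, fst (y (Suc k)))) = exp_pos (CI M y) * stopv g y"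
proof -
 define t where "t k = (if snd (y k) = None then ext (g k) (fst (y k)) else 1)" for k
 define c where "c k = costI_D M (fst (y k)) (snd (y k)) (fst (y (Suc k)))" for k
 have sp: "y k \<in> space SDI" for k using y Yset_space by (auto simp: space_PiM PiE_iff)
 have t1: "1 <= t k" for k using sp[of k] g by (auto simp: t_def ext_def space_pair_measure space_SD split: option.split)
 have c0: "c k = 0" if "snd (y k) = None" for k using that by (simp add: c_def costI_D_def split: option.split)
 have "mfac g k (y k, fst (y (Suc k))) = exp_pos (c k) * t k" for k
  using c0[of k] by (simp add: mfac_def t_def c_def)
 then have "(SUP n. \<Prod>k<n. mfac g k (y k, fst (y (Suc k)))) = (SUP n. (\<Prod>k<n. exp_pos (c k)) * (\<Prod>k<n. t k))"
  by (simp add: prod.distrib)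
 also have "... = (SUP n. \<Prod>k<n. exp_pos (c k)) * (SUP n. \<Prod>k<n. t k)"
 proof (rule ennreal_SUP_mult)
  have "p <= p * q" if "1 <= q" for p q :: ennreal using mult_left_mono[OF that, of p] by simp
  then show "incseq (%n. \<Prod>k<n. exp_pos (c k))" "incseq (%n. \<Prod>k<n. t k)"
   using t1 exp_pos_ge1 by (auto intro!: incseq_SucI)
 qed
 also have "(SUP n. \<Prod>k<n. exp_pos (c k)) = exp_pos (CI M y)" by (simp add: exp_pos_suminf CI_def c_def)
 also have "(SUP n. \<Prod>k<n. t k) = stopv g y"
  using y unfolding Yset_def
 proof (elim UnE UN_E)
  assume "y \<in> Yinf M"
  then have "t k = 1" for k by (auto simp: t_def Yinf_def) (metis (no_types, lifting) imageE mem_Sigma_iff option.distinct(1) prod.collapse)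
  then show ?thesis using \<open>y \<in> Yinf M\<close> by (simp add: stopv_Yinf)
 next
  fix k assume yk: "y \<in> Yfin M k"
  have tk: "t i = (if i = k then ext (g k) (fst (y k)) else 1)" for i
  proof (cases i k rule: linorder_cases)
   case less
   then have "y i \<in> Some ` S \<times> Some ` AI" using yk by (auto simp: Yfin_def)
   then show ?thesis using less by (auto simp: t_def)
  next
   case equal then show ?thesis using yk by (auto simp: t_def Yfin_def)
  next
   case greater
   then have "y i = (None, None)" using yk by (auto simp: Yfin_def)
   then show ?thesis using greater by (auto simp: t_def)
  qed
  have p: "(\<Prod>i<n. t i) = (if k < n then ext (g k) (fst (y k)) else 1)" for n
   unfolding tk by (simp add: prod.If_cases)
  have "1 <= ext (g k) (fst (y k))" using t1[of k] tk[of k] by simp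
  then show ?thesis unfolding p stopv_Yfin[OF yk]
   by (intro antisym SUP_least SUP_upper2[of "Suc k"]) auto
 qed
 finally show ?thesis .
qed

lemma intervention_cost:
 assumes "\<sigma> \<in> strat" "x \<in> S" "!!n. g n \<in> borel_measurable SM"
 shows "dtmdp_cost SD ID (QkerD M) (admD M) \<sigma> (Some x) (mfac g)"
 using strat_dtmdp[OF assms(1)] Some_space[OF assms(2)] mfac_measurable assms(3)
 by (intro dtmdp_cost.intro dtmdp_cost_axioms.intro) auto

lemma intervention_value:
 assumes \<sigma>: "\<sigma> \<in> strat" and x: "x \<in> S" and gm: "!!n. g n \<in> borel_measurable SM"
  and g1: "!!n x. x \<in> S ==> 1 <= g n x"
 shows "(\<integral>\<^sup>+y. exp_pos (CI M y) * stopv g y \<partial>beta M \<sigma> x)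
  = (\<integral>\<^sup>+y. (SUP n. dtmdp_cost.cum (mfac g) n y) \<partial>dtmdp_law SD ID (QkerD M) \<sigma> (Some x))"
proof -
 interpret dtmdp_cost SD ID "QkerD M" "admD M" \<sigma> "Some x" "mfac g" by (rule intervention_cost[OF \<sigma> x gm])
 show ?thesis unfolding nn_integral_beta[OF assms(1,2)]
 proof (rule nn_integral_cong_AE, rule AE_mp[OF AE_Yset[OF assms(1,2)]], intro AE_I2 impI)
  fix y assume "y \<in> Yset M & fst (y 0) = Some x"
  then show "exp_pos (CI M y) * stopv g y * indicator (Yset M) y = (SUP n. cum n y)"
   unfolding cum_def using mfac_SUP[of y g] g1 by simp
 qed
qed

lemma stage_mfac:
 assumes G: "G \<in> borel_measurable SD" and gm: "g n \<in> borel_measurable SM"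
 shows "a \<in> space ID ==> (\<integral>\<^sup>+s'. mfac g n ((None, a), s') * G s' \<partial>QkerD M None a) = G None"
  "s \<in> space SD ==> (\<integral>\<^sup>+s'. mfac g n ((s, None), s') * G s' \<partial>QkerD M s None) = ext (g n) s * G None"
  "x \<in> S ==> b \<in> AI ==> (\<integral>\<^sup>+s'. mfac g n ((Some x, Some b), s') * G s' \<partial>QkerD M (Some x) (Some b))
   = (\<integral>\<^sup>+y. ennreal (exp (costI M x b y)) * G (Some y) \<partial>Qker M x b)"
proof -
 have m: "(%s'. mfac g n (z, s') * G s') \<in> borel_measurable SD" if "z \<in> space SDI" for z
  using measurable_compose[OF measurable_Pair1'[OF that] mfac_measurable[of g n, OF gm]] G by (rule borel_measurable_times_ennreal)
 show "(\<integral>\<^sup>+s'. mfac g n ((None, a), s') * G s' \<partial>QkerD M None a) = G None" if "a \<in> space ID"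
  using nn_integral_QkerD(1)[OF m[of "(None, a)"]] that
  by (auto simp: space_pair_measure space_SD mfac_def costI_D_def)
 show "(\<integral>\<^sup>+s'. mfac g n ((s, None), s') * G s' \<partial>QkerD M s None) = ext (g n) s * G None" if "s \<in> space SD"
  using nn_integral_QkerD(2)[OF m[of "(s, None)"]] that
  by (auto simp: space_pair_measure space_ID mfac_def)
 show "(\<integral>\<^sup>+s'. mfac g n ((Some x, Some b), s') * G s' \<partial>QkerD M (Some x) (Some b))
   = (\<integral>\<^sup>+y. ennreal (exp (costI M x b y)) * G (Some y) \<partial>Qker M x b)" if "x \<in> S" "b \<in> AI"
 proof -
  have sp: "space (Qker M x b) = S" using Q_kernel[OF that] by (auto simp: space_prob_algebra dest: sets_eq_imp_space_eq)
  have "(\<integral>\<^sup>+s'. mfac g n ((Some x, Some b), s') * G s' \<partial>QkerD M (Some x) (Some b))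
   = (\<integral>\<^sup>+y. mfac g n ((Some x, Some b), Some y) * G (Some y) \<partial>Qker M x b)"
   using that by (intro nn_integral_QkerD(3) m) (auto simp: space_pair_measure space_SD space_ID)
  also have "... = (\<integral>\<^sup>+y. ennreal (exp (costI M x b y)) * G (Some y) \<partial>Qker M x b)"
   using that by (intro nn_integral_cong) (simp add: mfac_def costI_D_def exp_pos_ennreal cI_nonneg sp)
  finally show ?thesis .
 qed
qed

lemma intervention_lower:
 assumes \<sigma>: "\<sigma> \<in> strat" and x: "x \<in> S" and gm: "!!n. g n \<in> borel_measurable SM"
  and g1: "!!n x. x \<in> S ==> 1 <= g n x"
  and sub: "!!n x b. x \<in> S ==> b \<in> AI ==> g n x <= (\<integral>\<^sup>+y. ennreal (exp (costI M x b y)) * g (Suc n) y \<partial>Qker M x b)"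
  and eps: "!!n x. x \<in> S ==> g n x <= ennreal (1 + \<epsilon> n)" "\<epsilon> \<longlonglongrightarrow> 0" "!!n. 0 <= \<epsilon> n"
 shows "g 0 x <= (\<integral>\<^sup>+y. exp_pos (CI M y) * stopv g y \<partial>beta M \<sigma> x)"
proof -
 interpret dtmdp_cost SD ID "QkerD M" "admD M" \<sigma> "Some x" "mfac g" by (rule intervention_cost[OF \<sigma> x gm])
 have "ext (g 0) (Some x) <= (\<integral>\<^sup>+om. (SUP n. cum n om) \<partial>P)"
 proof (rule lower_bound[where g="%n. ext (g n)" and \<epsilon>=\<epsilon>])
  fix n :: nat and h s assume h: "h \<in> space (H n)" and s: "s \<in> space SD"
  interpret prob_space "\<sigma> n h s" using sigma_space[OF h s] by (simp add: space_prob_algebra)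
  have sp: "space (\<sigma> n h s) = space ID" using sigma_space[OF h s] by (auto simp: space_prob_algebra dest: sets_eq_imp_space_eq)
  have em: "ext (g (Suc n)) \<in> borel_measurable SD" using gm by measurable
  have "ext (g n) s = (\<integral>\<^sup>+a. ext (g n) s \<partial>\<sigma> n h s)" by (simp add: emeasure_space_1)
  also have "... <= (\<integral>\<^sup>+a. stage n (ext (g (Suc n))) (s, a) \<partial>\<sigma> n h s)"
  proof (rule nn_integral_mono)
   fix a assume "a \<in> space (\<sigma> n h s)"
   then have a: "a \<in> space ID" using sp by simp
   consider "s = None" | "a = None" | x' b where "s = Some x'" "a = Some b" "x' \<in> S" "b \<in> AI"
    using a s by (auto simp: space_SD space_ID)
   then show "ext (g n) s <= stage n (ext (g (Suc n))) (s, a)"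
   proof cases
    case 1 then show ?thesis using stage_mfac(1)[where g=g, OF em gm a] by (simp add: stage_def)
   next
    case 2 then show ?thesis using stage_mfac(2)[where g=g, OF em gm s] by (simp add: stage_def)
   next
    case 3 then show ?thesis using stage_mfac(3)[where g=g, OF em gm] sub by (simp add: stage_def)
   qed
  qed
  finally show "ext (g n) s <= (\<integral>\<^sup>+a. stage n (ext (g (Suc n))) (s, a) \<partial>\<sigma> n h s)" .
 next
  show "ext (g n) s <= ennreal (1 + \<epsilon> n)" if "s \<in> space SD" for n s
   using that eps(1)[of _ n] eps(3)[of n] by (auto simp: space_SD ext_def)
 qed (use gm eps in auto)
 then show ?thesis using intervention_value[OF assms(1,2) gm g1] by simp
qed

lemma intervention_upper:
 assumes \<sigma>: "\<sigma> \<in> strat" and x: "x \<in> S" and gm: "g \<in> borel_measurable SM"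
  and g1: "!!x. x \<in> S ==> 1 <= g x"
  and act: "!!n h s. h \<in> space (PiM {0..<n} (%_. SDI)) ==> s \<in> space SD ==> \<sigma> n h s = return ID (c s)"
  and cm: "c \<in> SD \<rightarrow>\<^sub>M ID" and cN: "c None = None"
  and sup: "!!x b. x \<in> S ==> c (Some x) = Some b ==> (\<integral>\<^sup>+y. ennreal (exp (costI M x b y)) * g y \<partial>Qker M x b) <= g x"
 shows "(\<integral>\<^sup>+y. exp_pos (CI M y) * ext g (xbar M y) \<partial>beta M \<sigma> x) <= g x"
proof -
 interpret dtmdp_cost SD ID "QkerD M" "admD M" \<sigma> "Some x" "mfac (%_. g)" by (rule intervention_cost[OF \<sigma> x gm])
 have em: "ext g \<in> borel_measurable SD" using gm by measurable
 have "(\<integral>\<^sup>+om. (SUP n. cum n om) \<partial>P) <= ext g (Some x)"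
 proof (rule upper_bound)
  fix n :: nat and h s assume h: "h \<in> space (H n)" and s: "s \<in> space SD"
  have cs: "c s \<in> space ID" using measurable_space[OF cm s] .
  have "(\<integral>\<^sup>+a. stage n (ext g) (s, a) \<partial>\<sigma> n h s) = stage n (ext g) (s, c s)"
   unfolding act[OF h s] using s cs em
   by (intro nn_integral_return) (auto intro!: measurable_compose[OF _ stage_measurable] measurable_Pair)
  also have "... <= ext g s"
  proof -
   consider "s = None" | x' where "s = Some x'" "c s = None" | x' b where "s = Some x'" "c s = Some b" "x' \<in> S" "b \<in> AI"
    using cs s by (auto simp: space_SD space_ID)
   then show ?thesis
   proof cases
    case 1 then show ?thesis using stage_mfac(1)[where g="%_. g" and n=n, OF em gm cs] by (simp add: stage_def)
   next
    case 2 then show ?thesis using stage_mfac(2)[where g="%_. g" and n=n, OF em gm s] by (simp add: stage_def)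
   next
    case 3 then show ?thesis using stage_mfac(3)[where g="%_. g" and n=n, OF em gm] sup by (simp add: stage_def)
   qed
  qed
  finally show "(\<integral>\<^sup>+a. stage n (ext g) (s, a) \<partial>\<sigma> n h s) <= ext g s" .
 next
  show "1 <= ext g s" if "s \<in> space SD" for s using that g1 by (auto simp: space_SD)
 next
  show "1 <= mfac (%_. g) n z" if "z \<in> space (SA \<Otimes>\<^sub>M SD)" for n z
   using that g1 exp_pos_ge1 by (auto simp: mfac_def space_pair_measure space_SD)
 qed (use em in auto)
 then have "(\<integral>\<^sup>+y. exp_pos (CI M y) * stopv (%_. g) y \<partial>beta M \<sigma> x) <= g x"
  using intervention_value[OF assms(1,2) gm g1] by simp
 moreover have "stopv (%_. g) y = ext g (xbar M y)" if "y \<in> Yset M" for y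
  using that by (auto simp: stopv_def xbar_def)
 moreover have "space (beta M \<sigma> x) = Yset M"
  using beta_prob[OF assms(1,2)] by (auto simp: space_prob_algebra dest: sets_eq_imp_space_eq)
 ultimately show ?thesis by (subst (asm) nn_integral_cong[where v="%y. exp_pos (CI M y) * ext g (xbar M y)"]) auto
qed

text \<open>Discounted subsolutions of the Bellman equation gain a factor with every impulse.\<close>
lemma intervention_kill:
 assumes \<sigma>: "\<sigma> \<in> strat" and x: "x \<in> S" and \<beta>: "0 <= \<beta>" "\<beta> <= 1"
 shows "kill \<beta> (V j) x <= (\<integral>\<^sup>+y. exp_pos (CI M y) * stopv (%n. kill (\<beta> * af j ^ n) (V j)) y \<partial>beta M \<sigma> x)"
proof -
 let ?\<alpha> = "af j"
 have \<alpha>: "0 <= ?\<alpha> ^ n" "?\<alpha> ^ n <= 1" for n using af[of j] by (auto intro: power_le_one)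
 have \<beta>\<alpha>: "0 <= \<beta> * ?\<alpha> ^ n" "\<beta> * ?\<alpha> ^ n <= 1" for n using \<alpha>[of n] \<beta> by (auto intro: mult_le_one)
 have "kill (\<beta> * ?\<alpha> ^ 0) (V j) x <= (\<integral>\<^sup>+y. exp_pos (CI M y) * stopv (%n. kill (\<beta> * ?\<alpha> ^ n) (V j)) y \<partial>beta M \<sigma> x)"
 proof (rule intervention_lower[where g="%n. kill (\<beta> * ?\<alpha> ^ n) (V j)" and \<epsilon>="%n. ?\<alpha> ^ n * real (j + 1)", OF \<sigma> x])
  show "1 <= kill (\<beta> * ?\<alpha> ^ n) (V j) x" if "x \<in> S" for n x using \<beta>\<alpha> V_ge1[OF that] by (intro kill_ge1)
  show "kill (\<beta> * ?\<alpha> ^ n) (V j) x <= (\<integral>\<^sup>+y. ennreal (exp (costI M x b y)) * kill (\<beta> * ?\<alpha> ^ Suc n) (V j) y \<partial>Qker M x b)"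
   if "x \<in> S" "b \<in> AI" for n x b
  proof -
   have "kill (\<beta> * ?\<alpha> ^ n) (V j) x <= bell (kill (\<beta> * ?\<alpha> ^ n * ?\<alpha>) (V j)) x b"
    using that af[of j] \<beta>\<alpha>[of n] by (intro bell_kill V_subsolution V_measurable) auto
   then show ?thesis using that(2) by (simp add: bell_I mult_ac)
  qed
  show "kill (\<beta> * ?\<alpha> ^ n) (V j) x <= ennreal (1 + ?\<alpha> ^ n * real (j + 1))" if "x \<in> S" for n x
  proof -
   have "kill (\<beta> * ?\<alpha> ^ n) (V j) x <= kill (?\<alpha> ^ n) (V j) x"
    by (rule kill_mono) (use \<beta>\<alpha> \<alpha> \<beta> V_ge1[OF that] in "auto intro: mult_left_le_one_le")
   also have "... <= ennreal (1 + ?\<alpha> ^ n * real (j + 1))"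
    by (rule kill_power_bound) (use af[of j] V_le in auto)
   finally show ?thesis .
  qed
  have "(%n. ?\<alpha> ^ n) \<longlonglongrightarrow> 0" using af[of j] by (intro LIMSEQ_power_zero) simp
  then show "(%n. ?\<alpha> ^ n * real (j + 1)) \<longlonglongrightarrow> 0" by (rule tendsto_mult_left_zero)
  show "0 <= ?\<alpha> ^ n * real (j + 1)" for n using \<alpha>[of n] by simp
 qed simp
 then show ?thesis by simp
qed

text \<open>Further impulses lower the discount and hence the value of \<open>kill\<close>, so the number of impulses can
be forgotten.\<close>
lemma PY_lower:
 assumes \<mu>: "\<mu> \<in> PY M x" and x: "x \<in> S" and \<beta>: "0 <= \<beta>" "\<beta> <= 1"
 shows "kill \<beta> (V j) x <= (\<integral>\<^sup>+y. exp_pos (CI M y) * ext (kill \<beta> (V j)) (xbar M y) \<partial>\<mu>)"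
proof -
 obtain \<sigma> where \<sigma>: "\<sigma> \<in> strat" "\<mu> = beta M \<sigma> x" using \<mu> by (auto simp: PY_def)
 have sp: "space (beta M \<sigma> x) = Yset M"
  using beta_prob[OF \<sigma>(1) x] by (auto simp: space_prob_algebra dest: sets_eq_imp_space_eq)
 have \<alpha>: "0 <= af j ^ n" "af j ^ n <= 1" for n using af[of j] by (auto intro: power_le_one)
 have "kill \<beta> (V j) x <= (\<integral>\<^sup>+y. exp_pos (CI M y) * stopv (%n. kill (\<beta> * af j ^ n) (V j)) y \<partial>beta M \<sigma> x)"
  by (rule intervention_kill[OF \<sigma>(1) x \<beta>])
 also have "... <= (\<integral>\<^sup>+y. exp_pos (CI M y) * ext (kill \<beta> (V j)) (xbar M y) \<partial>beta M \<sigma> x)"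
 proof (intro nn_integral_mono mult_left_mono)
  fix y assume "y \<in> space (beta M \<sigma> x)"
  then have y: "y \<in> Yset M" using sp by simp
  show "stopv (%n. kill (\<beta> * af j ^ n) (V j)) y <= ext (kill \<beta> (V j)) (xbar M y)"
  proof (cases "xbar M y")
   case None
   then have "y \<in> Yinf M" using xbar_None_iff[OF y] by simp
   then show ?thesis by (simp add: stopv_Yinf None)
  next
   case (Some z)
   obtain k where k: "y \<in> Yfin M k" "y k = (Some z, None)" "z \<in> S" by (rule xbar_SomeD[OF y Some])
   have "kill (\<beta> * af j ^ k) (V j) z <= kill \<beta> (V j) z"
    by (rule kill_mono) (use \<alpha>[of k] \<beta> V_ge1[OF k(3)] in "auto intro: mult_right_le_one_le")
   then show ?thesis using k by (simp add: stopv_Yfin xbar_Yfin)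
  qed
 qed simp
 finally show ?thesis by (simp add: \<sigma>)
qed

text \<open>An intervention with at least one impulse earns one factor \<open>af j\<close>. A planned intervention has to
earn it for the discount to tend to 0 with the number of stages.\<close>
lemma PYstar_lower:
 assumes \<mu>: "\<mu> \<in> PYstar M x" and x: "x \<in> S" and \<beta>: "0 <= \<beta>" "\<beta> <= 1"
 shows "kill \<beta> (V j) x <= (\<integral>\<^sup>+y. exp_pos (CI M y) * ext (kill (\<beta> * af j) (V j)) (xbar M y) \<partial>\<mu>)"
proof -
 obtain \<sigma> where \<sigma>: "\<sigma> \<in> strat" "\<mu> = beta M \<sigma> x" and star: "emeasure (beta M \<sigma> x) (Ystar M) = 1"
  using \<mu> x by (auto simp: PYstar_def PY_kernels_def)
 have sb: "sets (beta M \<sigma> x) = sets (YM M)" using beta_prob[OF \<sigma>(1) x] by (simp add: space_prob_algebra)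
 have sp: "space (beta M \<sigma> x) = Yset M" using sets_eq_imp_space_eq[OF sb] by simp
 interpret prob_space "beta M \<sigma> x" using beta_prob[OF \<sigma>(1) x] by (simp add: space_prob_algebra)
 have "Ystar M \<in> sets (beta M \<sigma> x)" by (simp add: sb sets_YM Ystar_def)
 then have AE: "AE y in beta M \<sigma> x. y \<in> Ystar M" using star by (intro AE_prob_1) (simp add: measure_def)
 have \<alpha>: "0 <= af j ^ n" "af j ^ n <= 1" for n using af[of j] by (auto intro: power_le_one)
 have "kill \<beta> (V j) x <= (\<integral>\<^sup>+y. exp_pos (CI M y) * stopv (%n. kill (\<beta> * af j ^ n) (V j)) y \<partial>beta M \<sigma> x)"
  by (rule intervention_kill[OF \<sigma>(1) x \<beta>])
 also have "... <= (\<integral>\<^sup>+y. exp_pos (CI M y) * ext (kill (\<beta> * af j) (V j)) (xbar M y) \<partial>beta M \<sigma> x)"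
 proof (rule nn_integral_mono_AE, rule AE_mp[OF AE], intro AE_I2 impI mult_left_mono)
  fix y assume "y \<in> space (beta M \<sigma> x)" and ys: "y \<in> Ystar M"
  then have y: "y \<in> Yset M" using sp by simp
  show "stopv (%n. kill (\<beta> * af j ^ n) (V j)) y <= ext (kill (\<beta> * af j) (V j)) (xbar M y)"
  proof (cases "xbar M y")
   case None
   then have "y \<in> Yinf M" using xbar_None_iff[OF y] by simp
   then show ?thesis by (simp add: stopv_Yinf None)
  next
   case (Some z)
   obtain k where k: "y \<in> Yfin M k" "y k = (Some z, None)" "z \<in> S" by (rule xbar_SomeD[OF y Some])
   have "k ~= 0" using ys k(1) by (cases k) (auto simp: Ystar_def)
   then obtain i where i: "k = Suc i" by (cases k) auto
   have "kill (\<beta> * af j ^ k) (V j) z <= kill (\<beta> * af j) (V j) z"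
   proof (rule kill_mono)
    show "\<beta> * af j ^ k <= \<beta> * af j" unfolding i power_Suc
     using \<alpha>[of i] \<beta> af[of j] by (intro mult_left_mono mult_right_le_one_le) auto
    show "\<beta> * af j <= 1" using \<beta> af[of j] by (intro mult_le_one) auto
   qed (use \<alpha>[of k] \<beta> V_ge1[OF k(3)] in auto)
   then show ?thesis using k by (simp add: stopv_Yfin xbar_Yfin)
  qed
 qed simp
 finally show ?thesis by (simp add: \<sigma>)
qed

end

section \<open>Exponentials of indefinite integrals\<close>

definition cumint :: "(real => real) => real => real" where
 "cumint g t = (\<integral>r. indicator {0<..<t} r * g r \<partial>lborel)"

lemma exp_diff_bound:
 fixes u v L :: real
 assumes "u <= L" "v <= L"
 shows "\<bar>exp u - exp v\<bar> <= exp L * \<bar>u - v\<bar>"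
proof -
 have *: "exp b - exp a <= exp L * (b - a)" if "a <= b" "b <= L" for a b
 proof -
  have "exp a \<ge> exp b * (1 + (a - b))" using exp_ge_add_one_self[of "a - b"] mult_left_mono[of "1 + (a - b)" "exp (a - b)" "exp b"]
   by (simp add: exp_diff)
  then have "exp b - exp a <= exp b * (b - a)" by (simp add: algebra_simps)
  also have "... <= exp L * (b - a)" using that by (intro mult_right_mono) auto
  finally show ?thesis .
 qed
 show ?thesis using *[of u v] *[of v u] assms by (cases "u <= v") (auto simp: abs_if)
qed

lemma exp_diff_mean:
 fixes u v :: real
 obtains \<xi> where "exp u - exp v = exp \<xi> * (u - v)" "min u v <= \<xi>" "\<xi> <= max u v"
proof (cases u v rule: linorder_cases)
 case less
 obtain z where "u < z" "z < v" "exp v - exp u = (v - u) * exp z" using MVT2[OF less, of exp exp] by auto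
 then show ?thesis using less by (intro that[of z]) (auto simp: algebra_simps)
next
 case greater
 obtain z where "v < z" "z < u" "exp u - exp v = (u - v) * exp z" using MVT2[OF greater, of exp exp] by auto
 then show ?thesis using greater by (intro that[of z]) (auto simp: algebra_simps)
qed (use that[of u] in auto)

text \<open>Subdivision of \<open>[0, T]\<close> into \<open>n\<close> parts bounds the increment by \<open>C T\<^sup>2 /
n\<close>.\<close>
lemma quadratic_increments_constant:
 fixes F :: "real => real"
 assumes F: "!!s t. 0 <= s ==> s <= t ==> t <= T ==> \<bar>F t - F s\<bar> <= C * (t - s)^2" and T: "0 <= T"
 shows "F T = F 0"
proof -
 have b: "\<bar>F T - F 0\<bar> <= C * T^2 / real (Suc n)" for n
 proof -
  let ?t = "%i. real i * T / real (Suc n)"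
  have "F T - F 0 = (\<Sum>i<Suc n. F (?t (Suc i)) - F (?t i))" by (subst sum_lessThan_telescope) simp
  also have "\<bar>...\<bar> <= (\<Sum>i<Suc n. \<bar>F (?t (Suc i)) - F (?t i)\<bar>)" by (rule sum_abs)
  also have "... <= (\<Sum>i<Suc n. C * (T / real (Suc n))^2)"
  proof (rule sum_mono)
   fix i assume "i \<in> {..<Suc n}"
   then have "?t (Suc i) <= T" using T by (simp add: divide_le_eq mult.commute mult_left_mono)
   moreover have "?t i <= ?t (Suc i)" using T by (intro divide_right_mono mult_right_mono) auto
   ultimately have "\<bar>F (?t (Suc i)) - F (?t i)\<bar> <= C * (?t (Suc i) - ?t i)^2" using T by (intro F) auto
   also have "?t (Suc i) - ?t i = T / real (Suc n)" by (simp add: diff_divide_distrib[symmetric] algebra_simps)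
   finally show "\<bar>F (?t (Suc i)) - F (?t i)\<bar> <= C * (T / real (Suc n))^2" .
  qed
  also have "... = C * T^2 / real (Suc n)" by (simp add: power2_eq_square)
  finally show ?thesis .
 qed
 have "(%n. C * T^2 / real (Suc n)) \<longlonglongrightarrow> 0" by (rule LIMSEQ_Suc) (rule lim_const_over_n)
 then have "\<bar>F T - F 0\<bar> <= 0" using b by (intro LIMSEQ_le_const) auto
 then show ?thesis by simp
qed

lemma bounded_integrable:
 fixes h :: "real => real"
 assumes [measurable]: "h \<in> borel_measurable borel" and "!!r. a < r ==> r < b ==> \<bar>h r\<bar> <= C"
 shows "integrable lborel (%r. indicator {a<..<b} r * h r :: real)"
proof (rule Bochner_Integration.integrable_bound)
 show "integrable lborel (%r. indicator {a<..<b} r * C)"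
 proof -
  have "emeasure lborel {a<..<b} < \<infinity>" by (cases "a <= b") (auto simp: emeasure_lborel_Ioo not_le greaterThanLessThan_empty)
  then show ?thesis by (intro integrable_mult_left integrable_real_indicator) auto
 qed
 show "AE r in lborel. norm (indicator {a<..<b} r * h r) <= norm (indicator {a<..<b} r * C)"
  using assms(2) by (intro AE_I2) (auto simp: indicator_def intro: order_trans[OF _ abs_ge_self])
qed measurable

lemma cumint_diff:
 assumes h: "h \<in> borel_measurable borel" "!!r. 0 < r ==> r < t ==> \<bar>h r\<bar> <= C" and st: "0 <= s" "s <= t"
 shows "cumint h t - cumint h s = (\<integral>r. indicator {s<..<t} r * h r \<partial>lborel)"
proof -
 have "cumint h t = (\<integral>r. indicator {0<..<s} r * h r + indicator {s<..<t} r * h r \<partial>lborel)"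
  unfolding cumint_def
 proof (rule integral_cong_AE)
  have "AE r in lborel. r ~= s" by (rule AE_lborel_singleton)
  then show "AE r in lborel. indicator {0<..<t} r * h r = indicator {0<..<s} r * h r + indicator {s<..<t} r * h r"
   by (rule AE_mp) (use st in "auto simp: indicator_def intro!: AE_I2")
 qed (use h in measurable)
 also have "... = cumint h s + (\<integral>r. indicator {s<..<t} r * h r \<partial>lborel)"
  unfolding cumint_def using h st by (intro Bochner_Integration.integral_add bounded_integrable[where C=C]) auto
 finally show ?thesis by simp
qed

lemma segment_bound:
 fixes h :: "real => real"
 assumes h: "h \<in> borel_measurable borel" "!!r. s < r ==> r < t ==> \<bar>h r\<bar> <= C" and st: "s <= t"
 shows "\<bar>\<integral>r. indicator {s<..<t} r * h r \<partial>lborel\<bar> <= C * (t - s)"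
proof -
 have "\<bar>\<integral>r. indicator {s<..<t} r * h r \<partial>lborel\<bar> <= (\<integral>r. \<bar>indicator {s<..<t} r * h r\<bar> \<partial>lborel)" by (rule integral_abs_bound)
 also have "... <= (\<integral>r. indicator {s<..<t} r * C \<partial>lborel)"
  using h st bounded_integrable[OF h(1), of s t C] bounded_integrable[of "%_. C" s t "\<bar>C\<bar>"]
  by (intro integral_mono) (auto simp: indicator_def)
 also have "... = C * (t - s)" using st by simp
 finally show ?thesis .
qed

context
 fixes g :: "real => real" and B :: real
 assumes g[measurable]: "g \<in> borel_measurable borel" and B: "!!t. \<bar>g t\<bar> <= B"
begin

lemma cumint_bound: "0 <= t ==> \<bar>cumint g t\<bar> <= B * t"
 using segment_bound[of g 0 t B] B by (simp add: cumint_def)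

lemma cumint_lipschitz: "0 <= s ==> s <= t ==> \<bar>cumint g t - cumint g s\<bar> <= B * (t - s)"
 using cumint_diff[of g t B s] segment_bound[of g s t B] B by simp

lemma cumint_measurable[measurable]: "cumint g \<in> borel_measurable borel"
proof -
 have 1: "(%t. cumint g t) \<in> borel_measurable (restrict_space borel {0..})"
 proof (rule borel_measurable_continuous_on_restrict)
  have "B \<ge> 0" using B[of 0] by linarith
  then have "B-lipschitz_on {0..} (cumint g)"
  proof (intro lipschitz_onI)
   fix x y :: real assume "x \<in> {0..}" "y \<in> {0..}"
   then show "dist (cumint g x) (cumint g y) <= B * dist x y"
    using cumint_lipschitz[of x y] cumint_lipschitz[of y x] by (cases "x <= y") (auto simp: dist_real_def abs_minus_commute)
  qed
  then show "continuous_on {0..} (cumint g)" by (rule lipschitz_on_continuous_on)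
 qed
 have "(%t. if t \<in> {0..} then cumint g t else 0) \<in> borel_measurable borel"
  using measurable_restrict_space_iff[of "{0..}" borel 0 borel "cumint g"] 1 by simp
 moreover have "(%t. if t \<in> {0..} then cumint g t else 0) = cumint g"
  by (auto simp: fun_eq_iff cumint_def)
 ultimately show ?thesis by simp
qed

text \<open>The integrand is only measurable, so the fundamental theorem of calculus is not available pointwise. Instead,
the difference of both sides has quadratically small increments and is therefore constant.\<close>
theorem exp_cumint:
 assumes T: "0 <= T"
 shows "(\<integral>r. indicator {0<..<T} r * (g r * exp (cumint g r)) \<partial>lborel) = exp (cumint g T) - 1"
proof -
 define h where "h r = g r * exp (cumint g r)" for r
 have [measurable]: "h \<in> borel_measurable borel" unfolding h_def by measurable
 have B0: "B \<ge> 0" using B[of 0] by linarith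
 let ?L = "B * T"
 have AL: "cumint g r <= ?L" if "0 <= r" "r <= T" for r
  using cumint_bound[of r] that B0 mult_left_mono[of r T B] by linarith
 have hb: "\<bar>h r\<bar> <= B * exp ?L" if "0 <= r" "r <= T" for r
  unfolding h_def abs_mult using B[of r] AL[OF that] B0 by (intro mult_mono) auto
 define F where "F t = exp (cumint g t) - cumint h t" for t
 have "F T = F 0"
 proof (rule quadratic_increments_constant[OF _ T])
  fix s t assume st: "0 <= s" "s <= t" "t <= T"
  obtain \<xi> where \<xi>: "exp (cumint g t) - exp (cumint g s) = exp \<xi> * (cumint g t - cumint g s)"
   "min (cumint g t) (cumint g s) <= \<xi>" "\<xi> <= max (cumint g t) (cumint g s)" by (rule exp_diff_mean)
  have \<xi>L: "\<xi> <= ?L" using \<xi>(3) AL[of s] AL[of t] st by auto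
  have close: "\<bar>exp \<xi> * g r - h r\<bar> <= B * (exp ?L * (2 * B * (t - s)))" if r: "s < r" "r < t" for r
  proof -
   have "\<bar>\<xi> - cumint g r\<bar> <= 2 * B * (t - s)"
   proof -
    have "\<bar>cumint g t - cumint g r\<bar> <= B * (t - s)" "\<bar>cumint g s - cumint g r\<bar> <= B * (t - s)"
     using cumint_lipschitz[of r t] cumint_lipschitz[of s r] r st B0
      mult_left_mono[of "t - r" "t - s" B] mult_left_mono[of "r - s" "t - s" B] by (auto simp: abs_minus_commute)
    then show ?thesis using \<xi>(2,3) by (auto simp: abs_le_iff min_def max_def split: if_splits)
   qed
   then have "exp ?L * \<bar>\<xi> - cumint g r\<bar> <= exp ?L * (2 * B * (t - s))" by (rule mult_left_mono) simp
   moreover have "\<bar>exp \<xi> - exp (cumint g r)\<bar> <= exp ?L * \<bar>\<xi> - cumint g r\<bar>"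
    using r st by (intro exp_diff_bound[OF \<xi>L] AL) auto
   ultimately have "\<bar>exp \<xi> - exp (cumint g r)\<bar> <= exp ?L * (2 * B * (t - s))" by linarith
   moreover have "exp \<xi> * g r - h r = g r * (exp \<xi> - exp (cumint g r))" by (simp add: h_def algebra_simps)
   ultimately show ?thesis using B[of r] B0 by (simp add: abs_mult mult_mono)
  qed
  have "F t - F s = exp \<xi> * (cumint g t - cumint g s) - (cumint h t - cumint h s)"
   unfolding F_def using \<xi>(1) by simp
  also have "cumint g t - cumint g s = (\<integral>r. indicator {s<..<t} r * g r \<partial>lborel)"
   by (rule cumint_diff[of _ _ B]) (use st B in auto)
  also have "cumint h t - cumint h s = (\<integral>r. indicator {s<..<t} r * h r \<partial>lborel)"
   by (rule cumint_diff[of _ _ "B * exp ?L"]) (use st hb in auto)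
  also have "exp \<xi> * (\<integral>r. indicator {s<..<t} r * g r \<partial>lborel) - (\<integral>r. indicator {s<..<t} r * h r \<partial>lborel)
   = (\<integral>r. exp \<xi> * (indicator {s<..<t} r * g r) - indicator {s<..<t} r * h r \<partial>lborel)"
   using bounded_integrable[of g s t B] bounded_integrable[of h s t "B * exp ?L"] B hb st by simp
  also have "... = (\<integral>r. indicator {s<..<t} r * (exp \<xi> * g r - h r) \<partial>lborel)" by (simp add: algebra_simps)
  also have "\<bar>...\<bar> <= B * (exp ?L * (2 * B * (t - s))) * (t - s)"
   by (rule segment_bound[OF _ close]) (use st in auto)
  finally show "\<bar>F t - F s\<bar> <= (2 * B * B * exp ?L) * (t - s)^2" by (simp add: power2_eq_square algebra_simps)
 qed
 then show ?thesis by (simp add: F_def h_def[symmetric] cumint_def[of h, symmetric]) (simp add: cumint_def)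
qed

end

section \<open>The payoff of one sojourn\<close>

definition upto_int :: "(real => real) => ennreal => ennreal" where
 "upto_int g T = (\<integral>\<^sup>+s\<in>{s. 0 < s & ennreal s < T}. ennreal (g s) \<partial>lborel)"

lemma upto_int_real:
 assumes [measurable]: "g \<in> borel_measurable borel" and b: "!!t. 0 <= g t & g t <= B" and t: "0 <= t"
 shows "upto_int g (ennreal t) = ennreal (cumint g t)"
proof -
 have "upto_int g (ennreal t) = (\<integral>\<^sup>+s. ennreal (indicator {0<..<t} s * g s) \<partial>lborel)"
  unfolding upto_int_def using t by (intro nn_integral_cong) (auto simp: indicator_def ennreal_less_iff)
 also have "... = ennreal (cumint g t)"
  unfolding cumint_def using b
  by (intro nn_integral_eq_integral bounded_integrable[where C=B]) (auto intro!: AE_I2 simp: abs_le_iff intro: order_trans[OF _ conjunct2[OF b]])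
 finally show ?thesis .
qed

lemma exp_neg_ennreal: "0 <= r ==> exp_neg (ennreal r) = ennreal (exp (- r))"
 by (simp add: exp_neg_def)

lemma exp_neg_antimono: "a <= b ==> exp_neg b <= exp_neg a"
 by (cases a; cases b) (auto simp: exp_neg_def top_unique intro!: ennreal_leI)

lemma exp_neg_measurable[measurable]: "exp_neg \<in> borel_measurable borel"
 unfolding exp_neg_def[abs_def] by measurable

lemma exp_neg_SUP:
 assumes inc: "incseq s"
 shows "(%n::nat. exp_neg (s n)) \<longlonglongrightarrow> exp_neg (SUP n. s n)"
proof (cases "SUP n. s n")
 case (real r)
 have le: "s n <= ennreal r" for n using SUP_upper[of n UNIV s] real by simp
 have fin: "s n = ennreal (enn2real (s n))" for n
  using le[of n] by (simp add: ennreal_enn2real_if top_unique) (metis ennreal_neq_top top.extremum_uniqueI)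
 have "s \<longlonglongrightarrow> ennreal r" using LIMSEQ_SUP[OF inc] real by simp
 then have "(%n. ennreal (enn2real (s n))) \<longlonglongrightarrow> ennreal r" using fin by simp
 then have "(%n. enn2real (s n)) \<longlonglongrightarrow> r" using tendsto_ennreal_iff[of "%n. enn2real (s n)" sequentially r] real by simp
 then have "(%n. ennreal (exp (- enn2real (s n)))) \<longlonglongrightarrow> ennreal (exp (- r))" by (intro tendsto_ennrealI tendsto_exp tendsto_minus)
 moreover have "exp_neg (s n) = ennreal (exp (- enn2real (s n)))" for n
  using exp_neg_ennreal[of "enn2real (s n)"] fin[of n] by simp
 ultimately show ?thesis using real by (simp add: exp_neg_ennreal)
next
 case top
 have z: "exp_neg top = 0" by (simp add: exp_neg_def)
 show ?thesis unfolding top z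
 proof (rule order_tendstoI)
  fix a :: ennreal assume a: "0 < a"
  obtain K :: real where K: "0 <= K" "ennreal (exp (- K)) < a"
  proof (cases a)
   case (real b)
   then have b: "0 < b" using a by simp
   have "exp (- max 0 (- ln (b / 2))) <= exp (ln (b / 2))" by simp
   also have "... < b" using b by simp
   finally show ?thesis using that[of "max 0 (- ln (b / 2))"] real by (simp add: ennreal_less_iff)
  qed (use that[of 0] in simp)
  have "ennreal K < (SUP n. s n)" by (simp only: top ennreal_less_top)
  then obtain N where N: "ennreal K < s N" by (auto simp: less_SUP_iff)
  have "exp_neg (s n) < a" if "N <= n" for n
  proof -
   have "ennreal K <= s n" using N inc that by (auto simp: incseq_def intro: order_trans less_imp_le)
   then have "exp_neg (s n) <= ennreal (exp (- K))" using exp_neg_antimono K exp_neg_ennreal by metis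
   then show ?thesis using K(2) by (rule order_le_less_trans)
  qed
  then show "\<forall>\<^sub>F n in sequentially. exp_neg (s n) < a" by (auto simp: eventually_sequentially)
 qed simp
qed

lemma upto_int_SUP:
 assumes [measurable]: "g \<in> borel_measurable borel"
 shows "upto_int g \<infinity> = (SUP n. upto_int g (ennreal (real n)))" "incseq (%n. upto_int g (ennreal (real n)))"
proof -
 have i: "(SUP n. ennreal (g s) * indicator {s. 0 < s & ennreal s < ennreal (real n)} s) = ennreal (g s) * indicator {s. 0 < s & ennreal s < \<infinity>} s" for s
 proof (cases "0 < s")
  case True
  obtain n :: nat where n: "s < real n" using reals_Archimedean2 by blast
  show ?thesis
   by (intro antisym SUP_least SUP_upper2[of n]) (use n True in "auto simp: indicator_def ennreal_less_iff ennreal_less_top")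
 qed simp
 show inc: "incseq (%n. upto_int g (ennreal (real n)))"
  unfolding incseq_def
 proof (intro allI impI)
  fix m n :: nat assume "m <= n"
  then have "ennreal (real m) <= ennreal (real n)" by (intro ennreal_leI) simp
  then have "{s. 0 < s & ennreal s < ennreal (real m)} \<subseteq> {s. 0 < s & ennreal s < ennreal (real n)}"
   using order_less_le_trans by blast
  then show "upto_int g (ennreal (real m)) <= upto_int g (ennreal (real n))"
   unfolding upto_int_def by (intro nn_integral_mono mult_left_mono) (auto split: split_indicator)
 qed
 have "upto_int g \<infinity> = (\<integral>\<^sup>+s. (SUP n. ennreal (g s) * indicator {s. 0 < s & ennreal s < ennreal (real n)} s) \<partial>lborel)"
  unfolding upto_int_def i ..
 also have "... = (SUP n. upto_int g (ennreal (real n)))"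
  unfolding upto_int_def
 proof (rule nn_integral_monotone_convergence_SUP)
  show "incseq (%n s. ennreal (g s) * indicator {s. 0 < s & ennreal s < ennreal (real n)} s)"
   by (auto simp: incseq_def le_fun_def indicator_def ennreal_less_iff)
 qed measurable
 finally show "upto_int g \<infinity> = (SUP n. upto_int g (ennreal (real n)))" .
qed

text \<open>Cost rate \<open>c\<close> and jump rate \<open>q\<close> between two interventions. The weight
\<open>E\<close> is the expected exponential cost on the event that no natural jump has occurred,
\<open>D\<close> is the probability of this event.\<close>
locale sojourn =
 fixes c q :: "real => real" and B :: real
 assumes c[measurable]: "c \<in> borel_measurable borel" and q[measurable]: "q \<in> borel_measurable borel"
  and cB: "!!t. 0 <= c t & c t <= B" and qB: "!!t. 0 <= q t & q t <= B"
begin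

definition E :: "real => real" where "E t = exp (cumint (%t. c t - q t) t)"
definition D :: "real => real" where "D t = exp (- cumint q t)"

lemma B0: "0 <= B"
 using cB[of 0] by linarith

lemma gB: "\<bar>c t - q t\<bar> <= B" "\<bar>- q t\<bar> <= B" "\<bar>q t\<bar> <= B" "\<bar>c t\<bar> <= B"
 using cB[of t] qB[of t] by auto

lemma cumint_cq: "cumint (%t. c t - q t) t = cumint c t - cumint q t"
 unfolding cumint_def right_diff_distrib
 by (rule Bochner_Integration.integral_diff) (use gB in "auto intro!: bounded_integrable")

lemma cumint_q: "cumint (%t. - q t) t = - cumint q t"
 unfolding cumint_def by simp

lemma E_measurable[measurable]: "E \<in> borel_measurable borel"
 unfolding E_def using cumint_measurable[of "%t. c t - q t" B] gB by measurable

lemma D_measurable[measurable]: "D \<in> borel_measurable borel"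
 unfolding D_def cumint_q[symmetric] using cumint_measurable[of "%t. - q t" B] gB by measurable

lemma cumint_nonneg: "0 <= cumint c t" "0 <= cumint q t"
 unfolding cumint_def using cB qB by (auto intro!: integral_nonneg_AE AE_I2)

lemma weights:
 assumes "0 <= t"
 shows "exp_neg (upto_int q (ennreal t)) * exp_pos (upto_int c (ennreal t)) = ennreal (E t)"
  and "exp_neg (upto_int q (ennreal t)) = ennreal (D t)"
  and "exp_pos (upto_int c (ennreal t)) = ennreal (exp (cumint c t))"
proof -
 show 1: "exp_neg (upto_int q (ennreal t)) = ennreal (D t)"
  using upto_int_real[OF q qB assms] cumint_nonneg by (simp add: exp_neg_ennreal D_def)
 show 2: "exp_pos (upto_int c (ennreal t)) = ennreal (exp (cumint c t))"
  using upto_int_real[OF c cB assms] cumint_nonneg by (simp add: exp_pos_ennreal)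
 show "exp_neg (upto_int q (ennreal t)) * exp_pos (upto_int c (ennreal t)) = ennreal (E t)"
  unfolding 1 2 D_def E_def cumint_cq by (simp add: ennreal_mult[symmetric] exp_add[symmetric])
qed

lemma E_pos: "0 < E t" and D_pos: "0 < D t" by (simp_all add: E_def D_def)

lemma E_bound: "0 <= r ==> r <= s ==> E r <= exp (B * s)"
 using cumint_bound[of "%t. c t - q t" B r] gB mult_left_mono[of r s B] cB[of 0] by (auto simp: E_def)

lemma D_bound: "0 <= r ==> r <= s ==> D r <= exp (B * s)"
 using cumint_bound[of "%t. - q t" B r] gB mult_left_mono[of r s B] cB[of 0] by (auto simp: D_def cumint_q)

lemma set_Ioo: "(\<integral>\<^sup>+t\<in>{0<..s}. f t \<partial>lborel) = (\<integral>\<^sup>+t\<in>{0<..<s}. f t \<partial>lborel)" for s :: real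
proof (rule nn_integral_cong_AE)
 have "AE r in lborel. r ~= s" by (rule AE_lborel_singleton)
 then show "AE t in lborel. f t * indicator {0<..s} t = f t * indicator {0<..<s} t"
  by (rule AE_mp) (auto simp: indicator_def intro!: AE_I2)
qed

lemma mass_finite:
 assumes s: "0 <= s"
 shows "(\<integral>\<^sup>+t\<in>{0<..s}. ennreal (D t * q t) \<partial>lborel) + ennreal (D s) = 1"
proof -
 have int: "integrable lborel (%r. indicator {0<..<s} r * (D r * q r))"
  by (rule bounded_integrable[where C="exp (B * s) * B"])
    (use D_bound qB D_pos in "auto simp: abs_mult abs_of_pos intro!: mult_mono")
 have "(\<integral>r. indicator {0<..<s} r * (- q r * exp (cumint (%t. - q t) r)) \<partial>lborel) = exp (cumint (%t. - q t) s) - 1"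
  by (rule exp_cumint[of _ B]) (use gB s in auto)
 also have "(\<integral>r. indicator {0<..<s} r * (- q r * exp (cumint (%t. - q t) r)) \<partial>lborel)
   = - (\<integral>r. indicator {0<..<s} r * (D r * q r) \<partial>lborel)"
  by (simp add: cumint_q D_def mult.commute mult.left_commute)
 finally have I: "(\<integral>r. indicator {0<..<s} r * (D r * q r) \<partial>lborel) = 1 - D s" by (simp add: cumint_q D_def)
 have "(\<integral>\<^sup>+t\<in>{0<..s}. ennreal (D t * q t) \<partial>lborel) = (\<integral>\<^sup>+t. ennreal (indicator {0<..<s} t * (D t * q t)) \<partial>lborel)"
  unfolding set_Ioo by (intro nn_integral_cong) (auto simp: indicator_def)
 also have "... = ennreal (1 - D s)"
  unfolding I[symmetric] using D_pos qB by (intro nn_integral_eq_integral int) (auto intro!: AE_I2 simp: less_imp_le)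
 moreover have "D s <= 1" using cumint_nonneg by (simp add: D_def)
 ultimately show ?thesis using D_pos[of s] by (simp add: ennreal_plus[symmetric] del: ennreal_plus)
qed

lemma SUP_Ioc:
 assumes [measurable]: "f \<in> borel_measurable borel"
 shows "(\<integral>\<^sup>+t\<in>{0<..}. f t \<partial>lborel) = (SUP n::nat. \<integral>\<^sup>+t\<in>{0<..real n}. f t \<partial>lborel)"
proof -
 have "(\<integral>\<^sup>+t\<in>{0<..}. f t \<partial>lborel) = (\<integral>\<^sup>+t. (SUP n::nat. f t * indicator {0<..real n} t) \<partial>lborel)"
 proof (rule nn_integral_cong)
  fix t :: real
  obtain n :: nat where n: "t <= real n" using real_arch_simple by blast
  show "f t * indicator {0<..} t = (SUP n::nat. f t * indicator {0<..real n} t)"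
   by (intro antisym SUP_least SUP_upper2[of n]) (use n in "auto simp: indicator_def")
 qed
 also have "... = (SUP n::nat. \<integral>\<^sup>+t\<in>{0<..real n}. f t \<partial>lborel)"
  by (rule nn_integral_monotone_convergence_SUP) (auto simp: incseq_def le_fun_def indicator_def)
 finally show ?thesis .
qed

lemma mass_infinite: "(\<integral>\<^sup>+t\<in>{0<..}. ennreal (D t * q t) \<partial>lborel) + exp_neg (upto_int q \<infinity>) = 1"
proof -
 have "(%n. (\<integral>\<^sup>+t\<in>{0<..real n}. ennreal (D t * q t) \<partial>lborel)) \<longlonglongrightarrow> (\<integral>\<^sup>+t\<in>{0<..}. ennreal (D t * q t) \<partial>lborel)"
 proof -
  have "incseq (%n. \<integral>\<^sup>+t\<in>{0<..real n}. ennreal (D t * q t) \<partial>lborel)"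
   by (auto simp: incseq_def indicator_def intro!: nn_integral_mono)
  from LIMSEQ_SUP[OF this] show ?thesis using SUP_Ioc[of "%t. ennreal (D t * q t)"] by simp
 qed
 moreover have "(%n. exp_neg (upto_int q (ennreal (real n)))) \<longlonglongrightarrow> exp_neg (upto_int q \<infinity>)"
  unfolding upto_int_SUP(1)[OF q] by (rule exp_neg_SUP[OF upto_int_SUP(2)[OF q]])
 ultimately have "(%n. (\<integral>\<^sup>+t\<in>{0<..real n}. ennreal (D t * q t) \<partial>lborel) + exp_neg (upto_int q (ennreal (real n))))
   \<longlonglongrightarrow> (\<integral>\<^sup>+t\<in>{0<..}. ennreal (D t * q t) \<partial>lborel) + exp_neg (upto_int q \<infinity>)" by (rule tendsto_add)
 moreover have "(\<integral>\<^sup>+t\<in>{0<..real n}. ennreal (D t * q t) \<partial>lborel) + exp_neg (upto_int q (ennreal (real n))) = 1" for n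
  using mass_finite[of "real n"] weights(2)[of "real n"] by simp
 ultimately show ?thesis by (simp add: LIMSEQ_const_iff)
qed

lemma tail_mass:
 assumes s: "0 <= s"
 shows "(\<integral>\<^sup>+t\<in>{s<..}. ennreal (D t * q t) \<partial>lborel) + exp_neg (upto_int q \<infinity>) = ennreal (D s)"
proof -
 have "(\<integral>\<^sup>+t\<in>{0<..}. ennreal (D t * q t) \<partial>lborel) = (\<integral>\<^sup>+t\<in>{0<..s}. ennreal (D t * q t) \<partial>lborel) + (\<integral>\<^sup>+t\<in>{s<..}. ennreal (D t * q t) \<partial>lborel)"
  using s by (subst nn_integral_add[symmetric]) (auto intro!: nn_integral_cong simp: indicator_def)
 then have "(\<integral>\<^sup>+t\<in>{0<..s}. ennreal (D t * q t) \<partial>lborel) + ((\<integral>\<^sup>+t\<in>{s<..}. ennreal (D t * q t) \<partial>lborel) + exp_neg (upto_int q \<infinity>))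
  = (\<integral>\<^sup>+t\<in>{0<..s}. ennreal (D t * q t) \<partial>lborel) + ennreal (D s)"
  using mass_infinite mass_finite[OF s] by (simp add: add.assoc)
 moreover have "(\<integral>\<^sup>+t\<in>{0<..s}. ennreal (D t * q t) \<partial>lborel) ~= top"
  using mass_finite[OF s] by (metis ennreal_add_eq_top ennreal_one_neq_top)
 ultimately show ?thesis by (simp add: ennreal_add_left_cancel)
qed

context
 fixes p :: "real => real" and u \<delta> C :: real
 assumes p[measurable]: "p \<in> borel_measurable borel" and pC: "!!t. p t <= C" and qp: "!!t. q t <= p t"
  and u: "0 <= u" and \<delta>: "0 < \<delta>"
  and drift: "!!t. 0 < t ==> \<delta> * u <= p t + (c t - q t) * (1 + u)"
begin

lemma p0: "0 <= p t"
 using qB[of t] qp[of t] by linarith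

definition Pn :: "real => real" where "Pn s = (\<integral>r. indicator {0<..<s} r * (E r * p r) \<partial>lborel)"

lemma Pn_int: "integrable lborel (%r. indicator {0<..<s} r * (E r * p r))"
proof (rule bounded_integrable[where C="exp (B * s) * C"])
 fix r assume "0 < r" "r < s"
 moreover have "0 <= p r" using qB[of r] qp[of r] by linarith
 ultimately show "\<bar>E r * p r\<bar> <= exp (B * s) * C"
  using E_bound[of r s] E_pos[of r] pC[of r] by (auto simp: abs_mult intro!: mult_mono)
qed measurable

lemma E_int: "integrable lborel (%r. indicator {0<..<s} r * E r)"
 by (rule bounded_integrable[where C="exp (B * s)"]) (use E_bound E_pos in "auto simp: less_imp_le")

lemma nn_Pn: "(\<integral>\<^sup>+t\<in>{0<..s}. ennreal (E t * p t) \<partial>lborel) = ennreal (Pn s)"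
proof -
 have "0 <= p t" for t using qB[of t] qp[of t] by linarith
 then have "(\<integral>\<^sup>+t. ennreal (indicator {0<..<s} t * (E t * p t)) \<partial>lborel) = ennreal (Pn s)"
  unfolding Pn_def using E_pos by (intro nn_integral_eq_integral Pn_int) (auto intro!: AE_I2 simp: less_imp_le)
 moreover have "(\<integral>\<^sup>+t\<in>{0<..s}. ennreal (E t * p t) \<partial>lborel) = (\<integral>\<^sup>+t. ennreal (indicator {0<..<s} t * (E t * p t)) \<partial>lborel)"
  unfolding set_Ioo by (intro nn_integral_cong) (auto simp: indicator_def)
 ultimately show ?thesis by simp
qed

text \<open>Here \<open>p\<close> is the rate at which the continuation payoff is earned by natural jumps, and \<open>1 +
u\<close> is the present value. The drift condition says that the derivative of the right-hand side minus the
left-hand side is nonnegative; \<open>exp_cumint\<close> integrates it.\<close>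
lemma Pn_lower:
 assumes s: "0 <= s"
 shows "1 + u + \<delta> * u * (\<integral>r. indicator {0<..<s} r * E r \<partial>lborel) <= Pn s + E s * (1 + u)"
proof -
 have gi: "integrable lborel (%r. indicator {0<..<s} r * ((c r - q r) * E r))"
  by (rule bounded_integrable[where C="B * exp (B * s)"])
    (use E_bound gB E_pos B0 in "auto simp: abs_mult abs_of_pos less_imp_le intro!: mult_mono")
 have "(\<integral>r. indicator {0<..<s} r * ((c r - q r) * E r) \<partial>lborel) = E s - 1"
  unfolding E_def by (rule exp_cumint[of _ B]) (use gB s in auto)
 then have "\<delta> * u * (\<integral>r. indicator {0<..<s} r * E r \<partial>lborel) - (1 + u) * (E s - 1)
  = (\<integral>r. \<delta> * u * (indicator {0<..<s} r * E r) - (1 + u) * (indicator {0<..<s} r * ((c r - q r) * E r)) \<partial>lborel)"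
  using gi E_int by simp
 also have "... <= Pn s"
  unfolding Pn_def
 proof (rule integral_mono)
  fix r
  have "\<delta> * u * E r - (1 + u) * ((c r - q r) * E r) <= E r * p r" if "0 < r"
   using mult_left_mono[OF drift[OF that], of "E r"] E_pos[of r] by (simp add: algebra_simps)
  then show "\<delta> * u * (indicator {0<..<s} r * E r) - (1 + u) * (indicator {0<..<s} r * ((c r - q r) * E r)) <= indicator {0<..<s} r * (E r * p r)"
   by (auto simp: indicator_def)
 qed (use gi E_int Pn_int in auto)
 finally show ?thesis by (simp add: algebra_simps)
qed

lemma sojourn_finite:
 assumes s: "0 <= s"
 shows "ennreal (1 + u) <= (\<integral>\<^sup>+t\<in>{0<..s}. ennreal (E t * p t) \<partial>lborel) + ennreal (E s * (1 + u))"
proof -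
 have "0 <= (\<integral>r. indicator {0<..<s} r * E r \<partial>lborel)" using E_pos by (intro integral_nonneg_AE AE_I2) (auto simp: less_imp_le)
 then have "1 + u <= Pn s + E s * (1 + u)" using Pn_lower[OF s] u \<delta> by (smt (verit, best) mult_nonneg_nonneg)
 moreover have "0 <= Pn s"
  unfolding Pn_def using E_pos p0 by (intro integral_nonneg_AE AE_I2) (auto simp: less_imp_le)
 moreover have "0 <= E s * (1 + u)" using E_pos[of s] u by simp
 ultimately have "ennreal (1 + u) <= ennreal (Pn s + E s * (1 + u))" "0 <= Pn s" "0 <= E s * (1 + u)"
  by (auto intro: ennreal_leI simp del: ennreal_plus)
 then show ?thesis unfolding nn_Pn by (simp only: ennreal_plus)
qed

text \<open>If the payoff is finite, then by \<open>Pn_lower\<close> the weight \<open>E\<close> is bounded with a bounded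
integral, so it takes arbitrarily small values and the term \<open>E s * u\<close> can be neglected. This is
the use of the strict inequality \<open>\<delta> > 0\<close>.\<close>
lemma sojourn_infinite:
 "ennreal (1 + u) <= (\<integral>\<^sup>+t\<in>{0<..}. ennreal (E t * p t) \<partial>lborel) + exp_neg (upto_int q \<infinity>) * exp_pos (upto_int c \<infinity>)"
 (is "_ <= ?J")
proof (cases "?J = top")
 case False
 define J where "J = enn2real ?J"
 have J: "?J = ennreal J" "0 <= J" using False by (auto simp: J_def less_top)
 have P0: "0 <= Pn s" for s
  unfolding Pn_def using E_pos p0 by (intro integral_nonneg_AE AE_I2) (auto simp: less_imp_le)
 have PE: "Pn s + E s <= J" if s: "0 <= s" for s
 proof -
  have mono: "upto_int c (ennreal s) <= upto_int c T" if "ennreal s <= T" for T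
   unfolding upto_int_def using that by (intro nn_integral_mono) (auto simp: indicator_def)
  have PE': "ennreal (Pn s + E s) = ennreal (Pn s) + ennreal (exp (cumint c s)) * ennreal (D s)"
   using P0 E_pos[of s] by (simp add: E_def D_def cumint_cq exp_diff exp_minus divide_inverse ennreal_mult[symmetric] less_imp_le)
  have Ds: "ennreal (D s) = (\<integral>\<^sup>+t\<in>{s<..}. ennreal (D t * q t) \<partial>lborel) + exp_neg (upto_int q \<infinity>)"
   by (rule tail_mass[OF s, symmetric])
  have "ennreal (exp (cumint c s)) * ennreal (D s) = (\<integral>\<^sup>+t\<in>{s<..}. ennreal (exp (cumint c s)) * ennreal (D t * q t) \<partial>lborel)
    + ennreal (exp (cumint c s)) * exp_neg (upto_int q \<infinity>)"
   unfolding Ds by (simp add: distrib_left nn_integral_cmult[symmetric] mult.assoc)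
  also have "... <= (\<integral>\<^sup>+t\<in>{s<..}. ennreal (E t * p t) \<partial>lborel) + exp_neg (upto_int q \<infinity>) * exp_pos (upto_int c \<infinity>)"
  proof (rule add_mono)
   have "ennreal (exp (cumint c s)) * ennreal (D t * q t) <= ennreal (E t * p t)" if t: "s < t" for t
   proof -
    have "ennreal (cumint c s) <= ennreal (cumint c t)"
     using mono[of "ennreal t"] t s upto_int_real[OF c cB] by (simp add: ennreal_leI)
    then have "cumint c s <= cumint c t" using cumint_nonneg by simp
    then have "exp (cumint c s) * (D t * q t) <= exp (cumint c t) * (D t * p t)"
     using qB[of t] qp[of t] D_pos[of t] by (intro mult_mono) auto
    also have "... = E t * p t" by (simp add: E_def D_def cumint_cq exp_diff exp_minus divide_inverse)
    finally show ?thesis using D_pos[of t] qB[of t] by (subst ennreal_mult[symmetric]) (auto intro: ennreal_leI)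
   qed
   then show "(\<integral>\<^sup>+t\<in>{s<..}. ennreal (exp (cumint c s)) * ennreal (D t * q t) \<partial>lborel) <= (\<integral>\<^sup>+t\<in>{s<..}. ennreal (E t * p t) \<partial>lborel)"
    by (intro nn_integral_mono) (auto simp: indicator_def)
   have "ennreal (exp (cumint c s)) <= exp_pos (upto_int c \<infinity>)"
    unfolding weights(3)[OF s, symmetric] by (intro exp_pos_mono mono) simp
   then show "ennreal (exp (cumint c s)) * exp_neg (upto_int q \<infinity>) <= exp_neg (upto_int q \<infinity>) * exp_pos (upto_int c \<infinity>)"
    by (subst mult.commute) (intro mult_left_mono, auto)
  qed
  finally have "ennreal (Pn s + E s) <= ennreal (Pn s) + ((\<integral>\<^sup>+t\<in>{s<..}. ennreal (E t * p t) \<partial>lborel) + exp_neg (upto_int q \<infinity>) * exp_pos (upto_int c \<infinity>))"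
   unfolding PE' by (rule add_left_mono)
  also have "... = ?J"
  proof -
   have "(\<integral>\<^sup>+t\<in>{0<..}. ennreal (E t * p t) \<partial>lborel) = ennreal (Pn s) + (\<integral>\<^sup>+t\<in>{s<..}. ennreal (E t * p t) \<partial>lborel)"
    unfolding nn_Pn[symmetric] using s by (subst nn_integral_add[symmetric]) (auto intro!: nn_integral_cong simp: indicator_def)
   then show ?thesis by (simp add: add.assoc)
  qed
  finally have "ennreal (Pn s + E s) <= ennreal J" unfolding J(1) .
  then show ?thesis using J(2) by (rule ennreal_le_iff[THEN iffD1, rotated])
 qed
 have "1 + u <= J"
 proof (cases "u = 0")
  case True then show ?thesis using PE[of 0] by (simp add: Pn_def E_def cumint_def)
 next
  case False
  then have u0: "0 < u" using u by simp
  define I where "I s = (\<integral>r. indicator {0<..<s} r * E r \<partial>lborel)" for s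
  have key: "1 + u + \<delta> * u * I s <= J + E s * u" if "0 <= s" for s
   using Pn_lower[OF that] PE[OF that] by (simp add: I_def algebra_simps)
  have Eb: "E s <= J" if "0 <= s" for s using PE[OF that] P0[of s] by linarith
  \<comment> \<open>E takes arbitrarily small values since its integral is bounded\<close>
  have small: "\<exists>s\<ge>0. E s < e" if e: "0 < e" for e
  proof (rule ccontr)
   assume "\<not> ?thesis"
   then have ge: "e <= E s" if "0 <= s" for s using that by force
   have Ige: "e * s <= I s" if s: "0 <= s" for s
   proof -
    have "e * s = (\<integral>r. indicator {0<..<s} r * e \<partial>lborel)" using s by simp
    also have "... <= I s" unfolding I_def
    proof (rule integral_mono)
     show "integrable lborel (%r. indicator {0<..<s} r * e)" by (rule bounded_integrable[where C="\<bar>e\<bar>"]) auto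
     show "indicator {0<..<s} r * e <= indicator {0<..<s} r * E r" for r using ge[of r] by (auto simp: indicator_def)
    qed (rule E_int)
    finally show ?thesis .
   qed
   define s where "s = (J + J * u) / (\<delta> * u * e)"
   have pos: "0 < \<delta> * u * e" using u0 \<delta> e by simp
   have s0: "0 <= s" unfolding s_def using pos J u0 by (intro divide_nonneg_pos) auto
   have "\<delta> * u * (e * s) <= \<delta> * u * I s" using Ige[OF s0] u0 \<delta> by (intro mult_left_mono) auto
   moreover have "\<delta> * u * (e * s) = J + J * u" using u0 \<delta> e by (simp add: s_def)
   moreover have "E s * u <= J * u" using Eb[OF s0] u0 by simp
   ultimately show False using key[OF s0] u0 by linarith
  qed
  have I0: "0 <= I s" for s unfolding I_def using E_pos by (intro integral_nonneg_AE AE_I2) (auto simp: less_imp_le)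
  show ?thesis
  proof (rule field_le_epsilon)
   fix e :: real assume e: "0 < e"
   obtain s where s: "0 <= s" "E s < e / u" using small[of "e / u"] e u0 by auto
   then have "E s * u <= e" using u0 by (simp add: field_simps)
   moreover have "0 <= \<delta> * u * I s" using u0 \<delta> I0 by simp
   ultimately show "1 + u <= J + e" using key[OF s(1)] by linarith
  qed
 qed
 then show ?thesis unfolding J(1) by (rule ennreal_leI)
qed (simp only: top_greatest)

end

end

type_synonym ('x, 'a) path = "nat => ennreal \<times> (nat => 'x option \<times> 'a option) option"

section \<open>Jump kernels of the controlled process\<close>

lemma measurable_extend_time:
 fixes f :: "'n \<times> 't => ennreal"
 assumes f: "f \<in> borel_measurable (N \<Otimes>\<^sub>M restrict_space L A)" and A: "A \<in> sets L"
 shows "(%z. f z * indicator A (snd z)) \<in> borel_measurable (N \<Otimes>\<^sub>M L)"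
proof -
 let ?R = "restrict_space (N \<Otimes>\<^sub>M L) (space N \<times> A)"
 have "fst \<in> ?R \<rightarrow>\<^sub>M N" by (rule measurable_restrict_space1) simp
 moreover have "snd \<in> ?R \<rightarrow>\<^sub>M restrict_space L A"
  by (rule measurable_restrict_space2) (auto simp: space_restrict_space intro!: measurable_restrict_space1)
 ultimately have "(%z. (fst z, snd z)) \<in> ?R \<rightarrow>\<^sub>M N \<Otimes>\<^sub>M restrict_space L A" by (rule measurable_Pair)
 from measurable_compose[OF this f] have "f \<in> borel_measurable ?R" by simp
 moreover have "(space N \<times> A) \<inter> space (N \<Otimes>\<^sub>M L) \<in> sets (N \<Otimes>\<^sub>M L)" using A by (intro sets.Int pair_measureI) auto
 ultimately have "(%z. if z \<in> space N \<times> A then f z else 0) \<in> borel_measurable (N \<Otimes>\<^sub>M L)"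
  using measurable_restrict_space_iff[of "space N \<times> A" "N \<Otimes>\<^sub>M L" 0 borel f] by simp
 then show ?thesis
  by (rule measurable_cong[THEN iffD1, rotated]) (auto simp: space_pair_measure indicator_def)
qed

lemma measure_of_eqI:
 assumes D: "sets D = sets N" and em: "!!B. B \<in> sets N ==> emeasure D B = \<mu> B"
 shows "measure_of (space N) (sets N) \<mu> = D"
proof -
 have "measure_of (space N) (sets N) \<mu> = measure_of (space N) (sets N) (emeasure D)"
  by (rule measure_of_eq) (use em sets.space_closed[of N] sets.sigma_sets_eq[of N] in auto)
 also have "... = D" using measure_of_of_measure[of D] D sets_eq_imp_space_eq[OF D] by simp
 finally show ?thesis .
qed

lemma pos_functional_compose:
 assumes I: "pos_functional P I" and g: "g \<in> P \<rightarrow>\<^sub>M N"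
 shows "pos_functional N (%f. I (%y. f (g y)))"
 unfolding pos_functional_def
proof (intro conjI ballI allI impI)
 note m = measurable_compose[OF g]
 fix f f' :: "'b => ennreal" and c assume "f \<in> borel_measurable N"
 then have f: "(%y. f (g y)) \<in> borel_measurable P" by (rule m)
 show "I (%y. c * f (g y)) = c * I (%y. f (g y))"
  by (rule I[unfolded pos_functional_def, THEN conjunct2, THEN conjunct1, rule_format, OF f])
 assume "f' \<in> borel_measurable N"
 then have f': "(%y. f' (g y)) \<in> borel_measurable P" by (rule m)
 show "I (%y. f (g y) + f' (g y)) = I (%y. f (g y)) + I (%y. f' (g y))"
  by (rule I[unfolded pos_functional_def, THEN conjunct1, rule_format, OF f f'])
next
 fix F :: "nat => 'b => ennreal" assume F: "\<forall>i. F i \<in> borel_measurable N" "incseq F"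
 have "\<forall>i. (%y. F i (g y)) \<in> borel_measurable P" using F(1) measurable_compose[OF g] by blast
 moreover have "incseq (%i y. F i (g y))" using F(2) by (auto simp: incseq_def le_fun_def)
 ultimately show "I (%y. SUP i. F i (g y)) = (SUP i. I (%y. F i (g y)))"
  using I[unfolded pos_functional_def, THEN conjunct2, THEN conjunct2, THEN conjunct1, rule_format, of "%i y. F i (g y)"] by simp
next
 fix f f' :: "'b => ennreal" assume "\<forall>z\<in>space N. f z = f' z"
 then have "\<forall>y\<in>space P. f (g y) = f' (g y)" using measurable_space[OF g] by blast
 then show "I (%y. f (g y)) = I (%y. f' (g y))"
  using I[unfolded pos_functional_def, THEN conjunct2, THEN conjunct2, THEN conjunct2, rule_format, of "%y. f (g y)" "%y. f' (g y)"] by blast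
qed

context gi_control
begin

abbreviation "CM == coordM M"
abbreviation "HM == histM M"
abbreviation "TR == restrict_space borel {0<..} :: real measure"
abbreviation "HT n == HM n \<Otimes>\<^sub>M TR"
abbreviation "TE == restrict_space borel {0<..} :: ennreal measure"

lemma SM_borel[measurable]: "(%x. x) \<in> SM \<rightarrow>\<^sub>M borel"
 unfolding stateM_def by (rule measurable_restrict_space1) simp

lemma qtilde_int_measurable:
 assumes k: "k \<in> borel_measurable (P \<Otimes>\<^sub>M SM)"
 shows "(%z. \<integral>\<^sup>+y. k (fst (fst z), y) \<partial>qtilde M (snd (fst z)) (snd z)) \<in> borel_measurable ((P \<Otimes>\<^sub>M SM) \<Otimes>\<^sub>M gradM M)"
proof -
 let ?R = "(P \<Otimes>\<^sub>M SM) \<Otimes>\<^sub>M gradM M"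
 have K: "(%z. Qtil M w (snd (fst z)) (snd z)) \<in> ?R \<rightarrow>\<^sub>M subprob_algebra SM"
  using measurable_compose[of "%z. (snd (fst z), snd z)" ?R, OF _ measurable_prob_algebraD[OF Qtil_G_measurable]]
  by (simp add: split_beta')
 have [measurable]: "(%z. snd (fst (fst z))) \<in> ?R \<Otimes>\<^sub>M SM \<rightarrow>\<^sub>M borel" "snd \<in> ?R \<Otimes>\<^sub>M SM \<rightarrow>\<^sub>M borel"
  by (rule measurable_compose[OF _ SM_borel], measurable)+
 have "(%z. k (fst (fst (fst z)), snd z)) \<in> borel_measurable (?R \<Otimes>\<^sub>M SM)"
  by (rule measurable_compose[OF _ k]) measurable
 moreover have "(%z. if dist (snd z) (snd (fst (fst z))) = 0 then 0 else 1 :: ennreal) \<in> borel_measurable (?R \<Otimes>\<^sub>M SM)"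
  by measurable
 ultimately have "(%z. k (fst (fst (fst z)), snd z) * (if dist (snd z) (snd (fst (fst z))) = 0 then 0 else 1)) \<in> borel_measurable (?R \<Otimes>\<^sub>M SM)"
  by (rule borel_measurable_times_ennreal)
 then have "(%(z, y). k (fst (fst z), y) * indicator (- {snd (fst z)}) y) \<in> borel_measurable (?R \<Otimes>\<^sub>M SM)"
  by (rule measurable_cong[THEN iffD1, rotated]) (auto simp: indicator_def)
 from nn_integral_measurable_subprob_algebra2[OF this K]
 have [measurable]: "(%z. \<integral>\<^sup>+y. k (fst (fst z), y) * indicator (- {snd (fst z)}) y \<partial>Qtil M w (snd (fst z)) (snd z)) \<in> borel_measurable ?R" .
 have "(%z. ennreal (w (snd (fst z))) * (\<integral>\<^sup>+y. k (fst (fst z), y) * indicator (- {snd (fst z)}) y \<partial>Qtil M w (snd (fst z)) (snd z))) \<in> borel_measurable ?R"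
  by measurable
 then show ?thesis
 proof (rule measurable_cong[THEN iffD1, rotated])
  fix z assume z: "z \<in> space ?R"
  then have *: "snd (fst z) \<in> S" "snd z \<in> AG" "fst (fst z) \<in> space P" by (auto simp: space_pair_measure)
  have "(%y. k (fst (fst z), y)) \<in> borel_measurable SM" by (rule measurable_compose[OF measurable_Pair1'[OF *(3)] k])
  from nn_integral_qtilde[OF *(1,2) this]
  show "ennreal (w (snd (fst z))) * (\<integral>\<^sup>+y. k (fst (fst z), y) * indicator (- {snd (fst z)}) y \<partial>Qtil M w (snd (fst z)) (snd z))
   = (\<integral>\<^sup>+y. k (fst (fst z), y) \<partial>qtilde M (snd (fst z)) (snd z))" by simp
 qed
qed

lemma relaxed_measurable:
 assumes X: "X \<in> P \<rightarrow>\<^sub>M SD" and K: "K \<in> P \<rightarrow>\<^sub>M prob_algebra (gradM M)" and k: "k \<in> borel_measurable (P \<Otimes>\<^sub>M SM)"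
 shows "(%p. case X p of None => 0 | Some x => \<integral>\<^sup>+a. (\<integral>\<^sup>+y. k (p, y) \<partial>qtilde M x a) \<partial>K p) \<in> borel_measurable P"
proof -
 have L: "(%z. K (fst z)) \<in> P \<Otimes>\<^sub>M SM \<rightarrow>\<^sub>M subprob_algebra (gradM M)"
  by (rule measurable_compose[OF measurable_fst measurable_prob_algebraD[OF K]])
 have "(%z. \<integral>\<^sup>+a. (\<integral>\<^sup>+y. k (fst z, y) \<partial>qtilde M (snd z) a) \<partial>K (fst z)) \<in> borel_measurable (P \<Otimes>\<^sub>M SM)"
  by (rule nn_integral_measurable_subprob_algebra2[OF _ L]) (use qtilde_int_measurable[OF k] in "simp add: split_beta'")
 from measurable_cemetery_case[OF borel_measurable_const this X[unfolded stateD_def], of 0, unfolded fst_conv snd_conv]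
 show ?thesis .
qed

lemma relaxed_cost_measurable:
 assumes X: "X \<in> P \<rightarrow>\<^sub>M SD" and K: "K \<in> P \<rightarrow>\<^sub>M prob_algebra (gradM M)"
 shows "(%p. case X p of None => 0 | Some x => \<integral>\<^sup>+a. ennreal (costG M x a) \<partial>K p) \<in> borel_measurable P"
proof -
 have L: "(%z. K (fst z)) \<in> P \<Otimes>\<^sub>M SM \<rightarrow>\<^sub>M subprob_algebra (gradM M)"
  by (rule measurable_compose[OF measurable_fst measurable_prob_algebraD[OF K]])
 have "(%z. costG M (snd (fst z)) (snd z)) \<in> borel_measurable ((P \<Otimes>\<^sub>M SM) \<Otimes>\<^sub>M gradM M)"
  using measurable_compose[of "%z. (snd (fst z), snd z)" "(P \<Otimes>\<^sub>M SM) \<Otimes>\<^sub>M gradM M", OF _ cG_meas] by (simp add: split_beta')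
 then have "(%z. ennreal (costG M (snd (fst z)) (snd z))) \<in> borel_measurable ((P \<Otimes>\<^sub>M SM) \<Otimes>\<^sub>M gradM M)" by measurable
 then have "(%z. \<integral>\<^sup>+a. ennreal (costG M (snd z) a) \<partial>K (fst z)) \<in> borel_measurable (P \<Otimes>\<^sub>M SM)"
  by (intro nn_integral_measurable_subprob_algebra2[OF _ L]) (simp add: split_beta')
 from measurable_cemetery_case[OF borel_measurable_const this X[unfolded stateD_def], of 0, unfolded fst_conv snd_conv]
 show ?thesis .
qed

subsection \<open>Histories\<close>

lemma coord_sets[measurable]:
 "{0} \<times> Some ` Yset M \<in> sets CM" "{0<..<\<infinity>} \<times> Some ` Yset M \<in> sets CM" "{(\<infinity>, None)} \<in> sets CM"
proof -
 have Y: "Some ` Yset M \<in> sets (cemetery (YM M))" using Some_cemetery[OF sets.top[of "YM M"]] by simp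
 then show "{0} \<times> Some ` Yset M \<in> sets CM" "{0<..<\<infinity>} \<times> Some ` Yset M \<in> sets CM"
  unfolding coordM_def by (auto intro!: pair_measureI)
 have "{\<infinity>} \<times> {None} \<in> sets CM" unfolding coordM_def by (rule pair_measureI) auto
 then show "{(\<infinity>, None)} \<in> sets CM" by simp
qed

lemma space_CM: "space CM = UNIV \<times> insert None (Some ` Yset M)"
 by (simp add: coordM_def space_pair_measure)

lemma Hset_sets: "1 <= n ==> Hset M n \<inter> space (PiM {..n} (%_. CM)) \<in> sets (PiM {..n} (%_. CM))"
proof -
 assume n: "1 <= n"
 have m[measurable]: "(%h. h i) \<in> PiM {..n} (%_. CM) \<rightarrow>\<^sub>M CM" if "i <= n" for i
  using that by (intro measurable_component_singleton) auto
 have "Hset M n \<inter> space (PiM {..n} (%_. CM)) = {h \<in> space (PiM {..n} (%_. CM)).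
   h 0 \<in> {0} \<times> (Some ` Yset M) & h 1 \<in> {0} \<times> (Some ` Yset M) & (\<forall>i\<in>{2..n}. h i \<in> {0<..<\<infinity>} \<times> (Some ` Yset M))}"
  unfolding Hset_def by blast
 also have "... \<in> sets (PiM {..n} (%_. CM))"
 proof -
  have c: "{h \<in> space (PiM {..n} (%_. CM)). h i \<in> B} \<in> sets (PiM {..n} (%_. CM))" if "i <= n" "B \<in> sets CM" for i B
   using measurable_sets[OF m[OF that(1)] that(2)] by (simp add: vimage_def Int_def conj_commute)
  show ?thesis
   by (intro sets.sets_Collect_conj sets.sets_Collect_finite_All c coord_sets) (use n in auto)
 qed
 finally show ?thesis .
qed

lemma space_HM: "space (HM n) = space (PiM {..n} (%_. CM)) \<inter> Hset M n"
 by (auto simp: histM_def space_restrict_space)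

lemma hist_coord: "h \<in> space (HM n) ==> 1 <= n ==> \<exists>y\<in>Yset M. snd (h n) = Some y"
 by (cases "n = 1") (auto simp: space_HM Hset_def dest!: bspec[of _ _ n])

lemma hist_time: "h \<in> space (HM n) ==> i <= n ==> 1 <= n ==> fst (h i) < \<infinity>"
 by (cases "i = 0"; cases "i = 1") (auto simp: space_HM Hset_def dest!: bspec[of _ _ i])

lemma HM_coord[measurable]: "i <= n ==> (%h. h i) \<in> HM n \<rightarrow>\<^sub>M CM"
 unfolding histM_def by (intro measurable_restrict_space1 measurable_component_singleton) auto

lemma xbar_at_measurable[measurable]: "xbar_at M n \<in> HM n \<rightarrow>\<^sub>M SD"
proof -
 have o: "(%h. snd (h n)) \<in> HM n \<rightarrow>\<^sub>M cemetery (YM M)"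
  using measurable_compose[OF HM_coord[OF order_refl], of snd] by (simp add: coordM_def)
 have g: "(%z. xbar M (snd z)) \<in> HM n \<Otimes>\<^sub>M YM M \<rightarrow>\<^sub>M SD" by measurable
 have "(%h. case snd (h n) of None => None | Some y => (%z. xbar M (snd z)) (h, y)) \<in> HM n \<rightarrow>\<^sub>M SD"
  by (rule measurable_cemetery_case[OF _ g o]) (simp add: space_SD)
 then show ?thesis
  by (rule measurable_cong[THEN iffD1, rotated]) (simp add: xbar_at_def Ypath_def split: option.split)
qed

lemma xbar_at_space: "h \<in> space (HM n) ==> xbar_at M n h = Some x ==> x \<in> S"
 using measurable_space[OF xbar_at_measurable, of h n] by (auto simp: space_SD)

end

section \<open>Controlled sojourns\<close>

locale controlled = gi_control M w
 for M :: "('x::polish_space, 'a::polish_space) gi_model" and w +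
 fixes u :: "('x, 'a) gi_policy"
 assumes u: "u \<in> policies M"
begin

lemma
 assumes n: "1 <= n"
 shows Phi: "pol_Phi u n \<in> HM n \<rightarrow>\<^sub>M prob_algebra TE"
  and Phi_inf: "!!h. h \<in> space (HM n) ==> Ypath n h \<in> Some ` Yinf M ==> emeasure (pol_Phi u n h) {\<infinity>} = 1"
  and Pi: "(%z. pol_Pi u n (fst z) (snd z)) \<in> HT n \<rightarrow>\<^sub>M prob_algebra (gradM M)"
  and Gam0: "(%z. pol_Gam0 u n (fst (fst z)) (snd (fst z)) (snd z)) \<in> (HT n) \<Otimes>\<^sub>M SM \<rightarrow>\<^sub>M prob_algebra (YM M)"
  and Gam0_PY: "!!h t x. h \<in> space (HM n) ==> 0 < t ==> x \<in> S ==> pol_Gam0 u n h t x \<in> PY M x"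
  and Gam1: "pol_Gam1 u n \<in> HM n \<rightarrow>\<^sub>M prob_algebra (YM M)"
  and Gam1_PY: "!!h x. h \<in> space (HM n) ==> xbar_at M n h = Some x ==> pol_Gam1 u n h \<in> PYstar M x"
proof -
 note u' = u[unfolded policies_def mem_Collect_eq, THEN conjunct2, rule_format, OF n]
 show "pol_Phi u n \<in> HM n \<rightarrow>\<^sub>M prob_algebra TE" using u' by blast
 show "!!h. h \<in> space (HM n) ==> Ypath n h \<in> Some ` Yinf M ==> emeasure (pol_Phi u n h) {\<infinity>} = 1" using u' by blast
 show "(%z. pol_Pi u n (fst z) (snd z)) \<in> HT n \<rightarrow>\<^sub>M prob_algebra (gradM M)" using u' by (simp add: split_beta')
 have "(%(h, t, x). pol_Gam0 u n h t x) \<in> HM n \<Otimes>\<^sub>M (TR \<Otimes>\<^sub>M SM) \<rightarrow>\<^sub>M prob_algebra (YM M)" using u' by blast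
 from measurable_compose[of "%z. (fst (fst z), (snd (fst z), snd z))" "(HT n) \<Otimes>\<^sub>M SM", OF _ this]
 show "(%z. pol_Gam0 u n (fst (fst z)) (snd (fst z)) (snd z)) \<in> (HT n) \<Otimes>\<^sub>M SM \<rightarrow>\<^sub>M prob_algebra (YM M)"
  by (simp add: split_beta')
 show "!!h t x. h \<in> space (HM n) ==> 0 < t ==> x \<in> S ==> pol_Gam0 u n h t x \<in> PY M x" using u' by blast
 show "pol_Gam1 u n \<in> HM n \<rightarrow>\<^sub>M prob_algebra (YM M)" using u' by blast
 show "!!h x. h \<in> space (HM n) ==> xbar_at M n h = Some x ==> pol_Gam1 u n h \<in> PYstar M x" using u' by blast
qed

lemma Pi_prob: "1 <= n ==> h \<in> space (HM n) ==> 0 < t ==> pol_Pi u n h t \<in> space (prob_algebra (gradM M))"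
 using measurable_space[OF Pi, of n "(h, t)"] by (simp add: space_pair_measure space_restrict_space)

lemma Phi_prob: "1 <= n ==> h \<in> space (HM n) ==> pol_Phi u n h \<in> space (prob_algebra TE)"
 using measurable_space[OF Phi, of n h] by simp

lemma Gam0_prob: "1 <= n ==> h \<in> space (HM n) ==> 0 < t ==> x \<in> S ==> pol_Gam0 u n h t x \<in> space (prob_algebra (YM M))"
 using measurable_space[OF Gam0, of n "((h, t), x)"] by (simp add: space_pair_measure space_restrict_space)

lemma Gam1_prob: "1 <= n ==> h \<in> space (HM n) ==> pol_Gam1 u n h \<in> space (prob_algebra (YM M))"
 using measurable_space[OF Gam1, of n h] by simp

lemma
 assumes n: "1 <= n" and h: "h \<in> space (HM n)" and t: "0 < t"
 shows sets_lam: "sets (lam M u n h t) = sets SM"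
  and nn_integral_lam: "f \<in> borel_measurable SM ==> (\<integral>\<^sup>+y. f y \<partial>lam M u n h t) =
   (case xbar_at M n h of None => 0 | Some x => \<integral>\<^sup>+a. (\<integral>\<^sup>+y. f y \<partial>qtilde M x a) \<partial>pol_Pi u n h t)"
proof -
 have "sets (lam M u n h t) = sets SM & (\<forall>f \<in> borel_measurable SM. (\<integral>\<^sup>+y. f y \<partial>lam M u n h t) =
   (case xbar_at M n h of None => 0 | Some x => \<integral>\<^sup>+a. (\<integral>\<^sup>+y. f y \<partial>qtilde M x a) \<partial>pol_Pi u n h t))"
 proof (cases "xbar_at M n h")
  case None
  show ?thesis using None by (simp add: lam_def)
 next
  case (Some x)
  have x: "x \<in> S" by (rule xbar_at_space[OF h Some])
  have sP: "sets (pol_Pi u n h t) = sets (gradM M)" using Pi_prob[OF n h t] by (simp add: space_prob_algebra)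
  have spP: "space (pol_Pi u n h t) = AG" using sets_eq_imp_space_eq[OF sP] by simp
  let ?I = "%f. \<integral>\<^sup>+a. 1 * (\<integral>\<^sup>+y. f y \<partial>qtilde M x a) \<partial>pol_Pi u n h t"
  have I: "pos_functional SM ?I"
  proof (rule pos_functional_mixture)
   fix f :: "'x => ennreal" assume f: "f \<in> borel_measurable SM"
   have "(%z. f (snd z)) \<in> borel_measurable (SM \<Otimes>\<^sub>M SM)" using f by measurable
   from measurable_compose[of "%a. ((x, x), a)" "gradM M", OF _ qtilde_int_measurable[OF this]] x
   show "(%a. \<integral>\<^sup>+y. f y \<partial>qtilde M x a) \<in> borel_measurable (pol_Pi u n h t)"
    by (simp add: measurable_cong_sets[OF sP refl])
  qed (auto intro!: pos_functional_nn_integral sets_qtilde)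
  define D where "D = measure_of (space SM) (sets SM) (%B. ?I (indicator B))"
  have "lam M u n h t = D"
   unfolding lam_def Some option.case
  proof (rule measure_of_eqI[where N=SM, simplified])
   show "sets D = sets SM" unfolding D_def by (rule sets_functional[OF I])
   fix B assume B: "B \<in> sets SM"
   have "emeasure D B = ?I (indicator B)" unfolding D_def by (rule emeasure_functional[OF I B])
   then show "emeasure D B = (\<integral>\<^sup>+a. emeasure (qtilde M x a) B \<partial>pol_Pi u n h t)"
    using B by (simp add: sets_qtilde)
  qed
  then show ?thesis using sets_functional[OF I] nn_integral_functional[OF I] by (auto simp: D_def Some)
 qed
 then show "sets (lam M u n h t) = sets SM" "f \<in> borel_measurable SM ==> (\<integral>\<^sup>+y. f y \<partial>lam M u n h t) =
   (case xbar_at M n h of None => 0 | Some x => \<integral>\<^sup>+a. (\<integral>\<^sup>+y. f y \<partial>qtilde M x a) \<partial>pol_Pi u n h t)" by blast+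
qed

lemma lam_measurable:
 assumes n: "1 <= n" and k: "k \<in> borel_measurable ((HT n) \<Otimes>\<^sub>M SM)"
 shows "(%z. \<integral>\<^sup>+y. k (z, y) \<partial>lam M u n (fst z) (snd z)) \<in> borel_measurable (HT n)"
proof -
 have "(%z. case xbar_at M n (fst z) of None => 0 | Some x => \<integral>\<^sup>+a. (\<integral>\<^sup>+y. k (z, y) \<partial>qtilde M x a) \<partial>pol_Pi u n (fst z) (snd z))
   \<in> borel_measurable (HT n)"
  by (rule relaxed_measurable[OF _ Pi[OF n] k]) measurable
 then show ?thesis
 proof (rule measurable_cong[THEN iffD1, rotated])
  fix z assume z: "z \<in> space (HT n)"
  then have "(%y. k (z, y)) \<in> borel_measurable SM" by (intro measurable_compose[OF measurable_Pair1' k])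
  then show "(case xbar_at M n (fst z) of None => 0 | Some x => \<integral>\<^sup>+a. (\<integral>\<^sup>+y. k (z, y) \<partial>qtilde M x a) \<partial>pol_Pi u n (fst z) (snd z))
   = (\<integral>\<^sup>+y. k (z, y) \<partial>lam M u n (fst z) (snd z))"
   using z nn_integral_lam[OF n, of "fst z" "snd z" "%y. k (z, y)"] by (auto simp: space_pair_measure space_restrict_space)
 qed
qed

lemma rate_measurable:
 assumes n: "1 <= n"
 shows "(%z. emeasure (lam M u n (fst z) (snd z)) S) \<in> borel_measurable (HT n)"
proof -
 have "(%z. \<integral>\<^sup>+y. 1 \<partial>lam M u n (fst z) (snd z)) \<in> borel_measurable (HT n)"
  using lam_measurable[OF n, of "%_. 1"] by simp
 then show ?thesis
 proof (rule measurable_cong[THEN iffD1, rotated])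
  fix z assume "z \<in> space (HT n)"
  then have "sets (lam M u n (fst z) (snd z)) = sets SM"
   using sets_lam[OF n] by (auto simp: space_pair_measure space_restrict_space)
  from sets_eq_imp_space_eq[OF this]
  show "(\<integral>\<^sup>+y. 1 \<partial>lam M u n (fst z) (snd z)) = emeasure (lam M u n (fst z) (snd z)) S" by simp
 qed
qed

definition crate :: "nat => ('x, 'a) path => real => ennreal" where
 "crate n h t = (case xbar_at M n h of None => 0 | Some x => \<integral>\<^sup>+a. ennreal (costG M x a) \<partial>pol_Pi u n h t)"

definition kap :: "nat => ('x, 'a) path => ennreal => ennreal" where
 "kap n h T = (\<integral>\<^sup>+s\<in>{s. 0 < s & ennreal s < T}. crate n h s \<partial>lborel)"

lemma crate_measurable:
 assumes n: "1 <= n"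
 shows "(%z. crate n (fst z) (snd z)) \<in> borel_measurable (HT n)"
 unfolding crate_def by (rule relaxed_cost_measurable[OF _ Pi[OF n]]) measurable

lemma upto_measurable:
 assumes r: "(%z. r (fst z) (snd z)) \<in> borel_measurable (N \<Otimes>\<^sub>M TR)"
 shows "(%z. \<integral>\<^sup>+s\<in>{s. 0 < s & ennreal s < snd z}. r (fst z) s \<partial>lborel) \<in> borel_measurable (N \<Otimes>\<^sub>M (borel :: ennreal measure))"
proof -
 have "(%z. r (fst z) (snd z) * indicator {0<..} (snd z)) \<in> borel_measurable (N \<Otimes>\<^sub>M borel)"
  by (rule measurable_extend_time[OF r]) simp
 from measurable_compose[of "%p. (fst (fst p), snd p)" "(N \<Otimes>\<^sub>M (borel :: ennreal measure)) \<Otimes>\<^sub>M lborel", OF _ this]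
 have [measurable]: "(%p. r (fst (fst p)) (snd p) * indicator {0<..} (snd p)) \<in> borel_measurable ((N \<Otimes>\<^sub>M (borel :: ennreal measure)) \<Otimes>\<^sub>M lborel)"
  by simp
 have "(%p. r (fst (fst p)) (snd p) * indicator {0<..} (snd p) * (if ennreal (snd p) < snd (fst p) then 1 else 0))
   \<in> borel_measurable ((N \<Otimes>\<^sub>M (borel :: ennreal measure)) \<Otimes>\<^sub>M lborel)" by measurable
 from lborel.borel_measurable_nn_integral_fst[OF this]
 have "(%z. \<integral>\<^sup>+s. r (fst z) s * indicator {0<..} s * (if ennreal s < snd z then 1 else 0) \<partial>lborel) \<in> borel_measurable (N \<Otimes>\<^sub>M (borel :: ennreal measure))"
  by simp
 moreover have "(\<integral>\<^sup>+s. r (fst z) s * indicator {0<..} s * (if ennreal s < snd z then 1 else 0) \<partial>lborel)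
  = (\<integral>\<^sup>+s\<in>{s. 0 < s & ennreal s < snd z}. r (fst z) s \<partial>lborel)" for z
  by (intro nn_integral_cong) (auto simp: indicator_def)
 ultimately show ?thesis by simp
qed

lemma Lam_measurable: "1 <= n ==> (%z. Lam M u n (fst z) (snd z)) \<in> borel_measurable (HM n \<Otimes>\<^sub>M borel)"
 unfolding Lam_def by (rule upto_measurable[OF rate_measurable])

lemma kap_measurable: "1 <= n ==> (%z. kap n (fst z) (snd z)) \<in> borel_measurable (HM n \<Otimes>\<^sub>M borel)"
 unfolding kap_def by (rule upto_measurable[OF crate_measurable])

end

context controlled
begin

text \<open>The defining formula of \<open>Gker\<close>, extended from indicators to functions.\<close>
definition GI :: "nat => ('x, 'a) path
  => (ennreal \<times> (nat => 'x option \<times> 'a option) option => ennreal) => ennreal" where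
 "GI n h f = exp_neg (Lam M u n h \<infinity>) * emeasure (pol_Phi u n h) {\<infinity>} * f (\<infinity>, None)
  + (\<integral>\<^sup>+t. exp_neg (Lam M u n h t) * indicator {0<..<\<infinity>} t * (\<integral>\<^sup>+y. f (t, Some y) \<partial>pol_Gam1 u n h) \<partial>pol_Phi u n h)
  + (\<integral>\<^sup>+t. 1 * (\<integral>\<^sup>+x. emeasure (pol_Phi u n h) {ennreal t..} * exp_neg (Lam M u n h (ennreal t))
     * (\<integral>\<^sup>+y. f (ennreal t, Some y) \<partial>pol_Gam0 u n h t x) \<partial>lam M u n h t) \<partial>restrict_space lborel {0<..})"

lemma Pair_Some_measurable: "(%y. (t, Some y)) \<in> YM M \<rightarrow>\<^sub>M CM"
 unfolding coordM_def by measurable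

lemma Phi_sets: "1 <= n ==> h \<in> space (HM n) ==> sets (pol_Phi u n h) = sets TE"
 using Phi_prob by (simp add: space_prob_algebra)

lemma Phi_space: "1 <= n ==> h \<in> space (HM n) ==> space (pol_Phi u n h) = {0<..}"
 using sets_eq_imp_space_eq[OF Phi_sets] by (simp add: space_restrict_space)

lemma Gam1_sets: "1 <= n ==> h \<in> space (HM n) ==> sets (pol_Gam1 u n h) = sets (YM M)"
 using Gam1_prob by (simp add: space_prob_algebra)

lemma Gam0_sets: "1 <= n ==> h \<in> space (HM n) ==> 0 < t ==> x \<in> S ==> sets (pol_Gam0 u n h t x) = sets (YM M)"
 using Gam0_prob by (simp add: space_prob_algebra)

lemma ennreal_TE: "(%t. t) \<in> TE \<rightarrow>\<^sub>M borel"
 by (rule measurable_restrict_space1) simp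

lemma real_TR: "(%t. t) \<in> TR \<rightarrow>\<^sub>M borel"
 by (rule measurable_restrict_space1) simp

lemma sets_TR: "sets (restrict_space lborel {0<..}) = sets TR"
 by (rule sets_restrict_space_cong) simp

lemma term2_measurable:
 assumes n: "1 <= n" and f: "f \<in> borel_measurable CM"
 shows "(%z. exp_neg (Lam M u n (fst z) (snd z)) * indicator {0<..<\<infinity>} (snd z) * (\<integral>\<^sup>+y. f (snd z, Some y) \<partial>pol_Gam1 u n (fst z)))
   \<in> borel_measurable (HM n \<Otimes>\<^sub>M TE)"
proof -
 have s: "snd \<in> HM n \<Otimes>\<^sub>M TE \<rightarrow>\<^sub>M borel" by (rule measurable_compose[OF measurable_snd ennreal_TE])
 have 1: "(%z. Lam M u n (fst z) (snd z)) \<in> borel_measurable (HM n \<Otimes>\<^sub>M TE)"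
  using measurable_compose[OF measurable_Pair[OF measurable_fst s] Lam_measurable[OF n]] by simp
 have 2: "(%z. indicator {0<..<\<infinity>} (snd z) :: ennreal) \<in> borel_measurable (HM n \<Otimes>\<^sub>M TE)"
  by (rule measurable_compose[OF s]) simp
 have "(%z. (snd (fst z), Some (snd z))) \<in> (HM n \<Otimes>\<^sub>M TE) \<Otimes>\<^sub>M YM M \<rightarrow>\<^sub>M CM"
  unfolding coordM_def using measurable_compose[OF measurable_fst s] by measurable
 from measurable_compose[OF this f]
 have "(%(z, y). f (snd z, Some y)) \<in> borel_measurable ((HM n \<Otimes>\<^sub>M TE) \<Otimes>\<^sub>M YM M)" by (simp add: split_beta')
 from nn_integral_measurable_subprob_algebra2[OF this measurable_compose[OF measurable_fst measurable_prob_algebraD[OF Gam1[OF n]]]]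
 have 3: "(%z. \<integral>\<^sup>+y. f (snd z, Some y) \<partial>pol_Gam1 u n (fst z)) \<in> borel_measurable (HM n \<Otimes>\<^sub>M TE)" .
 show ?thesis using 1 2 3 by measurable
qed

lemma term3_integrand:
 assumes n: "1 <= n" and f: "f \<in> borel_measurable CM"
 shows "(%z. emeasure (pol_Phi u n (fst (fst z))) {ennreal (snd (fst z))..} * exp_neg (Lam M u n (fst (fst z)) (ennreal (snd (fst z))))
    * (\<integral>\<^sup>+y. f (ennreal (snd (fst z)), Some y) \<partial>pol_Gam0 u n (fst (fst z)) (snd (fst z)) (snd z)))
   \<in> borel_measurable ((HT n) \<Otimes>\<^sub>M SM)"
proof -
 let ?R = "HT n"
 have s[measurable]: "snd \<in> ?R \<rightarrow>\<^sub>M borel" by (rule measurable_compose[OF measurable_snd real_TR])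
 have 1: "(%z. Lam M u n (fst z) (ennreal (snd z))) \<in> borel_measurable ?R"
  using measurable_compose[of "%z. (fst z, ennreal (snd z))" ?R, OF _ Lam_measurable[OF n]] by simp
 have 2: "(%z. emeasure (pol_Phi u n (fst z)) {ennreal (snd z)..}) \<in> borel_measurable ?R"
 proof -
  have [measurable]: "snd \<in> ?R \<Otimes>\<^sub>M TE \<rightarrow>\<^sub>M borel" by (rule measurable_compose[OF measurable_snd ennreal_TE])
  have "(%p. if ennreal (snd (fst p)) <= snd p then 1 else 0 :: ennreal) \<in> borel_measurable (?R \<Otimes>\<^sub>M TE)" by measurable
  then have "(%(z, r). if ennreal (snd z) <= r then 1 else 0 :: ennreal) \<in> borel_measurable (?R \<Otimes>\<^sub>M TE)" by (simp add: split_beta')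
  from nn_integral_measurable_subprob_algebra2[OF this measurable_compose[OF measurable_fst measurable_prob_algebraD[OF Phi[OF n]]]]
  have "(%z. \<integral>\<^sup>+r. (if ennreal (snd z) <= r then 1 else 0) \<partial>pol_Phi u n (fst z)) \<in> borel_measurable ?R" .
  then show ?thesis
  proof (rule measurable_cong[THEN iffD1, rotated])
   fix z assume z: "z \<in> space ?R"
   then have h: "fst z \<in> space (HM n)" "0 < snd z" by (auto simp: space_pair_measure space_restrict_space)
   have "{ennreal (snd z)..} \<in> sets (pol_Phi u n (fst z))"
    unfolding Phi_sets[OF n h(1)] sets_restrict_space using h(2) by (intro image_eqI[of _ _ "{ennreal (snd z)..}"]) (auto intro: order_less_le_trans[of _ "ennreal (snd z)"])
   moreover have "(\<integral>\<^sup>+r. (if ennreal (snd z) <= r then 1 else 0) \<partial>pol_Phi u n (fst z)) = (\<integral>\<^sup>+r. indicator {ennreal (snd z)..} r \<partial>pol_Phi u n (fst z))"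
    by (intro nn_integral_cong) (auto simp: indicator_def)
   ultimately show "(\<integral>\<^sup>+r. (if ennreal (snd z) <= r then 1 else 0) \<partial>pol_Phi u n (fst z)) = emeasure (pol_Phi u n (fst z)) {ennreal (snd z)..}"
    by simp
  qed
 qed
 have "(%p. (ennreal (snd (fst (fst p))), Some (snd p))) \<in> (?R \<Otimes>\<^sub>M SM) \<Otimes>\<^sub>M YM M \<rightarrow>\<^sub>M CM"
  unfolding coordM_def by measurable
 from measurable_compose[OF this f]
 have "(%(z, y). f (ennreal (snd (fst z)), Some y)) \<in> borel_measurable ((?R \<Otimes>\<^sub>M SM) \<Otimes>\<^sub>M YM M)" by (simp add: split_beta')
 from nn_integral_measurable_subprob_algebra2[OF this measurable_prob_algebraD[OF Gam0[OF n]]]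
 have 3: "(%z. \<integral>\<^sup>+y. f (ennreal (snd (fst z)), Some y) \<partial>pol_Gam0 u n (fst (fst z)) (snd (fst z)) (snd z)) \<in> borel_measurable (?R \<Otimes>\<^sub>M SM)" .
 show ?thesis
  using measurable_compose[OF measurable_fst 1, of SM] measurable_compose[OF measurable_fst 2, of SM] 3 by measurable
qed

lemma term3_measurable:
 assumes n: "1 <= n" and f: "f \<in> borel_measurable CM"
 shows "(%z. \<integral>\<^sup>+x. emeasure (pol_Phi u n (fst z)) {ennreal (snd z)..} * exp_neg (Lam M u n (fst z) (ennreal (snd z)))
     * (\<integral>\<^sup>+y. f (ennreal (snd z), Some y) \<partial>pol_Gam0 u n (fst z) (snd z) x) \<partial>lam M u n (fst z) (snd z)) \<in> borel_measurable (HT n)"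
 using lam_measurable[OF n term3_integrand[OF n f]] by simp

lemma GI_functional:
 assumes n: "1 <= n" and h: "h \<in> space (HM n)"
 shows "pos_functional CM (GI n h)"
 unfolding GI_def
proof (intro pos_functional_add)
 show "pos_functional CM (%f. exp_neg (Lam M u n h \<infinity>) * emeasure (pol_Phi u n h) {\<infinity>} * f (\<infinity>, None))"
  by (rule pos_functional_eval) (simp add: space_CM)
 show "pos_functional CM (%f. \<integral>\<^sup>+t. exp_neg (Lam M u n h t) * indicator {0<..<\<infinity>} t * (\<integral>\<^sup>+y. f (t, Some y) \<partial>pol_Gam1 u n h) \<partial>pol_Phi u n h)"
 proof (rule pos_functional_mixture)
  show "pos_functional CM (%f. \<integral>\<^sup>+y. f (t, Some y) \<partial>pol_Gam1 u n h)" for t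
   by (rule pos_functional_compose[OF pos_functional_nn_integral[OF Gam1_sets[OF n h]] Pair_Some_measurable])
  have l: "(%t. Lam M u n h t) \<in> borel_measurable TE"
   using measurable_compose[OF measurable_Pair1'[OF h] Lam_measurable[OF n]] measurable_compose[OF ennreal_TE] by simp
  have i: "(%t. indicator {0<..<\<infinity>} t :: ennreal) \<in> borel_measurable TE"
   by (rule measurable_compose[OF ennreal_TE]) simp
  show "(%t. exp_neg (Lam M u n h t) * indicator {0<..<\<infinity>} t) \<in> borel_measurable (pol_Phi u n h)"
   unfolding measurable_cong_sets[OF Phi_sets[OF n h] refl] using l i by measurable
  fix f :: "ennreal \<times> (nat => 'x option \<times> 'a option) option => ennreal" assume f: "f \<in> borel_measurable CM"
  have p: "(%p. (fst p, Some (snd p))) \<in> TE \<Otimes>\<^sub>M YM M \<rightarrow>\<^sub>M CM"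
   unfolding coordM_def using measurable_compose[OF measurable_fst ennreal_TE] by measurable
  from measurable_compose[OF p f] have "(%(t, y). f (t, Some y)) \<in> borel_measurable (TE \<Otimes>\<^sub>M YM M)" by (simp add: split_beta')
  then have "(%t. \<integral>\<^sup>+y. f (t, Some y) \<partial>pol_Gam1 u n h) \<in> borel_measurable TE"
   by (rule nn_integral_measurable_subprob_algebra2)
     (rule measurable_const, use Gam1_prob[OF n h] in "auto simp: space_prob_algebra space_subprob_algebra intro: prob_space_imp_subprob_space")
  then show "(%t. \<integral>\<^sup>+y. f (t, Some y) \<partial>pol_Gam1 u n h) \<in> borel_measurable (pol_Phi u n h)"
   unfolding measurable_cong_sets[OF Phi_sets[OF n h] refl] .
 qed
 show "pos_functional CM (%f. \<integral>\<^sup>+t. 1 * (\<integral>\<^sup>+x. emeasure (pol_Phi u n h) {ennreal t..} * exp_neg (Lam M u n h (ennreal t))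
     * (\<integral>\<^sup>+y. f (ennreal t, Some y) \<partial>pol_Gam0 u n h t x) \<partial>lam M u n h t) \<partial>restrict_space lborel {0<..})"
 proof (rule pos_functional_mixture)
  fix t :: real assume "t \<in> space (restrict_space lborel {0<..})"
  then have t: "0 < t" by (simp add: space_restrict_space)
  note sl = sets_lam[OF n h t]
  have spl: "space (lam M u n h t) = S" using sets_eq_imp_space_eq[OF sl] by simp
  show "pos_functional CM (%f. \<integral>\<^sup>+x. emeasure (pol_Phi u n h) {ennreal t..} * exp_neg (Lam M u n h (ennreal t))
     * (\<integral>\<^sup>+y. f (ennreal t, Some y) \<partial>pol_Gam0 u n h t x) \<partial>lam M u n h t)"
  proof (rule pos_functional_mixture)
   show "pos_functional CM (%f. \<integral>\<^sup>+y. f (ennreal t, Some y) \<partial>pol_Gam0 u n h t x)" if "x \<in> space (lam M u n h t)" for x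
    using that by (intro pos_functional_compose[OF pos_functional_nn_integral[OF Gam0_sets[OF n h t]] Pair_Some_measurable]) (simp add: spl)
   fix f :: "ennreal \<times> (nat => 'x option \<times> 'a option) option => ennreal" assume f: "f \<in> borel_measurable CM"
   have ht: "(h, t) \<in> space (HT n)" using h t by (simp add: space_pair_measure space_restrict_space)
   have "(%(x, y). f (ennreal t, Some y)) \<in> borel_measurable (SM \<Otimes>\<^sub>M YM M)"
    using measurable_compose[OF measurable_snd measurable_compose[OF Pair_Some_measurable f]] by (simp add: split_beta')
   moreover have "pol_Gam0 u n h t \<in> SM \<rightarrow>\<^sub>M subprob_algebra (YM M)"
    using measurable_compose[OF measurable_Pair1'[OF ht] measurable_prob_algebraD[OF Gam0[OF n]]] by simp
   ultimately show "(%x. \<integral>\<^sup>+y. f (ennreal t, Some y) \<partial>pol_Gam0 u n h t x) \<in> borel_measurable (lam M u n h t)"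
    unfolding measurable_cong_sets[OF sl refl] by (rule nn_integral_measurable_subprob_algebra2)
  qed simp
 next
  fix f :: "ennreal \<times> (nat => 'x option \<times> 'a option) option => ennreal" assume f: "f \<in> borel_measurable CM"
  from measurable_compose[OF measurable_Pair1'[OF h] term3_measurable[OF n f]]
  show "(%t. \<integral>\<^sup>+x. emeasure (pol_Phi u n h) {ennreal t..} * exp_neg (Lam M u n h (ennreal t))
     * (\<integral>\<^sup>+y. f (ennreal t, Some y) \<partial>pol_Gam0 u n h t x) \<partial>lam M u n h t) \<in> borel_measurable (restrict_space lborel {0<..})"
   unfolding measurable_cong_sets[OF sets_TR refl] by simp
 qed simp
qed

lemma Gker_eq:
 assumes n: "1 <= n" and h: "h \<in> space (HM n)"
 shows "Gker M u n h = measure_of (space CM) (sets CM) (%B. GI n h (indicator B))"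
 unfolding Gker_def
proof (rule measure_of_eqI)
 let ?D = "measure_of (space CM) (sets CM) (%B. GI n h (indicator B))"
 show "sets ?D = sets CM" by (rule sets_functional[OF GI_functional[OF n h]])
 fix B assume B: "B \<in> sets CM"
 have Bt: "{y \<in> Yset M. (t, Some y) \<in> B} \<in> sets (YM M)" for t
 proof -
  have "(%y. (t, Some y)) -` B \<inter> space (YM M) = {y \<in> Yset M. (t, Some y) \<in> B}" by auto
  then show ?thesis using measurable_sets[OF Pair_Some_measurable B, of t] by simp
 qed
 have em: "(\<integral>\<^sup>+y. indicator B (t, Some y) \<partial>\<mu>) = emeasure \<mu> {y \<in> Yset M. (t, Some y) \<in> B}" if "sets \<mu> = sets (YM M)" for t \<mu>
 proof -
  have "(\<integral>\<^sup>+y. indicator B (t, Some y) \<partial>\<mu>) = (\<integral>\<^sup>+y. indicator {y \<in> Yset M. (t, Some y) \<in> B} y \<partial>\<mu>)"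
   using sets_eq_imp_space_eq[OF that] by (intro nn_integral_cong) (auto simp: indicator_def)
  then show ?thesis using Bt that by simp
 qed
 have "emeasure ?D B = GI n h (indicator B)" by (rule emeasure_functional[OF GI_functional[OF n h] B])
 also have "... = exp_neg (Lam M u n h \<infinity>) * emeasure (pol_Phi u n h) {\<infinity>} * indicator B (\<infinity>, None)
  + (\<integral>\<^sup>+t\<in>{0<..<\<infinity>}. emeasure (pol_Gam1 u n h) {y \<in> Yset M. (t, Some y) \<in> B} * exp_neg (Lam M u n h t)
     \<partial>pol_Phi u n h)
  + (\<integral>\<^sup>+t\<in>{0<..}. (\<integral>\<^sup>+x. emeasure (pol_Phi u n h) {ennreal t..}
            * emeasure (pol_Gam0 u n h t x) {y \<in> Yset M. (ennreal t, Some y) \<in> B}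
            * exp_neg (Lam M u n h (ennreal t)) \<partial>lam M u n h t) \<partial>lborel)"
  unfolding GI_def
 proof (intro arg_cong2[where f="(+)"] refl)
  show "(\<integral>\<^sup>+t. exp_neg (Lam M u n h t) * indicator {0<..<\<infinity>} t * (\<integral>\<^sup>+y. indicator B (t, Some y) \<partial>pol_Gam1 u n h) \<partial>pol_Phi u n h)
   = (\<integral>\<^sup>+t\<in>{0<..<\<infinity>}. emeasure (pol_Gam1 u n h) {y \<in> Yset M. (t, Some y) \<in> B} * exp_neg (Lam M u n h t) \<partial>pol_Phi u n h)"
   by (simp add: em[OF Gam1_sets[OF n h]] mult_ac)
  show "(\<integral>\<^sup>+t. 1 * (\<integral>\<^sup>+x. emeasure (pol_Phi u n h) {ennreal t..} * exp_neg (Lam M u n h (ennreal t))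
     * (\<integral>\<^sup>+y. indicator B (ennreal t, Some y) \<partial>pol_Gam0 u n h t x) \<partial>lam M u n h t) \<partial>restrict_space lborel {0<..})
   = (\<integral>\<^sup>+t\<in>{0<..}. (\<integral>\<^sup>+x. emeasure (pol_Phi u n h) {ennreal t..}
            * emeasure (pol_Gam0 u n h t x) {y \<in> Yset M. (ennreal t, Some y) \<in> B}
            * exp_neg (Lam M u n h (ennreal t)) \<partial>lam M u n h t) \<partial>lborel)"
  proof (subst nn_integral_restrict_space, simp, rule nn_integral_cong)
   fix t :: real
   show "1 * (\<integral>\<^sup>+x. emeasure (pol_Phi u n h) {ennreal t..} * exp_neg (Lam M u n h (ennreal t))
     * (\<integral>\<^sup>+y. indicator B (ennreal t, Some y) \<partial>pol_Gam0 u n h t x) \<partial>lam M u n h t) * indicator {0<..} t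
    = (\<integral>\<^sup>+x. emeasure (pol_Phi u n h) {ennreal t..}
            * emeasure (pol_Gam0 u n h t x) {y \<in> Yset M. (ennreal t, Some y) \<in> B}
            * exp_neg (Lam M u n h (ennreal t)) \<partial>lam M u n h t) * indicator {0<..} t"
   proof (cases "0 < t")
    case True
    have "space (lam M u n h t) = S" using sets_eq_imp_space_eq[OF sets_lam[OF n h True]] by simp
    then have "(\<integral>\<^sup>+x. emeasure (pol_Phi u n h) {ennreal t..} * exp_neg (Lam M u n h (ennreal t))
      * (\<integral>\<^sup>+y. indicator B (ennreal t, Some y) \<partial>pol_Gam0 u n h t x) \<partial>lam M u n h t)
     = (\<integral>\<^sup>+x. emeasure (pol_Phi u n h) {ennreal t..}
            * emeasure (pol_Gam0 u n h t x) {y \<in> Yset M. (ennreal t, Some y) \<in> B}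
            * exp_neg (Lam M u n h (ennreal t)) \<partial>lam M u n h t)"
     by (intro nn_integral_cong) (simp add: em[OF Gam0_sets[OF n h True]] mult_ac)
    then show ?thesis by simp
   qed simp
  qed
 qed
 finally show "emeasure ?D B = ..." .
qed

lemma sets_Gker: "1 <= n ==> h \<in> space (HM n) ==> sets (Gker M u n h) = sets CM"
 unfolding Gker_eq by (rule sets_functional[OF GI_functional])

lemma nn_integral_Gker: "1 <= n ==> h \<in> space (HM n) ==> f \<in> borel_measurable CM ==> (\<integral>\<^sup>+z. f z \<partial>Gker M u n h) = GI n h f"
 unfolding Gker_eq by (rule nn_integral_functional[OF GI_functional])

lemma GI_measurable:
 assumes n: "1 <= n" and f: "f \<in> borel_measurable CM"
 shows "(%h. GI n h f) \<in> borel_measurable (HM n)"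
proof -
 have 1: "(%h. Lam M u n h \<infinity>) \<in> borel_measurable (HM n)"
  using measurable_compose[of "%h. (h, \<infinity>)" "HM n", OF _ Lam_measurable[OF n]] by simp
 have I: "{\<infinity>} \<in> sets TE" unfolding sets_restrict_space by (intro image_eqI[of _ _ "{\<infinity>}"]) auto
 have 2: "(%h. emeasure (pol_Phi u n h) {\<infinity>}) \<in> borel_measurable (HM n)"
  by (rule measurable_compose[OF measurable_prob_algebraD[OF Phi[OF n]] measurable_emeasure_subprob_algebra[OF I]])
 have 3: "(%h. \<integral>\<^sup>+t. exp_neg (Lam M u n h t) * indicator {0<..<\<infinity>} t * (\<integral>\<^sup>+y. f (t, Some y) \<partial>pol_Gam1 u n h) \<partial>pol_Phi u n h) \<in> borel_measurable (HM n)"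
  by (rule nn_integral_measurable_subprob_algebra2[OF _ measurable_prob_algebraD[OF Phi[OF n]]])
    (use term2_measurable[OF n f] in "simp add: split_beta'")
 let ?g = "%h t. \<integral>\<^sup>+x. emeasure (pol_Phi u n h) {ennreal t..} * exp_neg (Lam M u n h (ennreal t))
     * (\<integral>\<^sup>+y. f (ennreal t, Some y) \<partial>pol_Gam0 u n h t x) \<partial>lam M u n h t"
 have "(%z. ?g (fst z) (snd z) * indicator {0<..} (snd z)) \<in> borel_measurable (HM n \<Otimes>\<^sub>M borel)"
  by (rule measurable_extend_time[OF term3_measurable[OF n f]]) simp
 then have "(%z. ?g (fst z) (snd z) * indicator {0<..} (snd z)) \<in> borel_measurable (HM n \<Otimes>\<^sub>M lborel)"
  by (simp add: measurable_cong_sets[OF sets_pair_measure_cong[OF refl sets_lborel] refl])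
 from lborel.borel_measurable_nn_integral_fst[OF this]
 have "(%h. \<integral>\<^sup>+t. ?g h t * indicator {0<..} t \<partial>lborel) \<in> borel_measurable (HM n)" by simp
 then have 4: "(%h. \<integral>\<^sup>+t. 1 * ?g h t \<partial>restrict_space lborel {0<..}) \<in> borel_measurable (HM n)"
  by (subst nn_integral_restrict_space) simp_all
 show ?thesis unfolding GI_def using 1 2 3 4 by measurable
qed

end

lemma if_indicator_cong:
 fixes a b :: ennreal and t :: real
 assumes "0 < t ==> a = b"
 shows "(if P then a else 0) * indicator {0<..} t = (if P then b else 0) * indicator {0<..} t"
 using assms by (cases "0 < t") auto

lemma emeasure_lborel_Ioi: "emeasure lborel {0::real<..} = \<infinity>"
proof (rule ccontr)
 assume "emeasure lborel {0::real<..} ~= \<infinity>"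
 then obtain r where r: "0 <= r" "emeasure lborel {0::real<..} = ennreal r" by (cases "emeasure lborel {0::real<..}") auto
 have "emeasure lborel {0<..r + 1} <= emeasure lborel {0::real<..}" by (rule emeasure_mono) auto
 then show False using r by (simp add: ennreal_le_iff)
qed

lemma ennreal_summand_le: "(a::ennreal) + b = c ==> a <= c"
 by (auto simp: le_iff_add)

context controlled
begin

subsection \<open>Rates along a history\<close>

definition qr :: "nat => ('x, 'a) path => real => real" where
 "qr n h t = (if 0 < t then enn2real (emeasure (lam M u n h t) S) else 0)"

definition cr :: "nat => ('x, 'a) path => real => real" where
 "cr n h t = (if 0 < t then enn2real (crate n h t) else 0)"

lemma slice_measurable:
 assumes h: "h \<in> space (HM n)" and r: "(%z. r (fst z) (snd z)) \<in> borel_measurable (HT n)"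
 shows "(%t. if 0 < t then enn2real (r h t) else 0) \<in> borel_measurable borel"
proof -
 from measurable_compose[OF measurable_Pair1'[OF h] measurable_extend_time[OF r]]
 have "(%t. r h t * indicator {0<..} t) \<in> borel_measurable borel" by simp
 then have "(%t. enn2real (r h t * indicator {0<..} t)) \<in> borel_measurable borel" by measurable
 then show ?thesis by (rule measurable_cong[THEN iffD1, rotated]) simp
qed

lemma kill_real:
 assumes "V j x <= of_nat K" "1 <= V j x" "0 <= \<beta>" "\<beta> <= 1"
 shows "kill \<beta> (V j) x = ennreal (1 + \<beta> * (enn2real (V j x) - 1))" "1 <= enn2real (V j x)" "enn2real (V j x) <= real K"
proof -
 have fin: "V j x = ennreal (enn2real (V j x))"
  using assms(1) by (auto simp: less_top[symmetric] top_unique intro!: ennreal_enn2real[symmetric])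
 show ge: "1 <= enn2real (V j x)" using assms(2) by (subst (asm) fin) simp
 show "enn2real (V j x) <= real K" using assms(1) by (intro enn2real_leI) (auto simp: ennreal_of_nat_eq_real_of_nat)
 have "kill \<beta> (V j) x = ennreal \<beta> * ennreal (enn2real (V j x)) + ennreal (1 - \<beta>)" unfolding kill_def using fin by simp
 also have "... = ennreal (\<beta> * enn2real (V j x) + (1 - \<beta>))"
  using assms ge by (simp add: ennreal_mult[symmetric] ennreal_plus[symmetric] del: ennreal_plus)
 finally show "kill \<beta> (V j) x = ennreal (1 + \<beta> * (enn2real (V j x) - 1))" by (simp add: algebra_simps)
qed

text \<open>The end of the process, with no state left, counts as 1 for the same reason as in \<open>ext\<close>.\<close>
definition pay :: "('x => ennreal) => (nat => 'x option \<times> 'a option) option => ennreal" where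
 "pay g o' = (case o' of None => 1 | Some y => exp_pos (CI M y) * ext g (xbar M y))"

lemma pay_simps[simp]: "pay g None = 1" "pay g (Some y) = exp_pos (CI M y) * ext g (xbar M y)"
 by (simp_all add: pay_def)

lemma pay_measurable: "g \<in> borel_measurable SM ==> pay g \<in> borel_measurable (cemetery (YM M))"
proof (rule measurable_from_cemetery)
 assume g[measurable]: "g \<in> borel_measurable SM"
 have "(%y. exp_pos (CI M y) * ext g (xbar M y)) \<in> borel_measurable (YM M)" by measurable
 then show "(%y. pay g (Some y)) \<in> borel_measurable (YM M)" by simp
qed simp

context
 fixes n h
 assumes n: "1 <= n" and h: "h \<in> space (HM n)"
begin

abbreviation (input) "\<Phi> == pol_Phi u n h"
abbreviation (input) "\<Gamma> == pol_Gam0 u n h"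
abbreviation (input) "\<Gamma>' == pol_Gam1 u n h"
abbreviation (input) "\<pi> == pol_Pi u n h"
abbreviation (input) "\<nu> == lam M u n h"
abbreviation (input) "\<Lambda> == Lam M u n h"
abbreviation (input) "\<kappa> == kap n h"
abbreviation (input) "surv t == exp_neg (Lam M u n h t)"
abbreviation (input) "jumped v t == (\<integral>\<^sup>+x. (\<integral>\<^sup>+y. v (Some y) \<partial>\<Gamma> t x) \<partial>\<nu> t)"

text \<open>Separating the time of the next impulse from the rest of the sojourn.\<close>
lemma nn_integral_Gker_product:
 assumes k[measurable]: "k \<in> borel_measurable borel" and v: "v \<in> borel_measurable (cemetery (YM M))"
 shows "(\<integral>\<^sup>+z. k (fst z) * v (snd z) \<partial>Gker M u n h) =
  (\<integral>\<^sup>+s. (\<integral>\<^sup>+t\<in>{0<..}. (if ennreal t <= s then surv (ennreal t) * k (ennreal t) *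
     jumped v t else 0) \<partial>lborel)
   + (if s = \<infinity> then surv \<infinity> * k \<infinity> * v None
     else surv s * k s * (\<integral>\<^sup>+y. v (Some y) \<partial>\<Gamma>')) \<partial>\<Phi>)"
proof -
 interpret P: prob_space \<Phi> using Phi_prob[OF n h] by (simp add: space_prob_algebra)
 note s\<Phi> = Phi_sets[OF n h] and sp\<Phi> = Phi_space[OF n h]
 have fm: "(%z. k (fst z) * v (snd z)) \<in> borel_measurable CM" unfolding coordM_def using v by measurable
 have I: "{\<infinity>} \<in> sets \<Phi>" unfolding s\<Phi> sets_restrict_space by (intro image_eqI[of _ _ "{\<infinity>}"]) auto
 have id\<Phi>[measurable]: "(%s. s) \<in> \<Phi> \<rightarrow>\<^sub>M borel" by (simp add: measurable_cong_sets[OF s\<Phi> refl] ennreal_TE)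
 have Lm: "\<Lambda> \<in> borel_measurable borel"
  using measurable_compose[OF measurable_Pair1'[OF h] Lam_measurable[OF n]] by simp
 have L\<Phi>[measurable]: "(%s. \<Lambda> s) \<in> borel_measurable \<Phi>" by (rule measurable_compose[OF id\<Phi> Lm])
 define \<gamma> where "\<gamma> = (\<integral>\<^sup>+y. v (Some y) \<partial>\<Gamma>')"
 define \<rho> where "\<rho> t = surv (ennreal t) * k (ennreal t) *
     jumped v t" for t
 have vS: "(%y. v (Some y)) \<in> borel_measurable (YM M)" by (rule measurable_compose[OF measurable_Some v])
 have gm: "(%x. \<integral>\<^sup>+y. v (Some y) \<partial>\<Gamma> t x) \<in> borel_measurable (\<nu> t)" if t: "0 < t" for t
 proof -
  have ht: "(h, t) \<in> space (HT n)" using h t by (simp add: space_pair_measure space_restrict_space)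
  have "\<Gamma> t \<in> SM \<rightarrow>\<^sub>M subprob_algebra (YM M)"
   using measurable_compose[OF measurable_Pair1'[OF ht] measurable_prob_algebraD[OF Gam0[OF n]]] by simp
  from measurable_compose[OF this nn_integral_measurable_subprob_algebra[OF vS]]
  show ?thesis by (simp add: measurable_cong_sets[OF sets_lam[OF n h t] refl])
 qed
 have \<rho>m: "(%t. \<rho> t * indicator {0<..} t) \<in> borel_measurable borel"
 proof -
  have "(%p. v (Some (snd p))) \<in> borel_measurable (((HT n) \<Otimes>\<^sub>M SM) \<Otimes>\<^sub>M YM M)"
   by (rule measurable_compose[OF measurable_snd vS])
  then have "(%(z, y). v (Some y)) \<in> borel_measurable (((HT n) \<Otimes>\<^sub>M SM) \<Otimes>\<^sub>M YM M)" by (simp add: split_beta')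
  from nn_integral_measurable_subprob_algebra2[OF this measurable_prob_algebraD[OF Gam0[OF n]]]
  have "(%z. \<integral>\<^sup>+y. v (Some y) \<partial>pol_Gam0 u n (fst (fst z)) (snd (fst z)) (snd z)) \<in> borel_measurable ((HT n) \<Otimes>\<^sub>M SM)" .
  from lam_measurable[OF n this]
  have "(%z. \<integral>\<^sup>+x. (\<integral>\<^sup>+y. v (Some y) \<partial>pol_Gam0 u n (fst z) (snd z) x) \<partial>lam M u n (fst z) (snd z)) \<in> borel_measurable (HT n)" by simp
  from measurable_compose[OF measurable_Pair1'[OF h] measurable_extend_time[OF this]]
  have [measurable]: "(%t. jumped v t * indicator {0<..} t) \<in> borel_measurable borel"
   by simp
  have [measurable]: "(%t::real. \<Lambda> (ennreal t)) \<in> borel_measurable borel" by (rule measurable_compose[OF _ Lm]) simp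
  have "(%t. surv (ennreal t) * k (ennreal t) *
     (jumped v t * indicator {0<..} t)) \<in> borel_measurable borel" by measurable
  then show ?thesis by (simp add: \<rho>_def mult.assoc)
 qed
 have T3: "(\<integral>\<^sup>+t. 1 * (\<integral>\<^sup>+x. emeasure \<Phi> {ennreal t..} * surv (ennreal t)
     * (\<integral>\<^sup>+y. k (ennreal t) * v (Some y) \<partial>\<Gamma> t x) \<partial>\<nu> t) \<partial>restrict_space lborel {0<..})
   = (\<integral>\<^sup>+s. (\<integral>\<^sup>+t\<in>{0<..}. (if ennreal t <= s then \<rho> t else 0) \<partial>lborel) \<partial>\<Phi>)"
 proof -
  have "(\<integral>\<^sup>+t. 1 * (\<integral>\<^sup>+x. emeasure \<Phi> {ennreal t..} * surv (ennreal t)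
     * (\<integral>\<^sup>+y. k (ennreal t) * v (Some y) \<partial>\<Gamma> t x) \<partial>\<nu> t) \<partial>restrict_space lborel {0<..})
   = (\<integral>\<^sup>+t. (\<integral>\<^sup>+s. (if ennreal t <= s then 1 else 0) * (\<rho> t * indicator {0<..} t) \<partial>\<Phi>) \<partial>lborel)"
  proof (subst nn_integral_restrict_space, simp, rule nn_integral_cong)
   fix t :: real
   show "1 * (\<integral>\<^sup>+x. emeasure \<Phi> {ennreal t..} * surv (ennreal t)
     * (\<integral>\<^sup>+y. k (ennreal t) * v (Some y) \<partial>\<Gamma> t x) \<partial>\<nu> t) * indicator {0<..} t
    = (\<integral>\<^sup>+s. (if ennreal t <= s then 1 else 0) * (\<rho> t * indicator {0<..} t) \<partial>\<Phi>)"
   proof (cases "0 < t")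
    case True
    have sp: "space (\<nu> t) = S" using sets_eq_imp_space_eq[OF sets_lam[OF n h True]] by simp
    have tS: "{ennreal t..} \<in> sets \<Phi>"
     unfolding s\<Phi> sets_restrict_space using True by (intro image_eqI[of _ _ "{ennreal t..}"]) (auto intro: order_less_le_trans[of _ "ennreal t"])
    have "(\<integral>\<^sup>+x. emeasure \<Phi> {ennreal t..} * surv (ennreal t)
      * (\<integral>\<^sup>+y. k (ennreal t) * v (Some y) \<partial>\<Gamma> t x) \<partial>\<nu> t)
     = (\<integral>\<^sup>+x. (emeasure \<Phi> {ennreal t..} * surv (ennreal t) * k (ennreal t))
      * (\<integral>\<^sup>+y. v (Some y) \<partial>\<Gamma> t x) \<partial>\<nu> t)"
     using sp by (intro nn_integral_cong) (simp add: nn_integral_cmult measurable_cong_sets[OF Gam0_sets[OF n h True] refl] vS mult.assoc)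
    also have "... = emeasure \<Phi> {ennreal t..} * \<rho> t"
     unfolding \<rho>_def by (subst nn_integral_cmult[OF gm[OF True]]) (simp only: mult.assoc)
    also have "... = (\<integral>\<^sup>+s. indicator {ennreal t..} s * \<rho> t \<partial>\<Phi>)"
     using tS by (simp add: nn_integral_multc)
    also have "... = (\<integral>\<^sup>+s. (if ennreal t <= s then 1 else 0) * \<rho> t \<partial>\<Phi>)"
     by (intro nn_integral_cong) (auto simp: indicator_def)
    finally show ?thesis using True by simp
   qed simp
  qed
  also have "... = (\<integral>\<^sup>+s. (\<integral>\<^sup>+t. (if ennreal t <= s then 1 else 0) * (\<rho> t * indicator {0<..} t) \<partial>lborel) \<partial>\<Phi>)"
  proof (rule pair_sigma_finite.Fubini')
   show "pair_sigma_finite \<Phi> lborel" by (intro pair_sigma_finite.intro P.sigma_finite_measure_axioms lborel.sigma_finite_measure_axioms)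
   have [measurable]: "(%z. \<rho> (snd z) * indicator {0<..} (snd z)) \<in> borel_measurable (\<Phi> \<Otimes>\<^sub>M lborel)"
    by (rule measurable_compose[OF _ \<rho>m]) simp
   have [measurable]: "fst \<in> \<Phi> \<Otimes>\<^sub>M lborel \<rightarrow>\<^sub>M borel" by (rule measurable_compose[OF measurable_fst id\<Phi>])
   have "(%z. (if ennreal (snd z) <= fst z then 1 else 0) * (\<rho> (snd z) * indicator {0<..} (snd z))) \<in> borel_measurable (\<Phi> \<Otimes>\<^sub>M lborel)"
    by measurable
   then show "(%(s, t). (if ennreal t <= s then 1 else 0) * (\<rho> t * indicator {0<..} t)) \<in> borel_measurable (\<Phi> \<Otimes>\<^sub>M lborel)"
    by (simp add: split_beta')
  qed
  also have "... = (\<integral>\<^sup>+s. (\<integral>\<^sup>+t\<in>{0<..}. (if ennreal t <= s then \<rho> t else 0) \<partial>lborel) \<partial>\<Phi>)"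
   by (intro nn_integral_cong) auto
  finally show ?thesis .
 qed
 have T12: "surv \<infinity> * emeasure \<Phi> {\<infinity>} * (k \<infinity> * v None)
  + (\<integral>\<^sup>+t. surv t * indicator {0<..<\<infinity>} t * (\<integral>\<^sup>+y. k t * v (Some y) \<partial>\<Gamma>') \<partial>\<Phi>)
  = (\<integral>\<^sup>+s. (if s = \<infinity> then surv \<infinity> * k \<infinity> * v None else surv s * k s * \<gamma>) \<partial>\<Phi>)"
 proof -
  have "surv \<infinity> * emeasure \<Phi> {\<infinity>} * (k \<infinity> * v None)
   = (\<integral>\<^sup>+s. surv \<infinity> * k \<infinity> * v None * indicator {\<infinity>} s \<partial>\<Phi>)"
   by (subst nn_integral_cmult_indicator[OF I]) (simp add: mult_ac)
  moreover have "(\<integral>\<^sup>+t. surv t * indicator {0<..<\<infinity>} t * (\<integral>\<^sup>+y. k t * v (Some y) \<partial>\<Gamma>') \<partial>\<Phi>)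
   = (\<integral>\<^sup>+t. surv t * k t * \<gamma> * indicator {0<..<\<infinity>} t \<partial>\<Phi>)"
   unfolding \<gamma>_def by (intro nn_integral_cong) (simp add: nn_integral_cmult measurable_cong_sets[OF Gam1_sets[OF n h] refl] vS mult_ac)
  ultimately have "surv \<infinity> * emeasure \<Phi> {\<infinity>} * (k \<infinity> * v None)
    + (\<integral>\<^sup>+t. surv t * indicator {0<..<\<infinity>} t * (\<integral>\<^sup>+y. k t * v (Some y) \<partial>\<Gamma>') \<partial>\<Phi>)
   = (\<integral>\<^sup>+s. surv \<infinity> * k \<infinity> * v None * indicator {\<infinity>} s + surv s * k s * \<gamma> * indicator {0<..<\<infinity>} s \<partial>\<Phi>)"
  proof (subst nn_integral_add)
   show "(%s. surv \<infinity> * k \<infinity> * v None * indicator {\<infinity>} s) \<in> borel_measurable \<Phi>"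
    using I by (intro borel_measurable_times_ennreal borel_measurable_const borel_measurable_indicator)
   have [measurable]: "(%s. indicator {0<..<\<infinity>} s :: ennreal) \<in> borel_measurable \<Phi>"
    by (rule measurable_compose[OF id\<Phi>]) simp
   show "(%s. surv s * k s * \<gamma> * indicator {0<..<\<infinity>} s) \<in> borel_measurable \<Phi>" by measurable
  qed simp
  also have "... = (\<integral>\<^sup>+s. (if s = \<infinity> then surv \<infinity> * k \<infinity> * v None else surv s * k s * \<gamma>) \<partial>\<Phi>)"
  proof (rule nn_integral_cong)
   fix s assume "s \<in> space \<Phi>"
   then have "0 < s" using sp\<Phi> by simp
   then show "surv \<infinity> * k \<infinity> * v None * indicator {\<infinity>} s + surv s * k s * \<gamma> * indicator {0<..<\<infinity>} s
    = (if s = \<infinity> then surv \<infinity> * k \<infinity> * v None else surv s * k s * \<gamma>)"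
    by (cases "s = \<infinity>") (auto simp: indicator_def less_top[symmetric])
  qed
  finally show ?thesis .
 qed
 have m1: "(%s. \<integral>\<^sup>+t\<in>{0<..}. (if ennreal t <= s then \<rho> t else 0) \<partial>lborel) \<in> borel_measurable \<Phi>"
 proof -
  have [measurable]: "(%z. \<rho> (snd z) * indicator {0<..} (snd z)) \<in> borel_measurable (\<Phi> \<Otimes>\<^sub>M lborel)"
   by (rule measurable_compose[OF _ \<rho>m]) simp
  have [measurable]: "fst \<in> \<Phi> \<Otimes>\<^sub>M lborel \<rightarrow>\<^sub>M borel" by (rule measurable_compose[OF measurable_fst id\<Phi>])
  have "(%z. (if ennreal (snd z) <= fst z then 1 else 0) * (\<rho> (snd z) * indicator {0<..} (snd z))) \<in> borel_measurable (\<Phi> \<Otimes>\<^sub>M lborel)"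
   by measurable
  from lborel.borel_measurable_nn_integral_fst[OF this]
  have "(%s. \<integral>\<^sup>+t. (if ennreal t <= s then 1 else 0) * (\<rho> t * indicator {0<..} t) \<partial>lborel) \<in> borel_measurable \<Phi>" by simp
  moreover have "(\<integral>\<^sup>+t. (if ennreal t <= s then 1 else 0) * (\<rho> t * indicator {0<..} t) \<partial>lborel)
    = (\<integral>\<^sup>+t\<in>{0<..}. (if ennreal t <= s then \<rho> t else 0) \<partial>lborel)" for s
   by (intro nn_integral_cong) auto
  ultimately show ?thesis by simp
 qed
 have m2: "(%s. if s = \<infinity> then surv \<infinity> * k \<infinity> * v None else surv s * k s * \<gamma>) \<in> borel_measurable \<Phi>"
 proof (rule measurable_If)
  show "(%s. surv s * k s * \<gamma>) \<in> borel_measurable \<Phi>" by measurable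
  have "{x \<in> space \<Phi>. x = \<infinity>} = {\<infinity>}" unfolding sp\<Phi> by auto
  then show "{x \<in> space \<Phi>. x = \<infinity>} \<in> sets \<Phi>" using I by simp
 qed simp
 have "(\<integral>\<^sup>+z. k (fst z) * v (snd z) \<partial>Gker M u n h) = GI n h (%z. k (fst z) * v (snd z))"
  by (rule nn_integral_Gker[OF n h fm])
 also have "... = (\<integral>\<^sup>+s. (if s = \<infinity> then surv \<infinity> * k \<infinity> * v None else surv s * k s * \<gamma>) \<partial>\<Phi>)
   + (\<integral>\<^sup>+s. (\<integral>\<^sup>+t\<in>{0<..}. (if ennreal t <= s then \<rho> t else 0) \<partial>lborel) \<partial>\<Phi>)"
  unfolding GI_def fst_conv snd_conv T12[symmetric] T3[symmetric] ..
 also have "... = (\<integral>\<^sup>+s. (\<integral>\<^sup>+t\<in>{0<..}. (if ennreal t <= s then \<rho> t else 0) \<partial>lborel)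
   + (if s = \<infinity> then surv \<infinity> * k \<infinity> * v None else surv s * k s * \<gamma>) \<partial>\<Phi>)"
  by (subst nn_integral_add[OF m1 m2]) (rule add.commute)
 finally show ?thesis unfolding \<rho>_def \<gamma>_def .
qed

lemma rate_None:
 assumes "xbar_at M n h = None" "0 < t"
 shows "f \<in> borel_measurable SM ==> (\<integral>\<^sup>+y. f y \<partial>\<nu> t) = 0" "crate n h t = 0" "emeasure (\<nu> t) S = 0"
 using nn_integral_lam[OF n h assms(2), of f] assms(1)
 by (simp_all add: crate_def lam_def)

lemma Lam_None:
 assumes "xbar_at M n h = None"
 shows "\<Lambda> T = 0" "\<kappa> T = 0"
proof -
 have "\<Lambda> T = (\<integral>\<^sup>+s. 0 \<partial>(lborel :: real measure))" "\<kappa> T = (\<integral>\<^sup>+s. 0 \<partial>(lborel :: real measure))"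
  unfolding Lam_def kap_def using rate_None(2,3)[OF assms]
  by (intro nn_integral_cong, simp add: indicator_def)+
 then show "\<Lambda> T = 0" "\<kappa> T = 0" by simp_all
qed

context
 fixes x
 assumes hx: "xbar_at M n h = Some x"
begin

lemma hist_x: "x \<in> S"
 by (rule xbar_at_space[OF h hx])

lemma Pi_facts:
 assumes "0 < t"
 shows "prob_space (\<pi> t)" "sets (\<pi> t) = sets (gradM M)" "space (\<pi> t) = AG"
 using Pi_prob[OF n h assms] by (auto simp: space_prob_algebra dest: sets_eq_imp_space_eq)

lemma relaxed_bound:
 assumes t: "0 < t" and f: "!!a. a \<in> AG ==> f a <= ennreal C"
 shows "(\<integral>\<^sup>+a. f a \<partial>\<pi> t) <= ennreal C"
proof -
 interpret prob_space "\<pi> t" by (rule Pi_facts[OF t])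
 have "(\<integral>\<^sup>+a. f a \<partial>\<pi> t) <= (\<integral>\<^sup>+a. ennreal C \<partial>\<pi> t)"
  by (intro nn_integral_mono f) (simp add: Pi_facts[OF t])
 then show ?thesis by (simp add: emeasure_space_1)
qed

lemma rate_eq:
 assumes t: "0 < t"
 shows "emeasure (\<nu> t) S = (\<integral>\<^sup>+a. ennreal (jump_rate M x a) \<partial>\<pi> t)"
  and "crate n h t = (\<integral>\<^sup>+a. ennreal (costG M x a) \<partial>\<pi> t)"
proof -
 have "emeasure (\<nu> t) S = (\<integral>\<^sup>+y. indicator S y \<partial>\<nu> t)"
  using S_sets sets_lam[OF n h t] by simp
 also have "... = (\<integral>\<^sup>+a. (\<integral>\<^sup>+y. indicator S y \<partial>qtilde M x a) \<partial>\<pi> t)"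
  using nn_integral_lam[OF n h t, of "indicator S"] S_sets by (simp add: hx)
 also have "... = (\<integral>\<^sup>+a. ennreal (jump_rate M x a) \<partial>\<pi> t)"
  using S_sets by (intro nn_integral_cong) (simp add: sets_qtilde Pi_facts[OF t] emeasure_qtilde_S hist_x)
 finally show "emeasure (\<nu> t) S = (\<integral>\<^sup>+a. ennreal (jump_rate M x a) \<partial>\<pi> t)" .
qed (simp add: crate_def hx)

lemma w_dominates: "a \<in> AG ==> jump_rate M x a <= w x" "a \<in> AG ==> costG M x a <= w x"
 using w_bounds[OF hist_x, of a] cG_nonneg[OF hist_x, of a] by auto

lemma rate_bound: "0 < t ==> emeasure (\<nu> t) S <= ennreal (w x)" "0 < t ==> crate n h t <= ennreal (w x)"
 by (auto simp: rate_eq intro!: relaxed_bound ennreal_leI w_dominates)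

lemma rate_real: "0 < t ==> ennreal (qr n h t) = emeasure (\<nu> t) S" "0 < t ==> ennreal (cr n h t) = crate n h t"
 using rate_bound[of t] by (auto simp: qr_def cr_def less_top[symmetric] top_unique intro!: ennreal_enn2real)

lemma sojourn: "sojourn (cr n h) (qr n h) (w x)"
proof
 show "cr n h \<in> borel_measurable borel" unfolding cr_def[abs_def] by (rule slice_measurable[OF h crate_measurable[OF n]])
 show "qr n h \<in> borel_measurable borel" unfolding qr_def[abs_def] by (rule slice_measurable[OF h rate_measurable[OF n]])
 have w0: "0 <= w x" using w_ge_1 hist_x by fastforce
 show "0 <= cr n h t & cr n h t <= w x" "0 <= qr n h t & qr n h t <= w x" for t
  using rate_bound[of t] w0 by (auto simp: cr_def qr_def intro: enn2real_leI)
qed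

lemma Lam_eq: "\<Lambda> T = upto_int (qr n h) T" and kap_eq: "\<kappa> T = upto_int (cr n h) T"
 unfolding Lam_def kap_def upto_int_def by (auto intro!: nn_integral_cong simp: rate_real split: split_indicator)

end

subsection \<open>The jump kernel is stochastic\<close>

text \<open>Conditionally on the time \<open>s\<close> of the next impulse, a natural jump before \<open>s\<close> and its
absence exhaust all possibilities.\<close>
lemma Gker_mass:
 shows "emeasure (Gker M u n h) (space CM) = 1"
proof -
 interpret P: prob_space "\<Phi>" using Phi_prob[OF n h] by (simp add: space_prob_algebra)
 have G1: "(\<integral>\<^sup>+y. 1 \<partial>\<Gamma>') = 1"
  using Gam1_prob[OF n h] by (simp add: space_prob_algebra prob_space.emeasure_space_1)
 have G0: "(\<integral>\<^sup>+x. (\<integral>\<^sup>+y. 1 \<partial>\<Gamma> t x) \<partial>\<nu> t) = emeasure (\<nu> t) S" if t: "0 < t" for t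
 proof -
  have sp: "space (\<nu> t) = S" using sets_eq_imp_space_eq[OF sets_lam[OF n h t]] by simp
  have "(\<integral>\<^sup>+x. (\<integral>\<^sup>+y. 1 \<partial>\<Gamma> t x) \<partial>\<nu> t) = (\<integral>\<^sup>+x. 1 \<partial>\<nu> t)"
   using Gam0_prob[OF n h t] by (intro nn_integral_cong) (simp add: sp space_prob_algebra prob_space.emeasure_space_1)
  then show ?thesis by (simp add: sp)
 qed
 let ?J = "%s. \<integral>\<^sup>+t\<in>{0<..}. (if ennreal t <= s then surv (ennreal t) * 1 *
     (\<integral>\<^sup>+x. (\<integral>\<^sup>+y. 1 \<partial>\<Gamma> t x) \<partial>\<nu> t) else 0) \<partial>lborel"
 have F: "?J s + (if s = \<infinity> then surv \<infinity> * 1 * 1 else surv s * 1 * (\<integral>\<^sup>+y. 1 \<partial>\<Gamma>')) = 1"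
  if s: "0 < s" for s
 proof (cases "xbar_at M n h")
  case None
  note L = Lam_None[OF None]
  have "?J s = (\<integral>\<^sup>+t. 0 \<partial>(lborel :: real measure))"
  proof (intro nn_integral_cong)
   fix t :: real
   have "(\<integral>\<^sup>+x. (\<integral>\<^sup>+y. 1 \<partial>\<Gamma> t x) \<partial>\<nu> t) = 0" if "0 < t"
    using that by (simp only: G0 rate_None(3)[OF None])
   then show "(if ennreal t <= s then surv (ennreal t) * 1 *
     (\<integral>\<^sup>+x. (\<integral>\<^sup>+y. 1 \<partial>\<Gamma> t x) \<partial>\<nu> t) else 0) * indicator {0<..} t = 0"
    using if_indicator_cong[of t _ 0 "ennreal t <= s"] by (simp only: mult_zero_right if_cancel mult_zero_left)
  qed
  then show ?thesis by (simp only: G1 L) (simp add: exp_neg_def)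
 next
  case (Some x)
  interpret sojourn "cr n h" "qr n h" "w x" by (rule sojourn[OF Some])
  have a: "?J s = (\<integral>\<^sup>+t\<in>{0<..}. (if ennreal t <= s then ennreal (D t * qr n h t) else 0) \<partial>lborel)"
  proof (intro nn_integral_cong)
   fix t :: real
   have "surv (ennreal t) * 1 * (\<integral>\<^sup>+x. (\<integral>\<^sup>+y. 1 \<partial>\<Gamma> t x) \<partial>\<nu> t) = ennreal (D t * qr n h t)" if "0 < t"
    using that D_pos[of t] qB[of t]
    by (simp only: G0 Lam_eq[OF Some] weights(2) less_imp_le rate_real(1)[OF Some, symmetric] mult_1_right)
      (simp add: ennreal_mult)
   then show "(if ennreal t <= s then surv (ennreal t) * 1 *
     (\<integral>\<^sup>+x. (\<integral>\<^sup>+y. 1 \<partial>\<Gamma> t x) \<partial>\<nu> t) else 0) * indicator {0<..} t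
    = (if ennreal t <= s then ennreal (D t * qr n h t) else 0) * indicator {0<..} t"
    by (rule if_indicator_cong)
  qed
  show ?thesis
  proof (cases s)
   case (real r)
   have r: "0 < r" using s real by simp
   have "(\<integral>\<^sup>+t\<in>{0<..}. (if ennreal t <= s then ennreal (D t * qr n h t) else 0) \<partial>lborel) = (\<integral>\<^sup>+t\<in>{0<..r}. ennreal (D t * qr n h t) \<partial>lborel)"
    using real by (intro nn_integral_cong) (auto simp: indicator_def ennreal_le_iff)
   then show ?thesis unfolding a G1 using mass_finite[of r] r real
    by (simp add: Lam_eq[OF Some] weights(2))
  next
   case top
   then show ?thesis unfolding a using mass_infinite by (simp add: Lam_eq[OF Some])
  qed
 qed
 have "emeasure (Gker M u n h) (space CM) = (\<integral>\<^sup>+z. 1 * 1 \<partial>Gker M u n h)"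
  using sets_eq_imp_space_eq[OF sets_Gker[OF n h]] by simp
 also have "... = (\<integral>\<^sup>+s. ?J s + (if s = \<infinity> then surv \<infinity> * 1 * 1
   else surv s * 1 * (\<integral>\<^sup>+y. 1 \<partial>\<Gamma>')) \<partial>\<Phi>)"
  by (rule nn_integral_Gker_product) auto
 also have "... = (\<integral>\<^sup>+s. 1 \<partial>\<Phi>)"
  by (intro nn_integral_cong F) (simp only: Phi_space[OF n h] greaterThan_iff)
 also have "... = 1" by (simp add: P.emeasure_space_1)
 finally show ?thesis .
qed

subsection \<open>Lower bound for one stage\<close>

lemma kap_slice: "(%s. exp_pos (\<kappa> s)) \<in> borel_measurable borel"
 using measurable_compose[OF measurable_compose[OF measurable_Pair1'[OF h] kap_measurable[OF n]] exp_pos_measurable] by simp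

lemma nn_integral_Gker_no_impulse:
 assumes one: "emeasure (\<Phi>) {\<infinity>} = 1"
  and k: "k \<in> borel_measurable borel" and v: "v \<in> borel_measurable (cemetery (YM M))"
 shows "(\<integral>\<^sup>+z. k (fst z) * v (snd z) \<partial>Gker M u n h) =
  (\<integral>\<^sup>+t\<in>{0<..}. surv (ennreal t) * k (ennreal t) *
     jumped v t \<partial>lborel)
   + surv \<infinity> * k \<infinity> * v None"
proof -
 interpret P: prob_space "\<Phi>" using Phi_prob[OF n h] by (simp add: space_prob_algebra)
 have "P.prob {\<infinity>} = 1" using one by (simp add: measure_def)
 from P.AE_prob_1[OF this] have AE: "AE s in \<Phi>. s = \<infinity>" by simp
 let ?J = "%s. \<integral>\<^sup>+t\<in>{0<..}. (if ennreal t <= s then surv (ennreal t) * k (ennreal t) *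
     jumped v t else 0) \<partial>lborel"
 have "(\<integral>\<^sup>+z. k (fst z) * v (snd z) \<partial>Gker M u n h) =
  (\<integral>\<^sup>+s. ?J s + (if s = \<infinity> then surv \<infinity> * k \<infinity> * v None
     else surv s * k s * (\<integral>\<^sup>+y. v (Some y) \<partial>\<Gamma>')) \<partial>\<Phi>)"
  by (rule nn_integral_Gker_product[OF k v])
 also have "... = (\<integral>\<^sup>+s. ?J \<infinity> + surv \<infinity> * k \<infinity> * v None \<partial>\<Phi>)"
  by (rule nn_integral_cong_AE, rule AE_mp[OF AE], rule AE_I2, rule impI) (simp only: refl if_True simp_thms)
 also have "... = ?J \<infinity> + surv \<infinity> * k \<infinity> * v None" by (simp only: nn_integral_const P.emeasure_space_1 mult_1_right)
 finally show ?thesis by (simp only: infinity_ennreal_def top_greatest if_True)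
qed

text \<open>An infinite intervention forces \<open>\<Phi>\<close> to be concentrated at \<open>\<infinity>\<close>, and
there are neither natural jumps nor running costs.\<close>
lemma stage_None:
 assumes None: "xbar_at M n h = None" and gm: "g \<in> borel_measurable SM"
 shows "(\<integral>\<^sup>+z. exp_pos (\<kappa> (fst z)) * pay g (snd z) \<partial>Gker M u n h) = 1"
proof -
 obtain y where y: "y \<in> Yset M" "snd (h n) = Some y" using hist_coord[OF h n] by auto
 then have "y \<in> Yinf M" using None xbar_None_iff[of y] by (simp add: xbar_at_def Ypath_def)
 then have one: "emeasure (\<Phi>) {\<infinity>} = 1" using y by (intro Phi_inf[OF n h]) (simp add: Ypath_def)
 let ?f = "%t. surv (ennreal t) * exp_pos (\<kappa> (ennreal t)) * jumped (pay g) t"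
 have "(\<integral>\<^sup>+t\<in>{0<..}. ?f t \<partial>lborel) = (\<integral>\<^sup>+t. 0 \<partial>(lborel :: real measure))"
 proof (intro nn_integral_cong)
  fix t :: real
  have "\<nu> t = null_measure SM" by (simp add: lam_def None)
  then show "?f t * indicator {0<..} t = 0" by simp
 qed
 then have "(\<integral>\<^sup>+t\<in>{0<..}. ?f t \<partial>lborel) = 0" by (simp only: nn_integral_const mult_zero_left)
 then show ?thesis
  using nn_integral_Gker_no_impulse[OF one kap_slice pay_measurable[OF gm]]
  by (simp add: Lam_None[OF None] exp_neg_def exp_pos_0)
qed

text \<open>Pointwise in the time \<open>s\<close> of the next impulse. Averaging the subsolution property of \<open>V
j\<close> over the relaxed control turns it into the drift condition of \<open>sojourn_finite\<close> and
\<open>sojourn_infinite\<close>. The jumps earn the factor \<open>af j\<close> through the drift, the impulse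
at time \<open>s\<close> earns it by \<open>PYstar_lower\<close>.\<close>
lemma stage_lower:
 assumes \<beta>: "0 <= \<beta>" "\<beta> <= 1"
 shows "ext (kill \<beta> (V j)) (xbar_at M n h) <= (\<integral>\<^sup>+z. exp_pos (\<kappa> (fst z)) * pay (kill (\<beta> * af j) (V j)) (snd z) \<partial>Gker M u n h)"
proof -
 let ?\<alpha> = "af j" and ?g = "kill \<beta> (V j)" and ?g' = "kill (\<beta> * af j) (V j)"
 have \<alpha>: "0 <= ?\<alpha>" "?\<alpha> < 1" using af by auto
 have \<beta>\<alpha>: "0 <= \<beta> * ?\<alpha>" "\<beta> * ?\<alpha> <= 1" using \<alpha> \<beta> by (auto intro: mult_le_one)
 interpret P: prob_space "\<Phi>" using Phi_prob[OF n h] by (simp add: space_prob_algebra)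
 have g'm: "?g' \<in> borel_measurable SM" by (intro kill_measurable V_measurable)
 let ?R = "%s. (\<integral>\<^sup>+t\<in>{0<..}. (if ennreal t <= s then surv (ennreal t) * exp_pos (\<kappa> (ennreal t)) *
     jumped (pay ?g') t else 0) \<partial>lborel)
   + (if s = \<infinity> then surv \<infinity> * exp_pos (\<kappa> \<infinity>) * pay ?g' None
     else surv s * exp_pos (\<kappa> s) * (\<integral>\<^sup>+y. pay ?g' (Some y) \<partial>\<Gamma>'))"
 have eq: "(\<integral>\<^sup>+z. exp_pos (\<kappa> (fst z)) * pay ?g' (snd z) \<partial>Gker M u n h) = (\<integral>\<^sup>+s. ?R s \<partial>\<Phi>)"
  by (rule nn_integral_Gker_product[OF kap_slice pay_measurable[OF g'm]])
 have const: "(\<integral>\<^sup>+s. c \<partial>\<Phi>) = c" for c :: ennreal by (simp add: P.emeasure_space_1)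
 show ?thesis
 proof (cases "xbar_at M n h")
  case None
  then show ?thesis using stage_None[OF None g'm] by simp
 next
  case (Some x)
  note x = hist_x[OF Some]
  interpret sojourn "cr n h" "qr n h" "w x" by (rule sojourn[OF Some])
  let ?v = "%x. enn2real (V j x)"
  define U where "U = \<beta> * (?v x - 1)"
  have kr: "kill \<beta>' (V j) z = ennreal (1 + \<beta>' * (?v z - 1))" "1 <= ?v z" "?v z <= real (j + 1)"
   if "z \<in> S" "0 <= \<beta>'" "\<beta>' <= 1" for z \<beta>'
   using kill_real[OF V_le V_ge1[OF that(1)] that(2,3), of j] by auto
  have U0: "0 <= U" using kr(2)[OF x, of 1] \<beta> by (simp add: U_def)
  have gx: "?g x = ennreal (1 + U)" "?g' x = ennreal (1 + ?\<alpha> * U)"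
   using kr(1)[OF x \<beta>] kr(1)[OF x \<beta>\<alpha>] by (simp_all add: U_def ac_simps)
  \<comment> \<open>expected payoff rate of natural jumps\<close>
  define p where "p t = (if 0 < t then enn2real (\<integral>\<^sup>+z. ?g' z \<partial>\<nu> t) else 0)" for t
  let ?C = "(1 + real (j + 1)) * w x"
  have w0: "0 <= w x" using w_ge_1 x by fastforce
  have C0: "0 <= ?C" using w0 by simp
  have g'K: "?g' z <= ennreal (1 + real (j + 1))" and g'1: "1 <= ?g' z" if z: "z \<in> S" for z
  proof -
   have "(\<beta> * ?\<alpha>) * (?v z - 1) <= 1 * real (j + 1)" using kr(2,3)[OF z \<beta>\<alpha>] \<beta>\<alpha> by (intro mult_mono) auto
   then show "?g' z <= ennreal (1 + real (j + 1))" unfolding kr(1)[OF z \<beta>\<alpha>] by (intro ennreal_leI) simp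
   show "1 <= ?g' z" using \<beta>\<alpha> V_ge1[OF z] by (intro kill_ge1)
  qed
  have lp: "(\<integral>\<^sup>+z. ?g' z \<partial>\<nu> t) = ennreal (p t)" and pC: "p t <= ?C" and qp: "qr n h t <= p t" if t: "0 < t" for t
  proof -
   note sl = sets_lam[OF n h t]
   have sp: "space (\<nu> t) = S" using sets_eq_imp_space_eq[OF sl] by simp
   have "(\<integral>\<^sup>+z. ?g' z \<partial>\<nu> t) <= (\<integral>\<^sup>+z. ennreal (1 + real (j + 1)) \<partial>\<nu> t)"
    by (intro nn_integral_mono g'K) (simp add: sp)
   also have "... = ennreal (1 + real (j + 1)) * emeasure (\<nu> t) S" by (simp add: sp)
   also have "... <= ennreal (1 + real (j + 1)) * ennreal (w x)" by (intro mult_left_mono rate_bound[OF Some t]) simp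
   also have "... = ennreal ?C" using w0 by (simp add: ennreal_mult)
   finally have le: "(\<integral>\<^sup>+z. ?g' z \<partial>\<nu> t) <= ennreal ?C" .
   then show lp: "(\<integral>\<^sup>+z. ?g' z \<partial>\<nu> t) = ennreal (p t)"
    using t by (auto simp: p_def less_top[symmetric] top_unique intro!: ennreal_enn2real[symmetric])
   show "p t <= ?C" using le C0 unfolding lp by (simp add: ennreal_le_iff)
   have "ennreal (qr n h t) = (\<integral>\<^sup>+z. 1 \<partial>\<nu> t)" using rate_real(1)[OF Some t] by (simp add: sp)
   also have "... <= ennreal (p t)" unfolding lp[symmetric] by (intro nn_integral_mono g'1) (simp add: sp)
   finally show "qr n h t <= p t" using t by (simp add: p_def ennreal_le_iff)
  qed
  have pm: "p \<in> borel_measurable borel"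
  proof -
   have "(%z. ?g' (snd z)) \<in> borel_measurable ((HT n) \<Otimes>\<^sub>M SM)" using g'm by measurable
   from lam_measurable[OF n this] have "(%z. \<integral>\<^sup>+y. ?g' y \<partial>lam M u n (fst z) (snd z)) \<in> borel_measurable (HT n)" by simp
   from slice_measurable[OF h this] show ?thesis unfolding p_def[abs_def] .
  qed
  have drift: "(1 - ?\<alpha>) * U <= p t + (cr n h t - qr n h t) * (1 + U)" if t: "0 < t" for t
  proof -
   interpret Pt: prob_space "\<pi> t" by (rule Pi_facts[OF Some t])
   note sP = Pi_facts(2)[OF Some t] and spP = Pi_facts(3)[OF Some t]
   have m1: "(%a. \<integral>\<^sup>+y. ?g' y \<partial>qtilde M x a) \<in> borel_measurable (\<pi> t)"
   proof -
    have "(%z. ?g' (snd z)) \<in> borel_measurable (SM \<Otimes>\<^sub>M SM)" using g'm by measurable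
    from measurable_compose[of "%a. ((x, x), a)" "gradM M", OF _ qtilde_int_measurable[OF this]] x
    show ?thesis by (simp add: measurable_cong_sets[OF sP refl])
   qed
   have m2: "(%a. ennreal (costG M x a)) \<in> borel_measurable (\<pi> t)"
    using measurable_compose[of "%a. (x, a)" "gradM M", OF _ cG_meas] x by (simp add: measurable_cong_sets[OF sP refl])
   have m3: "(%a. ennreal (jump_rate M x a)) \<in> borel_measurable (\<pi> t)"
    using measurable_compose[of "%a. (x, a)" "gradM M", OF _ q_meas[OF sing_SM[OF x]]] x
    by (simp add: measurable_cong_sets[OF sP refl] jump_rate_def)
   have pt: "ennreal ((1 - ?\<alpha>) * U) + ennreal (jump_rate M x a) * ennreal (1 + U)
     <= (\<integral>\<^sup>+y. ?g' y \<partial>qtilde M x a) + ennreal (costG M x a) * ennreal (1 + U)" if a: "a \<in> AG" for a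
   proof -
    let ?I = "\<integral>\<^sup>+y. ?g' y \<partial>qtilde M x a"
    note wb = w_bounds[OF x a] and j0 = jump_nonneg[OF x a] and c0 = cG_nonneg[OF x a]
    have "?g x <= bell ?g' x a"
     by (rule bell_kill[OF x _ _ _ \<beta>]) (use a \<alpha> V_subsolution[OF x] in auto)
    then have "ennreal (w x - costG M x a) * ?g x <= ennreal (w x - costG M x a) * bell ?g' x a" by (rule mult_left_mono) simp
    also have "... = ?I + ennreal (w x - jump_rate M x a) * ?g' x" by (rule bell_G[OF x a g'm])
    finally have le: "ennreal ((w x - costG M x a) * (1 + U)) <= ?I + ennreal ((w x - jump_rate M x a) * (1 + ?\<alpha> * U))"
     unfolding gx using wb U0 \<alpha> by (simp add: ennreal_mult)
    show ?thesis
    proof (cases ?I)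
     case (real I)
     have "0 <= (w x - jump_rate M x a) * (1 + ?\<alpha> * U)" using wb U0 \<alpha> by (intro mult_nonneg_nonneg add_nonneg_nonneg) auto
     then have "(w x - costG M x a) * (1 + U) <= I + (w x - jump_rate M x a) * (1 + ?\<alpha> * U)"
      using le real by (simp add: ennreal_plus[symmetric] ennreal_le_iff del: ennreal_plus)
     moreover have "1 * ((1 - ?\<alpha>) * U) <= (w x - jump_rate M x a) * ((1 - ?\<alpha>) * U)" using wb U0 \<alpha> by (intro mult_right_mono) auto
     ultimately have "(1 - ?\<alpha>) * U + jump_rate M x a * (1 + U) <= I + costG M x a * (1 + U)" by (simp add: algebra_simps)
     then have "ennreal ((1 - ?\<alpha>) * U + jump_rate M x a * (1 + U)) <= ennreal (I + costG M x a * (1 + U))" by (rule ennreal_leI)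
     moreover have "ennreal ((1 - ?\<alpha>) * U + jump_rate M x a * (1 + U)) = ennreal ((1 - ?\<alpha>) * U) + ennreal (jump_rate M x a) * ennreal (1 + U)"
      using U0 \<alpha> j0 by (simp only: ennreal_mult[symmetric] ennreal_plus[symmetric] add_nonneg_nonneg mult_nonneg_nonneg zero_le_one diff_ge_0_iff_ge less_imp_le)
     moreover have "ennreal (I + costG M x a * (1 + U)) = ?I + ennreal (costG M x a) * ennreal (1 + U)"
      using U0 real c0 by (simp only: ennreal_mult[symmetric] ennreal_plus[symmetric] add_nonneg_nonneg mult_nonneg_nonneg zero_le_one)
     ultimately show ?thesis by (simp only:)
    qed simp
   qed
   have "ennreal ((1 - ?\<alpha>) * U) + emeasure (\<nu> t) S * ennreal (1 + U)
    = (\<integral>\<^sup>+a. ennreal ((1 - ?\<alpha>) * U) + ennreal (jump_rate M x a) * ennreal (1 + U) \<partial>\<pi> t)"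
    unfolding rate_eq(1)[OF Some t] using m3 by (simp add: nn_integral_add nn_integral_multc Pt.emeasure_space_1 del: ennreal_plus)
   also have "... <= (\<integral>\<^sup>+a. (\<integral>\<^sup>+y. ?g' y \<partial>qtilde M x a) + ennreal (costG M x a) * ennreal (1 + U) \<partial>\<pi> t)"
    by (intro nn_integral_mono pt) (simp add: spP)
   also have "... = (\<integral>\<^sup>+z. ?g' z \<partial>\<nu> t) + crate n h t * ennreal (1 + U)"
    unfolding rate_eq(2)[OF Some t] using m1 m2 nn_integral_lam[OF n h t g'm]
    by (simp add: nn_integral_add nn_integral_multc Some del: ennreal_plus)
   finally have "ennreal ((1 - ?\<alpha>) * U) + ennreal (qr n h t) * ennreal (1 + U) <= ennreal (p t) + ennreal (cr n h t) * ennreal (1 + U)"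
    unfolding rate_real[OF Some t] lp[OF t] .
   moreover have p0: "0 <= p t" by (simp add: p_def)
   moreover have "0 <= qr n h t" "0 <= cr n h t" using qB cB by auto
   ultimately have "ennreal ((1 - ?\<alpha>) * U + qr n h t * (1 + U)) <= ennreal (p t + cr n h t * (1 + U))"
    using U0 \<alpha> by (simp add: ennreal_mult[symmetric] ennreal_plus[symmetric] del: ennreal_plus)
   then have "(1 - ?\<alpha>) * U + qr n h t * (1 + U) <= p t + cr n h t * (1 + U)"
    using p0 cB[of t] U0 by (subst (asm) ennreal_le_iff) auto
   then show ?thesis by (simp add: algebra_simps)
  qed
  have pC': "p t <= ?C" and qp': "qr n h t <= p t" for t
   using pC[of t] qp[of t] C0 by (cases "0 < t"; simp add: p_def qr_def)+
  have l0: "ennreal (p t) <= jumped (pay ?g') t" if t: "0 < t" for t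
   unfolding lp[OF t, symmetric]
  proof (rule nn_integral_mono)
   fix z assume "z \<in> space (\<nu> t)"
   then have z: "z \<in> S" using sets_eq_imp_space_eq[OF sets_lam[OF n h t]] by simp
   show "?g' z <= (\<integral>\<^sup>+y. pay ?g' (Some y) \<partial>\<Gamma> t z)"
    using PY_lower[OF Gam0_PY[OF n h t z] z \<beta>\<alpha>] by simp
  qed
  have l1: "ennreal (1 + U) <= (\<integral>\<^sup>+y. pay ?g' (Some y) \<partial>\<Gamma>')"
   using PYstar_lower[OF Gam1_PY[OF n h Some] x \<beta>, of j] gx by simp
  have wt: "surv (ennreal t) * exp_pos (\<kappa> (ennreal t)) = ennreal (E t)" if "0 <= t" for t
   using weights(1)[OF that] by (simp add: Lam_eq[OF Some] kap_eq[OF Some])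
  have R: "ennreal (1 + U) <= ?R s" if s: "0 < s" for s
  proof (cases s)
   case (real r)
   then have r: "0 < r" using s by simp
   have "ennreal (1 + U) <= (\<integral>\<^sup>+t\<in>{0<..r}. ennreal (E t * p t) \<partial>lborel) + ennreal (E r * (1 + U))"
    by (rule sojourn_finite[OF pm pC' qp' U0 _ drift]) (use r \<alpha> in auto)
   also have "... <= ?R s"
   proof (rule add_mono)
    show "(\<integral>\<^sup>+t\<in>{0<..r}. ennreal (E t * p t) \<partial>lborel) <= (\<integral>\<^sup>+t\<in>{0<..}. (if ennreal t <= s then surv (ennreal t) * exp_pos (\<kappa> (ennreal t)) *
     jumped (pay ?g') t else 0) \<partial>lborel)"
    proof (rule nn_integral_mono)
     fix t :: real
     show "ennreal (E t * p t) * indicator {0<..r} t <= (if ennreal t <= s then surv (ennreal t) * exp_pos (\<kappa> (ennreal t)) *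
      jumped (pay ?g') t else 0) * indicator {0<..} t"
     proof (cases "t \<in> {0<..r}")
      case True
      then have t: "0 < t" "ennreal t <= s" using real by (auto intro: ennreal_leI)
      have "ennreal (E t * p t) = ennreal (E t) * ennreal (p t)"
       using E_pos[of t] by (intro ennreal_mult) (auto simp: p_def less_imp_le)
      also have "... <= ennreal (E t) * jumped (pay ?g') t"
       by (rule mult_left_mono[OF l0[OF t(1)]]) simp
      finally show ?thesis using True t wt[of t] by (simp del: pay_simps)
     qed simp
    qed
    have "ennreal (E r * (1 + U)) = ennreal (E r) * ennreal (1 + U)" using E_pos[of r] U0 by (intro ennreal_mult) auto
    also have "... <= surv s * exp_pos (\<kappa> s) * (\<integral>\<^sup>+y. pay ?g' (Some y) \<partial>\<Gamma>')"
     using wt[of r] r real by (simp only: less_imp_le) (rule mult_left_mono[OF l1], simp)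
    finally show "ennreal (E r * (1 + U)) <= (if s = \<infinity> then surv \<infinity> * exp_pos (\<kappa> \<infinity>) * pay ?g' None
     else surv s * exp_pos (\<kappa> s) * (\<integral>\<^sup>+y. pay ?g' (Some y) \<partial>\<Gamma>'))"
     using real by (simp del: pay_simps ennreal_plus)
   qed
   finally show ?thesis .
  next
   case top
   have "ennreal (1 + U) <= (\<integral>\<^sup>+t\<in>{0<..}. ennreal (E t * p t) \<partial>lborel) + exp_neg (upto_int (qr n h) \<infinity>) * exp_pos (upto_int (cr n h) \<infinity>)"
    by (rule sojourn_infinite[OF pm pC' qp' U0 _ drift]) (use \<alpha> in auto)
   also have "... <= ?R s"
   proof (rule add_mono)
    show "(\<integral>\<^sup>+t\<in>{0<..}. ennreal (E t * p t) \<partial>lborel) <= (\<integral>\<^sup>+t\<in>{0<..}. (if ennreal t <= s then surv (ennreal t) * exp_pos (\<kappa> (ennreal t)) *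
     jumped (pay ?g') t else 0) \<partial>lborel)"
    proof (rule nn_integral_mono)
     fix t :: real
     show "ennreal (E t * p t) * indicator {0<..} t <= (if ennreal t <= s then surv (ennreal t) * exp_pos (\<kappa> (ennreal t)) *
      jumped (pay ?g') t else 0) * indicator {0<..} t"
     proof (cases "0 < t")
      case True
      have "ennreal (E t * p t) = ennreal (E t) * ennreal (p t)"
       using E_pos[of t] by (intro ennreal_mult) (auto simp: p_def less_imp_le)
      also have "... <= ennreal (E t) * jumped (pay ?g') t"
       by (rule mult_left_mono[OF l0[OF True]]) simp
      finally show ?thesis using True top wt[of t] by (simp del: pay_simps)
     qed simp
    qed
   qed (simp add: top Lam_eq[OF Some] kap_eq[OF Some])
   finally show ?thesis .
  qed
  have "ext ?g (Some x) = (\<integral>\<^sup>+s. ennreal (1 + U) \<partial>\<Phi>)" using const gx by simp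
  also have "... <= (\<integral>\<^sup>+s. ?R s \<partial>\<Phi>)"
   by (rule nn_integral_mono) (use R Phi_space[OF n h] in "simp del: pay_simps ennreal_plus")
  finally show ?thesis unfolding eq Some .
 qed
qed

subsection \<open>Upper bound for one stage\<close>

text \<open>With constant rates the sojourn is exponential. If \<open>q = 0\<close>, then conservation forces \<open>c =
0\<close> and nothing more happens. Otherwise it forces \<open>c < q\<close>, and the jumps earn at most
\<open>(q - c) g x \<integral>exp ((c - q) t) dt = g x\<close>.\<close>
lemma stage_upper:
 assumes Some: "xbar_at M n h = Some x"
  and one: "emeasure (\<Phi>) {\<infinity>} = 1" and a: "a \<in> AG" and Pi: "!!t. 0 < t ==> \<pi> t = return (gradM M) a"
  and gm: "g \<in> borel_measurable SM" and g1: "!!z. z \<in> S ==> 1 <= g z" and g'm: "g' \<in> borel_measurable SM"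
  and conserving: "bell g x a <= g x"
  and next_imp: "!!t z. 0 < t ==> z \<in> S ==> (\<integral>\<^sup>+y. pay g' (Some y) \<partial>\<Gamma> t z) <= g z"
 shows "(\<integral>\<^sup>+z. exp_pos (\<kappa> (fst z)) * pay g' (snd z) \<partial>Gker M u n h) <= g x"
proof (cases "g x = \<infinity>")
 case False
 note x = hist_x[OF Some]
 interpret sojourn "cr n h" "qr n h" "w x" by (rule sojourn[OF Some])
 note wb = w_bounds[OF x a] and q0 = jump_nonneg[OF x a] and c0 = cG_nonneg[OF x a]
 let ?q = "jump_rate M x a" and ?c = "costG M x a" and ?I = "\<integral>\<^sup>+y. g y \<partial>qtilde M x a"
 obtain r where r: "g x = ennreal r" "1 <= r"
  using False g1[OF x] by (cases "g x") (auto simp: ennreal_le_iff)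
 have "?I + ennreal (w x - ?q) * g x = ennreal (w x - ?c) * bell g x a" by (rule bell_G[OF x a gm, symmetric])
 also have "... <= ennreal (w x - ?c) * g x" by (rule mult_left_mono[OF conserving]) simp
 finally have le: "?I + ennreal ((w x - ?q) * r) <= ennreal ((w x - ?c) * r)"
  using wb r by (simp add: ennreal_mult)
 then have "?I ~= \<infinity>" by (auto simp: top_unique)
 then obtain i where i: "?I = ennreal i" "0 <= i" by (cases ?I) auto
 have "i + (w x - ?q) * r <= (w x - ?c) * r"
  using le i r wb by (simp add: ennreal_plus[symmetric] ennreal_le_iff del: ennreal_plus)
 then have ile: "i <= (?q - ?c) * r" by (simp add: algebra_simps)
 have qi: "?q <= i"
 proof -
  have "ennreal ?q = (\<integral>\<^sup>+y. 1 \<partial>qtilde M x a)"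
   using sets_eq_imp_space_eq[OF sets_qtilde] by (simp add: emeasure_qtilde_S[OF x a])
  also have "... <= ?I" by (rule nn_integral_mono) (use sets_eq_imp_space_eq[OF sets_qtilde] g1 in auto)
  finally show ?thesis using i by (simp add: ennreal_le_iff)
 qed
 have rates: "cr n h t = ?c" "qr n h t = ?q" if t: "0 < t" for t
 proof -
  have "ennreal (cr n h t) = ennreal ?c" "ennreal (qr n h t) = ennreal ?q"
   unfolding rate_real[OF Some t] rate_eq[OF Some t] Pi[OF t] using a measurable_compose[of "%a. (x, a)" "gradM M", OF _ cG_meas] measurable_compose[of "%a. (x, a)" "gradM M", OF _ q_meas[OF sing_SM[OF x]]] x
   by (simp_all add: nn_integral_return jump_rate_def)
  then show "cr n h t = ?c" "qr n h t = ?q" using cB[of t] qB[of t] c0 q0 by (simp_all add: ennreal_inj)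
 qed
 have lamI: "(\<integral>\<^sup>+z. g z \<partial>\<nu> t) = ennreal i" if t: "0 < t" for t
 proof -
  have "(%z. g (snd z)) \<in> borel_measurable (SM \<Otimes>\<^sub>M SM)" using gm by measurable
  from measurable_compose[of "%a. ((x, x), a)" "gradM M", OF _ qtilde_int_measurable[OF this]] x
  have "(%a. \<integral>\<^sup>+y. g y \<partial>qtilde M x a) \<in> borel_measurable (gradM M)" by simp
  then show ?thesis using nn_integral_lam[OF n h t gm] a i by (simp add: Some Pi[OF t] nn_integral_return)
 qed
 have jump: "(\<integral>\<^sup>+z. (\<integral>\<^sup>+y. pay g' (Some y) \<partial>\<Gamma> t z) \<partial>\<nu> t) <= ennreal i" if t: "0 < t" for t
  unfolding lamI[OF t, symmetric]
  by (intro nn_integral_mono next_imp[OF t]) (use sets_eq_imp_space_eq[OF sets_lam[OF n h t]] in simp)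
 have wt: "surv (ennreal t) * exp_pos (\<kappa> (ennreal t)) = ennreal (E t)" if "0 <= t" for t
  using weights(1)[OF that] by (simp add: Lam_eq[OF Some] kap_eq[OF Some])
 have "(\<integral>\<^sup>+z. exp_pos (\<kappa> (fst z)) * pay g' (snd z) \<partial>Gker M u n h) =
  (\<integral>\<^sup>+t\<in>{0<..}. surv (ennreal t) * exp_pos (\<kappa> (ennreal t)) *
     jumped (pay g') t \<partial>lborel)
   + surv \<infinity> * exp_pos (\<kappa> \<infinity>) * pay g' None"
  by (rule nn_integral_Gker_no_impulse[OF one kap_slice pay_measurable[OF g'm]])
 also have "... <= (\<integral>\<^sup>+t\<in>{0<..}. ennreal (E t) * ennreal i \<partial>lborel) + surv \<infinity> * exp_pos (\<kappa> \<infinity>)"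
 proof (rule add_mono)
  show "(\<integral>\<^sup>+t\<in>{0<..}. surv (ennreal t) * exp_pos (\<kappa> (ennreal t)) *
     jumped (pay g') t \<partial>lborel) <= (\<integral>\<^sup>+t\<in>{0<..}. ennreal (E t) * ennreal i \<partial>lborel)"
   by (rule nn_integral_mono) (use wt mult_left_mono[OF jump] in "auto simp: indicator_def simp del: pay_simps")
 qed simp
 also have "... <= ennreal r"
 proof (cases "?q = 0")
  case True
  have "?c * r <= 0" using ile i True by simp
  then have "?c <= 0" using r by (simp add: mult_le_0_iff)
  then have c: "?c = 0" using c0 by simp
  then have "i = 0" using ile i True by simp
  moreover have "\<Lambda> \<infinity> = 0" "\<kappa> \<infinity> = 0"
   unfolding Lam_eq[OF Some] kap_eq[OF Some] upto_int_def using rates True c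
   by (auto intro!: nn_integral_zero' AE_I2 simp: indicator_def)
  ultimately show ?thesis using r by (simp add: exp_neg_def exp_pos_0)
 next
  case False
  then have q: "0 < ?q" using q0 by simp
  then have "0 < (?q - ?c) * r" using qi ile by simp
  then have d: "0 < ?q - ?c" using r by (simp add: zero_less_mult_iff)
  have "\<Lambda> \<infinity> = (\<integral>\<^sup>+t. ennreal ?q * indicator {0<..} t \<partial>(lborel :: real measure))"
   unfolding Lam_eq[OF Some] upto_int_def using rates(2) by (intro nn_integral_cong) (auto simp: indicator_def)
  also have "... = \<infinity>" using q by (simp add: nn_integral_cmult_indicator emeasure_lborel_Ioi ennreal_mult_top)
  finally have L: "surv \<infinity> = 0" by (simp add: exp_neg_def)
  \<comment> \<open>the density of an exponential sojourn with rate \<open>q - c\<close>\<close>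
  interpret S: sojourn "%_. 0" "%t. qr n h t - cr n h t" "w x"
  proof
   show "0 <= qr n h t - cr n h t & qr n h t - cr n h t <= w x" for t
    using rates[of t] d wb c0 B0 by (cases "0 < t") (auto simp: qr_def cr_def)
  qed (use B0 in auto)
  have ED: "S.D t = E t" for t
   using S.cumint_q[of t] by (simp add: S.D_def E_def)
  have "(\<integral>\<^sup>+t\<in>{0<..}. ennreal (E t) * ennreal i \<partial>lborel) <= (\<integral>\<^sup>+t\<in>{0<..}. ennreal r * (ennreal (S.D t * (qr n h t - cr n h t))) \<partial>lborel)"
  proof (rule nn_integral_mono)
   fix t :: real
   have "ennreal (E t) * ennreal i <= ennreal r * ennreal (S.D t * (qr n h t - cr n h t))" if t: "0 < t"
   proof -
    have "E t * i <= E t * ((?q - ?c) * r)" using E_pos[of t] ile by simp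
    then have "ennreal (E t * i) <= ennreal (r * (E t * (?q - ?c)))" by (intro ennreal_leI) (simp add: ac_simps)
    then show ?thesis unfolding ED rates[OF t] using E_pos[of t] i r d by (simp add: ennreal_mult)
   qed
   then show "ennreal (E t) * ennreal i * indicator {0<..} t <= ennreal r * ennreal (S.D t * (qr n h t - cr n h t)) * indicator {0<..} t"
    by (simp add: indicator_def)
  qed
  also have "... = ennreal r * (\<integral>\<^sup>+t\<in>{0<..}. ennreal (S.D t * (qr n h t - cr n h t)) \<partial>lborel)"
   by (subst nn_integral_cmult[symmetric]) (auto simp: mult.assoc)
  also have "... <= ennreal r * 1" by (rule mult_left_mono[OF ennreal_summand_le[OF S.mass_infinite]]) simp
  finally show ?thesis by (simp add: L[unfolded infinity_ennreal_def])
 qed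
 finally show ?thesis by (simp add: r)
qed simp

end

lemma Gker_prob: "1 <= n ==> h \<in> space (HM n) ==> prob_space (Gker M u n h)"
 using Gker_mass[of n h] sets_eq_imp_space_eq[OF sets_Gker, of n h] by (intro prob_spaceI) simp

lemma Gker_measurable: "1 <= n ==> Gker M u n \<in> HM n \<rightarrow>\<^sub>M prob_algebra CM"
proof (rule measurable_prob_algebraI)
 assume n: "1 <= n"
 show "prob_space (Gker M u n h)" if "h \<in> space (HM n)" for h by (rule Gker_prob[OF n that])
 show "Gker M u n \<in> HM n \<rightarrow>\<^sub>M subprob_algebra CM"
 proof (rule measurable_subprob_algebra)
  show "subprob_space (Gker M u n h)" if "h \<in> space (HM n)" for h using Gker_prob[OF n that] by (rule prob_space_imp_subprob_space)
  show "sets (Gker M u n h) = sets CM" if "h \<in> space (HM n)" for h by (rule sets_Gker[OF n that])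
  fix B assume B: "B \<in> sets CM"
  have "(%h. GI n h (indicator B)) \<in> borel_measurable (HM n)" using B by (intro GI_measurable[OF n]) simp
  then show "(%h. emeasure (Gker M u n h) B) \<in> borel_measurable (HM n)"
   by (rule measurable_cong[THEN iffD1, rotated])
     (use B in "simp add: Gker_eq[OF n] emeasure_functional[OF GI_functional[OF n]]")
 qed
qed

end

section \<open>The law of the controlled process\<close>

context controlled
begin

lemma Gker_support:
 assumes n: "1 <= n" and h: "h \<in> space (HM n)"
 shows "AE z in Gker M u n h. z \<in> {0<..<\<infinity>} \<times> Some ` Yset M | z = (\<infinity>, None)"
proof -
 let ?B = "space CM - ({0<..<\<infinity>} \<times> Some ` Yset M \<union> {(\<infinity>, None)})"
 have B: "?B \<in> sets CM" by measurable
 have "emeasure (Gker M u n h) ?B = GI n h (indicator ?B)"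
  using nn_integral_Gker[OF n h, of "indicator ?B"] B sets_Gker[OF n h] by simp
 also have "... = 0"
 proof -
  have z: "(\<integral>\<^sup>+y. indicator ?B (t, Some y) \<partial>\<mu>) = 0" if "0 < t" "t < \<infinity>" "sets \<mu> = sets (YM M)" for t \<mu>
   using that sets_eq_imp_space_eq[OF that(3)] by (intro nn_integral_zero' AE_I2) (auto simp: indicator_def)
  have K: "(\<integral>\<^sup>+t. exp_neg (Lam M u n h t) * indicator {0<..<\<infinity>} t * (\<integral>\<^sup>+y. indicator ?B (t, Some y) \<partial>pol_Gam1 u n h) \<partial>pol_Phi u n h) = 0"
  proof (intro nn_integral_zero' AE_I2)
   fix t
   show "exp_neg (Lam M u n h t) * indicator {0<..<\<infinity>} t * (\<integral>\<^sup>+y. indicator ?B (t, Some y) \<partial>pol_Gam1 u n h) = 0"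
    by (cases "t \<in> {0<..<\<infinity>}") (simp_all add: z[OF _ _ Gam1_sets[OF n h], simplified])
  qed
  moreover let ?J = "%t. \<integral>\<^sup>+x. emeasure (pol_Phi u n h) {ennreal t..} * exp_neg (Lam M u n h (ennreal t))
    * (\<integral>\<^sup>+y. indicator ?B (ennreal t, Some y) \<partial>pol_Gam0 u n h t x) \<partial>lam M u n h t"
  have J: "?J t = 0" if t: "0 < t" for t
  proof (intro nn_integral_zero' AE_I2)
   fix x assume "x \<in> space (lam M u n h t)"
   then have x: "x \<in> S" using sets_eq_imp_space_eq[OF sets_lam[OF n h t]] by simp
   show "emeasure (pol_Phi u n h) {ennreal t..} * exp_neg (Lam M u n h (ennreal t))
    * (\<integral>\<^sup>+y. indicator ?B (ennreal t, Some y) \<partial>pol_Gam0 u n h t x) = 0"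
    using z[OF _ _ Gam0_sets[OF n h t x], of "ennreal t"] t by simp
  qed
  have "(\<integral>\<^sup>+t. 1 * ?J t \<partial>restrict_space lborel {0<..}) = 0"
   by (intro nn_integral_zero' AE_I2) (simp only: J space_restrict_space Int_iff greaterThan_iff mult_zero_right)
  then show ?thesis unfolding GI_def by (simp only: K) simp
 qed
 finally have "emeasure (Gker M u n h) ?B = 0" .
 moreover have "?B \<in> sets (Gker M u n h)" using B sets_Gker[OF n h] by simp
 ultimately have "AE z in Gker M u n h. z \<notin> ?B" by (intro AE_not_in null_setsI)
 then show ?thesis
  by (rule AE_mp, intro AE_I2 impI) (use sets_eq_imp_space_eq[OF sets_Gker[OF n h]] in auto)
qed

lemma pol_init_law: "x \<in> S ==> pol_init u x \<in> space (prob_algebra (YM M)) & pol_init u x \<in> PY M x"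
 using u beta_prob by (fastforce simp: policies_def PY_kernels_def PY_def)

lemma y_init_Yset: "x \<in> S ==> y_init x \<in> Yset M"
 by (auto simp: y_init_def Yset_def Yfin_def intro!: exI[of _ 0])

lemma upto_Suc: "{0..<Suc n} = {..n}"
 by auto

lemma step_IT:
 assumes x: "x \<in> S"
 shows "Ionescu_Tulcea (gi_step M u x) (%_. CM)"
proof -
 have m: "gi_step M u x i \<in> PiM {0..<i} (%_. CM) \<rightarrow>\<^sub>M prob_algebra CM" for i
 proof -
  consider "i = 0" | "i = 1" | n where "i = Suc n" "1 <= n" by (cases i; cases "i - 1") auto
  then show ?thesis
  proof cases
   case 1
   note y = y_init_Yset[OF x]
   have "(0, Some (y_init x)) \<in> space CM" using y by (auto simp: space_CM)
   then have "return CM (0, Some (y_init x)) \<in> space (prob_algebra CM)" by (simp add: space_prob_algebra prob_space_return)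
   then show ?thesis unfolding 1 gi_step_def by simp
  next
   case 2
   note i = conjunct1[OF pol_init_law[OF x]]
   have "(%y. (0::ennreal, Some y)) \<in> YM M \<rightarrow>\<^sub>M CM" by (rule Pair_Some_measurable)
   then have "distr (pol_init u x) CM (%y. (0, Some y)) \<in> space (prob_algebra CM)"
    using i by (auto simp: space_prob_algebra measurable_cong_sets[of "pol_init u x" "YM M"] intro!: prob_space.prob_space_distr)
   then show ?thesis unfolding 2 gi_step_def by simp
  next
   case 3
   have "(%h. if h \<in> Hset M n then Gker M u n h else return CM (\<infinity>, None)) \<in> PiM {..n} (%_. CM) \<rightarrow>\<^sub>M prob_algebra CM"
   proof (subst measurable_If_restrict_space_iff)
    show "{h \<in> space (PiM {..n} (%_. CM)). h \<in> Hset M n} \<in> sets (PiM {..n} (%_. CM))"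
     using Hset_sets[OF 3(2)] by (simp add: Int_def conj_commute)
    have "return CM (\<infinity>, None) \<in> space (prob_algebra CM)" by (simp add: space_prob_algebra prob_space_return space_CM)
    moreover have "{h. h \<in> Hset M n} = Hset M n" by simp
    ultimately show "Gker M u n \<in> restrict_space (PiM {..n} (%_. CM)) {h. h \<in> Hset M n} \<rightarrow>\<^sub>M prob_algebra CM &
      (%h. return CM (\<infinity>, None)) \<in> restrict_space (PiM {..n} (%_. CM)) {h. h \<notin> Hset M n} \<rightarrow>\<^sub>M prob_algebra CM"
     using Gker_measurable[OF 3(2)] by (simp add: histM_def)
   qed
   then show ?thesis
    using 3(2) unfolding 3(1) upto_Suc gi_step_def[abs_def] by (simp cong: if_cong)
  qed
 qed
 show ?thesis
  by (rule Ionescu_Tulcea.intro[OF measurable_prob_algebraD[OF m]])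
    (use measurable_space[OF m] in "simp add: space_prob_algebra")
qed

subsection \<open>Almost every path is a sample path\<close>

text \<open>The one-step description of \<open>Omega\<close>: it is both measurable and almost sure coordinate by
coordinate.\<close>
definition good :: "nat => (nat => ennreal \<times> (nat => 'x option \<times> 'a option) option) => bool" where
 "good n om \<longleftrightarrow> (if n <= 1 then om n \<in> {0} \<times> Some ` Yset M
   else if om \<in> Hset M (n - 1) then om n \<in> {0<..<\<infinity>} \<times> Some ` Yset M | om n = (\<infinity>, None) else om n = (\<infinity>, None))"

lemma good_01:
 assumes "om 0 \<in> {0} \<times> Some ` Yset M" "om 1 \<in> {0} \<times> Some ` Yset M" "n <= 1"
 shows "good n om"
proof -
 have "n = 0 | n = 1" using assms(3) by auto
 then show ?thesis using assms by (auto simp: good_def)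
qed

lemma Hset_Suc: "1 <= n ==> om \<in> Hset M (Suc n) \<longleftrightarrow> om \<in> Hset M n & om (Suc n) \<in> {0<..<\<infinity>} \<times> Some ` Yset M"
proof -
 assume n: "1 <= n"
 then have "{2..Suc n} = insert (Suc n) {2..n}" by auto
 then show ?thesis by (auto simp: Hset_def)
qed

lemma Hset_1: "om \<in> Hset M 1 \<longleftrightarrow> om 0 \<in> {0} \<times> Some ` Yset M & om 1 \<in> {0} \<times> Some ` Yset M"
 by (auto simp: Hset_def)

lemma Hset_mono: "1 <= m ==> m <= n ==> om \<in> Hset M n ==> om \<in> Hset M m"
 by (auto simp: Hset_def)

lemma Hset_restrict: "1 <= n ==> n <= m ==> restrict om {..m} \<in> Hset M n \<longleftrightarrow> om \<in> Hset M n"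
 by (auto simp: Hset_def)

lemma Omega_good: "om \<in> Omega M \<longleftrightarrow> (\<forall>n. good n om)"
proof
 assume o: "om \<in> Omega M"
 have 01: "om 0 \<in> {0} \<times> Some ` Yset M" "om 1 \<in> {0} \<times> Some ` Yset M" using o by (auto simp: Omega_def)
 consider "\<forall>n\<ge>2. om n \<in> {0<..<\<infinity>} \<times> Some ` Yset M"
  | m where "1 <= m" "\<forall>n\<in>{2..m}. om n \<in> {0<..<\<infinity>} \<times> Some ` Yset M" "\<forall>n>m. om n = (\<infinity>, None)"
  using o unfolding Omega_def by blast
 then show "\<forall>n. good n om"
 proof cases
  case 1
  have "om \<in> Hset M n" for n using 01 1 by (simp add: Hset_def)
  then show ?thesis using good_01[OF 01] 1[rule_format] by (auto simp: good_def)
 next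
  case 2
  have H: "om \<in> Hset M n \<longleftrightarrow> n <= m" if "1 <= n" for n
  proof
   assume "n <= m" then show "om \<in> Hset M n" using 01 2 by (auto simp: Hset_def)
  next
   assume h: "om \<in> Hset M n"
   show "n <= m"
   proof (rule ccontr)
    assume "\<not> n <= m"
    then have "om n = (\<infinity>, None)" "n \<in> {2..n}" using 2 by auto
    then show False using h unfolding Hset_def by fastforce
   qed
  qed
  show ?thesis
  proof
   fix n show "good n om"
   proof (cases "n <= 1")
    case True then show ?thesis by (rule good_01[OF 01])
   next
    case False
    then show ?thesis using H[of "n - 1"] 2(2)[rule_format, of n] 2(3)[rule_format, of n]
     by (cases "n <= m") (auto simp: good_def)
   qed
  qed
 qed
next
 assume g: "\<forall>n. good n om"
 have 01: "om 0 \<in> {0} \<times> Some ` Yset M" "om 1 \<in> {0} \<times> Some ` Yset M"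
  using g[rule_format, of 0] g[rule_format, of 1] by (simp_all add: good_def)
 show "om \<in> Omega M"
 proof (cases "\<forall>n\<ge>1. om \<in> Hset M n")
  case True
  have "om n \<in> {0<..<\<infinity>} \<times> Some ` Yset M" if "2 <= n" for n
   using True[rule_format, of n] that unfolding Hset_def by auto
  then show ?thesis using 01 by (auto simp: Omega_def)
 next
  case False
  then obtain k where k: "1 <= k" "om \<notin> Hset M k" by auto
  define m where "m = (LEAST k. 1 <= Suc k & om \<notin> Hset M (Suc k))"
  have m: "om \<notin> Hset M (Suc m)" unfolding m_def by (rule LeastI2[of _ "k - 1"]) (use k in auto)
  have m1: "1 <= m" using m 01 by (cases m) (auto simp: Hset_def)
  have Hm: "om \<in> Hset M m"
  proof (rule ccontr)
   assume "om \<notin> Hset M m"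
   then have "m <= m - 1" unfolding m_def using m1 by (intro Least_le) (simp add: m_def)
   then show False using m1 by simp
  qed
  have N: "om n = (\<infinity>, None)" if "m < n" for n
  proof (cases "n = Suc m")
   case True
   then show ?thesis using g[rule_format, of n] Hm m m1 Hset_Suc[OF m1, of om] by (auto simp: good_def)
  next
   case False
   then have "Suc m <= n - 1" using that by linarith
   then have "om \<notin> Hset M (n - 1)" using m Hset_mono[of "Suc m" "n - 1" om] by auto
   then show ?thesis using g[rule_format, of n] that m1 by (simp add: good_def)
  qed
  have "\<forall>n\<in>{2..m}. om n \<in> {0<..<\<infinity>} \<times> Some ` Yset M" using Hm by (simp add: Hset_def)
  with N m1 01 show ?thesis unfolding Omega_def by blast
 qed
qed

lemma Hset_pred:
 assumes n: "1 <= n" and J: "{..n} \<subseteq> J"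
 shows "{om \<in> space (PiM J (%_. CM)). om \<in> Hset M n} \<in> sets (PiM J (%_. CM))"
proof -
 have "(%om. restrict om {..n}) \<in> PiM J (%_. CM) \<rightarrow>\<^sub>M PiM {..n} (%_. CM)" by (rule measurable_restrict_subset[OF J])
 from measurable_sets[OF this Hset_sets[OF n]]
 have "(%om. restrict om {..n}) -` (Hset M n \<inter> space (PiM {..n} (%_. CM))) \<inter> space (PiM J (%_. CM)) \<in> sets (PiM J (%_. CM))" .
 moreover have "(%om. restrict om {..n}) -` (Hset M n \<inter> space (PiM {..n} (%_. CM))) \<inter> space (PiM J (%_. CM))
   = {om \<in> space (PiM J (%_. CM)). om \<in> Hset M n}"
  using Hset_restrict[OF n order_refl] J by (auto simp: space_PiM PiE_iff extensional_def subset_eq)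
 ultimately show ?thesis by simp
qed

lemma good_pred:
 assumes J: "{..n} \<subseteq> J"
 shows "{om \<in> space (PiM J (%_. CM)). good n om} \<in> sets (PiM J (%_. CM))"
proof -
 have [measurable]: "(%om. om n) \<in> PiM J (%_. CM) \<rightarrow>\<^sub>M CM" by (rule measurable_component_singleton) (use J in auto)
 have c: "{om \<in> space (PiM J (%_. CM)). om n \<in> B} \<in> sets (PiM J (%_. CM))" if [measurable]: "B \<in> sets CM" for B by measurable
 show ?thesis
 proof (cases "n <= 1")
  case True
  then show ?thesis using c[OF coord_sets(1)] by (simp add: good_def)
 next
  case False
  have H: "{om \<in> space (PiM J (%_. CM)). om \<in> Hset M (n - 1)} \<in> sets (PiM J (%_. CM))"
   by (rule Hset_pred) (use False J in auto)
  have "{om \<in> space (PiM J (%_. CM)). (om \<in> Hset M (n - 1) & om n \<in> {0<..<\<infinity>} \<times> Some ` Yset M) | om n \<in> {(\<infinity>, None)}} \<in> sets (PiM J (%_. CM))"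
   by (intro sets.sets_Collect_disj sets.sets_Collect_conj H c coord_sets)
  moreover have "good n om \<longleftrightarrow> (om \<in> Hset M (n - 1) & om n \<in> {0<..<\<infinity>} \<times> Some ` Yset M) | om n \<in> {(\<infinity>, None)}" for om
   using False by (auto simp: good_def)
  ultimately show ?thesis by simp
 qed
qed

end

locale controlled_path = controlled +
 fixes x :: 'a
 assumes x: "x \<in> S"
begin

abbreviation PP :: "(nat => ennreal \<times> (nat => 'a option \<times> 'b option) option) measure" where
 "PP == path_measure (gi_step M u x) (%_. CM)"

sublocale IT: Ionescu_Tulcea "gi_step M u x" "%_. CM" by (rule step_IT[OF x])

lemma sets_PP: "sets PP = sets (PiM UNIV (%_. CM))" by (rule IT.sets_path_measure)

lemma space_PP: "space PP = space (PiM UNIV (%_. CM))" by (rule sets_eq_imp_space_eq[OF sets_PP])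

lemma hist_space: "om \<in> space PP ==> restrict om {0..<n} \<in> space (PiM {0..<n} (%_. CM))"
 by (auto simp: space_PP space_PiM)

lemma AE_Omega: "AE om in PP. om \<in> Omega M"
proof -
 have "AE om in PP. good n om" for n
 proof -
  let ?B = "{h \<in> space (PiM {0..<Suc n} (%_. CM)). \<not> good n h}"
  have B: "?B \<in> sets (PiM {0..<Suc n} (%_. CM))"
   by (intro sets.sets_Collect_neg good_pred) auto
  have "(\<integral>\<^sup>+om. indicator ?B (restrict om {0..<Suc n}) \<partial>PP)
   = (\<integral>\<^sup>+om. (\<integral>\<^sup>+z. indicator ?B (fun_upd (restrict om {0..<n}) n z) \<partial>gi_step M u x n (restrict om {0..<n})) \<partial>PP)"
   using B by (intro IT.nn_integral_path_Suc) simp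
  also have "... = (\<integral>\<^sup>+om. 0 \<partial>PP)"
  proof (rule nn_integral_cong)
   fix om assume om: "om \<in> space PP"
   let ?h = "restrict om {0..<n}"
   have AE: "AE z in gi_step M u x n ?h. good n (fun_upd ?h n z)"
   proof -
    consider "n = 0" | "n = 1" | m where "n = Suc m" "1 <= m" by (cases n; cases "n - 1") auto
    then show ?thesis
    proof cases
     case 1
     note y = y_init_Yset[OF x]
     have "{z \<in> space CM. z \<in> {0} \<times> Some ` Yset M} \<in> sets CM" by measurable
     then have "AE z in return CM (0, Some (y_init x)). z \<in> {0} \<times> Some ` Yset M"
      using y by (subst AE_return) (auto simp: space_CM pred_def)
     moreover have "gi_step M u x n ?h = return CM (0, Some (y_init x))" using 1 by (simp add: gi_step_def)
     ultimately show ?thesis using 1 by (simp only:) (simp add: good_def)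
    next
     case 2
     have s: "sets (pol_init u x) = sets (YM M)" using pol_init_law[OF x] by (simp add: space_prob_algebra)
     have "AE z in distr (pol_init u x) CM (%y. (0, Some y)). z \<in> {0} \<times> Some ` Yset M"
     proof (subst AE_distr_iff)
      show "(%y. (0, Some y)) \<in> pol_init u x \<rightarrow>\<^sub>M CM" using Pair_Some_measurable by (simp add: measurable_cong_sets[OF s refl])
      show "AE y in pol_init u x. (0, Some y) \<in> {0} \<times> Some ` Yset M" using sets_eq_imp_space_eq[OF s] by (intro AE_I2) auto
      show "{z \<in> space CM. z \<in> {0} \<times> Some ` Yset M} \<in> sets CM" by measurable
     qed
     moreover have "gi_step M u x n ?h = distr (pol_init u x) CM (%y. (0, Some y))" using 2 by (simp add: gi_step_def)
     ultimately show ?thesis using 2 by (simp only:) (simp add: good_def)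
    next
     case 3
     have c: "fun_upd ?h n z \<in> Hset M m \<longleftrightarrow> ?h \<in> Hset M m" for z using 3 by (auto simp: Hset_def)
     show ?thesis
     proof (cases "?h \<in> Hset M m")
      case True
      then have "?h \<in> space (HM m)" using hist_space[OF om, of n] 3 by (simp add: space_HM upto_Suc)
      from Gker_support[OF 3(2) this]
      have "AE z in Gker M u m ?h. good n (fun_upd ?h n z)" using 3 True c by (simp add: good_def)
      moreover have "gi_step M u x n ?h = Gker M u m ?h" using 3 True by (simp add: gi_step_def)
      ultimately show ?thesis by (simp only:)
     next
      case False
      have "{z \<in> space CM. z \<in> {(\<infinity>, None)}} \<in> sets CM" using coord_sets(3) by measurable
      then have "AE z in return CM (\<infinity>, None). z \<in> {(\<infinity>, None)}"
       by (subst AE_return) (simp_all only: pred_def, auto simp: space_CM)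
      then have "AE z in return CM (\<infinity>, None). good n (fun_upd ?h n z)" using 3 False c by (simp add: good_def)
      moreover have "gi_step M u x n ?h = return CM (\<infinity>, None)" using 3 False by (simp add: gi_step_def)
      ultimately show ?thesis by (simp only:)
     qed
    qed
   qed
   have "(\<integral>\<^sup>+z. indicator ?B (fun_upd ?h n z) \<partial>gi_step M u x n ?h) = (\<integral>\<^sup>+z. 0 \<partial>gi_step M u x n ?h)"
    by (rule nn_integral_cong_AE, rule AE_mp[OF AE], rule AE_I2) (auto simp: indicator_def)
   then show "(\<integral>\<^sup>+z. indicator ?B (fun_upd ?h n z) \<partial>gi_step M u x n ?h) = 0" by simp
  qed
  finally have "(\<integral>\<^sup>+om. indicator ?B (restrict om {0..<Suc n}) \<partial>PP) = 0" by simp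
  moreover have "(%om. indicator ?B (restrict om {0..<Suc n}) :: ennreal) \<in> borel_measurable PP"
   using B unfolding measurable_cong_sets[OF sets_PP refl]
   by (intro measurable_compose[OF measurable_restrict_subset]) auto
  ultimately have "AE om in PP. indicator ?B (restrict om {0..<Suc n}) = (0 :: ennreal)" by (simp add: nn_integral_0_iff_AE)
  then show ?thesis
  proof (rule AE_mp, intro AE_I2 impI)
   fix om assume om: "om \<in> space PP" and i: "indicator ?B (restrict om {0..<Suc n}) = (0 :: ennreal)"
   then have "good n (restrict om {0..<Suc n})" using hist_space[OF om, of "Suc n"] by (simp add: indicator_def split: if_splits)
   moreover have "restrict om {0..<Suc n} \<in> Hset M (n - 1) \<longleftrightarrow> om \<in> Hset M (n - 1)" if "1 < n"
    unfolding upto_Suc by (rule Hset_restrict) (use that in auto)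
   ultimately show "good n om" by (auto simp: good_def split: if_splits)
  qed
 qed
 then show ?thesis unfolding Omega_good by (simp add: AE_all_countable)
qed

lemma Omega_sets: "Omega M \<inter> space PP \<in> sets PP"
proof -
 have "Omega M \<inter> space PP = {om \<in> space (PiM UNIV (%_. CM)). \<forall>n. good n om}" by (auto simp: Omega_good space_PP)
 also have "... \<in> sets (PiM UNIV (%_. CM))" by (intro sets.sets_Collect_countable_All good_pred) simp
 finally show ?thesis by (simp add: sets_PP)
qed

lemma nn_integral_gi_law:
 "(\<integral>\<^sup>+om. f om \<partial>gi_law M u x) = (\<integral>\<^sup>+om. f om * indicator (Omega M) om \<partial>PP)"
 unfolding gi_law_def by (rule nn_integral_restrict_space) (rule Omega_sets)

end

section \<open>Total cost\<close>

context controlled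
begin

definition CIY :: "nat => ('x, 'a) path => ennreal" where
 "CIY m om = (case snd (om m) of None => 0 | Some y => CI M y)"

definition cst :: "nat => ('x, 'a) path => ennreal" where
 "cst m om = (if om \<in> Hset M m then CIY m om + kap m (restrict om {..m}) (fst (om (Suc m))) else 0)"

definition R :: "nat => ('x, 'a) path => ennreal" where
 "R n om = exp_pos (\<Sum>m<n. cst (Suc m) om)"

text \<open>The exponential cost of the first \<open>n\<close> sojourns and interventions, times the payoff at the
beginning of the next one.\<close>
definition Zf :: "('x => ennreal) => nat => ('x, 'a) path => ennreal" where
 "Zf g n om = R n om * pay g (snd (om (Suc n)))"

lemma Hset_space_HM: "1 <= n ==> om \<in> Hset M n ==> restrict om {..n} \<in> space (HM n)"
proof -
 assume n: "1 <= n" and om: "om \<in> Hset M n"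
 have "om i \<in> space CM" if "i <= n" for i
 proof -
  have "i = 0 | i = 1 | i \<in> {2..n}" using that by auto
  then have "snd (om i) \<in> Some ` Yset M" using om by (auto simp: Hset_def mem_Times_iff)
  then show ?thesis by (auto simp: space_CM mem_Times_iff)
 qed
 then show ?thesis using om Hset_restrict[OF n order_refl] by (auto simp: space_HM space_PiM)
qed

lemma Omega_dichotomy:
 assumes om: "om \<in> Omega M" and n: "1 <= n"
 obtains y where "om \<in> Hset M n" "y \<in> Yset M" "snd (om n) = Some y" | "om \<notin> Hset M n" "om n = (\<infinity>, None)" "2 <= n"
proof (cases "om \<in> Hset M n")
 case True
 from hist_coord[OF Hset_space_HM[OF n True] n] obtain y where "y \<in> Yset M" "snd (om n) = Some y" by auto
 with True that show thesis by blast
next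
 case False
 have g: "good k om" for k using om by (simp add: Omega_good)
 have n2: "2 <= n"
 proof (rule ccontr)
  assume "\<not> 2 <= n"
  then have "n = 1" using n by simp
  then show False using False g[of 0] g[of 1] Hset_1[of om] by (simp add: good_def)
 qed
 then have "Suc (n - 1) = n" by simp
 then have "om n = (\<infinity>, None)"
  using g[of n] n2 False Hset_Suc[of "n - 1" om] by (auto simp: good_def split: if_splits)
 with False n2 that show thesis by blast
qed

lemma Omega_cases:
 assumes "om \<in> Omega M"
 obtains y where "om \<in> Hset M (Suc m)" "y \<in> Yset M" "snd (om (Suc m)) = Some y" | "om \<notin> Hset M (Suc m)" "om (Suc m) = (\<infinity>, None)" "1 <= m"
 using Omega_dichotomy[OF assms, of "Suc m" thesis] by auto

lemma crate_slice: "1 <= n ==> h \<in> space (HM n) ==> (%t. crate n h t * indicator {0<..} t) \<in> borel_measurable borel"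
 using measurable_compose[OF measurable_Pair1' measurable_extend_time[OF crate_measurable]] by simp

text \<open>Monotonicity of the jump times identifies \<open>xi\<close> on the \<open>n\<close>-th sojourn, and a
translation moves the sojourn to the origin.\<close>
lemma gradual_cost:
 assumes om: "om \<in> Omega M" and n: "1 <= n" and H: "om \<in> Hset M n"
 shows "(\<integral>\<^sup>+s\<in>{s. Tpath n om < ennreal s & ennreal s < Tpath (Suc n) om}. costG_rate M u n om s \<partial>lborel)
  = kap n (restrict om {..n}) (fst (om (Suc n)))"
proof -
 let ?h = "restrict om {..n}" and ?\<theta> = "fst (om (Suc n))"
 note h = Hset_space_HM[OF n H]
 have "fst (om i) ~= \<infinity>" if "i <= n" for i using hist_time[OF h that n] that by simp
 then have "Tpath n om ~= \<infinity>" unfolding Tpath_def by (simp add: less_top)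
 then obtain \<tau> where \<tau>: "0 <= \<tau>" "Tpath n om = ennreal \<tau>" by (cases "Tpath n om") auto
 have T: "Tpath (Suc n) om = ennreal \<tau> + ?\<theta>" using \<tau> by (simp add: Tpath_def)
 have mono: "Tpath i om <= Tpath k om" if "i <= k" for i k
  unfolding Tpath_def by (rule sum_mono2) (use that in auto)
 define F where "F r = crate n ?h r * indicator {0<..} r * (if ennreal r < ?\<theta> then 1 else 0)" for r
 have Fm: "F \<in> borel_measurable borel" unfolding F_def using crate_slice[OF n h] by measurable
 have eq: "costG_rate M u n om s * indicator {s. Tpath n om < ennreal s & ennreal s < Tpath (Suc n) om} s = F (- \<tau> + 1 * s)" for s
 proof (cases "\<tau> < s")
  case True
  then have s: "ennreal s = ennreal \<tau> + ennreal (s - \<tau>)" using \<tau> by (simp add: ennreal_plus[symmetric] del: ennreal_plus)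
  have lt: "ennreal s < Tpath (Suc n) om \<longleftrightarrow> ennreal (s - \<tau>) < ?\<theta>" unfolding T s by (simp add: ennreal_add_left_cancel_less)
  have lt2: "Tpath n om < ennreal s" using \<tau> True by (simp add: ennreal_less_iff)
  have "costG_rate M u n om s = crate n ?h (s - \<tau>)" if l: "ennreal s < Tpath (Suc n) om"
  proof -
   have u: "m = n" if m: "m \<ge> 1 & Tpath m om <= ennreal s & ennreal s < Tpath (Suc m) om" for m
   proof (rule ccontr)
    assume "m ~= n"
    then consider "Suc m <= n" | "Suc n <= m" by linarith
    then show False
     by cases (use m l lt2 mono[of "Suc m" n] mono[of "Suc n" m] in auto)
   qed
   have ex: "n \<ge> 1 & Tpath n om <= ennreal s & ennreal s < Tpath (Suc n) om" using n lt2 l by simp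
   then have "(THE n. n \<ge> 1 & Tpath n om <= ennreal s & ennreal s < Tpath (Suc n) om) = n" using u by blast
   then have "xi om s = Ypath n om" using ex unfolding xi_def by (metis (no_types, lifting))
   moreover have "enn2real (Tpath n om) = \<tau>" using \<tau> by simp
   ultimately show ?thesis unfolding costG_rate_def crate_def xbar_at_def Ypath_def by (simp split: option.split)
  qed
  then show ?thesis using True lt lt2 by (simp add: F_def indicator_def)
 next
  case False
  then have "\<not> Tpath n om < ennreal s" using \<tau> by (simp add: not_less ennreal_leI)
  then show ?thesis using False by (simp add: F_def)
 qed
 have "(\<integral>\<^sup>+s\<in>{s. Tpath n om < ennreal s & ennreal s < Tpath (Suc n) om}. costG_rate M u n om s \<partial>lborel) = (\<integral>\<^sup>+r. F r \<partial>lborel)"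
  unfolding eq using nn_integral_real_affine[OF Fm, of 1 "- \<tau>"] by simp
 also have "... = kap n ?h ?\<theta>"
  unfolding kap_def F_def by (intro nn_integral_cong) (auto simp: indicator_def)
 finally show ?thesis .
qed

lemma total_cost_eq:
 assumes om: "om \<in> Omega M"
 shows "total_cost M u om = (\<Sum>m. cst (Suc m) om)"
 unfolding total_cost_def Let_def
proof (rule suminf_cong)
 fix m
 show "(case Ypath (Suc m) om of None => 0 | Some y => CI M y)
   + (\<integral>\<^sup>+s\<in>{s. Tpath (Suc m) om < ennreal s & ennreal s < Tpath (Suc (Suc m)) om}. costG_rate M u (Suc m) om s \<partial>lborel) = cst (Suc m) om"
 proof (cases rule: Omega_cases[OF om, of m])
  case (1 y)
  then show ?thesis using gradual_cost[OF om _ 1(1)] by (simp add: cst_def CIY_def Ypath_def)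
 next
  case 2
  have "fst (om (Suc m)) <= Tpath (Suc m) om" unfolding Tpath_def by (rule member_le_sum) auto
  then have "Tpath (Suc m) om = \<infinity>" using 2 by (simp add: top_unique)
  then show ?thesis using 2 by (simp add: cst_def Ypath_def)
 qed
qed

lemma cst_cong: "(!!i. i <= Suc m ==> om i = om' i) ==> 1 <= m ==> cst m om = cst m om'"
proof -
 assume eq: "!!i. i <= Suc m ==> om i = om' i" and m: "1 <= m"
 have r: "restrict om {..m} = restrict om' {..m}" using eq by (auto simp: restrict_def)
 have "om \<in> Hset M m \<longleftrightarrow> om' \<in> Hset M m"
  using Hset_restrict[OF m order_refl, of om] Hset_restrict[OF m order_refl, of om'] by (simp only: r)
 then show ?thesis using eq[of m] eq[of "Suc m"] by (simp add: cst_def CIY_def r)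
qed

lemma R_cong: "(!!i. i <= Suc n ==> om i = om' i) ==> R n om = R n om'"
 unfolding R_def by (intro arg_cong[where f=exp_pos] sum.cong refl cst_cong) auto

lemma R_Suc: "R (Suc n) om = R n om * exp_pos (cst (Suc n) om)"
 by (simp add: R_def exp_pos_add)

lemma CIY_measurable:
 assumes "m \<in> J"
 shows "CIY m \<in> borel_measurable (PiM J (%_. CM))"
proof -
 have "(%o'. case o' of None => 0 | Some y => CI M y) \<in> borel_measurable (cemetery (YM M))"
  by (rule measurable_from_cemetery) auto
 moreover have "(%om. snd (om m)) \<in> PiM J (%_. CM) \<rightarrow>\<^sub>M cemetery (YM M)"
  using measurable_compose[OF measurable_component_singleton[OF assms, of "%_. CM"], of snd] by (simp add: coordM_def)
 ultimately show ?thesis unfolding CIY_def[abs_def] by (rule measurable_compose[rotated])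
qed

lemma cst_measurable:
 assumes m: "1 <= m" and J: "{..Suc m} \<subseteq> J"
 shows "cst m \<in> borel_measurable (PiM J (%_. CM))"
 unfolding cst_def[abs_def]
proof (subst measurable_If_restrict_space_iff)
 show "{om \<in> space (PiM J (%_. CM)). om \<in> Hset M m} \<in> sets (PiM J (%_. CM))" using J by (intro Hset_pred[OF m]) auto
 let ?N = "restrict_space (PiM J (%_. CM)) {om. om \<in> Hset M m}"
 have r: "(%om. restrict om {..m}) \<in> ?N \<rightarrow>\<^sub>M HM m"
  unfolding histM_def
 proof (rule measurable_restrict_space2)
  show "(%om. restrict om {..m}) \<in> space ?N \<rightarrow> Hset M m" using Hset_restrict[OF m order_refl] by (auto simp: space_restrict_space)
  show "(%om. restrict om {..m}) \<in> ?N \<rightarrow>\<^sub>M PiM {..m} (%_. CM)"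
   by (rule measurable_restrict_space1, rule measurable_restrict_subset) (use J in auto)
 qed
 have t: "(%om. fst (om (Suc m))) \<in> borel_measurable ?N"
  using measurable_restrict_space1[OF measurable_compose[OF measurable_component_singleton[of "Suc m" J "%_. CM"], of fst borel]] J
  by (simp add: coordM_def subset_eq)
 have "(%om. kap m (restrict om {..m}) (fst (om (Suc m)))) \<in> borel_measurable ?N"
  using measurable_compose[OF measurable_Pair[OF r t] kap_measurable[OF m]] by simp
 moreover have "CIY m \<in> borel_measurable ?N" by (intro measurable_restrict_space1 CIY_measurable) (use J in auto)
 ultimately show "(%om. CIY m om + kap m (restrict om {..m}) (fst (om (Suc m)))) \<in> borel_measurable ?N &
  (%om. 0) \<in> borel_measurable (restrict_space (PiM J (%_. CM)) {om. om \<notin> Hset M m})" by (intro conjI borel_measurable_add) auto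
qed

lemma R_measurable: "{..Suc n} \<subseteq> J ==> R n \<in> borel_measurable (PiM J (%_. CM))"
proof -
 assume J: "{..Suc n} \<subseteq> J"
 have "cst (Suc m) \<in> borel_measurable (PiM J (%_. CM))" if "m < n" for m
  by (rule cst_measurable) (use J that in auto)
 then have "(%om. \<Sum>m<n. cst (Suc m) om) \<in> borel_measurable (PiM J (%_. CM))" by (intro borel_measurable_sum) auto
 from measurable_compose[OF this exp_pos_measurable] show ?thesis unfolding R_def[abs_def] .
qed

lemma Zf_measurable:
 assumes g: "g \<in> borel_measurable SM" and J: "{..Suc n} \<subseteq> J"
 shows "Zf g n \<in> borel_measurable (PiM J (%_. CM))"
proof -
 have "(%om. snd (om (Suc n))) \<in> PiM J (%_. CM) \<rightarrow>\<^sub>M cemetery (YM M)"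
  using measurable_compose[OF measurable_component_singleton[of "Suc n" J "%_. CM"], of snd] J by (simp add: coordM_def subset_eq)
 from R_measurable[OF J] measurable_compose[OF this pay_measurable[OF g]] show ?thesis
  unfolding Zf_def[abs_def] by measurable
qed

end

context controlled_path
begin

lemma Zf_0:
 assumes g: "g \<in> borel_measurable SM"
 shows "(\<integral>\<^sup>+om. Zf g 0 om \<partial>PP) = (\<integral>\<^sup>+y. pay g (Some y) \<partial>pol_init u x)"
proof -
 interpret PP: prob_space PP by (rule IT.prob_space_path_measure)
 have s: "sets (pol_init u x) = sets (YM M)" using pol_init_law[OF x] by (simp add: space_prob_algebra)
 have pm: "(%z. pay g (snd z)) \<in> borel_measurable CM" unfolding coordM_def using pay_measurable[OF g] by measurable
 have "(\<integral>\<^sup>+om. Zf g 0 om \<partial>PP) = (\<integral>\<^sup>+om. Zf g 0 (restrict om {0..<Suc 1}) \<partial>PP)"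
  by (intro nn_integral_cong) (simp add: Zf_def R_def)
 also have "... = (\<integral>\<^sup>+om. (\<integral>\<^sup>+z. Zf g 0 (fun_upd (restrict om {0..<1}) 1 z) \<partial>gi_step M u x 1 (restrict om {0..<1})) \<partial>PP)"
  by (intro IT.nn_integral_path_Suc Zf_measurable g) auto
 also have "... = (\<integral>\<^sup>+om. (\<integral>\<^sup>+z. pay g (snd z) \<partial>distr (pol_init u x) CM (%y. (0, Some y))) \<partial>PP)"
  by (simp add: Zf_def R_def gi_step_def)
 also have "... = (\<integral>\<^sup>+z. pay g (snd z) \<partial>distr (pol_init u x) CM (%y. (0, Some y)))" by (simp add: PP.emeasure_space_1)
 also have "... = (\<integral>\<^sup>+y. pay g (Some y) \<partial>pol_init u x)"
  by (subst nn_integral_distr) (use Pair_Some_measurable pm in "simp_all add: measurable_cong_sets[OF s refl]")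
 finally show ?thesis .
qed

lemma Zf_Suc:
 assumes g: "g \<in> borel_measurable SM"
 shows "(\<integral>\<^sup>+om. Zf g (Suc n) om \<partial>PP) = (\<integral>\<^sup>+om. R n om * (if om \<in> Hset M (Suc n) then exp_pos (CIY (Suc n) om) *
   (\<integral>\<^sup>+z. exp_pos (kap (Suc n) (restrict om {..Suc n}) (fst z)) * pay g (snd z) \<partial>Gker M u (Suc n) (restrict om {..Suc n})) else 1) \<partial>PP)"
proof -
 let ?k = "Suc (Suc n)"
 have pm: "(%z. pay g (snd z)) \<in> borel_measurable CM" unfolding coordM_def using pay_measurable[OF g] by measurable
 have "(\<integral>\<^sup>+om. Zf g (Suc n) om \<partial>PP) = (\<integral>\<^sup>+om. Zf g (Suc n) (restrict om {0..<Suc ?k}) \<partial>PP)"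
  unfolding Zf_def by (intro nn_integral_cong arg_cong2[where f="(*)"] R_cong) auto
 also have "... = (\<integral>\<^sup>+om. (\<integral>\<^sup>+z. Zf g (Suc n) (fun_upd (restrict om {0..<?k}) ?k z) \<partial>gi_step M u x ?k (restrict om {0..<?k})) \<partial>PP)"
  by (intro IT.nn_integral_path_Suc Zf_measurable g) auto
 also have "... = (\<integral>\<^sup>+om. R n om * (if om \<in> Hset M (Suc n) then exp_pos (CIY (Suc n) om) *
   (\<integral>\<^sup>+z. exp_pos (kap (Suc n) (restrict om {..Suc n}) (fst z)) * pay g (snd z) \<partial>Gker M u (Suc n) (restrict om {..Suc n})) else 1) \<partial>PP)"
 proof (rule nn_integral_cong)
  fix om :: "('a, 'b) path"
  let ?h = "restrict om {..Suc n}"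
  have Z: "Zf g (Suc n) (fun_upd ?h ?k z) = R n om * exp_pos (if om \<in> Hset M (Suc n) then CIY (Suc n) om + kap (Suc n) ?h (fst z) else 0) * pay g (snd z)" for z
  proof -
   have "R n (fun_upd ?h ?k z) = R n om" by (rule R_cong) auto
   moreover have "restrict (fun_upd ?h ?k z) {..Suc n} = ?h" by auto
   moreover from this have "fun_upd ?h ?k z \<in> Hset M (Suc n) \<longleftrightarrow> om \<in> Hset M (Suc n)"
    using Hset_restrict[of "Suc n" "Suc n" "fun_upd ?h ?k z"] Hset_restrict[of "Suc n" "Suc n" om] by simp
   moreover have "CIY (Suc n) (fun_upd ?h ?k z) = CIY (Suc n) om" by (simp add: CIY_def)
   ultimately show ?thesis by (simp add: Zf_def R_Suc cst_def)
  qed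
  have Hh: "?h \<in> Hset M (Suc n) \<longleftrightarrow> om \<in> Hset M (Suc n)" by (rule Hset_restrict) auto
  show "(\<integral>\<^sup>+z. Zf g (Suc n) (fun_upd (restrict om {0..<?k}) ?k z) \<partial>gi_step M u x ?k (restrict om {0..<?k})) =
   R n om * (if om \<in> Hset M (Suc n) then exp_pos (CIY (Suc n) om) *
    (\<integral>\<^sup>+z. exp_pos (kap (Suc n) ?h (fst z)) * pay g (snd z) \<partial>Gker M u (Suc n) ?h) else 1)"
   unfolding upto_Suc Z
  proof (cases "om \<in> Hset M (Suc n)")
   case True
   note h = Hset_space_HM[OF _ True]
   have st: "gi_step M u x ?k ?h = Gker M u (Suc n) ?h" using True Hh by (simp add: gi_step_def)
   have [measurable]: "(%s. exp_pos (kap (Suc n) ?h s)) \<in> borel_measurable borel" by (rule kap_slice[OF _ h]) auto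
   have "(%z. exp_pos (kap (Suc n) ?h (fst z)) * pay g (snd z)) \<in> borel_measurable CM"
    unfolding coordM_def using pay_measurable[OF g] by measurable
   then have m: "(%z. exp_pos (kap (Suc n) ?h (fst z)) * pay g (snd z)) \<in> borel_measurable (Gker M u (Suc n) ?h)"
    using h by (subst measurable_cong_sets[OF sets_Gker refl]) auto
   show "(\<integral>\<^sup>+z. R n om * exp_pos (if om \<in> Hset M (Suc n) then CIY (Suc n) om + kap (Suc n) ?h (fst z) else 0) * pay g (snd z)
     \<partial>gi_step M u x ?k ?h) = R n om * (if om \<in> Hset M (Suc n) then exp_pos (CIY (Suc n) om) *
    (\<integral>\<^sup>+z. exp_pos (kap (Suc n) ?h (fst z)) * pay g (snd z) \<partial>Gker M u (Suc n) ?h) else 1)"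
    using nn_integral_cmult[OF m, of "R n om * exp_pos (CIY (Suc n) om)"] True by (simp add: st exp_pos_add mult.assoc)
  next
   case False
   have st: "gi_step M u x ?k ?h = return CM (\<infinity>, None)" using False Hh by (simp add: gi_step_def)
   show "(\<integral>\<^sup>+z. R n om * exp_pos (if om \<in> Hset M (Suc n) then CIY (Suc n) om + kap (Suc n) ?h (fst z) else 0) * pay g (snd z)
     \<partial>gi_step M u x ?k ?h) = R n om * (if om \<in> Hset M (Suc n) then exp_pos (CIY (Suc n) om) *
    (\<integral>\<^sup>+z. exp_pos (kap (Suc n) ?h (fst z)) * pay g (snd z) \<partial>Gker M u (Suc n) ?h) else 1)"
    unfolding st using False pm by (subst nn_integral_return) (auto simp: space_CM)
  qed
 qed
 finally show ?thesis .
qed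

lemma performance_eq: "performance M x u = (\<integral>\<^sup>+om. exp_pos (\<Sum>m. cst (Suc m) om) \<partial>PP)"
 unfolding performance_def nn_integral_gi_law
 by (rule nn_integral_cong_AE, rule AE_mp[OF AE_Omega], rule AE_I2) (simp add: total_cost_eq)

lemma R_le: "R n om <= exp_pos (\<Sum>m. cst (Suc m) om)"
 unfolding R_def by (intro exp_pos_mono sum_le_suminf) auto

text \<open>The continuous-time counterpart of \<open>lower_bound\<close>, with one sojourn and the subsequent
intervention as a step.\<close>
lemma performance_lower:
 assumes gm: "!!n. g n \<in> borel_measurable SM"
  and step: "!!n h. h \<in> space (HM (Suc n)) ==> ext (g n) (xbar_at M (Suc n) h) <=
   (\<integral>\<^sup>+z. exp_pos (kap (Suc n) h (fst z)) * pay (g (Suc n)) (snd z) \<partial>Gker M u (Suc n) h)"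
  and init: "c <= (\<integral>\<^sup>+y. pay (g 0) (Some y) \<partial>pol_init u x)"
  and bound: "!!n z. g n z <= ennreal (1 + \<epsilon> n)" and \<epsilon>: "\<epsilon> \<longlonglongrightarrow> 0" "!!n. 0 <= \<epsilon> n"
 shows "c <= performance M x u"
proof (cases "performance M x u = \<infinity>")
 case False
 have inc: "c <= (\<integral>\<^sup>+om. Zf (g n) n om \<partial>PP)" for n
 proof (induction n)
  case 0 show ?case unfolding Zf_0[OF gm] by (rule init)
 next
  case (Suc n)
  have "(\<integral>\<^sup>+om. Zf (g n) n om \<partial>PP) <= (\<integral>\<^sup>+om. Zf (g (Suc n)) (Suc n) om \<partial>PP)"
   unfolding Zf_Suc[OF gm]
  proof (rule nn_integral_mono_AE, rule AE_mp[OF AE_Omega], rule AE_I2, rule impI)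
   fix om assume om: "om \<in> Omega M"
   show "Zf (g n) n om <= R n om * (if om \<in> Hset M (Suc n) then exp_pos (CIY (Suc n) om) *
    (\<integral>\<^sup>+z. exp_pos (kap (Suc n) (restrict om {..Suc n}) (fst z)) * pay (g (Suc n)) (snd z) \<partial>Gker M u (Suc n) (restrict om {..Suc n})) else 1)"
   proof (cases rule: Omega_cases[OF om, of n])
    case (1 y)
    have "xbar_at M (Suc n) (restrict om {..Suc n}) = xbar M y" using 1 by (simp add: xbar_at_def Ypath_def)
    with step[OF Hset_space_HM[OF _ 1(1)]] 1 show ?thesis
     by (simp add: Zf_def CIY_def mult_left_mono)
   next
    case 2
    then show ?thesis by (simp add: Zf_def)
   qed
  qed
  with Suc show ?case by (rule order_trans)
 qed
 have le: "c <= ennreal (1 + \<epsilon> n) * performance M x u" for n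
 proof -
  have "c <= (\<integral>\<^sup>+om. Zf (g n) n om \<partial>PP)" by (rule inc)
  also have "... <= (\<integral>\<^sup>+om. ennreal (1 + \<epsilon> n) * exp_pos (\<Sum>m. cst (Suc m) om) \<partial>PP)"
  proof (rule nn_integral_mono_AE, rule AE_mp[OF AE_Omega], rule AE_I2, rule impI)
   fix om assume om: "om \<in> Omega M"
   have e1: "1 <= ennreal (1 + \<epsilon> n)" using ennreal_leI[of 1 "1 + \<epsilon> n"] \<epsilon>(2)[of n] by simp
   show "Zf (g n) n om <= ennreal (1 + \<epsilon> n) * exp_pos (\<Sum>m. cst (Suc m) om)"
   proof (cases rule: Omega_cases[OF om, of n])
    case (1 y)
    have "exp_pos (CI M y) <= exp_pos (cst (Suc n) om)" using 1 by (intro exp_pos_mono) (simp add: cst_def CIY_def)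
    moreover have "ext (g n) (xbar M y) <= ennreal (1 + \<epsilon> n)" using bound e1 by (cases "xbar M y") (simp_all del: ennreal_plus)
    ultimately have "Zf (g n) n om <= R n om * (exp_pos (cst (Suc n) om) * ennreal (1 + \<epsilon> n))"
     using 1 by (simp add: Zf_def mult_left_mono mult_mono del: ennreal_plus)
    also have "... = ennreal (1 + \<epsilon> n) * R (Suc n) om" by (simp add: R_Suc ac_simps)
    also have "... <= ennreal (1 + \<epsilon> n) * exp_pos (\<Sum>m. cst (Suc m) om)" by (intro mult_left_mono R_le) simp
    finally show ?thesis .
   next
    case 2
    have "1 * R n om <= ennreal (1 + \<epsilon> n) * exp_pos (\<Sum>m. cst (Suc m) om)" by (intro mult_mono e1 R_le) auto
    then show ?thesis using 2 by (simp add: Zf_def del: ennreal_plus)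
   qed
  qed
  also have "... = ennreal (1 + \<epsilon> n) * performance M x u"
   unfolding performance_eq
  proof (rule nn_integral_cmult)
   have "(%om. cst (Suc m) om) \<in> borel_measurable PP" for m
    unfolding measurable_cong_sets[OF sets_PP refl] by (rule cst_measurable) auto
   then show "(%om. exp_pos (\<Sum>m. cst (Suc m) om)) \<in> borel_measurable PP" by measurable
  qed
  finally show ?thesis .
 qed
 have "(%n. performance M x u * ennreal (1 + \<epsilon> n)) \<longlonglongrightarrow> performance M x u * ennreal (1 + 0)"
  using False by (intro ennreal_tendsto_cmult tendsto_ennrealI tendsto_intros \<epsilon>) (simp add: less_top)
 from LIMSEQ_le_const[OF this, of c] le show ?thesis by (auto simp: mult.commute)
qed simp

lemma performance_upper:
 assumes gm: "g \<in> borel_measurable SM" and g1: "!!z. z \<in> S ==> 1 <= g z"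
  and step: "!!n h. h \<in> space (HM (Suc n)) ==>
   (\<integral>\<^sup>+z. exp_pos (kap (Suc n) h (fst z)) * pay g (snd z) \<partial>Gker M u (Suc n) h) <= ext g (xbar_at M (Suc n) h)"
  and init: "(\<integral>\<^sup>+y. pay g (Some y) \<partial>pol_init u x) <= c"
 shows "performance M x u <= c"
proof -
 have dec: "(\<integral>\<^sup>+om. Zf g n om \<partial>PP) <= c" for n
 proof (induction n)
  case 0 show ?case unfolding Zf_0[OF gm] by (rule init)
 next
  case (Suc n)
  have "(\<integral>\<^sup>+om. Zf g (Suc n) om \<partial>PP) <= (\<integral>\<^sup>+om. Zf g n om \<partial>PP)"
   unfolding Zf_Suc[OF gm]
  proof (rule nn_integral_mono_AE, rule AE_mp[OF AE_Omega], rule AE_I2, rule impI)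
   fix om assume om: "om \<in> Omega M"
   show "R n om * (if om \<in> Hset M (Suc n) then exp_pos (CIY (Suc n) om) *
    (\<integral>\<^sup>+z. exp_pos (kap (Suc n) (restrict om {..Suc n}) (fst z)) * pay g (snd z) \<partial>Gker M u (Suc n) (restrict om {..Suc n})) else 1) <= Zf g n om"
   proof (cases rule: Omega_cases[OF om, of n])
    case (1 y)
    have "xbar_at M (Suc n) (restrict om {..Suc n}) = xbar M y" using 1 by (simp add: xbar_at_def Ypath_def)
    with step[OF Hset_space_HM[OF _ 1(1)]] 1 show ?thesis
     by (simp add: Zf_def CIY_def mult_left_mono)
   next
    case 2
    then show ?thesis by (simp add: Zf_def)
   qed
  qed
  with Suc show ?case by (rule order_trans[rotated])
 qed
 have R: "(\<integral>\<^sup>+om. R n om \<partial>PP) <= c" for n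
 proof -
  have "(\<integral>\<^sup>+om. R n om \<partial>PP) <= (\<integral>\<^sup>+om. Zf g n om \<partial>PP)"
  proof (rule nn_integral_mono_AE, rule AE_mp[OF AE_Omega], rule AE_I2, rule impI)
   fix om assume om: "om \<in> Omega M"
   have "1 <= pay g (snd (om (Suc n)))"
   proof (cases rule: Omega_cases[OF om, of n])
    case (1 y)
    have "y \<in> space (YM M)" using 1 by simp
    then have "xbar M y \<in> space SD" by (rule measurable_space[OF xbar_measurable])
    then have "1 <= ext g (xbar M y)" using g1 by (cases "xbar M y") (auto simp: space_SD)
    then show ?thesis using 1 mult_mono[OF exp_pos_ge1, of 1 "ext g (xbar M y)" "CI M y"] by simp
   next
    case 2
    then show ?thesis by simp
   qed
   from mult_left_mono[OF this, of "R n om"] show "R n om <= Zf g n om" by (simp add: Zf_def)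
  qed
  with dec show ?thesis by (rule order_trans[rotated])
 qed
 have "performance M x u = (\<integral>\<^sup>+om. (SUP n. R n om) \<partial>PP)"
  unfolding performance_eq by (simp add: exp_pos_suminf R_def exp_pos_sum)
 also have "... = (SUP n. \<integral>\<^sup>+om. R n om \<partial>PP)"
 proof (rule nn_integral_monotone_convergence_SUP)
  show "incseq R" unfolding R_def by (intro incseq_SucI le_funI exp_pos_mono) simp
  show "R n \<in> borel_measurable PP" for n unfolding measurable_cong_sets[OF sets_PP refl] by (rule R_measurable) simp
 qed
 also have "... <= c" by (rule SUP_least) (rule R)
 finally show ?thesis .
qed

text \<open>The discount after \<open>n\<close> stages is \<open>af j ^ n\<close>.\<close>
lemma Vinf_le_performance: "Vinf x <= performance M x u"
 unfolding Vinf_def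
proof (rule SUP_least)
 fix j
 let ?\<alpha> = "af j"
 have \<alpha>: "0 <= ?\<alpha> ^ n" "?\<alpha> ^ n <= 1" for n using af[of j] by (auto intro: power_le_one)
 have "kill 1 (V j) x <= performance M x u"
 proof (rule performance_lower[where g="%n. kill (?\<alpha> ^ n) (V j)" and \<epsilon>="%n. ?\<alpha> ^ n * real (j + 1)"])
  show "kill (?\<alpha> ^ n) (V j) \<in> borel_measurable SM" for n by (intro kill_measurable V_measurable)
  show "ext (kill (?\<alpha> ^ n) (V j)) (xbar_at M (Suc n) h) <=
   (\<integral>\<^sup>+z. exp_pos (kap (Suc n) h (fst z)) * pay (kill (?\<alpha> ^ Suc n) (V j)) (snd z) \<partial>Gker M u (Suc n) h)"
   if "h \<in> space (HM (Suc n))" for n h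
   using stage_lower[OF _ that \<alpha>[of n], where j=j] by (simp add: mult.commute)
  from PY_lower[OF conjunct2[OF pol_init_law[OF x]] x, of 1 j]
  show "kill 1 (V j) x <= (\<integral>\<^sup>+y. pay (kill (?\<alpha> ^ 0) (V j)) (Some y) \<partial>pol_init u x)" by simp
  show "kill (?\<alpha> ^ n) (V j) z <= ennreal (1 + ?\<alpha> ^ n * real (j + 1))" for n z
   by (rule kill_power_bound) (use af[of j] V_le in auto)
  have "(%n. ?\<alpha> ^ n) \<longlonglongrightarrow> 0" using af[of j] by (intro LIMSEQ_power_zero) simp
  then show "(%n. ?\<alpha> ^ n * real (j + 1)) \<longlonglongrightarrow> 0" by (rule tendsto_mult_left_zero)
  show "0 <= ?\<alpha> ^ n * real (j + 1)" for n using \<alpha>[of n] by simp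
 qed
 then show "V j x <= performance M x u" by (simp add: kill_def)
qed

end

section \<open>Optimal stationary policies\<close>

context gi_control
begin

lemma XI_Vinf: "x \<in> XI M (Wstar M w) \<longleftrightarrow> x \<in> S & Vinf x = (INF b\<in>AI. bell Vinf x b)"
proof (cases "x \<in> S")
 case True
 have "(\<integral>\<^sup>+y. Wstar M w y * ennreal (exp (costI M x b y)) \<partial>Qker M x b) = bell Vinf x b" if b: "b \<in> AI" for b
 proof -
  have "space (Qker M x b) = S"
   using Q_kernel[OF True b] by (auto simp: space_prob_algebra dest: sets_eq_imp_space_eq)
  then show ?thesis unfolding bell_I[OF b] by (intro nn_integral_cong) (simp add: Wstar_eq_Vinf mult.commute)
 qed
 then show ?thesis using True by (simp add: XI_def Wstar_eq_Vinf)
qed (simp add: XI_def)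

lemma Vinf_min: "x \<in> S ==> Vinf x = min (INF b\<in>AI. bell Vinf x b) (INF a\<in>AG. bell Vinf x a)"
 unfolding Vinf_bellman by (simp add: INF_union inf_min)

lemma XI_sets: "XI M (Wstar M w) \<in> sets SM"
proof -
 have "(%x. INF b\<in>AI. bell Vinf x b) \<in> borel_measurable SM"
  using elsc_SM[OF elsc_INF_compact[OF AI(1) elsc_bell_I[OF Vinf_elsc]]] by simp
 then have "{x \<in> space SM. Vinf x = (INF b\<in>AI. bell Vinf x b)} \<in> sets SM" by measurable
 moreover have "XI M (Wstar M w) = {x \<in> space SM. Vinf x = (INF b\<in>AI. bell Vinf x b)}" using XI_Vinf by auto
 ultimately show ?thesis by simp
qed

lemma gradual_optimal:
 assumes x: "x \<in> S" "x \<notin> XI M (Wstar M w)"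
 shows "Vinf x < \<infinity>" "Vinf x = (INF a\<in>AG. bell Vinf x a)"
proof -
 have "Vinf x ~= (INF b\<in>AI. bell Vinf x b)" using x XI_Vinf by auto
 then have "(INF a\<in>AG. bell Vinf x a) < (INF b\<in>AI. bell Vinf x b)" "Vinf x = (INF a\<in>AG. bell Vinf x a)"
  using Vinf_min[OF x(1)] by (auto simp: min_def split: if_splits)
 then show "Vinf x < \<infinity>" "Vinf x = (INF a\<in>AG. bell Vinf x a)" by (auto intro: order_less_le_trans simp del: INF_less_iff)
qed

text \<open>Outside \<open>XI\<close> the infimum in the optimality equation is attained by a gradual control only. There
\<open>bell_G\<close> holds with equality for the minimizer, and with an inequality for all other controls.\<close>
lemma XG_Vinf:
 assumes x: "x \<in> S" "x \<notin> XI M (Wstar M w)"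
 shows "x \<in> XG M (Wstar M w)"
proof -
 note fin = gradual_optimal(1)[OF x] and opt = gradual_optimal(2)[OF x]
 obtain r where r: "Vinf x = ennreal r" "1 <= r"
  using fin Vinf_ge1[OF x(1)] by (cases "Vinf x") (auto simp: ennreal_le_iff)
 let ?T = "%a. enn2ereal (\<integral>\<^sup>+y. Wstar M w y \<partial>qtilde M x a) - ereal (jump_rate M x a - costG M x a) * enn2ereal (Wstar M w x)"
 have I: "(\<integral>\<^sup>+y. Wstar M w y \<partial>qtilde M x a) = (\<integral>\<^sup>+y. Vinf y \<partial>qtilde M x a)" for a
  by (rule nn_integral_cong) (use sets_eq_imp_space_eq[OF sets_qtilde] in "simp add: Wstar_eq_Vinf")
 have W: "enn2ereal (Wstar M w x) = ereal r" using r by (simp add: Wstar_eq_Vinf x)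
 have ge: "0 <= ?T a" and eq: "bell Vinf x a = Vinf x ==> ?T a = 0" if a: "a \<in> AG" for a
 proof -
  note wb = w_bounds[OF x(1) a]
  have le: "Vinf x <= bell Vinf x a" unfolding opt by (rule INF_lower[OF a])
  have B: "ennreal (w x - costG M x a) * bell Vinf x a = (\<integral>\<^sup>+y. Vinf y \<partial>qtilde M x a) + ennreal ((w x - jump_rate M x a) * r)"
   using bell_G[OF x(1) a Vinf_measurable] r wb by (simp add: ennreal_mult)
  have c: "ennreal (w x - costG M x a) * Vinf x = ennreal ((w x - costG M x a) * r)" using r wb by (simp add: ennreal_mult)
  have "ennreal ((w x - costG M x a) * r) <= (\<integral>\<^sup>+y. Vinf y \<partial>qtilde M x a) + ennreal ((w x - jump_rate M x a) * r)"
   unfolding B[symmetric] c[symmetric] by (rule mult_left_mono[OF le]) simp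
  note le' = this
  have wr: "0 <= (w x - jump_rate M x a) * r" "0 <= (w x - costG M x a) * r" using wb r by auto
  show "0 <= ?T a"
  proof (cases "\<integral>\<^sup>+y. Vinf y \<partial>qtilde M x a")
   case (real i)
   then have "(w x - costG M x a) * r <= i + (w x - jump_rate M x a) * r"
    using le' wr by (simp add: ennreal_plus[symmetric] ennreal_le_iff del: ennreal_plus)
   then have "(jump_rate M x a - costG M x a) * r <= i" by (simp add: algebra_simps)
   then show ?thesis unfolding I W real using real by (simp add: enn2ereal_ennreal)
  next
   case top
   then show ?thesis unfolding I W by simp
  qed
  assume "bell Vinf x a = Vinf x"
  then have e: "(\<integral>\<^sup>+y. Vinf y \<partial>qtilde M x a) + ennreal ((w x - jump_rate M x a) * r) = ennreal ((w x - costG M x a) * r)"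
   using B c by simp
  show "?T a = 0"
  proof (cases "\<integral>\<^sup>+y. Vinf y \<partial>qtilde M x a")
   case (real i)
   then have "i + (w x - jump_rate M x a) * r = (w x - costG M x a) * r"
    using e wr by (simp add: ennreal_plus[symmetric] ennreal_inj del: ennreal_plus)
   then have "(jump_rate M x a - costG M x a) * r = i" by (simp add: algebra_simps)
   then show ?thesis unfolding I W real using real by (simp add: enn2ereal_ennreal)
  next
   case top
   then show ?thesis using e by simp
  qed
 qed
 obtain \<psi> f where f: "f \<in> SM \<rightarrow>\<^sub>M gradM M" "!!x. x \<in> S ==> bell Vinf x (f x) = (INF a\<in>AG. bell Vinf x a)"
  using minimizers by metis
 have fx: "f x \<in> AG" using measurable_space[OF f(1), of x] x by simp
 have "(INF a\<in>AG. ?T a) = 0"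
 proof (rule antisym)
  have "?T (f x) = 0" by (rule eq[OF fx]) (use f(2)[OF x(1)] opt in simp)
  then show "(INF a\<in>AG. ?T a) <= 0" using INF_lower[OF fx, of ?T] by simp
  show "0 <= (INF a\<in>AG. ?T a)" by (rule INF_greatest) (rule ge)
 qed
 then show ?thesis using x fin by (simp add: XG_def Wstar_eq_Vinf)
qed

lemma bell_Wstar: "x \<in> S ==> a \<in> AA ==> bell (Wstar M w) x a = bell Vinf x a"
 by (rule bell_cong) (simp_all add: Wstar_eq_Vinf)

lemma INF_bell_Wstar: "x \<in> S ==> (INF a\<in>AA. bell (Wstar M w) x a) = Vinf x"
 by (subst Vinf_bellman, assumption, rule INF_cong[OF refl], rule bell_Wstar)

lemma conserving_pair_exists: "\<exists>\<psi> f. conserving_pair M w \<psi> f"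
proof -
 obtain \<psi> f where sel: "\<psi> \<in> SM \<rightarrow>\<^sub>M impM M" "f \<in> SM \<rightarrow>\<^sub>M gradM M"
  "!!x. x \<in> S ==> bell Vinf x (\<psi> x) = (INF b\<in>AI. bell Vinf x b)"
  "!!x. x \<in> S ==> bell Vinf x (f x) = (INF a\<in>AG. bell Vinf x a)"
  using minimizers by metis
 have "\<exists>c\<in>AA. (x \<in> XI M (Wstar M w) --> c \<in> AI) & conserving M w \<psi> f x c" if x: "x \<in> S" for x
 proof (cases "x \<in> XI M (Wstar M w)")
  case True
  have b: "\<psi> x \<in> AI" using measurable_space[OF sel(1), of x] x by simp
  then have "\<psi> x \<notin> AG" using disj by auto
  then show ?thesis using b True sel(3)[OF x] XI_Vinf[of x] bell_Wstar[OF x, of "\<psi> x"] INF_bell_Wstar[OF x]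
   by (intro bexI[of _ "\<psi> x"]) (auto simp: conserving_def)
 next
  case False
  have a: "f x \<in> AG" using measurable_space[OF sel(2), of x] x by simp
  then have "f x \<notin> AI" using disj by auto
  then show ?thesis using a False sel(4)[OF x] gradual_optimal(2)[OF x False] bell_Wstar[OF x, of "f x"] INF_bell_Wstar[OF x]
   by (intro bexI[of _ "f x"]) (auto simp: conserving_def)
 qed
 then show ?thesis using sel(1,2) unfolding conserving_pair_def by blast
qed

lemma return_strat:
 assumes c: "!!n. c n \<in> SD \<rightarrow>\<^sub>M ID" and N: "!!n. c n None = None"
 shows "(%n h s. return ID (c n s)) \<in> strat"
 unfolding strategies_def
proof (intro CollectI allI conjI ballI)
 fix n
 show "(%(h, s). return ID (c n s)) \<in> PiM {0..<n} (%_. SDI) \<Otimes>\<^sub>M SD \<rightarrow>\<^sub>M prob_algebra ID"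
  unfolding split_beta' by (intro measurable_compose[OF measurable_snd] measurable_compose[OF c] measurable_return_prob_space)
 fix h s assume s: "s \<in> space SD"
 show "emeasure (return ID (c n s)) (admD M s) = 1"
 proof (cases s)
  case None
  have "{None} \<in> sets ID" unfolding impD_def by simp
  then show ?thesis using None N by (simp add: admD_def)
 next
  case (Some x)
  then show ?thesis using measurable_space[OF c s, of n] by (simp add: admD_def)
 qed
qed

end

locale conserving_control = gi_control M w
 for M :: "('x::polish_space, 'a::polish_space) gi_model" and w +
 fixes \<psi> f
 assumes pair: "conserving_pair M w \<psi> f"
begin

abbreviation "XX == XI M (Wstar M w)"

definition phi :: "'x => ennreal" where "phi = (%x. if x \<in> XX then 0 else \<infinity>)"

definition act :: "'x option => 'a option" where
 "act s = (case s of None => None | Some x => if x \<in> XX then Some (\<psi> x) else None)"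

abbreviation "\<sigma> == stationary_imp M phi \<psi>"

lemma psi: "\<psi> \<in> SM \<rightarrow>\<^sub>M impM M" and f: "f \<in> SM \<rightarrow>\<^sub>M gradM M"
 using pair by (auto simp: conserving_pair_def)

lemma phi_measurable: "phi \<in> SM \<rightarrow>\<^sub>M borel"
 unfolding phi_def using XI_sets by (intro measurable_If_set) auto

lemma psi_conserves: "x \<in> XX ==> bell Vinf x (\<psi> x) <= Vinf x"
proof -
 assume X: "x \<in> XX"
 then have x: "x \<in> S" by (simp add: XI_def)
 obtain c where c: "c \<in> AI" "conserving M w \<psi> f x c" using pair X x by (auto simp: conserving_pair_def)
 have "c \<notin> AG" using c disj by auto
 moreover have "\<psi> x \<in> AI" using measurable_space[OF psi, of x] x by simp
 ultimately show ?thesis using c INF_bell_Wstar[OF x] bell_Wstar[OF x, of "\<psi> x"] by (simp add: conserving_def)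
qed

lemma f_conserves: "x \<in> S ==> x \<notin> XX ==> bell Vinf x (f x) <= Vinf x"
proof -
 assume x: "x \<in> S" and X: "x \<notin> XX"
 obtain c where c: "c \<in> AA" "conserving M w \<psi> f x c" using pair x by (auto simp: conserving_pair_def)
 have "c \<notin> AI"
 proof
  assume b: "c \<in> AI"
  have "bell Vinf x c = Vinf x" using c INF_bell_Wstar[OF x] bell_Wstar[OF x] by (simp add: conserving_def)
  then have "(INF b\<in>AI. bell Vinf x b) <= Vinf x" using INF_lower[OF b, of "bell Vinf x"] by simp
  then have "Vinf x = (INF b\<in>AI. bell Vinf x b)" using Vinf_min[OF x] by simp
  then show False using X x XI_Vinf by simp
 qed
 moreover have "f x \<in> AG" using measurable_space[OF f, of x] x by simp
 ultimately show ?thesis using c INF_bell_Wstar[OF x] bell_Wstar[OF x, of "f x"] by (simp add: conserving_def)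
qed

lemma act_measurable: "act \<in> SD \<rightarrow>\<^sub>M ID"
 unfolding stateD_def
proof (rule measurable_from_cemetery)
 show "act None \<in> space ID" by (simp add: act_def space_ID)
 have "(%x. Some (\<psi> x)) \<in> SM \<rightarrow>\<^sub>M ID" unfolding impD_def by (rule measurable_compose[OF psi measurable_Some])
 moreover have "(%x. None) \<in> SM \<rightarrow>\<^sub>M ID" by (simp add: space_ID)
 ultimately show "(%x. act (Some x)) \<in> SM \<rightarrow>\<^sub>M ID"
  unfolding act_def option.case using XI_sets by (intro measurable_If_set) auto
qed

lemma sigma_eq: "\<sigma> = (%n h s. return ID (act s))"
 by (intro ext) (auto simp: stationary_imp_def act_def phi_def split: option.split)

lemma sigma_strat: "\<sigma> \<in> strat"
 unfolding sigma_eq by (rule return_strat[OF act_measurable]) (simp add: act_def)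

text \<open>A policy that follows the conserving pair gives an impulse in every state of \<open>XI\<close>, so an
intervention never ends there. The value \<open>\<infinity>\<close> records this: it never contributes, and
gradual controls need to be conserving outside \<open>XI\<close> only.\<close>
definition Vstop :: "'x => ennreal" where "Vstop x = (if x \<in> XX then \<infinity> else Vinf x)"

lemma Vstop_measurable: "Vstop \<in> borel_measurable SM"
 unfolding Vstop_def[abs_def] using XI_sets by (intro measurable_If_set) auto

lemma intervention_decreases:
 assumes x: "x \<in> S"
 shows "(\<integral>\<^sup>+y. exp_pos (CI M y) * ext Vstop (xbar M y) \<partial>beta M \<sigma> x) <= Vinf x"
proof -
 interpret dtmdp SD ID "QkerD M" "admD M" \<sigma> by (rule strat_dtmdp[OF sigma_strat])
 let ?B = "Some ` XX \<times> {None}"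
 have B: "?B \<in> sets SDI"
 proof (rule pair_measureI)
  show "Some ` XX \<in> sets SD" unfolding stateD_def by (rule sets_cemetery_gen) (use XI_sets in auto)
  show "{None} \<in> sets ID" unfolding impD_def by simp
 qed
 have AE: "AE y in dtmdp_law SD ID (QkerD M) \<sigma> (Some x). \<forall>n. y n \<notin> ?B"
  unfolding AE_all_countable
 proof
  fix n
  show "AE y in dtmdp_law SD ID (QkerD M) \<sigma> (Some x). y n \<notin> ?B"
  proof (rule AE_action[OF Some_space[OF x] B])
   fix h s assume s: "s \<in> space SD"
   have "Pair s -` (space SDI - ?B) \<inter> space ID \<in> sets ID"
    by (rule measurable_sets[OF measurable_Pair1'[OF s]]) (use B in auto)
   also have "Pair s -` (space SDI - ?B) \<inter> space ID = {a \<in> space ID. (s, a) \<notin> ?B}"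
    using s by (auto simp: space_pair_measure)
   finally have "{a \<in> space ID. (s, a) \<notin> ?B} \<in> sets ID" .
   moreover have "(s, act s) \<notin> ?B" by (auto simp: act_def)
   moreover have "act s \<in> space ID" using measurable_space[OF act_measurable s] .
   ultimately show "AE a in \<sigma> n h s. (s, a) \<notin> ?B" unfolding sigma_eq by (subst AE_return) (auto simp: pred_def)
  qed
 qed
 have "(\<integral>\<^sup>+y. exp_pos (CI M y) * ext Vstop (xbar M y) \<partial>beta M \<sigma> x) = (\<integral>\<^sup>+y. exp_pos (CI M y) * ext Vinf (xbar M y) \<partial>beta M \<sigma> x)"
  unfolding nn_integral_beta[OF sigma_strat x]
 proof (rule nn_integral_cong_AE, rule AE_mp[OF AE], rule AE_I2, rule impI)
  fix y :: "nat => 'x option \<times> 'a option" assume nB: "\<forall>n. y n \<notin> ?B"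
  have "ext Vstop (xbar M y) = ext Vinf (xbar M y)" if y: "y \<in> Yset M"
  proof (cases "xbar M y")
   case (Some z)
   obtain k where k: "y \<in> Yfin M k" "y k = (Some z, None)" "z \<in> S" by (rule xbar_SomeD[OF y Some])
   have "z \<notin> XX" using nB[rule_format, of k] k by auto
   then show ?thesis by (simp add: Some Vstop_def)
  qed simp
  then show "exp_pos (CI M y) * ext Vstop (xbar M y) * indicator (Yset M) y = exp_pos (CI M y) * ext Vinf (xbar M y) * indicator (Yset M) y"
   by (simp add: indicator_def)
 qed
 also have "... <= Vinf x"
 proof (rule intervention_upper[OF sigma_strat x Vinf_measurable Vinf_ge1 _ act_measurable])
  show "\<sigma> n h s = return ID (act s)" for n h s by (simp add: sigma_eq)
  show "act None = None" by (simp add: act_def)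
  fix z b assume z: "z \<in> S" and "act (Some z) = Some b"
  then have X: "z \<in> XX" and b: "b = \<psi> z" by (auto simp: act_def split: if_splits)
  have "\<psi> z \<in> AI" using measurable_space[OF psi, of z] z by simp
  then show "(\<integral>\<^sup>+y. ennreal (exp (costI M z b y)) * Vinf y \<partial>Qker M z b) <= Vinf z"
   using psi_conserves[OF X] by (simp add: b bell_I)
 qed
 finally show ?thesis .
qed

lemma stationary_performance:
 assumes u: "det_stationary M phi \<psi> f u" and x: "x \<in> S"
 shows "performance M x u <= Vinf x"
proof -
 have pol: "u \<in> policies M" and init: "pol_init u x = beta M \<sigma> x"
  using u x by (auto simp: det_stationary_def)
 have sta: "emeasure (pol_Phi u n h) {\<infinity>} = 1" "!!t z. 0 < t ==> xbar_at M n h = Some z ==> pol_Pi u n h t = return (gradM M) (f z)"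
  "!!t z. 0 < t ==> z \<in> S ==> pol_Gam0 u n h t z = beta M \<sigma> z" if "1 <= n" "h \<in> space (HM n)" for n h
  using u that unfolding det_stationary_def by blast+
 interpret controlled_path M w u x by unfold_locales (use pol x in auto)
 show ?thesis
 proof (rule performance_upper[OF Vstop_measurable])
  show "1 <= Vstop z" if "z \<in> S" for z using Vinf_ge1[OF that] by (simp add: Vstop_def)
  show "(\<integral>\<^sup>+y. pay Vstop (Some y) \<partial>pol_init u x) <= Vinf x" using intervention_decreases[OF x] by (simp add: init)
  fix n h assume h: "h \<in> space (HM (Suc n))"
  have n: "1 <= Suc n" by simp
  show "(\<integral>\<^sup>+z. exp_pos (kap (Suc n) h (fst z)) * pay Vstop (snd z) \<partial>Gker M u (Suc n) h) <= ext Vstop (xbar_at M (Suc n) h)"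
  proof (cases "xbar_at M (Suc n) h")
   case None
   show ?thesis unfolding stage_None[OF n h None Vstop_measurable] by (simp add: None)
  next
   case (Some z)
   note z = xbar_at_space[OF h Some]
   show ?thesis
   proof (cases "z \<in> XX")
    case False
    have "f z \<in> AG" using measurable_space[OF f, of z] z by simp
    then have "(\<integral>\<^sup>+z. exp_pos (kap (Suc n) h (fst z)) * pay Vstop (snd z) \<partial>Gker M u (Suc n) h) <= Vinf z"
     using sta[OF n h] intervention_decreases
     by (intro stage_upper[OF n h Some _ _ _ Vinf_measurable Vinf_ge1 Vstop_measurable f_conserves[OF z False]]) (auto simp: Some)
    then show ?thesis using False by (simp add: Some Vstop_def)
   qed (simp add: Some Vstop_def)
  qed
 qed
qed

end

context gi_control
begin

text \<open>One impulse, then stop: a strategy that witnesses an admissible \<open>\<Gamma>\<^sup>1\<close>, which a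
policy needs even if it never plans an impulse.\<close>
definition once :: "'a => nat => (nat => 'x option \<times> 'a option) => 'x option => 'a option measure" where
 "once b = (%n h s. return ID (case s of None => None | Some _ => if n = 0 then Some b else None))"

lemma once_measurable: "b \<in> AI ==> (%s. case s of None => None | Some _ => if n = 0 then Some b else None) \<in> SD \<rightarrow>\<^sub>M ID"
 unfolding stateD_def by (rule measurable_from_cemetery) (auto simp: space_ID)

lemma once_strat: "b \<in> AI ==> once b \<in> strat"
 unfolding once_def by (rule return_strat[OF once_measurable]) auto

lemma once_PYstar:
 assumes b: "b \<in> AI" and x: "x \<in> S"
 shows "beta M (once b) x \<in> PYstar M x"
proof -
 interpret dtmdp SD ID "QkerD M" "admD M" "once b" by (rule strat_dtmdp[OF once_strat[OF b]])
 let ?B = "space SD \<times> {None} - {(None, None)}"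
 have B: "?B \<in> sets SDI"
 proof (rule sets.Diff)
  have N: "{None} \<in> sets ID" "{None} \<in> sets SD" unfolding impD_def stateD_def by simp_all
  show "space SD \<times> {None} \<in> sets SDI" by (rule pair_measureI[OF sets.top N(1)])
  have "{None} \<times> {None} \<in> sets SDI" by (rule pair_measureI[OF N(2,1)])
  then show "{(None, None)} \<in> sets SDI" by simp
 qed
 let ?c = "%s. case s of None => None | Some _ => if 0 = (0::nat) then Some b else None"
 have AE: "AE y in dtmdp_law SD ID (QkerD M) (once b) (Some x). y 0 \<notin> ?B"
 proof (rule AE_action[OF Some_space[OF x] B])
  fix h s assume s: "s \<in> space SD"
  have "Pair s -` (space SDI - ?B) \<inter> space ID \<in> sets ID"
   by (rule measurable_sets[OF measurable_Pair1'[OF s]]) (use B in auto)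
  also have "Pair s -` (space SDI - ?B) \<inter> space ID = {a \<in> space ID. (s, a) \<notin> ?B}"
   using s by (auto simp: space_pair_measure)
  finally have "{a \<in> space ID. (s, a) \<notin> ?B} \<in> sets ID" .
  moreover have "(s, ?c s) \<notin> ?B" by (cases s) auto
  moreover have "?c s \<in> space ID" using measurable_space[OF once_measurable[OF b, of 0] s] .
  ultimately show "AE a in once b 0 h s. (s, a) \<notin> ?B" unfolding once_def by (subst AE_return) (auto simp: pred_def)
 qed
 note bp = beta_prob[OF once_strat[OF b] x]
 interpret b: prob_space "beta M (once b) x" using bp by (simp add: space_prob_algebra)
 have sb: "sets (beta M (once b) x) = sets (YM M)" using bp by (simp add: space_prob_algebra)
 have Y: "Ystar M \<in> sets (beta M (once b) x)" by (simp add: sb sets_YM Ystar_def)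
 have "emeasure (beta M (once b) x) (Ystar M) = (\<integral>\<^sup>+y. indicator (Ystar M) y \<partial>beta M (once b) x)" using Y by simp
 also have "... = (\<integral>\<^sup>+y. 1 \<partial>beta M (once b) x)"
  unfolding nn_integral_beta[OF once_strat[OF b] x]
 proof (rule nn_integral_cong_AE, rule AE_mp[OF AE], rule AE_I2, rule impI)
  fix y :: "nat => 'x option \<times> 'a option" assume nB: "y 0 \<notin> ?B"
  have "y \<notin> Yfin M 0" using nB by (auto simp: Yfin_def space_SD)
  then show "indicator (Ystar M) y * indicator (Yset M) y = (1 :: ennreal) * indicator (Yset M) y"
   by (simp add: Ystar_def indicator_def)
 qed
 also have "... = 1" by (simp add: b.emeasure_space_1)
 finally show ?thesis using once_strat[OF b] unfolding PYstar_def PY_kernels_def by blast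
qed

end

context conserving_control
begin

lemma det_stationary_exists: "\<exists>u. det_stationary M phi \<psi> f u"
proof -
 obtain a0 where a0: "a0 \<in> AG" using AG by auto
 obtain b0 where b0: "b0 \<in> AI" using AI by auto
 define x0 where "x0 = (SOME x. x \<in> S)"
 define stay where "stay o' = (case o' of None => a0 | Some x => f x)" for o'
 define leave where "leave o' = (case o' of None => beta M (once b0) x0 | Some x => beta M (once b0) x)" for o'
 define u :: "('x, 'a) gi_policy" where "u = \<lparr>pol_init = beta M \<sigma>, pol_Phi = %n h. return TE \<infinity>,
   pol_Pi = %n h t. return (gradM M) (stay (xbar_at M n h)), pol_Gam0 = %n h t. beta M \<sigma>,
   pol_Gam1 = %n h. leave (xbar_at M n h)\<rparr>"
 have I: "{\<infinity>} \<in> sets TE" unfolding sets_restrict_space by (intro image_eqI[of _ _ "{\<infinity>}"]) auto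
 have "(\<infinity> :: ennreal) \<in> space TE" by (simp add: space_restrict_space)
 then have Phi: "return TE \<infinity> \<in> space (prob_algebra TE)" by (simp add: space_prob_algebra prob_space_return)
 have sm: "stay \<in> SD \<rightarrow>\<^sub>M gradM M"
  unfolding stateD_def by (rule measurable_from_cemetery) (use a0 f in "auto simp: stay_def")
 have xm: "(%z. xbar_at M n (fst z)) \<in> HM n \<Otimes>\<^sub>M K \<rightarrow>\<^sub>M SD" for n and K :: "'z measure"
  by (rule measurable_compose[OF measurable_fst xbar_at_measurable])
 have Pi: "(%(h, t). return (gradM M) (stay (xbar_at M n h))) \<in> HT n \<rightarrow>\<^sub>M prob_algebra (gradM M)" for n
  unfolding split_beta' by (intro measurable_compose[OF measurable_compose[OF xm sm]] measurable_return_prob_space)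
 have "(%z. beta M \<sigma> (snd (snd z))) \<in> HM n \<Otimes>\<^sub>M (TR \<Otimes>\<^sub>M SM) \<rightarrow>\<^sub>M prob_algebra (YM M)" for n
  by (rule measurable_compose[OF measurable_compose[OF measurable_snd measurable_snd] beta_measurable[OF sigma_strat]])
 then have Gam0: "(%(h, t, x). beta M \<sigma> x) \<in> HM n \<Otimes>\<^sub>M (TR \<Otimes>\<^sub>M SM) \<rightarrow>\<^sub>M prob_algebra (YM M)" for n
  by (simp add: split_beta')
 have Gam1: "(%h. leave (xbar_at M n h)) \<in> HM n \<rightarrow>\<^sub>M prob_algebra (YM M)" for n
 proof (cases "S = {}")
  case True
  have "Yset M = {}" using True by (auto simp: Yset_def Yfin_def Yinf_def)
  then have "space (HM n) = {}" by (auto simp: space_HM Hset_def)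
  then show ?thesis by (simp add: measurable_def)
 next
  case False
  then have x0: "x0 \<in> S" unfolding x0_def by (simp add: some_in_eq)
  have "leave \<in> SD \<rightarrow>\<^sub>M prob_algebra (YM M)"
   unfolding stateD_def
  proof (rule measurable_from_cemetery)
   show "leave None \<in> space (prob_algebra (YM M))" using beta_prob[OF once_strat[OF b0] x0] by (simp add: leave_def)
   show "(%x. leave (Some x)) \<in> SM \<rightarrow>\<^sub>M prob_algebra (YM M)" using beta_measurable[OF once_strat[OF b0]] by (simp add: leave_def)
  qed
  then show ?thesis by (rule measurable_compose[OF xbar_at_measurable])
 qed
 have pol: "u \<in> policies M"
  unfolding policies_def mem_Collect_eq
 proof (intro conjI allI impI ballI)
  show "pol_init u \<in> PY_kernels M" using sigma_strat by (auto simp: PY_kernels_def u_def)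
 next
  fix n :: nat
  show "pol_Phi u n \<in> HM n \<rightarrow>\<^sub>M prob_algebra TE" using Phi by (simp add: u_def)
  show "emeasure (pol_Phi u n h) {\<infinity>} = 1" for h using I by (simp add: u_def)
  show "(%(h, t). pol_Pi u n h t) \<in> HT n \<rightarrow>\<^sub>M prob_algebra (gradM M)" using Pi by (simp add: u_def)
  show "(%(h, t, x). pol_Gam0 u n h t x) \<in> HM n \<Otimes>\<^sub>M (TR \<Otimes>\<^sub>M SM) \<rightarrow>\<^sub>M prob_algebra (YM M)" using Gam0 by (simp add: u_def)
  show "pol_Gam0 u n h t x \<in> PY M x" for h t x using sigma_strat by (auto simp: PY_def u_def)
  show "pol_Gam1 u n \<in> HM n \<rightarrow>\<^sub>M prob_algebra (YM M)" using Gam1 by (simp add: u_def)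
  show "pol_Gam1 u n h \<in> PYstar M x" if "h \<in> space (HM n)" "xbar_at M n h = Some x" for h x
   using once_PYstar[OF b0 xbar_at_space[OF that]] that by (simp add: u_def leave_def)
 qed
 have "phi \<in> S \<rightarrow> {0, \<infinity>}" by (auto simp: phi_def)
 then show ?thesis
  using pol phi_measurable psi f I unfolding det_stationary_def by (intro exI[of _ u]) (simp add: u_def stay_def)
qed

lemma stationary_optimal:
 assumes u: "det_stationary M phi \<psi> f u"
 shows "optimal_policy M u" "x \<in> S ==> gi_value M x = Vinf x"
proof -
 have pol: "u \<in> policies M" using u by (simp add: det_stationary_def)
 have *: "gi_value M x = Vinf x & performance M x u = Vinf x" if x: "x \<in> S" for x
 proof -
  have "Vinf x <= performance M x v" if v: "v \<in> policies M" for v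
  proof -
   interpret controlled_path M w v x by unfold_locales (use v x in auto)
   show ?thesis by (rule Vinf_le_performance)
  qed
  then have "Vinf x <= gi_value M x" unfolding gi_value_def by (rule INF_greatest)
  moreover have "gi_value M x <= performance M x u" unfolding gi_value_def by (rule INF_lower[OF pol])
  ultimately show ?thesis using stationary_performance[OF u x] by (auto intro: antisym order_trans)
 qed
 then show "optimal_policy M u" "x \<in> S ==> gi_value M x = Vinf x" using pol by (auto simp: optimal_policy_def)
qed

end

theorem theorem3p1:
  fixes M :: "('x::polish_space, 'a::polish_space) gi_model"
    and w :: "'x \<Rightarrow> real"
  assumes prim: "gi_primitives M"
    and w_cont: "continuous_on (states M) w"
    and w_ge_1: "\<forall>x \<in> states M. 1 \<le> w x"
    and w_bound: "\<forall>x \<in> states M. \<forall>a \<in> gradual M. costG M x a + jump_rate M x a + 1 \<le> w x"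
    and cI_lsc: "lsc_on (states M \<times> impulses M \<times> states M) (\<lambda>(x, b, y). costI M x b y)"
    and cG_lsc: "lsc_on (states M \<times> gradual M) (\<lambda>(x, a). costG M x a)"
    and Q_cont: "\<forall>g :: 'x \<Rightarrow> real. continuous_on (states M) g \<longrightarrow> bounded (g ` states M) \<longrightarrow>
       continuous_on (states M \<times> impulses M) (\<lambda>(x, b). \<integral>y. g y \<partial>Qker M x b)"
    and q_cont: "\<forall>g :: 'x \<Rightarrow> real. continuous_on (states M) g \<longrightarrow> bounded (g ` states M) \<longrightarrow>
       continuous_on (states M \<times> gradual M) (\<lambda>(x, a). \<integral>y. g y \<partial>qtilde M x a)"
  shows "(\<forall>x \<in> states M. Wstar M w x = gi_value M x) \<and>
    states M - XI M (Wstar M w) \<subseteq> XG M (Wstar M w) \<and>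
    (\<exists>\<phi> \<psi> f u. det_stationary M \<phi> \<psi> f u \<and> optimal_policy M u) \<and>
    (\<exists>\<psi> f. conserving_pair M w \<psi> f) \<and>
    (\<forall>\<psi> f. conserving_pair M w \<psi> f \<longrightarrow>
       (let \<phi> = (\<lambda>x. if x \<in> XI M (Wstar M w) then 0 else \<infinity>) in
         (\<exists>u. det_stationary M \<phi> \<psi> f u) \<and>
         (\<forall>u. det_stationary M \<phi> \<psi> f u \<longrightarrow> optimal_policy M u)))"
proof -
 interpret gi_control M w
  using prim w_cont w_ge_1 w_bound cI_lsc cG_lsc Q_cont q_cont by (rule gi_control.intro)
 let ?\<phi> = "%x. if x \<in> XI M (Wstar M w) then 0 else \<infinity> :: ennreal"
 have stat: "(\<exists>u. det_stationary M ?\<phi> \<psi> f u) & (\<forall>u. det_stationary M ?\<phi> \<psi> f u --> optimal_policy M u & (\<forall>x \<in> S. gi_value M x = Vinf x))"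
  if "conserving_pair M w \<psi> f" for \<psi> f
 proof -
  interpret conserving_control M w \<psi> f by unfold_locales (rule that)
  show ?thesis using det_stationary_exists stationary_optimal unfolding phi_def by blast
 qed
 obtain \<psi> f where pair: "conserving_pair M w \<psi> f" using conserving_pair_exists by blast
 obtain u where u: "det_stationary M ?\<phi> \<psi> f u" "optimal_policy M u" "\<forall>x \<in> S. gi_value M x = Vinf x"
  using stat[OF pair] by blast
 show ?thesis
 proof (intro conjI)
  show "\<forall>x \<in> S. Wstar M w x = gi_value M x" using u(3) by (simp add: Wstar_eq_Vinf)
  show "S - XI M (Wstar M w) \<subseteq> XG M (Wstar M w)" using XG_Vinf by blast
  show "\<exists>\<phi> \<psi> f u. det_stationary M \<phi> \<psi> f u & optimal_policy M u" using u by blast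
  show "\<exists>\<psi> f. conserving_pair M w \<psi> f" by (rule conserving_pair_exists)
  show "\<forall>\<psi> f. conserving_pair M w \<psi> f -->
    (let \<phi> = ?\<phi> in (\<exists>u. det_stationary M \<phi> \<psi> f u) & (\<forall>u. det_stationary M \<phi> \<psi> f u --> optimal_policy M u))"
   unfolding Let_def using stat by blast
 qed
qed

end
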